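(* Let $0<a<b$, let $A=\{x\in\mathbb{R}^2:a<|x|<b\}$, let $N\ge1$ be an integer and let $u_*^N$ minimize $I_\infty$ in $\tilde{\mathcal{A}}_{N,\mathrm{sym}}$, with parameters $\omega>0$ and $k\in(a,b)$. Let $v\in\tilde{\mathcal{A}}_N$ be such that $\varphi:=v-u_*^N$ has support in the annulus $A(r_*,b)\subset A$, where $$\frac1{r_*}=\frac1k+\frac{a^2}{a^2+\omega^2}.$$ Then $I_\infty(v)\ge I_\infty(u_*^N)$.
   Context: $A(p,q)=\{x\in\mathbb{R}^2:p<|x|<q\}$. $h_\infty(s)=0$ if $s\ge0$, $h_\infty(s)=+\infty$ if $s<0$, and $I_\infty(u)=\int_A\frac12|\nabla u|^2+h_\infty(\det\nabla u)\,dx$. $\tilde{\mathcal{A}}_N$ is the set of $u\in W^{1,2}(A;\mathbb{R}^2)$ with $u=\mathrm{id}$ on $\partial A$ (in the sense of trace), $\det\nabla u\ge0$ a.e. in $A$, and $\mathrm{wind}\#\gamma_\theta=N$ for a.e. $\theta\in[0,2\pi]$, where in polar coordinates $\gamma_\theta(r)=u(r,\theta)/|u(r,\theta)|$, $a\le r\le b$. The winding number of a closed $C^1$ curve $\gamma=(x,y):[a,b]\to\mathbb{R}^2\setminus\{0\}$ is $\frac1{2\pi}\int_a^b\frac{xy'-x'y}{x^2+y^2}\,dr$, extended to closed continuous curves by approximation. $\tilde{\mathcal{A}}_{N,\mathrm{sym}}=\{u\in\tilde{\mathcal{A}}_N:u(x)=Q^Tu(Qx)\text{ for all }Q\in SO(2)\}$.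 The parameters $\omega,k$: the minimizer is $u_*^N(r,\theta)=\rho(r)(\cos(\theta+\psi(r)),\sin(\theta+\psi(r)))$ where, for uniquely determined $\omega>0$ and $k\in(a,b)$, $\rho(r)=a$ on $[a,k]$ and $\rho(r)=\frac12\left(\left(a^2+\frac{\omega^2}{a^2}\right)\left(\frac{r^2}{k^2}+\frac{k^2}{r^2}\right)+2\left(a^2-\frac{\omega^2}{a^2}\right)\right)^{1/2}$ on $(k,b]$, $\dot\psi=\omega/(r\rho^2)$, $\psi(a)=0$, and $\omega,k$ are fixed by $\rho(b)=b$, $\psi(b)=2\pi N$. *)

theory Defs
  imports "HOL-Analysis.Analysis" "HOL-Complex_Analysis.Complex_Analysis"
begin

text \<open>Planar maps are total functions on \<^typ>\<open>real^2\<close>. Everything below depends only on their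
  values almost everywhere in the domain under consideration, so they represent elements of
  Sobolev spaces.\<close>

definition annulus :: "real \<Rightarrow> real \<Rightarrow> (real^2) set" where
  "annulus p q = {x. p < norm x \<and> norm x < q}"

definition polar :: "real \<Rightarrow> real \<Rightarrow> real^2" where
  "polar r \<theta> = vector [r * cos \<theta>, r * sin \<theta>]"

primrec Ck :: "nat \<Rightarrow> (real^2 \<Rightarrow> real) \<Rightarrow> bool" where
  "Ck 0 f \<longleftrightarrow> continuous_on UNIV f"
| "Ck (Suc n) f \<longleftrightarrow> (\<forall>x. f differentiable (at x)) \<and>
     (\<forall>j. Ck n (\<lambda>x. frechet_derivative f (at x) (axis j 1)))"

definition smooth :: "(real^2 \<Rightarrow> real) \<Rightarrow> bool" where
  "smooth f \<longleftrightarrow> (\<forall>n. Ck n f)"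

definition test_function :: "(real^2) set \<Rightarrow> (real^2 \<Rightarrow> real) \<Rightarrow> bool" where
  "test_function \<Omega> f \<longleftrightarrow>
     smooth f \<and> compact (closure {x. f x \<noteq> 0}) \<and> closure {x. f x \<noteq> 0} \<subseteq> \<Omega>"

definition L2_on :: "(real^2) set \<Rightarrow> (real^2 \<Rightarrow> 'a::euclidean_space) \<Rightarrow> bool" where
  "L2_on \<Omega> f \<longleftrightarrow> f \<in> borel_measurable (lebesgue_on \<Omega>) \<and>
     integrable (lebesgue_on \<Omega>) (\<lambda>x. (norm (f x))\<^sup>2)"

text \<open>Row \<open>i\<close>, column \<open>j\<close> of a gradient is the \<open>j\<close>-th partial derivative of the \<open>i\<close>-th component.
  The norm on \<^typ>\<open>real^2^2\<close> is the Frobenius norm.\<close>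

definition is_weak_grad ::
    "(real^2) set \<Rightarrow> (real^2 \<Rightarrow> real^2) \<Rightarrow> (real^2 \<Rightarrow> real^2^2) \<Rightarrow> bool" where
  "is_weak_grad \<Omega> u G \<longleftrightarrow> L2_on \<Omega> G \<and>
     (\<forall>f. test_function \<Omega> f \<longrightarrow> (\<forall>i j.
        (LINT x|lebesgue_on \<Omega>. u x $ i * frechet_derivative f (at x) (axis j 1))
          = - (LINT x|lebesgue_on \<Omega>. G x $ i $ j * f x)))"

definition W12 :: "(real^2) set \<Rightarrow> (real^2 \<Rightarrow> real^2) set" where
  "W12 \<Omega> = {u. L2_on \<Omega> u \<and> (\<exists>G. is_weak_grad \<Omega> u G)}"

text \<open>The choice is immaterial: a weak gradient is unique up to null sets.\<close>

definition weak_grad :: "(real^2) set \<Rightarrow> (real^2 \<Rightarrow> real^2) \<Rightarrow> real^2 \<Rightarrow> real^2^2" where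
  "weak_grad \<Omega> u = (SOME G. is_weak_grad \<Omega> u G)"

text \<open>\<open>g\<close> is the trace of \<open>u\<close> on the two boundary circles: \<open>u\<close> is a \<open>W\<^sup>1\<^sup>,\<^sup>2\<close>-limit of maps smooth up
  to the boundary whose boundary values converge to \<open>g\<close> in \<open>L\<^sup>2\<close> of the boundary, i.e. \<open>g\<close> is the
  value at \<open>u\<close> of the continuous extension of the restriction operator.\<close>

definition has_trace_annulus ::
    "real \<Rightarrow> real \<Rightarrow> (real^2 \<Rightarrow> real^2) \<Rightarrow> (real^2 \<Rightarrow> real^2) \<Rightarrow> bool" where
  "has_trace_annulus a b u g \<longleftrightarrow>
     (\<exists>w :: nat \<Rightarrow> real^2 \<Rightarrow> real^2.
        (\<forall>n i. smooth (\<lambda>x. w n x $ i)) \<and>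
        (\<lambda>n. \<integral>\<^sup>+x. ennreal ((norm (w n x - u x))\<^sup>2
               + (norm (jacobian (w n) (at x) - weak_grad (annulus a b) u x))\<^sup>2)
             \<partial>lebesgue_on (annulus a b)) \<longlonglongrightarrow> 0 \<and>
        (\<forall>c\<in>{a, b}.
          (\<lambda>n. \<integral>\<^sup>+\<theta>. ennreal ((norm (w n (polar c \<theta>) - g (polar c \<theta>)))\<^sup>2 * c)
             \<partial>lebesgue_on {0..2*pi}) \<longlonglongrightarrow> 0))"

definition h_inf :: "real \<Rightarrow> ennreal" where
  "h_inf s = (if s \<ge> 0 then 0 else \<infinity>)"

definition I_inf :: "real \<Rightarrow> real \<Rightarrow> (real^2 \<Rightarrow> real^2) \<Rightarrow> ennreal" where
  "I_inf a b u = (\<integral>\<^sup>+x. ennreal (1/2 * (norm (weak_grad (annulus a b) u x))\<^sup>2)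
                        + h_inf (det (weak_grad (annulus a b) u x)) \<partial>lebesgue_on (annulus a b))"

text \<open>Winding number about the origin of a closed planar curve parametrised over \<open>[a,b]\<close>.\<close>

definition wind :: "real \<Rightarrow> real \<Rightarrow> (real \<Rightarrow> real^2) \<Rightarrow> complex" where
  "wind a b \<gamma> =
     winding_number ((\<lambda>r. Complex (\<gamma> r $ 1) (\<gamma> r $ 2)) \<circ> linepath a b) 0"

text \<open>A Sobolev map agrees on almost every ray with a function \<open>\<eta>\<close> that is continuous up to the
  end points; \<open>\<eta>\<close> is then unique, and it is the meaning of \<open>r \<mapsto> u(r,\<theta>)\<close> on \<open>[a,b]\<close>.\<close>

definition radial_winding ::
    "real \<Rightarrow> real \<Rightarrow> (real^2 \<Rightarrow> real^2) \<Rightarrow> real \<Rightarrow> int \<Rightarrow> bool" where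
  "radial_winding a b u \<theta> N \<longleftrightarrow>
     (\<exists>\<eta>. continuous_on {a..b} \<eta> \<and>
          (AE r in lebesgue_on {a<..<b}. \<eta> r = u (polar r \<theta>)) \<and>
          (\<forall>r\<in>{a..b}. \<eta> r \<noteq> 0) \<and>
          (let \<gamma> = (\<lambda>r. \<eta> r /\<^sub>R norm (\<eta> r)) in \<gamma> a = \<gamma> b \<and> wind a b \<gamma> = of_int N))"

definition admissible :: "real \<Rightarrow> real \<Rightarrow> int \<Rightarrow> (real^2 \<Rightarrow> real^2) set" where
  "admissible a b N =
     {u \<in> W12 (annulus a b).
        has_trace_annulus a b u (\<lambda>x. x) \<and>
        (AE x in lebesgue_on (annulus a b). det (weak_grad (annulus a b) u x) \<ge> 0) \<and>
        (AE \<theta> in lebesgue_on {0..2*pi}. radial_winding a b u \<theta> N)}"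

definition admissible_sym :: "real \<Rightarrow> real \<Rightarrow> int \<Rightarrow> (real^2 \<Rightarrow> real^2) set" where
  "admissible_sym a b N =
     {u \<in> admissible a b N.
        \<forall>Q. rotation_matrix Q \<longrightarrow>
          (AE x in lebesgue_on (annulus a b). u x = transpose Q *v u (Q *v x))}"

definition rho :: "real \<Rightarrow> real \<Rightarrow> real \<Rightarrow> real \<Rightarrow> real" where
  "rho a \<omega> k r =
     (if r \<le> k then a
      else 1/2 * sqrt ((a\<^sup>2 + \<omega>\<^sup>2 / a\<^sup>2) * (r\<^sup>2 / k\<^sup>2 + k\<^sup>2 / r\<^sup>2) + 2 * (a\<^sup>2 - \<omega>\<^sup>2 / a\<^sup>2)))"

text \<open>\<open>\<omega>\<close> and \<open>k\<close> are the parameters of the twist map \<open>u\<close>, which in polar coordinates is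
  \<open>\<rho>(r)(cos(\<theta> + \<psi>(r)), sin(\<theta> + \<psi>(r)))\<close> up to a null set.\<close>

definition has_twist_parameters ::
    "real \<Rightarrow> real \<Rightarrow> int \<Rightarrow> (real^2 \<Rightarrow> real^2) \<Rightarrow> real \<Rightarrow> real \<Rightarrow> bool" where
  "has_twist_parameters a b N u \<omega> k \<longleftrightarrow>
     0 < \<omega> \<and> a < k \<and> k < b \<and> rho a \<omega> k b = b \<and>
     (\<exists>\<psi> w.
        (\<forall>r\<in>{a..b}. (\<psi> has_real_derivative \<omega> / (r * (rho a \<omega> k r)\<^sup>2)) (at r within {a..b})) \<and>
        \<psi> a = 0 \<and> \<psi> b = 2 * pi * of_int N \<and>
        (\<forall>r\<in>{a<..<b}. \<forall>\<theta>. w (polar r \<theta>) = polar (rho a \<omega> k r) (\<theta> + \<psi> r)) \<and>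
        (AE x in lebesgue_on (annulus a b). u x = w x))"

end

theory Submission
  imports Defs
begin

text \<open>The twist map minimises the energy in the whole class of admissible maps. With \<open>m = \<omega> / a\<^sup>2\<close>, its energy is \<open>\<pi> a\<^sup>2 (1 + m\<^sup>2) (ln (k/a) + sinh T cosh T)\<close>,
  where \<open>T = ln (b/k)\<close>.

  Lower bound: \<open>v\<close> is a limit of smooth maps that agree with the identity on the boundary. For such
  maps the integral of any function of \<open>z\<close> times the Jacobian depends only on the boundary values.
  For a function that vanishes outside the disc of radius \<open>a\<close> it is zero, so that \<open>det \<ge> 0\<close> forces
  the Jacobian to vanish over that disc in the limit, although the image may enter it. Hence the
  angle form of the plane, cut off inside the disc, pulls back to an almost closed form, and has an
  angular primitive \<open>t + X\<close> there; a product of two such forms shows that the increment of \<open>X\<close> along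
  the rays is the same for all cut-offs, namely \<open>2 \<pi> N\<close>. The energy is then bounded from below by a
  calibration in involute coordinates around the disc (for \<open>r \<le> k\<close>) and, for \<open>r \<ge> k\<close>, by
  developing the universal cover of the exterior of the disc onto a half plane, where the twist map
  is harmonic and is compared by convexity.\<close>

subsection \<open>Integrals over rectangles\<close>

text \<open>Two calibrations are needed because the twist has two phases: for r \<le>
  \<open>k\<close> it slides along the circle of radius \<open>a\<close>, for r \<ge>
  \<open>k\<close> it is harmonic. They meet at r = \<open>k\<close> only through an inequality,
  \<open>involute_inequality\<close>, valid for nonnegative contact angles. For points that lag
  behind, the plane isometry would violate it; hence the development is straightened beyond a
  tangent line, where it still does not increase lengths.

  The winding number is given for the limit map only, along almost every ray, and such a ray avoids
  the origin but may cross the disc of radius \<open>a\<close>. It is therefore read off with a tiny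
  cut-off radius \<open>c\<close> and has to be carried over to radius \<open>a\<close>. In this
  comparison the lifted angles fail to close up, by an error small in L1 only, and the two forms are
  evaluated at points a small rotation apart. These losses are paid for by the negative part of the
  Jacobian, by the L2 equicontinuity of the gradients under rotations, and by the fact that the two
  weights differ only where the first form has positive curl.\<close>

definition cont_rect :: "real \<Rightarrow> real \<Rightarrow> (real \<Rightarrow> real \<Rightarrow> 'a::topological_space) \<Rightarrow> bool" where
  "cont_rect a b f \<longleftrightarrow> continuous_on ({a..b} \<times> UNIV) (\<lambda>p. f (fst p) (snd p))"

definition rect_int :: "real \<Rightarrow> real \<Rightarrow> (real \<Rightarrow> real \<Rightarrow> real) \<Rightarrow> real" where
  "rect_int a b f = integral (cbox (a, 0) (b, 2*pi)) (\<lambda>p. f (fst p) (snd p))"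

abbreviation sq2 :: "complex \<Rightarrow> complex \<Rightarrow> real" where
  "sq2 x y \<equiv> (cmod x)^2 + (cmod y)^2"

text \<open>Dirichlet density in polar coordinates: applied to the derivatives in r and t it is the
  squared norm of the gradient times the area factor r.\<close>

abbreviation wsq :: "real \<Rightarrow> complex \<Rightarrow> complex \<Rightarrow> real" where
  "wsq r x y \<equiv> r * (cmod x)^2 + (cmod y)^2 / r"

named_theorems cont_rects

lemmas real_vector_derivative_iff = has_real_derivative_iff_has_vector_derivative

lemma cont_rect_const [cont_rects]: "cont_rect a b (\<lambda>r t. c)"
  by (simp add: cont_rect_def)

lemma cont_rect_fst:
  "continuous_on {a..b} g \<Longrightarrow> cont_rect a b (\<lambda>r t. g r)"
  unfolding cont_rect_def
  by (rule continuous_on_compose2[where g = g]) (auto intro: continuous_intros)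

lemma cont_rect_snd:
  "continuous_on UNIV g \<Longrightarrow> cont_rect a b (\<lambda>r t. g t)"
  unfolding cont_rect_def
  by (rule continuous_on_compose2[where g = g]) (auto intro: continuous_intros)

lemma cont_rect_var [cont_rects]:
  "cont_rect a b (\<lambda>r t. r)" "cont_rect a b (\<lambda>r t. t)"
  unfolding cont_rect_def by (auto intro!: continuous_intros)

lemma cont_rect_compose:
  "continuous_on UNIV g \<Longrightarrow> cont_rect a b f \<Longrightarrow> cont_rect a b (\<lambda>r t. g (f r t))"
  unfolding cont_rect_def by (rule continuous_on_compose2[where g = g]) auto

lemma cont_rect_arith [cont_rects]:
  fixes f g :: "real \<Rightarrow> real \<Rightarrow> 'a::real_normed_algebra_1"
  assumes "cont_rect a b f" "cont_rect a b g"
  shows "cont_rect a b (\<lambda>r t. f r t + g r t)" "cont_rect a b (\<lambda>r t. f r t - g r t)"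
    "cont_rect a b (\<lambda>r t. f r t * g r t)"
  using assms unfolding cont_rect_def by (auto intro!: continuous_intros)

lemma cont_rect_unary [cont_rects]:
  fixes f :: "real \<Rightarrow> real \<Rightarrow> 'a::real_normed_algebra_1"
  assumes "cont_rect a b f"
  shows "cont_rect a b (\<lambda>r t. - f r t)" "cont_rect a b (\<lambda>r t. norm (f r t))"
    "cont_rect a b (\<lambda>r t. f r t ^ n)"
  using assms unfolding cont_rect_def by (auto intro!: continuous_intros)

lemma cont_rect_real [cont_rects]:
  fixes f g :: "real \<Rightarrow> real \<Rightarrow> real"
  assumes "cont_rect a b f"
  shows "cont_rect a b (\<lambda>r t. \<bar>f r t\<bar>)" "cont_rect a b (\<lambda>r t. complex_of_real (f r t))"
    "cont_rect a b (\<lambda>r t. cis (f r t))" "cont_rect a b (\<lambda>r t. sin (f r t))"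
    "cont_rect a b (\<lambda>r t. cos (f r t))" "cont_rect a b (\<lambda>r t. arctan (f r t))"
  using assms unfolding cont_rect_def by (auto intro!: continuous_intros)

lemma cont_rect_max [cont_rects]:
  fixes f g :: "real \<Rightarrow> real \<Rightarrow> real"
  assumes "cont_rect a b f" "cont_rect a b g"
  shows "cont_rect a b (\<lambda>r t. max (f r t) (g r t))"
  using assms unfolding cont_rect_def by (auto intro!: continuous_intros)

lemma cont_rect_divide [cont_rects]:
  fixes f g :: "real \<Rightarrow> real \<Rightarrow> real"
  assumes "cont_rect a b f" "cont_rect a b g" "\<And>r t. a \<le> r \<Longrightarrow> r \<le> b \<Longrightarrow> g r t \<noteq> 0"
  shows "cont_rect a b (\<lambda>r t. f r t / g r t)"
  using assms unfolding cont_rect_def by (auto intro!: continuous_intros)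

lemma cont_rect_complex [cont_rects]:
  fixes f :: "real \<Rightarrow> real \<Rightarrow> complex"
  assumes "cont_rect a b f"
  shows "cont_rect a b (\<lambda>r t. Re (f r t))" "cont_rect a b (\<lambda>r t. Im (f r t))"
    "cont_rect a b (\<lambda>r t. cnj (f r t))" "cont_rect a b (\<lambda>r t. cmod (f r t))"
  using assms unfolding cont_rect_def by (auto intro!: continuous_intros)

text \<open>This is why \<open>cont_rect\<close> lets the angle range over all reals and not over
  one period: shifted functions stay in the class, and periodicity is added only where integrals are
  shifted.\<close>

lemma cont_rect_shift:
  assumes "cont_rect a b f"
  shows "cont_rect a b (\<lambda>r t. f r (t + s))"
  unfolding cont_rect_def
  by (rule continuous_on_compose2[OF assms[unfolded cont_rect_def],
        where f = "\<lambda>p. (fst p, snd p + s)", simplified]) (auto intro!: continuous_intros)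

lemma cont_rect_subset: "cont_rect a b f \<Longrightarrow> a \<le> c \<Longrightarrow> d \<le> b \<Longrightarrow> cont_rect c d f"
  unfolding cont_rect_def by (erule continuous_on_subset) auto

lemma cont_rect_slice1:
  assumes "cont_rect a b f"
  shows "continuous_on {a..b} (\<lambda>r. f r t)"
  by (rule continuous_on_compose2[OF assms[unfolded cont_rect_def],
        where f = "\<lambda>r. (r, t)", simplified]) (auto intro!: continuous_intros)

lemma cont_rect_slice2:
  assumes "cont_rect a b f" "a \<le> r" "r \<le> b"
  shows "continuous_on S (\<lambda>t. f r t)"
  by (rule continuous_on_compose2[OF assms(1)[unfolded cont_rect_def],
        where f = "\<lambda>t. (r, t)", simplified]) (use assms in \<open>auto intro!: continuous_intros\<close>)

lemma cont_rect_cbox: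
  assumes "cont_rect a b f"
  shows "continuous_on (cbox (a, c) (b, d)) (\<lambda>p. f (fst p) (snd p))"
  using assms unfolding cont_rect_def by (rule continuous_on_subset) (auto simp: cbox_Pair_eq)

lemma cont_rect_integrable:
  fixes f :: "real \<Rightarrow> real \<Rightarrow> real"
  assumes "cont_rect a b f"
  shows "(\<lambda>p. f (fst p) (snd p)) integrable_on cbox (a, c) (b, d)"
  by (rule integrable_continuous[OF cont_rect_cbox[OF assms]])

lemma rect_int_add:
  "cont_rect a b f \<Longrightarrow> cont_rect a b g \<Longrightarrow>
    rect_int a b (\<lambda>r t. f r t + g r t) = rect_int a b f + rect_int a b g"
  unfolding rect_int_def by (intro integral_add cont_rect_integrable)

lemma rect_int_diff:
  "cont_rect a b f \<Longrightarrow> cont_rect a b g \<Longrightarrow>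
    rect_int a b (\<lambda>r t. f r t - g r t) = rect_int a b f - rect_int a b g"
  unfolding rect_int_def by (intro integral_diff cont_rect_integrable)

lemma rect_int_cmult: "rect_int a b (\<lambda>r t. c * f r t) = c * rect_int a b f"
  unfolding rect_int_def by simp

lemma rect_int_mono:
  "cont_rect a b f \<Longrightarrow> cont_rect a b g \<Longrightarrow> (\<And>r t. a \<le> r \<Longrightarrow> r \<le> b \<Longrightarrow> f r t \<le> g r t) \<Longrightarrow>
    rect_int a b f \<le> rect_int a b g"
  unfolding rect_int_def
  by (intro integral_le cont_rect_integrable) (auto simp: cbox_Pair_eq)

lemma rect_int_cong:
  "(\<And>r t. a \<le> r \<Longrightarrow> r \<le> b \<Longrightarrow> f r t = g r t) \<Longrightarrow> rect_int a b f = rect_int a b g"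
  unfolding rect_int_def by (intro integral_cong) (auto simp: cbox_Pair_eq)

lemma rect_int_nonneg:
  "cont_rect a b f \<Longrightarrow> (\<And>r t. a \<le> r \<Longrightarrow> r \<le> b \<Longrightarrow> 0 \<le> f r t) \<Longrightarrow> 0 \<le> rect_int a b f"
  unfolding rect_int_def
  by (intro integral_nonneg cont_rect_integrable) (auto simp: cbox_Pair_eq)

lemma rect_int_abs_le:
  assumes "cont_rect a b f" "cont_rect a b g" "\<And>r t. a \<le> r \<Longrightarrow> r \<le> b \<Longrightarrow> \<bar>f r t\<bar> \<le> g r t"
  shows "\<bar>rect_int a b f\<bar> \<le> rect_int a b g"
  unfolding rect_int_def real_norm_def[symmetric]
  by (intro integral_norm_bound_integral cont_rect_integrable assms)
    (use assms(3) in \<open>auto simp: cbox_Pair_eq\<close>)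

lemma rect_int_const: "a \<le> b \<Longrightarrow> rect_int a b (\<lambda>r t. c) = 2 * pi * (b - a) * c"
  unfolding rect_int_def by (simp add: content_Pair)

lemma rect_int_rt:
  "cont_rect a b f \<Longrightarrow> rect_int a b f = integral {a..b} (\<lambda>r. integral {0..2*pi} (\<lambda>t. f r t))"
  unfolding rect_int_def
  by (subst integral_prod_continuous) (auto intro: cont_rect_cbox)

lemma rect_int_tr:
  assumes "cont_rect a b f"
  shows "rect_int a b f = integral {0..2*pi} (\<lambda>t. integral {a..b} (\<lambda>r. f r t))"
  using integral_swap_continuous[of a 0 b "2*pi" "\<lambda>r t. f r t"] cont_rect_cbox[OF assms, of 0 "2*pi"]
    rect_int_rt[OF assms]
  by (simp add: split_beta)

lemma rect_int_combine:
  assumes "cont_rect a b f" "a \<le> c" "c \<le> b"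
  shows "rect_int a b f = rect_int a c f + rect_int c b f"
proof -
  note s = cont_rect_subset[OF assms(1), of a c] cont_rect_subset[OF assms(1), of c b]
  have "(\<lambda>r. integral {0..2*pi} (\<lambda>t. f r t)) integrable_on {a..b}"
    using integral_integrable_2dim[of a 0 b "2*pi" "\<lambda>p. f (fst p) (snd p)"] cont_rect_cbox[OF assms(1), of 0 "2*pi"]
    by (simp add: split_beta)
  then show ?thesis
    using assms s by (simp add: rect_int_rt Henstock_Kurzweil_Integration.integral_combine)
qed

lemma cont_rect_bounded:
  fixes f :: "real \<Rightarrow> real \<Rightarrow> 'a::real_normed_vector"
  assumes "cont_rect a b f"
  obtains M where "M > 0" "\<And>r t. a \<le> r \<Longrightarrow> r \<le> b \<Longrightarrow> c \<le> t \<Longrightarrow> t \<le> d \<Longrightarrow> norm (f r t) \<le> M"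
proof -
  have "bounded ((\<lambda>p. f (fst p) (snd p)) ` cbox (a, c) (b, d))"
    by (intro compact_imp_bounded compact_continuous_image cont_rect_cbox assms compact_cbox)
  then obtain M where "M > 0" "\<forall>x\<in>(\<lambda>p. f (fst p) (snd p)) ` cbox (a, c) (b, d). norm x \<le> M"
    by (auto simp: bounded_pos)
  then show ?thesis
    by (intro that[of M]) (auto simp: cbox_Pair_eq)
qed

lemma cont_rect_integral1:
  fixes f :: "real \<Rightarrow> real \<Rightarrow> real"
  assumes "cont_rect a b f" "a \<le> b"
  shows "continuous_on S (\<lambda>t. integral {a..b} (\<lambda>r. f r t))"
proof -
  have "continuous_on (S \<times> cbox a b) (\<lambda>(t, r). f r t)"
    by (auto simp: split_beta intro!: continuous_on_compose2[OF assms(1)[unfolded cont_rect_def],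
        where f = "\<lambda>p. (snd p, fst p)", simplified] continuous_intros)
  from integral_continuous_on_param[OF this] show ?thesis by simp
qed

lemma cont_rect_integral2:
  fixes f :: "real \<Rightarrow> real \<Rightarrow> real"
  assumes "cont_rect a b f"
  shows "continuous_on {a..b} (\<lambda>r. integral {c..d} (\<lambda>t. f r t))"
proof -
  have "continuous_on ({a..b} \<times> cbox c d) (\<lambda>(r, t). f r t)"
    using assms unfolding cont_rect_def split_beta by (rule continuous_on_subset) auto
  from integral_continuous_on_param[OF this] show ?thesis by simp
qed

text \<open>Moves the variable end point into the integrand, so that the joint continuity of a
  primitive in \<open>r\<close> and \<open>t\<close> follows from that of parameter integrals over a
  fixed interval.\<close>

lemma integral_rescale:
  fixes f :: "real \<Rightarrow> real"
  assumes "a \<le> r" "continuous_on {a..r} f"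
  shows "integral {a..r} f = (r - a) * integral {0..1} (\<lambda>x. f (a + x * (r - a)))"
proof (cases "a = r")
  case False
  then have "a < r" using assms by simp
  have "((\<lambda>x. f ((r - a) *\<^sub>R x + a)) has_integral (1 / \<bar>r - a\<bar> ^ DIM(real)) *\<^sub>R integral {a..r} f)
      ((\<lambda>x. (1 / (r - a)) *\<^sub>R x + - ((1 / (r - a)) *\<^sub>R a)) ` cbox a r)"
    using \<open>a < r\<close> assms(2)
    by (intro has_integral_affinity integrable_integral) (auto intro: integrable_continuous_real)
  moreover have "(\<lambda>x. (1 / (r - a)) *\<^sub>R x + - ((1 / (r - a)) *\<^sub>R a)) ` cbox a r = {0..1}"
  proof -
    have "(\<lambda>x. (1 / (r - a)) *\<^sub>R x + - ((1 / (r - a)) *\<^sub>R a)) = (\<lambda>x. (1 / (r - a)) * x + (- a / (r - a)))"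
      by auto
    then show ?thesis
      using \<open>a < r\<close> image_affinity_atLeastAtMost[of "1/(r-a)" "-a/(r-a)" a r]
      by (auto simp: diff_divide_distrib[symmetric])
  qed
  ultimately have "((\<lambda>x. f (a + x * (r - a))) has_integral (1 / (r - a)) * integral {a..r} f) {0..1}"
    using \<open>a < r\<close> by (simp add: algebra_simps)
  then show ?thesis using \<open>a < r\<close> by (simp add: integral_unique)
qed auto

lemma cont_rect_primitive:
  fixes f :: "real \<Rightarrow> real \<Rightarrow> real"
  assumes "cont_rect a b f"
  shows "cont_rect a b (\<lambda>r t. integral {a..r} (\<lambda>\<rho>. f \<rho> t))"
proof -
  have in_ab: "a + x * (r - a) \<in> {a..b}" if "r \<in> {a..b}" "x \<in> {0..1}" for r x :: real
    using that mult_right_mono[of x 1 "r - a"] by auto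
  have "continuous_on (({a..b} \<times> UNIV) \<times> cbox 0 1)
      (\<lambda>(p, x). f (a + x * (fst p - a)) (snd p))"
    unfolding split_beta
    by (rule continuous_on_compose2[OF assms(1)[unfolded cont_rect_def],
        where f = "\<lambda>q. (a + snd q * (fst (fst q) - a), snd (fst q))", simplified])
      (use in_ab in \<open>auto intro!: continuous_intros\<close>)
  from integral_continuous_on_param[OF this]
  have "continuous_on ({a..b} \<times> UNIV)
      (\<lambda>p. (fst p - a) * integral (cbox 0 1) (\<lambda>x. f (a + x * (fst p - a)) (snd p)))"
    by (intro continuous_intros) auto
  then show ?thesis
    unfolding cont_rect_def
    by (rule continuous_on_eq)
      (auto intro!: integral_rescale[symmetric] continuous_on_subset[OF cont_rect_slice1[OF assms]])
qed

lemma primitive_derivative1: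
  fixes f :: "real \<Rightarrow> real \<Rightarrow> real"
  assumes "cont_rect a b f" "a \<le> r" "r \<le> b"
  shows "((\<lambda>r. integral {a..r} (\<lambda>\<rho>. f \<rho> t)) has_real_derivative f r t) (at r within {a..b})"
  by (intro integral_has_real_derivative cont_rect_slice1 assms) (use assms in auto)

lemma primitive_derivative2:
  fixes f f' :: "real \<Rightarrow> real \<Rightarrow> real"
  assumes "cont_rect a b f" "cont_rect a b f'" "r \<le> b"
    and "\<And>r t. a \<le> r \<Longrightarrow> r \<le> b \<Longrightarrow> ((\<lambda>t. f r t) has_real_derivative f' r t) (at t)"
  shows "((\<lambda>t. integral {a..r} (\<lambda>\<rho>. f \<rho> t)) has_real_derivative integral {a..r} (\<lambda>\<rho>. f' \<rho> t)) (at t)"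
proof -
  have c: "continuous_on (UNIV \<times> cbox a r) (\<lambda>(t, r). f' r t)"
    using assms(3)
    by (auto simp: split_beta intro!: continuous_on_compose2[OF assms(2)[unfolded cont_rect_def],
        where f = "\<lambda>p. (snd p, fst p)", simplified] continuous_intros)
  have i: "(\<lambda>\<rho>. f \<rho> t) integrable_on cbox a r" for t
    using assms by (auto intro!: integrable_continuous_real continuous_on_subset[OF cont_rect_slice1[OF assms(1)]])
  show ?thesis
    using leibniz_rule_field_derivative[where f = "\<lambda>t r. f r t", OF _ i c, of t] assms by auto
qed

text \<open>As a function of the shift \<open>s\<close>, the integral over a window of one period
  has derivative f (2 pi + s) - f s = 0.\<close>

lemma periodic_integral_shift:
  fixes f :: "real \<Rightarrow> real"
  assumes "continuous_on UNIV f" "\<And>t. f (t + 2*pi) = f t"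
  shows "integral {0..2*pi} (\<lambda>t. f (t + s)) = integral {0..2*pi} f"
proof -
  obtain F where F: "\<And>x. (F has_vector_derivative f x) (at x)"
    using einterval_antiderivative[of "-\<infinity>" "\<infinity>" f] assms(1)
    by (auto simp: continuous_on_eq_continuous_at)
  have F': "(F has_real_derivative f x) (at x)" for x
    using F by (simp add: real_vector_derivative_iff)
  have 1: "integral {0..2*pi} (\<lambda>t. f (t + s)) = F (2*pi + s) - F (0 + s)" for s
    by (intro integral_unique fundamental_theorem_of_calculus)
      (auto intro!: DERIV_shift[THEN iffD1, OF F'] has_field_derivative_at_within
        simp: real_vector_derivative_iff[symmetric])
  have "((\<lambda>s. F (2*pi + s) - F (0 + s)) has_real_derivative f (2*pi + s) - f (0 + s)) (at s)" for s
    using F'[of "2*pi + s"] F'[of "0 + s"]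
    by (intro DERIV_diff) (simp_all add: DERIV_shift[symmetric] add.commute)
  then have "F (2*pi + s) - F (0 + s) = F (2*pi + 0) - F (0 + 0)"
    using assms(2) by (intro DERIV_isconst_all[of _ s 0]) (auto simp: add.commute)
  then show ?thesis using 1[of s] 1[of 0] by simp
qed

lemma rect_int_shift:
  assumes "cont_rect a b f" "\<And>r t. f r (t + 2*pi) = f r t"
  shows "rect_int a b (\<lambda>r t. f r (t + s)) = rect_int a b f"
proof -
  have "integral {0..2*pi} (\<lambda>t. f r (t + s)) = integral {0..2*pi} (\<lambda>t. f r t)" if "r \<in> {a..b}" for r
    using that by (intro periodic_integral_shift assms cont_rect_slice2[OF assms(1)]) auto
  then show ?thesis
    unfolding rect_int_rt[OF assms(1)] rect_int_rt[OF cont_rect_shift[OF assms(1)]]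
    by (rule integral_cong)
qed

lemma rect_int_fst:
  assumes "continuous_on {a..b} g"
  shows "rect_int a b (\<lambda>r t. g r) = 2 * pi * integral {a..b} g"
  using assms by (simp add: rect_int_rt cont_rect_fst)

lemma rect_int_derivative1:
  assumes "a \<le> b" "cont_rect a b F" "cont_rect a b f"
    and "\<And>r t. a \<le> r \<Longrightarrow> r \<le> b \<Longrightarrow> ((\<lambda>r. F r t) has_real_derivative f r t) (at r within {a..b})"
  shows "rect_int a b f = integral {0..2*pi} (\<lambda>t. F b t) - integral {0..2*pi} (\<lambda>t. F a t)"
proof -
  have "integral {a..b} (\<lambda>r. f r t) = F b t - F a t" for t
    by (intro integral_unique fundamental_theorem_of_calculus)
      (use assms in \<open>auto simp: real_vector_derivative_iff[symmetric]\<close>)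
  then show ?thesis
    unfolding rect_int_tr[OF assms(3)] using assms(1)
    by (simp add: integral_diff integrable_continuous_real cont_rect_slice2[OF assms(2)])
qed

lemma rect_int_derivative2:
  assumes "cont_rect a b f" "continuous_on {a..b} g"
    and "\<And>r t. a \<le> r \<Longrightarrow> r \<le> b \<Longrightarrow> ((\<lambda>t. F r t) has_real_derivative f r t) (at t)"
    and "\<And>r t. F r (t + 2*pi) = F r t"
  shows "rect_int a b (\<lambda>r t. g r * f r t) = 0"
proof -
  have "integral {0..2*pi} (\<lambda>t. f r t) = F r (2*pi) - F r 0" if "r \<in> {a..b}" for r
    by (intro integral_unique fundamental_theorem_of_calculus)
      (use that in \<open>auto intro!: has_field_derivative_at_within[OF assms(3)]
        simp: real_vector_derivative_iff[symmetric]\<close>)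
  moreover have "F r (2*pi) = F r 0" for r
    using assms(4)[of r 0] by simp
  ultimately have "integral {a..b} (\<lambda>r. integral {0..2*pi} (\<lambda>t. g r * f r t)) = integral {a..b} (\<lambda>r. 0)"
    by (intro integral_cong) simp
  then show ?thesis
    by (subst rect_int_rt) (auto intro!: cont_rects cont_rect_fst assms)
qed

lemma integral_inverse_ln:
  fixes a b :: real
  assumes "0 < a" "a \<le> b"
  shows "integral {a..b} (\<lambda>r. 1 / r) = ln (b / a)"
proof -
  have "((\<lambda>r. 1 / r) has_integral ln b - ln a) {a..b}"
  proof (rule fundamental_theorem_of_calculus[OF assms(2)])
    fix x assume "x \<in> {a..b}"
    then have "(ln has_real_derivative 1 / x) (at x within {a..b})"
      using assms by (auto intro!: derivative_eq_intros)
    then show "(ln has_vector_derivative 1 / x) (at x within {a..b})"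
      by (simp add: real_vector_derivative_iff)
  qed
  then show ?thesis using assms by (simp add: integral_unique ln_div)
qed

section \<open>A mollified corner and elementary inequalities for involutes\<close>

lemma has_derivative_max_square:
  "((\<lambda>x::real. (max 0 (x - c))^2) has_real_derivative 2 * max 0 (x - c)) (at x)"
proof (cases x c rule: linorder_cases)
  case less
  have "((\<lambda>x::real. 0) has_real_derivative 2 * max 0 (x - c)) (at x)"
    using less by simp
  then show ?thesis
    by (rule has_field_derivative_transform_within_open[of _ _ _ "{..<c}"]) (use less in auto)
next
  case greater
  have "((\<lambda>x::real. (x - c)^2) has_real_derivative 2 * max 0 (x - c)) (at x)"
    using greater by (auto intro!: derivative_eq_intros)
  then show ?thesis
    by (rule has_field_derivative_transform_within_open[of _ _ _ "{c<..}"]) (use greater in auto)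
next
  case equal
  have "((\<lambda>h. (max 0 h)^2 / h) \<longlongrightarrow> 0) (at (0::real))"
    by (rule Lim_null_comparison[where g = "\<lambda>h. \<bar>h\<bar>"])
      (auto simp: max_def power2_eq_square abs_mult intro!: always_eventually tendsto_eq_intros)
  then show ?thesis
    using equal by (simp add: DERIV_def)
qed

text \<open>A mollified version of the angle \<open>max 0 \<xi>\<close>, together with a unit speed plane curve
  \<open>(C, S)\<close> with that tangent angle: a straight line that closes up with the unit circle.\<close>

lemma bend_exists:
  fixes \<eta> :: real
  assumes "0 < \<eta>" "\<eta> \<le> 1"
  obtains \<sigma> \<sigma>' C S :: "real \<Rightarrow> real"
  where "continuous_on UNIV \<sigma>'" "\<And>x. (\<sigma> has_real_derivative \<sigma>' x) (at x)"
    "\<And>x. (C has_real_derivative - sin (\<sigma> x)) (at x)" "\<And>x. (S has_real_derivative cos (\<sigma> x)) (at x)"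
    "\<And>x. 0 \<le> \<sigma>' x" "\<And>x. \<sigma>' x \<le> 1"
    "\<And>x. x \<le> 0 \<Longrightarrow> \<sigma> x = 0" "\<And>x. x \<le> 0 \<Longrightarrow> \<sigma>' x = 0"
    "\<And>x. x \<le> 0 \<Longrightarrow> C x = 1" "\<And>x. x \<le> 0 \<Longrightarrow> S x = x"
    "\<And>x. 0 \<le> x \<Longrightarrow> 0 \<le> \<sigma> x" "\<And>x. 0 \<le> x \<Longrightarrow> \<sigma> x \<le> x" "\<And>x. 0 \<le> x \<Longrightarrow> x - \<sigma> x \<le> \<eta>"
    "\<And>x. 0 \<le> x \<Longrightarrow> \<bar>C x - cos (\<sigma> x)\<bar> \<le> \<eta>" "\<And>x. 0 \<le> x \<Longrightarrow> \<bar>S x - sin (\<sigma> x)\<bar> \<le> \<eta>"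
    "\<And>x. 0 \<le> x \<Longrightarrow> \<sigma>' x < 1 \<Longrightarrow> \<sigma> x \<le> \<eta>"
proof -
  \<comment> \<open>The derivative climbs linearly from 0 to 1 on [0, \<eta>] and is constant on
    either side, so that \<sigma> ends up trailing the corner by \<eta> / 2.\<close>
  define \<sigma> where "\<sigma> = (\<lambda>x. ((max 0 (x - 0))^2 - (max 0 (x - \<eta>))^2) / (2 * \<eta>))"
  define \<sigma>' where "\<sigma>' = (\<lambda>x. (max 0 (x - 0) - max 0 (x - \<eta>)) / \<eta>)"
  have \<sigma>: "(\<sigma> has_real_derivative \<sigma>' x) (at x)" for x
    unfolding \<sigma>_def
    by (rule DERIV_cong[OF DERIV_cdivide[OF DERIV_diff[OF has_derivative_max_square has_derivative_max_square]]])
      (simp add: \<sigma>'_def diff_divide_distrib)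
  have cont: "continuous_on UNIV \<sigma>"
    using \<sigma> by (meson DERIV_isCont continuous_at_imp_continuous_on)
  have "\<exists>F. \<forall>x. (F has_real_derivative f x) (at x)" if "continuous_on UNIV f" for f :: "real \<Rightarrow> real"
    using einterval_antiderivative[of "-\<infinity>" "\<infinity>" f] that
    by (auto simp: continuous_on_eq_continuous_at real_vector_derivative_iff)
  note prim = this
  obtain C0 where C0: "(C0 has_real_derivative - sin (\<sigma> x)) (at x)" for x
    using prim[OF continuous_on_minus[OF continuous_on_sin[OF cont]]] by blast
  obtain S0 where S0: "(S0 has_real_derivative cos (\<sigma> x)) (at x)" for x
    using prim[OF continuous_on_cos[OF cont]] by blast
  define C S where "C = (\<lambda>x. C0 x - C0 0 + 1)" and "S = (\<lambda>x. S0 x - S0 0)"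
  have C: "(C has_real_derivative - sin (\<sigma> x)) (at x)" and S: "(S has_real_derivative cos (\<sigma> x)) (at x)" for x
    unfolding C_def S_def by (auto intro!: derivative_eq_intros C0 S0)
  have \<sigma>'_range: "0 \<le> \<sigma>' x" "\<sigma>' x \<le> 1" for x
    using assms by (auto simp: \<sigma>'_def divide_simps)
  have neg: "\<sigma> x = 0" "\<sigma>' x = 0" if "x \<le> 0" for x
    using that assms by (auto simp: \<sigma>_def \<sigma>'_def)
  have Cneg: "C x = 1" if "x \<le> 0" for x
  proof -
    have "\<exists>c. \<forall>x\<in>{..0}. C x = c"
      by (rule has_field_derivative_zero_constant)
        (use neg in \<open>auto intro!: has_field_derivative_at_within[OF C[THEN DERIV_cong]]\<close>)
    then have "C x = C 0" using that by force
    then show ?thesis by (simp add: C_def)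
  qed
  have Sneg: "S x = x" if "x \<le> 0" for x
  proof -
    have "\<exists>c. \<forall>x\<in>{..0}. S x - x = c"
      by (rule has_field_derivative_zero_constant)
        (use neg in \<open>auto intro!: derivative_eq_intros has_field_derivative_at_within[OF S]\<close>)
    then have "S x - x = S 0 - 0" using that by force
    then show ?thesis by (simp add: S_def)
  qed
  have pos: "0 \<le> \<sigma> x" "\<sigma> x \<le> x" "x - \<sigma> x \<le> \<eta>" if "0 \<le> x" for x
  proof -
    have "(max 0 (x - 0))^2 = x^2" using that by simp
    moreover have "0 \<le> max 0 (x - \<eta>)" "max 0 (x - \<eta>) \<le> x" "x - \<eta> \<le> max 0 (x - \<eta>)"
      using that assms by auto
    moreover have "(max 0 (x - \<eta>))^2 \<le> x^2"
      using calculation by (intro power_mono) auto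
    moreover have "x^2 - (max 0 (x - \<eta>))^2 \<le> 2 * \<eta> * x"
    proof (cases "x \<le> \<eta>")
      case True
      then have "x * x \<le> (2 * \<eta>) * x" using that assms by (intro mult_right_mono) auto
      then show ?thesis using True that by (simp add: power2_eq_square)
    qed (simp add: max_def power2_eq_square algebra_simps)
    moreover have "2 * \<eta> * (x - \<eta>) \<le> x^2 - (max 0 (x - \<eta>))^2"
    proof (cases "x \<le> \<eta>")
      case True
      then have "2 * \<eta> * (x - \<eta>) \<le> 0" using assms by (simp add: mult_le_0_iff)
      then show ?thesis using True by (simp add: order_trans[OF _ zero_le_power2])
    next
      case False
      have "0 \<le> \<eta> * \<eta>" by simp
      then show ?thesis using False by (simp add: power2_eq_square algebra_simps)
    qed
    ultimately show "0 \<le> \<sigma> x" "\<sigma> x \<le> x" "x - \<sigma> x \<le> \<eta>"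
      using assms by (simp_all add: \<sigma>_def field_simps)
  qed
  have mono: "f 0 \<le> f x" if "0 \<le> x" "\<And>y. \<exists>d. (f has_real_derivative d) (at y) \<and> 0 \<le> d" for f :: "real \<Rightarrow> real" and x
    using that by (intro DERIV_nonneg_imp_nondecreasing[of 0 x f]) auto
  \<comment> \<open>The derivatives of \<open>C - cos \<sigma>\<close> and
    \<open>S - sin \<sigma>\<close> are at most 1 - \<sigma>' in absolute value, which is the
    derivative of x - \<sigma>. Hence these differences, taken with either sign, become monotone
    when x - \<sigma> is added, and x - \<sigma> never exceeds \<eta>.\<close>
  have le: "\<bar>sin (\<sigma> x) * (1 - \<sigma>' x)\<bar> \<le> 1 - \<sigma>' x" "\<bar>cos (\<sigma> x) * (1 - \<sigma>' x)\<bar> \<le> 1 - \<sigma>' x" for x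
    using \<sigma>'_range[of x] by (auto simp: abs_mult intro!: mult_left_le_one_le)
  have Cb: "\<bar>C x - cos (\<sigma> x)\<bar> \<le> \<eta>" if "0 \<le> x" for x
  proof -
    have "C 0 - cos (\<sigma> 0) + (0 - \<sigma> 0) \<le> C x - cos (\<sigma> x) + (x - \<sigma> x)"
    proof (rule mono[OF that])
      fix y
      have "((\<lambda>y. C y - cos (\<sigma> y) + (y - \<sigma> y)) has_real_derivative - sin (\<sigma> y) - (- sin (\<sigma> y) * \<sigma>' y) + (1 - \<sigma>' y)) (at y)"
        by (auto intro!: derivative_eq_intros C \<sigma>)
      moreover have "0 \<le> - sin (\<sigma> y) - (- sin (\<sigma> y) * \<sigma>' y) + (1 - \<sigma>' y)"
        using le[of y] by (simp add: algebra_simps abs_le_iff)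
      ultimately show "\<exists>d. ((\<lambda>y. C y - cos (\<sigma> y) + (y - \<sigma> y)) has_real_derivative d) (at y) \<and> 0 \<le> d" by blast
    qed
    moreover have "- C 0 + cos (\<sigma> 0) + (0 - \<sigma> 0) \<le> - C x + cos (\<sigma> x) + (x - \<sigma> x)"
    proof (rule mono[OF that])
      fix y
      have "((\<lambda>y. - C y + cos (\<sigma> y) + (y - \<sigma> y)) has_real_derivative - (- sin (\<sigma> y) - (- sin (\<sigma> y) * \<sigma>' y)) + (1 - \<sigma>' y)) (at y)"
        by (auto intro!: derivative_eq_intros C \<sigma>)
      moreover have "0 \<le> - (- sin (\<sigma> y) - (- sin (\<sigma> y) * \<sigma>' y)) + (1 - \<sigma>' y)"
        using le[of y] by (simp add: algebra_simps abs_le_iff)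
      ultimately show "\<exists>d. ((\<lambda>y. - C y + cos (\<sigma> y) + (y - \<sigma> y)) has_real_derivative d) (at y) \<and> 0 \<le> d" by blast
    qed
    ultimately show ?thesis using pos[OF that] Cneg[of 0] neg[of 0] by (simp add: abs_le_iff)
  qed
  have Sb: "\<bar>S x - sin (\<sigma> x)\<bar> \<le> \<eta>" if "0 \<le> x" for x
  proof -
    have "S 0 - sin (\<sigma> 0) + (0 - \<sigma> 0) \<le> S x - sin (\<sigma> x) + (x - \<sigma> x)"
    proof (rule mono[OF that])
      fix y
      have "((\<lambda>y. S y - sin (\<sigma> y) + (y - \<sigma> y)) has_real_derivative cos (\<sigma> y) - (cos (\<sigma> y) * \<sigma>' y) + (1 - \<sigma>' y)) (at y)"
        by (auto intro!: derivative_eq_intros S \<sigma>)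
      moreover have "0 \<le> cos (\<sigma> y) - (cos (\<sigma> y) * \<sigma>' y) + (1 - \<sigma>' y)"
        using le[of y] by (simp add: algebra_simps abs_le_iff)
      ultimately show "\<exists>d. ((\<lambda>y. S y - sin (\<sigma> y) + (y - \<sigma> y)) has_real_derivative d) (at y) \<and> 0 \<le> d" by blast
    qed
    moreover have "- S 0 + sin (\<sigma> 0) + (0 - \<sigma> 0) \<le> - S x + sin (\<sigma> x) + (x - \<sigma> x)"
    proof (rule mono[OF that])
      fix y
      have "((\<lambda>y. - S y + sin (\<sigma> y) + (y - \<sigma> y)) has_real_derivative - (cos (\<sigma> y) - (cos (\<sigma> y) * \<sigma>' y)) + (1 - \<sigma>' y)) (at y)"
        by (auto intro!: derivative_eq_intros S \<sigma>)
      moreover have "0 \<le> - (cos (\<sigma> y) - (cos (\<sigma> y) * \<sigma>' y)) + (1 - \<sigma>' y)"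
        using le[of y] by (simp add: algebra_simps abs_le_iff)
      ultimately show "\<exists>d. ((\<lambda>y. - S y + sin (\<sigma> y) + (y - \<sigma> y)) has_real_derivative d) (at y) \<and> 0 \<le> d" by blast
    qed
    ultimately show ?thesis using pos[OF that] Sneg[of 0] neg[of 0] by (simp add: abs_le_iff)
  qed
  have small: "\<sigma> x \<le> \<eta>" if "0 \<le> x" "\<sigma>' x < 1" for x
  proof -
    have "x < \<eta>" using that assms by (auto simp: \<sigma>'_def max_def split: if_splits)
    then show ?thesis using pos(2)[OF that(1)] by simp
  qed
  have cont': "continuous_on UNIV \<sigma>'"
    unfolding \<sigma>'_def using assms by (intro continuous_intros) auto
  show ?thesis
    by (rule that[OF cont' \<sigma> C S \<sigma>'_range(1) \<sigma>'_range(2) neg(1) neg(2) Cneg Sneg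
          pos(1) pos(2) pos(3) Cb Sb small])
qed

lemma angle_le_2_tan_half:
  assumes "0 \<le> p" "p < pi"
  shows "p \<le> 2 * tan (p / 2)"
proof -
  have "\<bar>p / 2\<bar> \<le> \<bar>tan (p / 2)\<bar>" using assms by (intro abs_tan_ge) auto
  moreover have "0 \<le> tan (p / 2)" using assms tan_gt_zero[of "p/2"] by (cases "p = 0") auto
  ultimately show ?thesis using assms by simp
qed

text \<open>For negative y = -p, the half-angle identity sin p + tan (p/2) (1 - cos p) = 2 tan (p/2)
  together with tan (p/2) \<ge> p/2 gives the claim with p/2 in place of \<kappa>, and p/2 \<le>
  \<kappa> allows the replacement.\<close>

lemma angle_inequality:
  assumes "0 \<le> \<kappa>" "\<kappa> < pi / 2" "- 2 * \<kappa> \<le> y"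
  shows "0 \<le> y - sin y + tan \<kappa> * (1 - cos y)"
proof (cases "0 \<le> y")
  case True
  have "0 \<le> tan \<kappa>" using assms tan_gt_zero[of \<kappa>] by (cases "\<kappa> = 0") auto
  then show ?thesis using True sin_x_le_x[OF True] by simp
next
  case False
  define p where "p = - y"
  have p: "0 < p" "p \<le> 2 * \<kappa>" "p < pi" using False assms by (auto simp: p_def)
  define s c where "s = sin (p / 2)" and "c = cos (p / 2)"
  have c: "0 < c" using p by (auto simp: c_def intro!: cos_gt_zero)
  have sc: "s^2 + c^2 = 1" by (simp add: s_def c_def)
  have sp: "sin p = 2 * s * c" "cos p = 1 - 2 * s^2"
    using sin_double[of "p/2"] cos_double_sin[of "p/2"] by (auto simp: s_def c_def)
  have "tan (p / 2) \<le> tan \<kappa>"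
  proof (cases "p / 2 = \<kappa>")
    case False
    then show ?thesis
      using p assms by (intro less_imp_le tan_monotone) auto
  qed simp
  then have "tan (p/2) * (1 - cos p) \<le> tan \<kappa> * (1 - cos p)"
    by (intro mult_right_mono) auto
  moreover have "sin p + tan (p/2) * (1 - cos p) = 2 * tan (p/2)"
  proof -
    have "sin p + tan (p/2) * (1 - cos p) = 2 * s * c + s / c * (2 * s^2)"
      by (simp add: sp tan_def s_def c_def)
    also have "\<dots> = 2 * (s / c) * (c^2 + s^2)"
      using c by (simp add: field_simps power2_eq_square)
    also have "\<dots> = 2 * tan (p / 2)" using sc by (simp add: tan_def s_def c_def add.commute)
    finally show ?thesis .
  qed
  ultimately have "0 \<le> - p + sin p + tan \<kappa> * (1 - cos p)"
    using angle_le_2_tan_half[of p] p by linarith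
  then show ?thesis by (simp add: p_def)
qed

text \<open>The substitution l = a tan \<kappa>, x = y + 2 \<kappa> turns this into
  \<open>angle_inequality\<close>. It is the condition under which the two calibrations match on the
  circle r = \<open>k\<close>; equality occurs at x = 2 arctan (l / a), in particular at l = x = 0,
  the position of the twist.\<close>

lemma involute_inequality:
  assumes "0 < a" "0 \<le> l" "0 \<le> x"
  shows "0 \<le> a * x - a * sin x + l * (1 + cos x) - 2 * a * arctan (l / a)"
proof -
  define \<kappa> where "\<kappa> = arctan (l / a)"
  have \<kappa>: "0 \<le> \<kappa>" "\<kappa> < pi / 2" and l: "l = a * tan \<kappa>"
    using assms by (auto simp: \<kappa>_def arctan_ubound[of "l/a", simplified] tan_arctan)
  have c: "0 < cos \<kappa>" using \<kappa> by (intro cos_gt_zero_pi) auto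
  define y where "y = x - 2 * \<kappa>"
  have x: "x = y + 2 * \<kappa>" by (simp add: y_def)
  have "tan \<kappa> * cos x - sin x = - (sin (x - \<kappa>) / cos \<kappa>)"
    using c by (simp add: tan_def sin_diff field_simps)
  moreover have "sin (x - \<kappa>) / cos \<kappa> = sin y + tan \<kappa> * cos y"
  proof -
    have "x - \<kappa> = y + \<kappa>" by (simp add: y_def)
    then show ?thesis using c by (simp add: tan_def sin_add field_simps)
  qed
  ultimately have "x - sin x + tan \<kappa> * (1 + cos x) - 2 * \<kappa> = y - sin y + tan \<kappa> * (1 - cos y)"
    by (simp add: algebra_simps y_def)
  then have "0 \<le> x - sin x + tan \<kappa> * (1 + cos x) - 2 * \<kappa>"
    using angle_inequality[OF \<kappa>, of y] assms by (simp add: y_def)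
  then have "0 \<le> a * (x - sin x + tan \<kappa> * (1 + cos x) - 2 * \<kappa>)"
    using assms by simp
  also have "\<dots> = a * x - a * sin x + (a * tan \<kappa>) * (1 + cos x) - 2 * a * \<kappa>"
    by (simp add: algebra_simps)
  finally show ?thesis by (simp only: \<kappa>_def[symmetric] l[symmetric])
qed

text \<open>Both sides are the Euclidean metric. On the right it is in polar coordinates with
  modulus sqrt (a^2 + l^2) and angular derivative \<open>A\<close>; on the left it is in terms of
  the tangent length \<open>l\<close> and the contact angle, which is the polar angle plus arctan (l
  / a) and has derivative \<open>A + a * l' / (a^2 + l^2)\<close>.\<close>

lemma involute_metric:
  fixes a l l' A :: real
  assumes "0 < a"
  shows "(l * (A + a * l' / (a^2 + l^2)))^2 + (a * (A + a * l' / (a^2 + l^2)) - l')^2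
    = (a^2 + l^2) * A^2 + (l * l')^2 / (a^2 + l^2)"
proof -
  define R where "R = a^2 + l^2"
  have R: "R > 0" using assms by (simp add: R_def add_pos_nonneg)
  define y where "y = l' / R"
  have l': "l' = R * y" using R by (simp add: y_def)
  have "(l * (A + a * y))^2 + (a * (A + a * y) - R * y)^2 = R * A^2 + l^2 * (R * y^2)"
    unfolding R_def by algebra
  moreover have "a * (R * y) / R = a * y" "(l * (R * y))^2 / R = l^2 * (R * y^2)"
    using R by (simp_all add: power2_eq_square)
  ultimately show ?thesis
    unfolding R_def[symmetric] l' by simp
qed

text \<open>The missing square is that of l A - a l l' / (a^2 + l^2). The bracket on the left is the
  derivative of the string length around the disc, and the inequality says that this function has
  gradient of length at most one.\<close>

lemma involute_gradient_le:
  fixes a l l' A :: real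
  assumes "0 < a"
  shows "(a * A + l^2 * l' / (a^2 + l^2))^2 \<le> (a^2 + l^2) * A^2 + (l * l')^2 / (a^2 + l^2)"
proof -
  define R where "R = a^2 + l^2"
  have R: "R > 0" using assms by (simp add: R_def add_pos_nonneg)
  define y where "y = l' / R"
  have l': "l' = R * y" using R by (simp add: y_def)
  have "(a * A + l^2 * y)^2 + (l * A - a * l * y)^2 = R * A^2 + l^2 * (R * y^2)"
    unfolding R_def by algebra
  then have "(a * A + l^2 * y)^2 \<le> R * A^2 + l^2 * (R * y^2)"
    using zero_le_power2[of "l * A - a * l * y"] by linarith
  moreover have "l^2 * (R * y) / R = l^2 * y" "(l * (R * y))^2 / R = l^2 * (R * y^2)"
    using R by (simp_all add: power2_eq_square)
  ultimately show ?thesis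
    unfolding R_def[symmetric] l' by simp
qed

subsection \<open>Calibrations in the exterior of the inner disc\<close>

text \<open>Data of a map in the exterior of the disc of radius \<open>a\<close>: \<open>l\<close> is the length of the tangent
  from the image point to that disc, so that the modulus of the image is \<open>sqrt (a^2 + l^2)\<close>, and
  \<open>t + X\<close> is its angle, up to the closing error \<open>e\<close>. The bounds on \<open>M1\<close>, \<open>M2\<close> say that these
  dominate the squared speeds of that map in the directions \<open>r\<close> and \<open>t\<close>.\<close>

locale exterior_lift =
  fixes a p q L :: real and X A1 A2 e l l1 l2 M1 M2 :: "real \<Rightarrow> real \<Rightarrow> real"
  assumes a_pos: "0 < a" and p_pos: "0 < p" and pq: "p \<le> q"
    and conts: "cont_rect p q X" "cont_rect p q A1" "cont_rect p q A2" "cont_rect p q e"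
      "cont_rect p q l" "cont_rect p q l1" "cont_rect p q l2" "cont_rect p q M1" "cont_rect p q M2"
    and X_r: "\<And>r t. p \<le> r \<Longrightarrow> r \<le> q \<Longrightarrow> ((\<lambda>r. X r t) has_real_derivative A1 r t) (at r within {p..q})"
    and X_t: "\<And>r t. p \<le> r \<Longrightarrow> r \<le> q \<Longrightarrow> ((\<lambda>t. X r t) has_real_derivative A2 r t - 1 - e r t) (at t)"
    and l_r: "\<And>r t. p \<le> r \<Longrightarrow> r \<le> q \<Longrightarrow> ((\<lambda>r. l r t) has_real_derivative l1 r t) (at r within {p..q})"
    and l_t: "\<And>r t. p \<le> r \<Longrightarrow> r \<le> q \<Longrightarrow> ((\<lambda>t. l r t) has_real_derivative l2 r t) (at t)"
    and per: "\<And>r t. X r (t + 2*pi) = X r t" "\<And>r t. l r (t + 2*pi) = l r t"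
    and l_range: "\<And>r t. p \<le> r \<Longrightarrow> r \<le> q \<Longrightarrow> 0 \<le> l r t" "\<And>r t. p \<le> r \<Longrightarrow> r \<le> q \<Longrightarrow> l r t \<le> L"
    and M1: "\<And>r t. p \<le> r \<Longrightarrow> r \<le> q \<Longrightarrow>
      (a^2 + (l r t)^2) * (A1 r t)^2 + (l r t * l1 r t)^2 / (a^2 + (l r t)^2) \<le> M1 r t"
    and M2: "\<And>r t. p \<le> r \<Longrightarrow> r \<le> q \<Longrightarrow>
      (a^2 + (l r t)^2) * (A2 r t)^2 + (l r t * l2 r t)^2 / (a^2 + (l r t)^2) \<le> M2 r t"
begin

definition energy :: real where
  "energy = rect_int p q (\<lambda>r t. r * M1 r t + M2 r t / r) / 2"

text \<open>Length of a taut string: the arc of the disc up to the contact point with angle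
  \<open>X - arctan (l / a)\<close>, then the free tangent of length \<open>l\<close>.
  \<open>X\<close> stands in place of the full angle t + X, which makes the function periodic in
  t.\<close>

definition involute :: "real \<Rightarrow> real \<Rightarrow> real" where
  "involute r t = a * X r t + l r t - a * arctan (l r t / a)"

lemma R_pos: "0 < a^2 + (l r t)^2"
  using a_pos by (simp add: add_pos_nonneg)

lemma arctan_derivative:
  assumes "(f has_real_derivative f') (at x within s)"
  shows "((\<lambda>x. arctan (f x / a)) has_real_derivative a * f' / (a^2 + (f x)^2)) (at x within s)"
proof -
  have "inverse (1 + (f x / a)^2) * (f' / a) = a * f' / (a^2 + (f x)^2)"
  proof -
    have "1 + (f x / a)^2 = (a^2 + (f x)^2) / a^2"
      using a_pos by (simp add: field_simps)
    then show ?thesis using a_pos by (simp add: power2_eq_square)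
  qed
  then show ?thesis
    using DERIV_chain2[OF DERIV_arctan DERIV_cdivide[OF assms, of a]] by simp
qed

lemma inv_r_cont: "continuous_on {p..q} (\<lambda>r. 1 / r)"
  using p_pos by (auto intro!: continuous_intros)

lemma energy_integrand_cont: "cont_rect p q (\<lambda>r t. r * M1 r t + M2 r t / r)"
  using p_pos by (intro cont_rects conts) auto

text \<open>The squares are replaced by their tangents at the values taken on the twist,
  \<open>a * m / r\<close> for the radial derivative of the string length and \<open>a\<close> for
  its full angular derivative. What is left are exact derivatives: the angular one integrates to
  zero, the radial one to the values at \<open>p\<close> and \<open>q\<close>.\<close>

lemma involute_energy_bound:
  "energy \<ge> a * m * (integral {0..2*pi} (involute q) - integral {0..2*pi} (involute p))
     + pi * a^2 * (1 - m^2) * ln (q / p) - a^2 / p * rect_int p q (\<lambda>r t. \<bar>e r t\<bar>)"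
proof -
  define G1 where "G1 = (\<lambda>r t. a * A1 r t + (l r t)^2 * l1 r t / (a^2 + (l r t)^2))"
  define G2 where "G2 = (\<lambda>r t. a * (A2 r t - 1 - e r t) + (l r t)^2 * l2 r t / (a^2 + (l r t)^2))"
  have cG: "cont_rect p q G1" "cont_rect p q G2" "cont_rect p q involute"
    unfolding G1_def G2_def involute_def using R_pos a_pos
    by (intro cont_rects conts; simp add: less_imp_neq[THEN not_sym])+
  have split: "a * A + l' - a * (a * l' / (a^2 + (l r t)^2)) = a * A + (l r t)^2 * l' / (a^2 + (l r t)^2)"
    for A l' r t
  proof -
    have "a * (a * l' / (a^2 + (l r t)^2)) + (l r t)^2 * l' / (a^2 + (l r t)^2)
        = (a^2 + (l r t)^2) * l' / (a^2 + (l r t)^2)"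
      by (simp add: algebra_simps add_divide_distrib power2_eq_square)
    also have "\<dots> = l'" using a_pos by simp
    finally show ?thesis by simp
  qed
  have G1: "((\<lambda>r. involute r t) has_real_derivative G1 r t) (at r within {p..q})"
    if "p \<le> r" "r \<le> q" for r t
    unfolding involute_def G1_def split[symmetric]
    by (intro DERIV_add DERIV_diff DERIV_cmult X_r l_r arctan_derivative that)
  have G2: "((\<lambda>t. involute r t) has_real_derivative G2 r t) (at t)"
    if "p \<le> r" "r \<le> q" for r t
    unfolding involute_def G2_def split[symmetric]
    by (intro DERIV_add DERIV_diff DERIV_cmult X_t l_t arctan_derivative that)
  have iper: "involute r (t + 2*pi) = involute r t" for r t
    by (simp add: involute_def per)
  define low where "low = (\<lambda>r t. 2 * a * m * G1 r t + 2 * a * (1 / r * G2 r t)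
      + a^2 * (1 - m^2) * (1 / r) - 2 * a^2 / p * \<bar>e r t\<bar>)"
  have low: "low r t \<le> r * M1 r t + M2 r t / r" if r: "p \<le> r" "r \<le> q" for r t
  proof -
    have r0: "0 < r" using r p_pos by simp
    have 1: "(G1 r t)^2 \<le> M1 r t"
      unfolding G1_def using involute_gradient_le[OF a_pos] M1[OF r, of t] by (rule order_trans)
    \<comment> \<open>Adds back the multiple \<open>a * (1 + e)\<close> that the derivative of
      \<open>X\<close> in t subtracts from that of the true angle, so that \<open>Y\<close> is the
      quantity controlled by \<open>M2\<close>.\<close>
    define Y where "Y = G2 r t + a + a * e r t"
    have "Y = a * A2 r t + (l r t)^2 * l2 r t / (a^2 + (l r t)^2)"
      by (simp add: Y_def G2_def algebra_simps)
    then have 2: "Y^2 \<le> M2 r t"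
      using involute_gradient_le[OF a_pos, of "A2 r t" "l r t" "l2 r t"] M2[OF r, of t] by simp
    have "0 \<le> (r * G1 r t - a * m)^2 / r" using r0 by simp
    also have "\<dots> = r * (G1 r t)^2 - 2 * a * m * G1 r t + a^2 * m^2 / r"
      using r0 by (simp add: power2_eq_square field_simps)
    also have "r * (G1 r t)^2 \<le> r * M1 r t" using 1 r0 by simp
    finally have I1: "2 * a * m * G1 r t - a^2 * m^2 / r \<le> r * M1 r t" by simp
    have "0 \<le> (Y - a)^2 / r" using r0 by simp
    also have "\<dots> = Y^2 / r - 2 * a * Y / r + a^2 / r"
      using r0 by (simp add: power2_eq_square field_simps)
    also have "Y^2 / r \<le> M2 r t / r" using 2 r0 by (simp add: divide_right_mono)
    finally have I2: "2 * a * Y / r - a^2 / r \<le> M2 r t / r" by simp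
    have I3: "- (2 * a^2 / p * \<bar>e r t\<bar>) \<le> 2 * a^2 / r * e r t"
    proof -
      have "- (2 * a^2 / r * e r t) \<le> 2 * a^2 / r * \<bar>e r t\<bar>"
        using r0 by (simp add: abs_if mult_nonneg_nonpos divide_nonpos_nonneg)
      also have "\<dots> \<le> 2 * a^2 / p * \<bar>e r t\<bar>"
        using r0 p_pos r by (intro mult_right_mono divide_left_mono) auto
      finally show ?thesis by simp
    qed
    have "2 * a * Y / r - a^2 / r = 2 * a * (1 / r * G2 r t) + a^2 * (1 / r) + 2 * a^2 / r * e r t"
      using r0 by (simp add: Y_def field_simps power2_eq_square)
    moreover have "a^2 * (1 - m^2) * (1 / r) = a^2 * (1 / r) - a^2 * m^2 / r"
      by (simp add: algebra_simps diff_divide_distrib)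
    ultimately show ?thesis using I1 I2 I3 unfolding low_def by linarith
  qed
  have clow: "cont_rect p q low"
    unfolding low_def using p_pos by (intro cont_rects cG conts) auto
  have cr: "cont_rect p q (\<lambda>r t. 1 / r)" by (rule cont_rect_fst[OF inv_r_cont])
  have "rect_int p q low \<le> 2 * energy"
    unfolding energy_def
    using rect_int_mono[OF clow energy_integrand_cont low] by simp
  moreover have "rect_int p q low = 2 * a * m * rect_int p q G1 + 2 * a * rect_int p q (\<lambda>r t. 1 / r * G2 r t)
      + a^2 * (1 - m^2) * rect_int p q (\<lambda>r t. 1 / r) - 2 * a^2 / p * rect_int p q (\<lambda>r t. \<bar>e r t\<bar>)"
    unfolding low_def
    by (subst rect_int_diff rect_int_add; (intro cont_rects cG conts cr)?)+
      (simp only: rect_int_cmult)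
  moreover have "rect_int p q G1 = integral {0..2*pi} (involute q) - integral {0..2*pi} (involute p)"
    using rect_int_derivative1[OF pq cG(3) cG(1) G1] by simp
  moreover have "rect_int p q (\<lambda>r t. 1 / r * G2 r t) = 0"
    by (rule rect_int_derivative2[OF cG(2) inv_r_cont G2 iper])
  moreover have "rect_int p q (\<lambda>r t. 1 / r) = 2 * pi * ln (q / p)"
    by (simp only: rect_int_fst[OF inv_r_cont] integral_inverse_ln[OF p_pos pq])
  ultimately show ?thesis by (simp add: algebra_simps)
qed

end

section \<open>The development onto the plane and comparison with the harmonic map\<close>

lemma rotate_norm:
  fixes x y s :: real
  shows "(cos s * x - sin s * y)^2 + (sin s * x + cos s * y)^2 = x^2 + y^2"
proof -
  have "(cos s * x - sin s * y)^2 + (sin s * x + cos s * y)^2 = ((sin s)^2 + (cos s)^2) * (x^2 + y^2)"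
    by algebra
  then show ?thesis by simp
qed

lemma abs_cos_diff_le: "\<bar>cos x - cos y\<bar> \<le> \<bar>x - y\<bar>" for x y :: real
proof -
  have "\<bar>cos x - cos y\<bar> = 2 * (\<bar>sin ((x + y) / 2)\<bar> * \<bar>sin ((y - x) / 2)\<bar>)"
    by (simp add: cos_diff_cos abs_mult)
  also have "\<dots> \<le> 2 * (1 * \<bar>(y - x) / 2\<bar>)"
    by (intro mult_left_mono mult_mono abs_sin_x_le_abs_x) auto
  finally show ?thesis by (simp add: abs_minus_commute)
qed

lemma abs_sin_diff_le: "\<bar>sin x - sin y\<bar> \<le> \<bar>x - y\<bar>" for x y :: real
  using abs_cos_diff_le[of "pi/2 - x" "pi/2 - y"] by (simp add: cos_diff)

locale bend =
  fixes \<eta> :: real and \<sigma> \<sigma>' C S :: "real \<Rightarrow> real"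
  assumes eta: "0 < \<eta>" "\<eta> \<le> 1"
    and sigma'_cont: "continuous_on UNIV \<sigma>'" and sigma: "\<And>x. (\<sigma> has_real_derivative \<sigma>' x) (at x)"
    and C: "\<And>x. (C has_real_derivative - sin (\<sigma> x)) (at x)"
    and S: "\<And>x. (S has_real_derivative cos (\<sigma> x)) (at x)"
    and sigma'_range: "\<And>x. 0 \<le> \<sigma>' x" "\<And>x. \<sigma>' x \<le> 1"
    and neg: "\<And>x. x \<le> 0 \<Longrightarrow> \<sigma> x = 0" "\<And>x. x \<le> 0 \<Longrightarrow> \<sigma>' x = 0"
      "\<And>x. x \<le> 0 \<Longrightarrow> C x = 1" "\<And>x. x \<le> 0 \<Longrightarrow> S x = x"
    and pos: "\<And>x. 0 \<le> x \<Longrightarrow> 0 \<le> \<sigma> x" "\<And>x. 0 \<le> x \<Longrightarrow> \<sigma> x \<le> x" "\<And>x. 0 \<le> x \<Longrightarrow> x - \<sigma> x \<le> \<eta>"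
    and CS_close: "\<And>x. 0 \<le> x \<Longrightarrow> \<bar>C x - cos (\<sigma> x)\<bar> \<le> \<eta>" "\<And>x. 0 \<le> x \<Longrightarrow> \<bar>S x - sin (\<sigma> x)\<bar> \<le> \<eta>"
    and small: "\<And>x. 0 \<le> x \<Longrightarrow> \<sigma>' x < 1 \<Longrightarrow> \<sigma> x \<le> \<eta>"
begin

lemma bend_conts: "continuous_on UNIV \<sigma>" "continuous_on UNIV C" "continuous_on UNIV S"
  using sigma C S by (meson DERIV_isCont continuous_at_imp_continuous_on)+

text \<open>Cartesian coordinates of the map that develops the universal cover of the exterior of the
  disc of radius \<open>a\<close> onto a half plane: beyond the tangent line at angle \<open>0\<close> it only keeps the
  distance along that line. The arguments are the tangent length and the angle of its contact point.\<close>

definition dev1 :: "real \<Rightarrow> real \<Rightarrow> real \<Rightarrow> real" where "dev1 a l x = a * C x + l * sin (\<sigma> x)"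
definition dev2 :: "real \<Rightarrow> real \<Rightarrow> real \<Rightarrow> real" where "dev2 a l x = a * S x - l * cos (\<sigma> x)"
text \<open>Partial derivatives of the development in the contact angle at fixed tangent length,
  that is, the image of the rotation field.\<close>

definition dev1' :: "real \<Rightarrow> real \<Rightarrow> real \<Rightarrow> real" where "dev1' a l x = l * \<sigma>' x * cos (\<sigma> x) - a * sin (\<sigma> x)"
definition dev2' :: "real \<Rightarrow> real \<Rightarrow> real \<Rightarrow> real" where "dev2' a l x = l * \<sigma>' x * sin (\<sigma> x) + a * cos (\<sigma> x)"

text \<open>The derivative is displayed in the frame turned by \<sigma>, with components
  \<open>l * \<sigma>' * x'\<close> and \<open>a * x' - l'\<close>. As \<sigma>' \<le> 1,
  \<open>rotate_norm\<close> and \<open>involute_metric\<close> then show that the development does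
  not increase lengths.\<close>

lemma dev_derivative:
  assumes "(l has_real_derivative l') (at s within A)" "(x has_real_derivative x') (at s within A)"
  shows "((\<lambda>s. dev1 a (l s) (x s)) has_real_derivative
      cos (\<sigma> (x s)) * (l s * \<sigma>' (x s) * x') - sin (\<sigma> (x s)) * (a * x' - l')) (at s within A)"
    and "((\<lambda>s. dev2 a (l s) (x s)) has_real_derivative
      sin (\<sigma> (x s)) * (l s * \<sigma>' (x s) * x') + cos (\<sigma> (x s)) * (a * x' - l')) (at s within A)"
proof -
  note D = DERIV_chain2[OF C assms(2)] DERIV_chain2[OF S assms(2)] DERIV_chain2[OF sigma assms(2)]
  show "((\<lambda>s. dev1 a (l s) (x s)) has_real_derivative
      cos (\<sigma> (x s)) * (l s * \<sigma>' (x s) * x') - sin (\<sigma> (x s)) * (a * x' - l')) (at s within A)"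
    unfolding dev1_def
    by (rule DERIV_cong[OF DERIV_add[OF DERIV_cmult[OF D(1)] DERIV_mult[OF assms(1) DERIV_chain2[OF DERIV_sin D(3)]]]])
      (simp add: algebra_simps)
  show "((\<lambda>s. dev2 a (l s) (x s)) has_real_derivative
      sin (\<sigma> (x s)) * (l s * \<sigma>' (x s) * x') + cos (\<sigma> (x s)) * (a * x' - l')) (at s within A)"
    unfolding dev2_def
    by (rule DERIV_cong[OF DERIV_diff[OF DERIV_cmult[OF D(2)] DERIV_mult[OF assms(1) DERIV_chain2[OF DERIV_cos D(3)]]]])
      (simp add: algebra_simps)
qed

lemma dev'_bound:
  assumes "0 \<le> a" "0 \<le> l" "l \<le> L"
  shows "\<bar>dev1' a l x\<bar> \<le> a + L" "\<bar>dev2' a l x\<bar> \<le> a + L"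
proof -
  have b: "\<bar>l * \<sigma>' x * c\<bar> \<le> L" if "\<bar>c\<bar> \<le> 1" for c
  proof -
    have "\<bar>l * \<sigma>' x * c\<bar> = l * (\<sigma>' x * \<bar>c\<bar>)" using assms sigma'_range[of x] by (simp add: abs_mult)
    also have "\<dots> \<le> l * 1"
      using assms sigma'_range[of x] that by (intro mult_left_mono mult_le_one) auto
    finally show ?thesis using assms by simp
  qed
  have a: "\<bar>a * c\<bar> \<le> a" if "\<bar>c\<bar> \<le> 1" for c
    using assms that by (simp add: abs_mult mult_left_le)
  show "\<bar>dev1' a l x\<bar> \<le> a + L"
    unfolding dev1'_def using b[of "cos (\<sigma> x)"] a[of "sin (\<sigma> x)"] by (simp add: abs_le_iff)
  show "\<bar>dev2' a l x\<bar> \<le> a + L"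
    unfolding dev2'_def using b[of "sin (\<sigma> x)"] a[of "cos (\<sigma> x)"] by (simp add: abs_le_iff)
qed

text \<open>Where \<sigma>' = 1 the development commutes with rotations up to the mollification
  error, so both expressions are of order \<eta>. On the straight part rotations become translations
  along the line: the first expression is \<open>a * x - l\<close>, the second is zero. In the
  transition layer \<sigma> \<le> \<eta> keeps sine and cosine nonnegative. One-sided bounds are
  enough since they are multiplied by the nonnegative \<open>U1\<close> and
  \<open>U2\<close>.\<close>

lemma dev_twist:
  assumes "0 \<le> a" "0 \<le> l" "l \<le> L"
  shows "dev1' a l x + dev2 a l x \<le> a * \<eta>" "- (a + L) * \<eta> \<le> dev2' a l x - dev1 a l x"
proof -
  have 1: "dev1' a l x + dev2 a l x = a * (S x - sin (\<sigma> x)) - l * ((1 - \<sigma>' x) * cos (\<sigma> x))"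
    by (simp add: dev1'_def dev2_def algebra_simps)
  have 2: "dev2' a l x - dev1 a l x = - (a * (C x - cos (\<sigma> x))) - l * ((1 - \<sigma>' x) * sin (\<sigma> x))"
    by (simp add: dev2'_def dev1_def algebra_simps)
  have both: "dev1' a l x + dev2 a l x \<le> a * \<eta> \<and> - (a + L) * \<eta> \<le> dev2' a l x - dev1 a l x"
  proof (cases "x \<le> 0")
    case True
    have "0 \<le> (a + L) * \<eta>" "0 \<le> a * \<eta>" "a * x \<le> 0"
      using assms eta True by (auto simp: mult_nonneg_nonpos)
    moreover from this(1) have "- (a + L) * \<eta> \<le> 0" by linarith
    ultimately show ?thesis using True assms unfolding 1 2 by (simp add: neg)
  next
    case False
    then have x: "0 \<le> x" by simp
    have "0 \<le> (1 - \<sigma>' x) * cos (\<sigma> x) \<and> (1 - \<sigma>' x) * sin (\<sigma> x) \<le> \<eta>"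
    proof (cases "\<sigma>' x < 1")
      case True
      have s: "0 \<le> \<sigma> x" "\<sigma> x \<le> \<eta>" using pos(1)[OF x] small[OF x True] by auto
      then have "0 \<le> cos (\<sigma> x)" using eta pi_gt3 by (intro cos_ge_zero) auto
      moreover have "0 \<le> sin (\<sigma> x)" using s eta pi_gt3 by (intro sin_ge_zero) auto
      moreover have "sin (\<sigma> x) \<le> \<eta>" using sin_x_le_x[OF s(1)] s by simp
      moreover have "(1 - \<sigma>' x) * sin (\<sigma> x) \<le> 1 * sin (\<sigma> x)"
        using sigma'_range[of x] calculation by (intro mult_right_mono) auto
      ultimately show ?thesis using True by simp
    next
      case False
      then have "\<sigma>' x = 1" using sigma'_range(2)[of x] by linarith
      then show ?thesis using eta by simp
    qed
    note b = this
    have "0 \<le> l * ((1 - \<sigma>' x) * cos (\<sigma> x))" using b assms by simp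
    moreover have "l * ((1 - \<sigma>' x) * sin (\<sigma> x)) \<le> l * \<eta>"
      using b assms by (intro mult_left_mono) auto
    moreover have "l * \<eta> \<le> L * \<eta>" using assms eta by (intro mult_right_mono) auto
    moreover have "a * (S x - sin (\<sigma> x)) \<le> a * \<eta>" "a * (C x - cos (\<sigma> x)) \<le> a * \<eta>"
      using CS_close[OF x] assms by (auto intro!: mult_left_mono)
    moreover have "- (a + L) * \<eta> = - (a * \<eta>) - L * \<eta>" by algebra
    ultimately show ?thesis unfolding 1 2 by (intro conjI) linarith+
  qed
  show "dev1' a l x + dev2 a l x \<le> a * \<eta>" by (rule both[THEN conjunct1])
  show "- (a + L) * \<eta> \<le> dev2' a l x - dev1 a l x" by (rule both[THEN conjunct2])
qed

text \<open>The matching of the two calibrations at r = \<open>k\<close>. Beyond the tangent line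
  the left side is \<open>a * x - l\<close>, and arctan s \<le> s suffices; otherwise it is
  \<open>involute_inequality\<close> at the angle \<sigma> x, which is at most x.\<close>

lemma dev2_le_involute:
  assumes "0 < a" "0 \<le> l"
  shows "dev2 a l x \<le> a * x + l - 2 * a * arctan (l / a) + a * \<eta>"
proof (cases "x \<le> 0")
  case True
  have "arctan (l / a) \<le> l / a" using assms by (intro arctan_le_self) auto
  then have "a * arctan (l / a) \<le> l" using assms by (simp add: field_simps)
  moreover have "0 \<le> a * \<eta>" using assms eta by simp
  ultimately show ?thesis using True by (simp add: dev2_def neg)
next
  case False
  then have x: "0 \<le> x" by simp
  have "a * S x \<le> a * (sin (\<sigma> x) + \<eta>)" using CS_close(2)[OF x] assms by (intro mult_left_mono) auto
  moreover have "a * \<sigma> x \<le> a * x" using pos(2)[OF x] assms by simp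
  ultimately show ?thesis
    using involute_inequality[OF assms pos(1)[OF x]] unfolding dev2_def by (simp add: algebra_simps)
qed

text \<open>Only mollification separates the curved part of the development from the Cartesian
  coordinates of the point itself; this evaluates the boundary term at the outer circle, where the
  image is known.\<close>

lemma dev_close:
  assumes "0 < a" "0 \<le> l" "l \<le> L" "0 \<le> x"
  shows "\<bar>dev1 a l x - (a * cos x + l * sin x)\<bar> \<le> (2 * a + L) * \<eta>"
    and "\<bar>dev2 a l x - (a * sin x - l * cos x)\<bar> \<le> (2 * a + L) * \<eta>"
proof -
  have s: "\<bar>\<sigma> x - x\<bar> \<le> \<eta>" using pos[OF assms(4)] by auto
  have c: "\<bar>cos (\<sigma> x) - cos x\<bar> \<le> \<eta>" and i: "\<bar>sin (\<sigma> x) - sin x\<bar> \<le> \<eta>"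
    using s abs_cos_diff_le[of "\<sigma> x" x] abs_sin_diff_le[of "\<sigma> x" x] by auto
  have k: "\<bar>a * u + l * v\<bar> \<le> (2 * a + L) * \<eta>" if "\<bar>u\<bar> \<le> 2 * \<eta>" "\<bar>v\<bar> \<le> \<eta>" for u v
  proof -
    have "\<bar>a * u + l * v\<bar> \<le> a * \<bar>u\<bar> + l * \<bar>v\<bar>"
      using assms abs_triangle_ineq[of "a * u" "l * v"] by (simp add: abs_mult)
    also have "\<dots> \<le> a * (2 * \<eta>) + L * \<eta>"
      using assms that eta by (intro add_mono mult_mono) auto
    finally show ?thesis by (simp add: algebra_simps)
  qed
  have "\<bar>C x - cos x\<bar> \<le> 2 * \<eta>" "\<bar>S x - sin x\<bar> \<le> 2 * \<eta>"
    using CS_close[OF assms(4)] c i by linarith+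
  then have "\<bar>a * (C x - cos x) + l * (sin (\<sigma> x) - sin x)\<bar> \<le> (2 * a + L) * \<eta>"
    "\<bar>a * (S x - sin x) + l * - (cos (\<sigma> x) - cos x)\<bar> \<le> (2 * a + L) * \<eta>"
    using c i by (intro k; simp)+
  then show "\<bar>dev1 a l x - (a * cos x + l * sin x)\<bar> \<le> (2 * a + L) * \<eta>"
    "\<bar>dev2 a l x - (a * sin x - l * cos x)\<bar> \<le> (2 * a + L) * \<eta>"
    by (simp_all add: dev1_def dev2_def algebra_simps)
qed

end

lemma bend_locale_exists:
  assumes "0 < \<eta>" "\<eta> \<le> 1"
  shows "\<exists>\<sigma> \<sigma>' C S. bend \<eta> \<sigma> \<sigma>' C S"
  by (rule bend_exists[OF assms], intro exI, rule bend.intro) (assumption | rule assms)+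

text \<open>Polar components \<open>U1\<close>, \<open>U2\<close> of the harmonic part of the twist map, in the frame rotating with
  the angle \<open>t + \<psi>\<close>, and their derivatives \<open>V1\<close>, \<open>V2\<close> with respect to \<open>ln r\<close>.\<close>

locale exterior_lift_bend = exterior_lift + bend +
  fixes m \<psi> :: real
  assumes m: "0 \<le> m"
begin

definition U1 :: "real \<Rightarrow> real" where "U1 r = a * cosh (ln (r / p))"
definition U2 :: "real \<Rightarrow> real" where "U2 r = a * m * sinh (ln (r / p))"
definition V1 :: "real \<Rightarrow> real" where "V1 r = a * sinh (ln (r / p))"
definition V2 :: "real \<Rightarrow> real" where "V2 r = a * m * cosh (ln (r / p))"

lemma UV_derivative:
  assumes "p \<le> r"
  shows "(U1 has_real_derivative V1 r / r) (at r within A)"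
    "(U2 has_real_derivative V2 r / r) (at r within A)"
    "(V1 has_real_derivative U1 r / r) (at r within A)"
    "(V2 has_real_derivative U2 r / r) (at r within A)"
  unfolding U1_def U2_def V1_def V2_def using assms p_pos
  by (auto intro!: derivative_eq_intros simp: field_simps)

lemma UV_cont: "continuous_on {p..q} U1" "continuous_on {p..q} U2"
  "continuous_on {p..q} V1" "continuous_on {p..q} V2"
  unfolding continuous_on_eq_continuous_within
  by (auto intro!: UV_derivative[THEN DERIV_continuous])

lemma UV_range:
  assumes "p \<le> r" "r \<le> q"
  shows "0 \<le> U1 r" "U1 r \<le> U1 q" "0 \<le> U2 r" "U2 r \<le> U2 q"
proof -
  have l: "0 \<le> ln (r / p)" "ln (r / p) \<le> ln (q / p)"
    using assms p_pos by (auto simp: divide_right_mono)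
  then show "0 \<le> U1 r" "U1 r \<le> U1 q" "0 \<le> U2 r" "U2 r \<le> U2 q"
    using a_pos m unfolding U1_def U2_def
    by (auto intro!: mult_left_mono simp: cosh_real_nonneg_le_iff)
qed

text \<open>Angle of the other contact point, the one ahead of the image point, in the frame that
  rotates with t + \<psi>; \<open>involute\<close> uses the contact point behind.\<close>

definition xi :: "real \<Rightarrow> real \<Rightarrow> real" where "xi r t = X r t - \<psi> + arctan (l r t / a)"

text \<open>The developed map paired with the radial flux of the harmonic map; this is what Green's
  formula leaves on each circle.\<close>

definition boundary :: "real \<Rightarrow> real \<Rightarrow> real" where
  "boundary r t = V1 r * dev1 a (l r t) (xi r t) + V2 r * dev2 a (l r t) (xi r t)"

text \<open>Since the development does not increase lengths, the energy of the developed map is a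
  lower bound, and it is compared with the harmonic map by convexity. The relations r V' = U make
  the mixed terms exact, except for the failure of the development to commute with rotations, which
  has a favourable sign up to \<eta> by \<open>dev_twist\<close>, and for terms linear in the
  closing error.\<close>

lemma developed_energy_bound:
  "energy \<ge> integral {0..2*pi} (boundary q) - integral {0..2*pi} (boundary p)
     - pi * (U1 q * V1 q + U2 q * V2 q)
     - 2 * pi * (U2 q * a + U1 q * (a + L)) * (q - p) / p * \<eta>
     - (U1 q + U2 q) * (a + L) / p * rect_int p q (\<lambda>r t. \<bar>e r t\<bar>)"
proof -
  have cU: "cont_rect p q (\<lambda>r t. U1 r)" "cont_rect p q (\<lambda>r t. U2 r)"
    "cont_rect p q (\<lambda>r t. V1 r)" "cont_rect p q (\<lambda>r t. V2 r)"
    by (intro cont_rect_fst UV_cont)+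
  define y1 where "y1 = (\<lambda>r t. A1 r t + a * l1 r t / (a^2 + (l r t)^2))"
  define y2 where "y2 = (\<lambda>r t. A2 r t - 1 - e r t + a * l2 r t / (a^2 + (l r t)^2))"
  define s where "s = (\<lambda>r t. \<sigma> (xi r t))"
  define P where "P = (\<lambda>r t. dev1 a (l r t) (xi r t))"
  define Q where "Q = (\<lambda>r t. dev2 a (l r t) (xi r t))"
  define P1 where "P1 = (\<lambda>r t. cos (s r t) * (l r t * \<sigma>' (xi r t) * y1 r t) - sin (s r t) * (a * y1 r t - l1 r t))"
  define Q1 where "Q1 = (\<lambda>r t. sin (s r t) * (l r t * \<sigma>' (xi r t) * y1 r t) + cos (s r t) * (a * y1 r t - l1 r t))"
  define P2 where "P2 = (\<lambda>r t. cos (s r t) * (l r t * \<sigma>' (xi r t) * y2 r t) - sin (s r t) * (a * y2 r t - l2 r t))"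
  define Q2 where "Q2 = (\<lambda>r t. sin (s r t) * (l r t * \<sigma>' (xi r t) * y2 r t) + cos (s r t) * (a * y2 r t - l2 r t))"
  have cxi: "cont_rect p q xi"
    unfolding xi_def using a_pos by (intro cont_rects conts) auto
  have cs: "cont_rect p q s" "cont_rect p q (\<lambda>r t. \<sigma>' (xi r t))"
    unfolding s_def by (intro cont_rect_compose[OF bend_conts(1)] cont_rect_compose[OF sigma'_cont] cxi)+
  have cPQ: "cont_rect p q P" "cont_rect p q Q"
    unfolding P_def Q_def dev1_def dev2_def s_def[symmetric]
    using cont_rect_compose[OF bend_conts(2) cxi] cont_rect_compose[OF bend_conts(3) cxi] cs
    by (intro cont_rects conts; simp add: s_def)+
  have cy: "cont_rect p q y1" "cont_rect p q y2"
    unfolding y1_def y2_def using R_pos a_pos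
    by (intro cont_rects conts; simp add: add_nonneg_eq_0_iff)+
  have cPQ': "cont_rect p q P1" "cont_rect p q Q1" "cont_rect p q P2" "cont_rect p q Q2"
    unfolding P1_def Q1_def P2_def Q2_def by (intro cont_rects conts cs cy)+
  have xi_r: "((\<lambda>r. xi r t) has_real_derivative y1 r t) (at r within {p..q})" if "p \<le> r" "r \<le> q" for r t
    unfolding xi_def y1_def
    by (rule DERIV_cong[OF DERIV_add[OF DERIV_diff[OF X_r[OF that] DERIV_const] arctan_derivative[OF l_r[OF that]]]]) simp
  have xi_t: "((\<lambda>t. xi r t) has_real_derivative y2 r t) (at t)" if "p \<le> r" "r \<le> q" for r t
    unfolding xi_def y2_def
    by (rule DERIV_cong[OF DERIV_add[OF DERIV_diff[OF X_t[OF that] DERIV_const] arctan_derivative[OF l_t[OF that]]]]) simp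
  have PQ_r: "((\<lambda>r. P r t) has_real_derivative P1 r t) (at r within {p..q})"
    "((\<lambda>r. Q r t) has_real_derivative Q1 r t) (at r within {p..q})" if "p \<le> r" "r \<le> q" for r t
    unfolding P_def Q_def P1_def Q1_def s_def by (intro dev_derivative l_r xi_r that)+
  have PQ_t: "((\<lambda>t. P r t) has_real_derivative P2 r t) (at t)"
    "((\<lambda>t. Q r t) has_real_derivative Q2 r t) (at t)" if "p \<le> r" "r \<le> q" for r t
    unfolding P_def Q_def P2_def Q2_def s_def by (intro dev_derivative l_t xi_t that)+
  define F where "F = (\<lambda>r t. V1 r * P r t + V2 r * Q r t)"
  define F1 where "F1 = (\<lambda>r t. U1 r / r * P r t + V1 r * P1 r t + (U2 r / r * Q r t + V2 r * Q1 r t))"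
  define H where "H = (\<lambda>r t. U1 r * Q r t - U2 r * P r t)"
  define H2 where "H2 = (\<lambda>r t. U1 r * Q2 r t - U2 r * P2 r t)"
  define W where "W = (\<lambda>r. (V1 r)^2 + (V2 r)^2 + (U1 r)^2 + (U2 r)^2)"
  have cF: "cont_rect p q F" "cont_rect p q F1" "cont_rect p q H2" "cont_rect p q (\<lambda>r t. W r / r)"
    unfolding F_def F1_def H2_def W_def using p_pos by (intro cont_rects cU cPQ cPQ'; simp)+
  have F1: "((\<lambda>r. F r t) has_real_derivative F1 r t) (at r within {p..q})" if "p \<le> r" "r \<le> q" for r t
    unfolding F_def F1_def
    by (rule DERIV_cong[OF DERIV_add[OF DERIV_mult[OF UV_derivative(3)[OF that(1)] PQ_r(1)[OF that]]
            DERIV_mult[OF UV_derivative(4)[OF that(1)] PQ_r(2)[OF that]]]]) simp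
  have H2: "((\<lambda>t. H r t) has_real_derivative H2 r t) (at t)" if "p \<le> r" "r \<le> q" for r t
    unfolding H_def H2_def by (intro DERIV_diff DERIV_cmult PQ_t that)
  have Hper: "H r (t + 2*pi) = H r t" for r t
    by (simp add: H_def P_def Q_def xi_def per)
  define B1 where "B1 = U2 q * a + U1 q * (a + L)"
  define B2 where "B2 = (U1 q + U2 q) * (a + L)"
  define low where "low = (\<lambda>r t. 2 * F1 r t + 2 * (1 / r * H2 r t) - W r / r
      - 2 * B1 * \<eta> / p - 2 * B2 / p * \<bar>e r t\<bar>)"
  have low: "low r t \<le> r * M1 r t + M2 r t / r" if r: "p \<le> r" "r \<le> q" for r t
  proof -
    have r0: "0 < r" using r p_pos by simp
    have aL: "0 \<le> a" "0 \<le> a + L" using a_pos l_range[OF r, of t] by auto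
    define x where "x = xi r t"
    define l0 where "l0 = l r t"
    define PX QX where "PX = dev1' a l0 x" and "QX = dev2' a l0 x"
    have bound: "(cos (s r t) * (l0 * \<sigma>' x * y) - sin (s r t) * (a * y - l'))^2
        + (sin (s r t) * (l0 * \<sigma>' x * y) + cos (s r t) * (a * y - l'))^2
        \<le> (a^2 + l0^2) * A^2 + (l0 * l')^2 / (a^2 + l0^2)" if y: "y = A + a * l' / (a^2 + l0^2)" for y l' A
    proof -
      have "(l0 * \<sigma>' x * y)^2 = (\<sigma>' x)^2 * (l0 * y)^2" by (simp add: power_mult_distrib)
      also have "\<dots> \<le> 1 * (l0 * y)^2"
        using sigma'_range[of x] by (intro mult_right_mono) (auto simp: power_le_one)
      finally show ?thesis
        unfolding rotate_norm using involute_metric[OF a_pos, of l0 A l'] by (simp add: y)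
    qed
    have b1: "(P1 r t)^2 + (Q1 r t)^2 \<le> M1 r t"
      using order_trans[OF bound M1[OF r, of t, folded l0_def], of "y1 r t"]
      by (simp add: P1_def Q1_def x_def l0_def y1_def)
    define y where "y = A2 r t + a * l2 r t / (a^2 + l0^2)"
    have y2: "y2 r t = y - (1 + e r t)" by (simp add: y_def y2_def l0_def)
    \<comment> \<open>Angular derivatives of the developed map as seen in a frame that does not
      rotate with t: the rotation by \<open>1 + e\<close> that is missing from the derivative of
      \<open>X\<close> is put back. Only these are dominated by \<open>M2\<close>.\<close>
    define P3 Q3 where "P3 = P2 r t + (1 + e r t) * PX" and "Q3 = Q2 r t + (1 + e r t) * QX"
    have "P3 = cos (s r t) * (l0 * \<sigma>' x * y) - sin (s r t) * (a * y - l2 r t)"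
      "Q3 = sin (s r t) * (l0 * \<sigma>' x * y) + cos (s r t) * (a * y - l2 r t)"
      by (simp_all add: P3_def Q3_def P2_def Q2_def PX_def QX_def dev1'_def dev2'_def y2
          s_def x_def l0_def algebra_simps)
    then have b2: "P3^2 + Q3^2 \<le> M2 r t"
      using order_trans[OF bound M2[OF r, of t, folded l0_def], of y] by (simp add: y_def)
    have "0 \<le> ((r * P1 r t - V1 r)^2 + (r * Q1 r t - V2 r)^2) / r" using r0 by simp
    also have "\<dots> = r * ((P1 r t)^2 + (Q1 r t)^2) - 2 * (V1 r * P1 r t + V2 r * Q1 r t) + ((V1 r)^2 + (V2 r)^2) / r"
      using r0 by (simp add: power2_eq_square field_simps)
    also have "r * ((P1 r t)^2 + (Q1 r t)^2) \<le> r * M1 r t" using b1 r0 by simp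
    finally have I1: "2 * (V1 r * P1 r t + V2 r * Q1 r t) - ((V1 r)^2 + (V2 r)^2) / r \<le> r * M1 r t" by simp
    have "0 \<le> ((P3 + U2 r)^2 + (Q3 - U1 r)^2) / r" using r0 by simp
    also have "\<dots> = (P3^2 + Q3^2) / r - 2 * (U1 r * Q3 - U2 r * P3) / r + ((U1 r)^2 + (U2 r)^2) / r"
      using r0 by (simp add: power2_eq_square field_simps)
    also have "(P3^2 + Q3^2) / r \<le> M2 r t / r" using b2 r0 by (simp add: divide_right_mono)
    finally have I2: "2 * (U1 r * Q3 - U2 r * P3) / r - ((U1 r)^2 + (U2 r)^2) / r \<le> M2 r t / r" by simp
    note U = UV_range[OF r]
    have tw: "PX + Q r t \<le> a * \<eta>" "- (a + L) * \<eta> \<le> QX - P r t"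
      using dev_twist[OF aL(1), of l0 L x] l_range[OF r, of t]
      by (auto simp: PX_def QX_def P_def Q_def l0_def x_def)
    have "U1 r * (QX - P r t) \<ge> U1 r * (- (a + L) * \<eta>)" "U2 r * (PX + Q r t) \<le> U2 r * (a * \<eta>)"
      using tw U by (auto intro: mult_left_mono)
    moreover have "U1 r * ((a + L) * \<eta>) \<le> U1 q * ((a + L) * \<eta>)" "U2 r * (a * \<eta>) \<le> U2 q * (a * \<eta>)"
      using U aL eta by (auto intro!: mult_right_mono)
    ultimately have "- (B1 * \<eta>) \<le> U1 r * (QX - P r t) - U2 r * (PX + Q r t)"
      unfolding B1_def by (simp add: algebra_simps)
    then have "- (B1 * \<eta>) / r \<le> (U1 r * (QX - P r t) - U2 r * (PX + Q r t)) / r"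
      using r0 by (intro divide_right_mono) auto
    moreover have "B1 * \<eta> / r \<le> B1 * \<eta> / p"
      using r p_pos U aL eta a_pos unfolding B1_def by (intro divide_left_mono) auto
    ultimately have I3: "- (B1 * \<eta> / p) \<le> (U1 r * (QX - P r t) - U2 r * (PX + Q r t)) / r" by simp
    have "\<bar>U1 r * QX - U2 r * PX\<bar> \<le> U1 r * \<bar>QX\<bar> + U2 r * \<bar>PX\<bar>"
      using U abs_triangle_ineq4[of "U1 r * QX" "U2 r * PX"] by (simp add: abs_mult)
    also have "\<dots> \<le> U1 q * (a + L) + U2 q * (a + L)"
      using U dev'_bound[OF aL(1), of l0 L x] l_range[OF r, of t]
      by (intro add_mono mult_mono) (auto simp: PX_def QX_def l0_def)
    finally have "\<bar>U1 r * QX - U2 r * PX\<bar> \<le> B2" by (simp add: B2_def algebra_simps)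
    then have "\<bar>e r t * (U1 r * QX - U2 r * PX) / r\<bar> \<le> \<bar>e r t\<bar> * B2 / r"
      using r0 by (auto simp: abs_mult intro!: divide_right_mono mult_left_mono)
    also have "\<dots> \<le> \<bar>e r t\<bar> * B2 / p"
      using r p_pos U aL unfolding B2_def by (intro divide_left_mono) auto
    also have "\<dots> = B2 / p * \<bar>e r t\<bar>" by simp
    finally have "- (e r t * (U1 r * QX - U2 r * PX) / r) \<le> B2 / p * \<bar>e r t\<bar>"
      by (rule abs_le_D2)
    then have I4: "- (B2 / p * \<bar>e r t\<bar>) \<le> e r t * (U1 r * QX - U2 r * PX) / r"
      by (simp only: minus_le_iff)
    have "2 * (V1 r * P1 r t + V2 r * Q1 r t) + 2 * (U1 r * Q3 - U2 r * P3) / r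
       = 2 * F1 r t + 2 * (1 / r * H2 r t) + 2 * ((U1 r * (QX - P r t) - U2 r * (PX + Q r t)) / r)
         + 2 * (e r t * (U1 r * QX - U2 r * PX) / r)"
      using r0 by (simp add: F1_def H2_def P3_def Q3_def field_simps)
    moreover have "W r / r = ((V1 r)^2 + (V2 r)^2) / r + ((U1 r)^2 + (U2 r)^2) / r"
      by (simp add: W_def add_divide_distrib)
    moreover have "2 * B1 * \<eta> / p = 2 * (B1 * \<eta> / p)" "2 * B2 / p * \<bar>e r t\<bar> = 2 * (B2 / p * \<bar>e r t\<bar>)"
      by simp_all
    ultimately show ?thesis using I1 I2 I3 I4 unfolding low_def by linarith
  qed
  have clow: "cont_rect p q low"
    unfolding low_def using p_pos by (intro cont_rects cF conts) auto
  have cr: "cont_rect p q (\<lambda>r t. 1 / r * H2 r t)"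
    using p_pos by (intro cont_rects cF) auto
  have F: "F = boundary" by (intro ext) (simp add: F_def boundary_def P_def Q_def)
  have "rect_int p q low \<le> 2 * energy"
    unfolding energy_def
    using rect_int_mono[OF clow energy_integrand_cont low] by simp
  moreover have "rect_int p q low = 2 * rect_int p q F1 + 2 * rect_int p q (\<lambda>r t. 1 / r * H2 r t)
      - rect_int p q (\<lambda>r t. W r / r) - rect_int p q (\<lambda>r t. 2 * B1 * \<eta> / p)
      - 2 * B2 / p * rect_int p q (\<lambda>r t. \<bar>e r t\<bar>)"
    unfolding low_def
    by (subst rect_int_diff rect_int_add; (intro cont_rects cF conts cr)?)+
      (use p_pos in \<open>simp_all only: rect_int_cmult\<close>)
  moreover have "rect_int p q F1 = integral {0..2*pi} (boundary q) - integral {0..2*pi} (boundary p)"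
    using rect_int_derivative1[OF pq cF(1) cF(2) F1] by (simp add: F)
  moreover have "rect_int p q (\<lambda>r t. 1 / r * H2 r t) = 0"
    by (rule rect_int_derivative2[OF cF(3) inv_r_cont H2 Hper])
  \<comment> \<open>The pairing of \<open>U\<close> with \<open>V\<close> is a primitive of
    \<open>W / r\<close>, and it vanishes at \<open>p\<close> because \<open>V1\<close> and
    \<open>U2\<close> do.\<close>
  moreover have "rect_int p q (\<lambda>r t. W r / r) = 2 * pi * (U1 q * V1 q + U2 q * V2 q)"
  proof -
    have c: "continuous_on {p..q} (\<lambda>r. W r / r)"
      unfolding W_def using p_pos by (intro continuous_intros UV_cont) auto
    have "((\<lambda>r. W r / r) has_integral (U1 q * V1 q + U2 q * V2 q) - (U1 p * V1 p + U2 p * V2 p)) {p..q}"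
    proof (rule fundamental_theorem_of_calculus[OF pq])
      fix r assume "r \<in> {p..q}"
      then have "((\<lambda>r. U1 r * V1 r + U2 r * V2 r) has_real_derivative W r / r) (at r within {p..q})"
        by (intro DERIV_cong[OF DERIV_add[OF DERIV_mult[OF UV_derivative(1,3)] DERIV_mult[OF UV_derivative(2,4)]]])
          (auto simp: W_def add_divide_distrib power2_eq_square)
      then show "((\<lambda>r. U1 r * V1 r + U2 r * V2 r) has_vector_derivative W r / r) (at r within {p..q})"
        by (simp add: real_vector_derivative_iff)
    qed
    moreover have "V1 p = 0" "U2 p = 0" using p_pos by (auto simp: V1_def U2_def)
    ultimately have "integral {p..q} (\<lambda>r. W r / r) = U1 q * V1 q + U2 q * V2 q"
      by (simp add: integral_unique)
    then show ?thesis using rect_int_fst[OF c] by simp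
  qed
  moreover have "rect_int p q (\<lambda>r t. 2 * B1 * \<eta> / p) = 2 * pi * (q - p) * (2 * B1 * \<eta> / p)"
    by (rule rect_int_const[OF pq])
  moreover have "2 * pi * (q - p) * (2 * B1 * \<eta> / p) = 2 * (2 * pi * B1 * (q - p) / p * \<eta>)"
    "2 * B2 / p * rect_int p q (\<lambda>r t. \<bar>e r t\<bar>) = 2 * (B2 / p * rect_int p q (\<lambda>r t. \<bar>e r t\<bar>))"
    by simp_all
  ultimately show ?thesis unfolding B1_def[symmetric] B2_def[symmetric] by linarith
qed

end

section \<open>Gluing the two calibrations at r = k\<close>

lemma exterior_lift_subset:
  assumes "exterior_lift a p q L X A1 A2 e l l1 l2 M1 M2" "p \<le> p'" "p' \<le> q'" "q' \<le> q"
  shows "exterior_lift a p' q' L X A1 A2 e l l1 l2 M1 M2"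
proof -
  interpret exterior_lift a p q L X A1 A2 e l l1 l2 M1 M2 by fact
  have sub: "{p'..q'} \<subseteq> {p..q}" using assms by auto
  show ?thesis
  proof
    show "cont_rect p' q' X" "cont_rect p' q' A1" "cont_rect p' q' A2" "cont_rect p' q' e"
      "cont_rect p' q' l" "cont_rect p' q' l1" "cont_rect p' q' l2" "cont_rect p' q' M1" "cont_rect p' q' M2"
      using conts assms by (auto intro: cont_rect_subset)
  next
    fix r t assume r: "p' \<le> r" "r \<le> q'"
    then have r': "p \<le> r" "r \<le> q" using assms by auto
    show "((\<lambda>r. X r t) has_real_derivative A1 r t) (at r within {p'..q'})"
      using X_r[OF r'] sub by (rule DERIV_subset)
    show "((\<lambda>r. l r t) has_real_derivative l1 r t) (at r within {p'..q'})"
      using l_r[OF r'] sub by (rule DERIV_subset)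
    show "((\<lambda>t. X r t) has_real_derivative A2 r t - 1 - e r t) (at t)"
      "((\<lambda>t. l r t) has_real_derivative l2 r t) (at t)" "0 \<le> l r t" "l r t \<le> L"
      "(a^2 + (l r t)^2) * (A1 r t)^2 + (l r t * l1 r t)^2 / (a^2 + (l r t)^2) \<le> M1 r t"
      "(a^2 + (l r t)^2) * (A2 r t)^2 + (l r t * l2 r t)^2 / (a^2 + (l r t)^2) \<le> M2 r t"
      by (rule X_t[OF r'] l_t[OF r'] l_range[OF r'] M1[OF r'] M2[OF r'])+
  qed (use a_pos p_pos assms per in auto)
qed

lemma rotate_arctan:
  assumes "0 < a"
  shows "a * cos (x + arctan (l / a)) + l * sin (x + arctan (l / a)) = sqrt (a^2 + l^2) * cos x"
    and "a * sin (x + arctan (l / a)) - l * cos (x + arctan (l / a)) = sqrt (a^2 + l^2) * sin x"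
proof -
  define R where "R = sqrt (a^2 + l^2)"
  have R: "0 < R" "R^2 = a^2 + l^2" using assms by (auto simp: R_def add_pos_nonneg)
  have "sqrt (1 + (l / a)^2) = R / a"
  proof -
    have "1 + (l / a)^2 = (a^2 + l^2) / a^2" using assms by (simp add: field_simps)
    then show ?thesis using assms by (simp add: real_sqrt_divide R_def)
  qed
  then have cs: "cos (arctan (l / a)) = a / R" "sin (arctan (l / a)) = l / R"
    using assms R by (auto simp: cos_arctan sin_arctan)
  have e: "(a * a + l * l) / R = R" using R by (simp add: power2_eq_square field_simps)
  have "a * cos (x + arctan (l / a)) + l * sin (x + arctan (l / a)) = (a * a + l * l) / R * cos x"
    using R(1) unfolding cos_add sin_add cs by (simp add: field_simps)
  then show "a * cos (x + arctan (l / a)) + l * sin (x + arctan (l / a)) = sqrt (a^2 + l^2) * cos x"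
    unfolding e unfolding R_def .
  have "a * sin (x + arctan (l / a)) - l * cos (x + arctan (l / a)) = (a * a + l * l) / R * sin x"
    using R(1) unfolding cos_add sin_add cs by (simp add: field_simps)
  then show "a * sin (x + arctan (l / a)) - l * cos (x + arctan (l / a)) = sqrt (a^2 + l^2) * sin x"
    unfolding e unfolding R_def .
qed

text \<open>Factors of the error terms, in order: closing error in the string part, mollification in
  the matching at \<open>k\<close>, mollification and closing error in the developed part, and the
  evaluation of the boundary term at \<open>b\<close>.\<close>

definition twist_const :: "real \<Rightarrow> real \<Rightarrow> real \<Rightarrow> real \<Rightarrow> real \<Rightarrow> real" where
  "twist_const a k b m L =
     a + 2 * pi * a^2 * m
     + 2 * pi * (a * m * sinh (ln (b / k)) * a + a * cosh (ln (b / k)) * (a + L)) * (b - k) / k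
     + (a * cosh (ln (b / k)) + a * m * sinh (ln (b / k))) * (a + L) / k
     + 2 * pi * (a * sinh (ln (b / k)) + a * m * cosh (ln (b / k))) * (3 * a + 2 * L)"

text \<open>At r = \<open>k\<close> the component \<open>V1\<close> vanishes, so
  \<open>boundary\<close> is \<open>a * m\<close> times \<open>dev2\<close>, and
  \<open>dev2_le_involute\<close> trades it against the string length with the gain a \<psi>. At r =
  \<open>b\<close> the lifted angle is known up to \<kappa>, so the flux can be evaluated. The
  string part contributes 1 - m^2 and the gain 2 m^2, which together give 1 + m^2.\<close>

lemma twist_lower_bound:
  assumes lift: "exterior_lift a a b L X A1 A2 e l l1 l2 M1 M2"
    and k: "a < k" "k < b" and m: "0 \<le> m"
    and inner: "\<And>t. X a t = 0" "\<And>t. l a t = 0" and outer: "\<And>t. l b t = lb"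
    and X_b: "\<And>t. \<bar>X b t - \<Psi>\<bar> \<le> \<kappa>" and \<kappa>: "\<kappa> \<le> \<Psi> - m * ln (k / a)"
    and \<eta>: "0 < \<eta>" "\<eta> \<le> 1"
  shows "rect_int a b (\<lambda>r t. r * M1 r t + M2 r t / r) / 2
    \<ge> pi * a^2 * (1 + m^2) * ln (k / a)
      - pi * (a * cosh (ln (b / k)) * (a * sinh (ln (b / k))) + a * m * sinh (ln (b / k)) * (a * m * cosh (ln (b / k))))
      + 2 * pi * (sqrt (a^2 + lb^2) * (a * sinh (ln (b / k)) * cos (\<Psi> - m * ln (k / a))
                    + a * m * cosh (ln (b / k)) * sin (\<Psi> - m * ln (k / a))))
      - twist_const a k b m L * (\<eta> + \<kappa> + rect_int a b (\<lambda>r t. \<bar>e r t\<bar>))"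
proof -
  interpret E: exterior_lift a a b L X A1 A2 e l l1 l2 M1 M2 by fact
  interpret I: exterior_lift a a k L X A1 A2 e l l1 l2 M1 M2
    by (rule exterior_lift_subset[OF lift]) (use k in auto)
  define \<psi> where "\<psi> = m * ln (k / a)"
  obtain \<sigma> \<sigma>' C S where "bend \<eta> \<sigma> \<sigma>' C S"
    using bend_locale_exists[OF \<eta>] by blast
  then interpret O: exterior_lift_bend a k b L X A1 A2 e l l1 l2 M1 M2 \<eta> \<sigma> \<sigma>' C S m \<psi>
    using exterior_lift_subset[OF lift, of k b] k m
    by (auto simp: exterior_lift_bend_def exterior_lift_bend_axioms_def)
  have a: "0 < a" by (rule E.a_pos)
  have k0: "0 < k" using a k by simp
  define Eab where "Eab = rect_int a b (\<lambda>r t. \<bar>e r t\<bar>)"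
  have ce: "cont_rect a b (\<lambda>r t. \<bar>e r t\<bar>)" by (intro cont_rects E.conts)
  have e_parts: "rect_int a k (\<lambda>r t. \<bar>e r t\<bar>) \<le> Eab" "rect_int k b (\<lambda>r t. \<bar>e r t\<bar>) \<le> Eab" "0 \<le> Eab"
  proof -
    have "0 \<le> rect_int a k (\<lambda>r t. \<bar>e r t\<bar>)" "0 \<le> rect_int k b (\<lambda>r t. \<bar>e r t\<bar>)"
      by (intro rect_int_nonneg cont_rect_subset[OF ce]; use k in simp)+
    then show "rect_int a k (\<lambda>r t. \<bar>e r t\<bar>) \<le> Eab" "rect_int k b (\<lambda>r t. \<bar>e r t\<bar>) \<le> Eab" "0 \<le> Eab"
      using rect_int_combine[OF ce, of k] k by (auto simp: Eab_def)
  qed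
  have L: "0 \<le> lb" "lb \<le> L" using E.l_range[of b 0] outer[of 0] k by auto
  have \<kappa>0: "0 \<le> \<kappa>" using X_b[of 0] by linarith
  define U1 U2 V1 V2 where "U1 = a * cosh (ln (b / k))" and "U2 = a * m * sinh (ln (b / k))"
    and "V1 = a * sinh (ln (b / k))" and "V2 = a * m * cosh (ln (b / k))"
  have UV: "O.U1 b = U1" "O.U2 b = U2" "O.V1 b = V1" "O.V2 b = V2"
    by (simp_all add: O.U1_def O.U2_def O.V1_def O.V2_def U1_def U2_def V1_def V2_def)
  have T: "0 < ln (b / k)" using k k0 by simp
  have nn: "0 \<le> U1" "0 \<le> U2" "0 \<le> V1" "0 \<le> V2"
    using a m T by (auto simp: U1_def U2_def V1_def V2_def)
  have inv_a: "I.involute a t = 0" for t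
    by (simp add: I.involute_def inner)
  have 1: "I.energy \<ge> a * m * integral {0..2*pi} (I.involute k)
     + pi * a^2 * (1 - m^2) * ln (k / a) - a * Eab"
  proof -
    have "a^2 / a * rect_int a k (\<lambda>r t. \<bar>e r t\<bar>) \<le> a * Eab"
      using a e_parts by (simp add: power2_eq_square)
    moreover have "integral {0..2*pi} (I.involute a) = 0"
      using inv_a by (simp cong: integral_cong)
    ultimately show ?thesis using I.involute_energy_bound[of m] by simp
  qed
  define K2 where "K2 = 2 * pi * (U2 * a + U1 * (a + L)) * (b - k) / k"
  define K3 where "K3 = (U1 + U2) * (a + L) / k"
  have 2: "O.energy \<ge> integral {0..2*pi} (O.boundary b) - integral {0..2*pi} (O.boundary k)
     - pi * (U1 * V1 + U2 * V2) - K2 * \<eta> - K3 * Eab"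
  proof -
    have "K3 * rect_int k b (\<lambda>r t. \<bar>e r t\<bar>) \<le> K3 * Eab"
      using e_parts nn L a k0 unfolding K3_def by (intro mult_left_mono) auto
    then show ?thesis using O.developed_energy_bound unfolding UV K2_def K3_def by linarith
  qed
  have O_cont: "continuous_on {0..2*pi} (O.boundary r)" if "k \<le> r" "r \<le> b" for r
  proof -
    have c: "continuous_on {0..2*pi} (\<lambda>t. X r t)" "continuous_on {0..2*pi} (\<lambda>t. l r t)"
      using that by (auto intro!: cont_rect_slice2 O.conts)
    then have x: "continuous_on {0..2*pi} (\<lambda>t. O.xi r t)"
      unfolding O.xi_def using a by (intro continuous_intros) auto
    show ?thesis
      unfolding O.boundary_def O.dev1_def O.dev2_def
      by (intro continuous_intros c continuous_on_compose2[OF O.bend_conts(1) x]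
        continuous_on_compose2[OF O.bend_conts(2) x] continuous_on_compose2[OF O.bend_conts(3) x]) auto
  qed
  have I_cont: "continuous_on {0..2*pi} (I.involute k)"
  proof -
    have "continuous_on {0..2*pi} (\<lambda>t. X k t)" "continuous_on {0..2*pi} (\<lambda>t. l k t)"
      using k by (auto intro!: cont_rect_slice2 I.conts)
    then show ?thesis
      unfolding I.involute_def using a by (intro continuous_intros) auto
  qed
  have 3: "a * m * integral {0..2*pi} (I.involute k) - integral {0..2*pi} (O.boundary k)
      \<ge> 2 * pi * (a * m * (a * \<psi> - a * \<eta>))"
  proof -
    have pt: "a * m * (a * \<psi> - a * \<eta>) \<le> a * m * I.involute k t - O.boundary k t" for t
    proof -
      have "O.boundary k t = a * m * O.dev2 a (l k t) (O.xi k t)"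
        using k0 by (simp add: O.boundary_def O.V1_def O.V2_def)
      moreover have "O.dev2 a (l k t) (O.xi k t) \<le> a * O.xi k t + l k t - 2 * a * arctan (l k t / a) + a * \<eta>"
        using a O.l_range(1)[of k t] k by (intro O.dev2_le_involute) auto
      then have "a * \<psi> - a * \<eta> \<le> I.involute k t - O.dev2 a (l k t) (O.xi k t)"
        by (simp add: I.involute_def O.xi_def algebra_simps)
      then have "a * m * (a * \<psi> - a * \<eta>) \<le> a * m * (I.involute k t - O.dev2 a (l k t) (O.xi k t))"
        using a m by (intro mult_left_mono) auto
      ultimately show ?thesis by (simp add: algebra_simps)
    qed
    have "integral {0..2*pi} (\<lambda>t. a * m * (a * \<psi> - a * \<eta>)) \<le> integral {0..2*pi} (\<lambda>t. a * m * I.involute k t - O.boundary k t)"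
      using k by (intro integral_le integrable_continuous_real continuous_intros I_cont O_cont pt) auto
    also have "\<dots> = a * m * integral {0..2*pi} (I.involute k) - integral {0..2*pi} (O.boundary k)"
      using k by (subst integral_diff) (auto intro!: integrable_continuous_real continuous_intros I_cont O_cont)
    finally show ?thesis by (simp add: ac_simps)
  qed
  define R where "R = sqrt (a^2 + lb^2)"
  have R: "0 \<le> R" "R \<le> a + L"
    using a L sqrt_sum_squares_le_sum[of a lb] by (auto simp: R_def)
  define \<delta> where "\<delta> = \<Psi> - \<psi>"
  define K5 where "K5 = (V1 + V2) * (3 * a + 2 * L)"
  have 4: "integral {0..2*pi} (O.boundary b) \<ge> 2 * pi * (R * (V1 * cos \<delta> + V2 * sin \<delta>) - K5 * (\<eta> + \<kappa>))"
  proof -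
    have pt: "R * (V1 * cos \<delta> + V2 * sin \<delta>) - K5 * (\<eta> + \<kappa>) \<le> O.boundary b t" for t
    proof -
      define y where "y = X b t - \<psi>"
      have y: "\<bar>y - \<delta>\<bar> \<le> \<kappa>" using X_b[of t] by (simp add: y_def \<delta>_def algebra_simps)
      have x: "O.xi b t = y + arctan (lb / a)" by (simp add: O.xi_def y_def outer)
      \<comment> \<open>The assumption on \<kappa> puts the outer contact angle on the nonnegative
        side, where the development is close to an isometry.\<close>
      have "0 \<le> arctan (lb / a)" using a L by simp
      then have "0 \<le> y + arctan (lb / a)" using y \<kappa> unfolding \<delta>_def \<psi>_def by linarith
      then have x0: "0 \<le> O.xi b t" unfolding x .
      define D where "D = (3 * a + 2 * L) * (\<eta> + \<kappa>)"
      have D: "(2 * a + L) * \<eta> + R * \<kappa> \<le> D"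
      proof -
        have "(2 * a + L) * \<eta> \<le> (3 * a + 2 * L) * \<eta>" "R * \<kappa> \<le> (3 * a + 2 * L) * \<kappa>"
          using a L R \<eta> \<kappa>0 by (auto intro!: mult_right_mono)
        then show ?thesis by (simp add: D_def algebra_simps)
      qed
      have "\<bar>R * cos y - R * cos \<delta>\<bar> \<le> R * \<kappa>" "\<bar>R * sin y - R * sin \<delta>\<bar> \<le> R * \<kappa>"
      proof -
        have "\<bar>R * (cos y - cos \<delta>)\<bar> \<le> R * \<kappa>" "\<bar>R * (sin y - sin \<delta>)\<bar> \<le> R * \<kappa>"
          using R y abs_cos_diff_le[of y \<delta>] abs_sin_diff_le[of y \<delta>]
          by (auto simp: abs_mult intro!: mult_left_mono)
        then show "\<bar>R * cos y - R * cos \<delta>\<bar> \<le> R * \<kappa>" "\<bar>R * sin y - R * sin \<delta>\<bar> \<le> R * \<kappa>"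
          by (simp_all add: right_diff_distrib)
      qed
      moreover have "\<bar>O.dev1 a lb (O.xi b t) - R * cos y\<bar> \<le> (2 * a + L) * \<eta>"
        "\<bar>O.dev2 a lb (O.xi b t) - R * sin y\<bar> \<le> (2 * a + L) * \<eta>"
        using O.dev_close[OF a L x0] unfolding x rotate_arctan[OF a] R_def by auto
      ultimately have "R * cos \<delta> - D \<le> O.dev1 a lb (O.xi b t)" "R * sin \<delta> - D \<le> O.dev2 a lb (O.xi b t)"
        using D by linarith+
      then have "V1 * (R * cos \<delta> - D) + V2 * (R * sin \<delta> - D) \<le> O.boundary b t"
        unfolding O.boundary_def UV outer using nn by (intro add_mono mult_left_mono) auto
      then show ?thesis by (simp add: K5_def D_def algebra_simps)
    qed
    have "integral {0..2*pi} (\<lambda>t. R * (V1 * cos \<delta> + V2 * sin \<delta>) - K5 * (\<eta> + \<kappa>)) \<le> integral {0..2*pi} (O.boundary b)"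
      using k by (intro integral_le integrable_continuous_real O_cont pt) auto
    then show ?thesis by simp
  qed
  have tot: "rect_int a b (\<lambda>r t. r * M1 r t + M2 r t / r) / 2 = I.energy + O.energy"
    unfolding I.energy_def O.energy_def
    using rect_int_combine[OF E.energy_integrand_cont, of k] k by simp
  have K: "twist_const a k b m L = a + 2 * pi * a^2 * m + K2 + K3 + 2 * pi * K5"
    by (simp add: twist_const_def K2_def K3_def K5_def U1_def U2_def V1_def V2_def)
  define Q where "Q = \<eta> + \<kappa> + Eab"
  have "a * Eab \<le> a * Q" "2 * pi * a^2 * m * \<eta> \<le> 2 * pi * a^2 * m * Q" "K2 * \<eta> \<le> K2 * Q" "K3 * Eab \<le> K3 * Q"
    "2 * pi * K5 * (\<eta> + \<kappa>) \<le> 2 * pi * K5 * Q"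
    using a m nn L k k0 \<kappa>0 \<eta> e_parts unfolding Q_def K2_def K3_def K5_def
    by (intro mult_left_mono; simp)+
  moreover have "2 * pi * (a * m * (a * \<psi> - a * \<eta>)) + pi * a^2 * (1 - m^2) * ln (k / a)
      = pi * a^2 * (1 + m^2) * ln (k / a) - 2 * pi * a^2 * m * \<eta>"
    by (simp add: \<psi>_def power2_eq_square algebra_simps)
  moreover have "2 * pi * (R * (V1 * cos \<delta> + V2 * sin \<delta>) - K5 * (\<eta> + \<kappa>))
      = 2 * pi * (R * (V1 * cos \<delta> + V2 * sin \<delta>)) - 2 * pi * K5 * (\<eta> + \<kappa>)"
    by (simp add: algebra_simps)
  moreover have "(a + 2 * pi * a^2 * m + K2 + K3 + 2 * pi * K5) * Q
      = a * Q + 2 * pi * a^2 * m * Q + K2 * Q + K3 * Q + 2 * pi * K5 * Q"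
    by (simp add: algebra_simps)
  ultimately have "I.energy + O.energy \<ge> pi * a^2 * (1 + m^2) * ln (k / a) - pi * (U1 * V1 + U2 * V2)
      + 2 * pi * (R * (V1 * cos \<delta> + V2 * sin \<delta>)) - (a + 2 * pi * a^2 * m + K2 + K3 + 2 * pi * K5) * Q"
    using 1 2 3 4 by linarith
  then show ?thesis
    unfolding tot K[symmetric] Q_def Eab_def R_def \<delta>_def \<psi>_def U1_def U2_def V1_def V2_def by simp
qed

subsection \<open>Lifted angles\<close>

lemma Im_cnj_mult_bound: "\<bar>Im (cnj u * v)\<bar> \<le> cmod u * cmod v"
  using abs_Im_le_cmod[of "cnj u * v"] by (simp add: norm_mult)

text \<open>Maps of the annulus with identity values on both circles. The mixed derivative
  \<open>z12\<close> belongs to the data because the curl of a pulled back form arises from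
  comparing the two orders of differentiation.\<close>

locale polar_map =
  fixes a b :: real and z z1 z2 z12 :: "real \<Rightarrow> real \<Rightarrow> complex"
  assumes a_pos: "0 < a" and ab: "a < b"
    and conts: "cont_rect a b z" "cont_rect a b z1" "cont_rect a b z2" "cont_rect a b z12"
    and z_r: "\<And>r t. a \<le> r \<Longrightarrow> r \<le> b \<Longrightarrow> ((\<lambda>r. z r t) has_vector_derivative z1 r t) (at r within {a..b})"
    and z_t: "\<And>r t. a \<le> r \<Longrightarrow> r \<le> b \<Longrightarrow> ((\<lambda>t. z r t) has_vector_derivative z2 r t) (at t)"
    and z1_t: "\<And>r t. a \<le> r \<Longrightarrow> r \<le> b \<Longrightarrow> ((\<lambda>t. z1 r t) has_vector_derivative z12 r t) (at t)"
    and z2_r: "\<And>r t. a \<le> r \<Longrightarrow> r \<le> b \<Longrightarrow> ((\<lambda>r. z2 r t) has_vector_derivative z12 r t) (at r within {a..b})"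
    and per: "\<And>r t. z r (t + 2*pi) = z r t" "\<And>r t. z1 r (t + 2*pi) = z1 r t"
      "\<And>r t. z2 r (t + 2*pi) = z2 r t"
    and inner: "\<And>t. z a t = of_real a * cis t" and outer: "\<And>t. z b t = of_real b * cis t"
begin

definition Jac :: "real \<Rightarrow> real \<Rightarrow> real" where
  "Jac r t = Im (cnj (z1 r t) * z2 r t)"

definition speed :: "real \<Rightarrow> real \<Rightarrow> real" where
  "speed r t = sq2 (z1 r t) (z2 r t)"

text \<open>Measures how far the derivatives are from invariance under a small rotation of the
  domain; it is the price for evaluating two forms at different points of a circle.\<close>

definition spread :: "real \<Rightarrow> real" where
  "spread \<sigma> = rect_int a b (\<lambda>r t. sq2 (z1 r (t + \<sigma>) - z1 r t) (z2 r (t + \<sigma>) - z2 r t))"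

definition neg_Jac :: real where
  "neg_Jac = rect_int a b (\<lambda>r t. max 0 (- Jac r t))"

lemma Jac_cont: "cont_rect a b Jac"
  unfolding Jac_def by (intro cont_rects conts)

lemma speed_cont: "cont_rect a b speed"
  unfolding speed_def by (intro cont_rects conts)

lemma circle_derivative: "((\<lambda>t. of_real c * cis t) has_vector_derivative \<i> * (of_real c * cis t)) (at t)"
proof -
  have "((\<lambda>x. of_real c * exp (\<i> * x)) has_field_derivative \<i> * (of_real c * exp (\<i> * of_real t))) (at (of_real t))"
    by (auto intro!: derivative_eq_intros)
  from has_vector_derivative_real_field[OF this] show ?thesis by (simp add: cis_conv_exp)
qed

lemma z2_boundary: "z2 a t = \<i> * (of_real a * cis t)" "z2 b t = \<i> * (of_real b * cis t)"
proof -
  have "((\<lambda>t. of_real a * cis t) has_vector_derivative z2 a t) (at t)"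
    using z_t[of a t] ab by (simp add: inner)
  then show "z2 a t = \<i> * (of_real a * cis t)" by (rule vector_derivative_unique_at[OF _ circle_derivative])
  have "((\<lambda>t. of_real b * cis t) has_vector_derivative z2 b t) (at t)"
    using z_t[of b t] ab by (simp add: outer)
  then show "z2 b t = \<i> * (of_real b * cis t)" by (rule vector_derivative_unique_at[OF _ circle_derivative])
qed

end

lemma has_vector_derivative_Im_cnj:
  assumes "(u has_vector_derivative u') (at x within S)" "(v has_vector_derivative v') (at x within S)"
  shows "((\<lambda>x. Im (cnj (u x) * v x)) has_real_derivative Im (cnj u' * v x) + Im (cnj (u x) * v')) (at x within S)"
proof -
  have "((\<lambda>x. cnj (u x) * v x) has_vector_derivative cnj (u x) * v' + cnj u' * v x) (at x within S)"
    by (intro has_vector_derivative_mult has_vector_derivative_cnj assms)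
  then have "((\<lambda>x. Im (cnj (u x) * v x)) has_vector_derivative Im (cnj (u x) * v' + cnj u' * v x)) (at x within S)"
    by (rule bounded_linear.has_vector_derivative[OF bounded_linear_Im])
  then show ?thesis by (simp add: real_vector_derivative_iff add.commute)
qed

lemma has_vector_derivative_cmod_square:
  assumes "(u has_vector_derivative u') (at x within S)"
  shows "((\<lambda>x. (cmod (u x))^2) has_real_derivative 2 * Re (cnj (u x) * u')) (at x within S)"
proof -
  have "((\<lambda>x. u x \<bullet> u x) has_vector_derivative u x \<bullet> u' + u' \<bullet> u x) (at x within S)"
    using bounded_bilinear.has_vector_derivative[OF bounded_bilinear_inner assms assms] by simp
  moreover have "u x \<bullet> u' + u' \<bullet> u x = 2 * Re (cnj (u x) * u')"
    by (simp add: inner_complex_def)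
  ultimately show ?thesis
    by (simp add: real_vector_derivative_iff power2_norm_eq_inner)
qed

text \<open>The pullback under \<open>z\<close> of the 1-form \<open>h (y \<bullet> y) (y1 dy2 - y2 dy1)\<close>. It is the differential of the
  angle outside the disc of radius \<open>a\<close>, and its primitive along the rays defines the lifted angle
  \<open>t + X\<close>; the form is not closed, and \<open>e\<close> measures by how much.\<close>

locale disc_form = polar_map +
  fixes h h' :: "real \<Rightarrow> real" and G :: real
  assumes h: "\<And>s. (h has_real_derivative h' s) (at s)" and h'_cont: "continuous_on UNIV h'"
    and h_out: "\<And>s. a^2 \<le> s \<Longrightarrow> h s = 1 / s"
    and curl: "\<And>s. 0 \<le> s \<Longrightarrow> 0 \<le> 2 * (h s + s * h' s)" "\<And>s. 0 \<le> s \<Longrightarrow> 2 * (h s + s * h' s) \<le> G"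
begin

definition A1 :: "real \<Rightarrow> real \<Rightarrow> real" where "A1 r t = h ((cmod (z r t))^2) * Im (cnj (z r t) * z1 r t)"
definition A2 :: "real \<Rightarrow> real \<Rightarrow> real" where "A2 r t = h ((cmod (z r t))^2) * Im (cnj (z r t) * z2 r t)"
text \<open>Pullback of the exterior derivative of the form, which has the density
  \<open>2 * (h s + s * h' s)\<close> in the target.\<close>

definition curlJ :: "real \<Rightarrow> real \<Rightarrow> real" where
  "curlJ r t = 2 * (h ((cmod (z r t))^2) + (cmod (z r t))^2 * h' ((cmod (z r t))^2)) * Jac r t"
definition X :: "real \<Rightarrow> real \<Rightarrow> real" where "X r t = integral {a..r} (\<lambda>\<rho>. A1 \<rho> t)"
definition e :: "real \<Rightarrow> real \<Rightarrow> real" where "e r t = integral {a..r} (\<lambda>\<rho>. curlJ \<rho> t)"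
definition err :: real where "err = rect_int a b (\<lambda>r t. \<bar>curlJ r t\<bar>)"

lemma h_cont: "continuous_on UNIV h"
  using h by (meson DERIV_isCont continuous_at_imp_continuous_on)

lemma form_conts: "cont_rect a b A1" "cont_rect a b A2" "cont_rect a b curlJ"
  unfolding A1_def A2_def curlJ_def
  by (intro cont_rects conts Jac_cont cont_rect_compose[OF h_cont] cont_rect_compose[OF h'_cont])+

lemma lift_conts: "cont_rect a b X" "cont_rect a b e"
  unfolding X_def e_def by (intro cont_rect_primitive form_conts)+

lemma lift_per: "X r (t + 2*pi) = X r t" "e r (t + 2*pi) = e r t"
  "A1 r (t + 2*pi) = A1 r t" "A2 r (t + 2*pi) = A2 r t" "curlJ r (t + 2*pi) = curlJ r t"
  by (simp_all add: X_def e_def A1_def A2_def curlJ_def Jac_def per)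

lemma X_r: "a \<le> r \<Longrightarrow> r \<le> b \<Longrightarrow> ((\<lambda>r. X r t) has_real_derivative A1 r t) (at r within {a..b})"
  unfolding X_def by (intro primitive_derivative1 form_conts)

lemma X_inner: "X a t = 0"
  by (simp add: X_def)

lemma A2_boundary: "A2 a t = 1" "A2 b t = 1"
proof -
  have "Im (cnj (of_real c * cis t) * (\<i> * (of_real c * cis t))) = c^2" for c
  proof -
    have "Im (cnj (of_real c * cis t) * (\<i> * (of_real c * cis t))) = c * cos t * (c * cos t) + c * sin t * (c * sin t)"
      by simp
    also have "\<dots> = c * c * (cos t * cos t + sin t * sin t)" by algebra
    also have "cos t * cos t + sin t * sin t = 1"
      using sin_cos_squared_add3[of t] by simp
    finally show ?thesis by (simp only: power2_eq_square mult_1_right)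
  qed
  moreover have "h (a^2) = 1 / a^2" "h (b^2) = 1 / b^2"
    using a_pos ab by (auto intro!: h_out power_mono)
  ultimately show "A2 a t = 1" "A2 b t = 1"
    unfolding A2_def z2_boundary inner outer using a_pos ab by (simp_all add: norm_mult)
qed

definition A12 :: "real \<Rightarrow> real \<Rightarrow> real" where
  "A12 r t = h' ((cmod (z r t))^2) * (2 * Re (cnj (z r t) * z2 r t)) * Im (cnj (z r t) * z1 r t)
     + h ((cmod (z r t))^2) * (Im (cnj (z2 r t) * z1 r t) + Im (cnj (z r t) * z12 r t))"

lemma A12_cont: "cont_rect a b A12"
  unfolding A12_def
  by (intro cont_rects conts cont_rect_compose[OF h_cont] cont_rect_compose[OF h'_cont])

lemma A1_t: "a \<le> r \<Longrightarrow> r \<le> b \<Longrightarrow> ((\<lambda>t. A1 r t) has_real_derivative A12 r t) (at t)"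
  unfolding A1_def A12_def
  by (rule DERIV_cong[OF DERIV_mult[OF DERIV_chain2[OF h has_vector_derivative_cmod_square[OF z_t]]
          has_vector_derivative_Im_cnj[OF z_t z1_t]]]) (auto simp: algebra_simps)

lemma A2_r: "a \<le> r \<Longrightarrow> r \<le> b \<Longrightarrow> ((\<lambda>r. A2 r t) has_real_derivative A12 r t + curlJ r t) (at r within {a..b})"
proof -
  assume r: "a \<le> r" "r \<le> b"
  define n where "n = (cmod (z r t))^2"
  have D: "((\<lambda>r. A2 r t) has_real_derivative
      h' n * (2 * Re (cnj (z r t) * z1 r t)) * Im (cnj (z r t) * z2 r t)
      + (Im (cnj (z1 r t) * z2 r t) + Im (cnj (z r t) * z12 r t)) * h n) (at r within {a..b})"
    unfolding A2_def n_def
    by (rule DERIV_mult[OF DERIV_chain2[OF h has_vector_derivative_cmod_square[OF z_r[OF r]]]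
          has_vector_derivative_Im_cnj[OF z_r[OF r] z2_r[OF r]]])
  \<comment> \<open>The planar identity that expresses the dot and cross products of
    \<open>z\<close> with \<open>z1\<close> and \<open>z2\<close> through |z|^2 times the cross
    product of \<open>z1\<close> and \<open>z2\<close>; it produces the part of the curl that
    contains h'.\<close>
  have "Re (cnj (z r t) * z1 r t) * Im (cnj (z r t) * z2 r t)
      - Re (cnj (z r t) * z2 r t) * Im (cnj (z r t) * z1 r t) = n * Jac r t"
  proof -
    have n: "n = (Re (z r t))^2 + (Im (z r t))^2" by (simp add: n_def cmod_power2)
    show ?thesis unfolding n Jac_def complex_mult complex.sel cnj.sel by simp algebra
  qed
  then have eq1: "h' n * (2 * Re (cnj (z r t) * z1 r t)) * Im (cnj (z r t) * z2 r t)
      - h' n * (2 * Re (cnj (z r t) * z2 r t)) * Im (cnj (z r t) * z1 r t) = 2 * n * h' n * Jac r t"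
    by algebra
  have eq2: "Im (cnj (z2 r t) * z1 r t) = - Jac r t" by (simp add: Jac_def)
  show ?thesis
    by (rule DERIV_cong[OF D], unfold A12_def curlJ_def n_def[symmetric] Jac_def[symmetric])
      (use eq1 eq2 in algebra)
qed

text \<open>Differentiation under the integral yields the radial integral of \<open>A12\<close>,
  which is the radial derivative of \<open>A2\<close> less the curl. The constant 1 is the value of
  \<open>A2\<close> on the inner circle, where the map is the identity.\<close>

lemma X_t:
  assumes "a \<le> r" "r \<le> b"
  shows "((\<lambda>t. X r t) has_real_derivative A2 r t - 1 - e r t) (at t)"
proof -
  have sub: "{a..r} \<subseteq> {a..b}" using assms by auto
  have "((\<lambda>\<rho>. A12 \<rho> t + curlJ \<rho> t) has_integral A2 r t - A2 a t) {a..r}"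
    using assms by (intro fundamental_theorem_of_calculus)
      (auto intro!: DERIV_subset[OF A2_r sub] simp: real_vector_derivative_iff[symmetric])
  moreover have i: "(\<lambda>\<rho>. A12 \<rho> t) integrable_on {a..r}" "(\<lambda>\<rho>. curlJ \<rho> t) integrable_on {a..r}"
    by (intro integrable_continuous_real continuous_on_subset[OF cont_rect_slice1 sub] A12_cont form_conts)+
  ultimately have "integral {a..r} (\<lambda>\<rho>. A12 \<rho> t) + e r t = A2 r t - 1"
    unfolding e_def by (simp add: integral_add[symmetric] integral_unique A2_boundary)
  then have "integral {a..r} (\<lambda>\<rho>. A12 \<rho> t) = A2 r t - 1 - e r t" by simp
  moreover have "((\<lambda>t. X r t) has_real_derivative integral {a..r} (\<lambda>\<rho>. A12 \<rho> t)) (at t)"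
    unfolding X_def using assms by (intro primitive_derivative2[OF form_conts(1) A12_cont _ A1_t])
  ultimately show ?thesis by simp
qed

lemma X_b_t: "((\<lambda>t. X b t) has_real_derivative - e b t) (at t)"
  using X_t[of b t] ab by (simp add: A2_boundary)

text \<open>On the outer circle \<open>X\<close> is periodic with derivative \<open>- e\<close>, so
  the curl has total integral zero. Its absolute value therefore integrates to twice its negative
  part, and as the curl density lies between 0 and \<open>G\<close>, that part is controlled by the
  negative part of the Jacobian.\<close>

lemma err_bound: "0 \<le> err" "err \<le> 2 * G * neg_Jac"
proof -
  have c: "cont_rect a b (\<lambda>r t. \<bar>curlJ r t\<bar>)" "cont_rect a b (\<lambda>r t. 2 * G * max 0 (- Jac r t))"
    by (intro cont_rects form_conts Jac_cont)+
  show "0 \<le> err" unfolding err_def by (rule rect_int_nonneg[OF c(1)]) simp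
  have "integral {0..2*pi} (\<lambda>t. e b t) = 0"
  proof -
    have "((\<lambda>t. - e b t) has_integral X b (2*pi) - X b 0) {0..2*pi}"
      using ab
      by (intro fundamental_theorem_of_calculus)
        (auto intro!: has_field_derivative_at_within[OF X_b_t]
          simp: real_vector_derivative_iff[symmetric])
    then show ?thesis using lift_per(1)[of b 0] by (simp add: integral_unique has_integral_neg_iff)
  qed
  then have 0: "rect_int a b curlJ = 0"
    by (simp add: rect_int_tr form_conts e_def)
  have "err \<le> rect_int a b (\<lambda>r t. curlJ r t + 2 * G * max 0 (- Jac r t))"
    unfolding err_def
  proof (rule rect_int_mono[OF c(1) cont_rect_arith(1)[OF form_conts(3) c(2)]])
    fix r t
    define n g where "n = (cmod (z r t))^2" and "g = 2 * (h n + n * h' n)"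
    have g: "0 \<le> g" "g \<le> G" using curl[of n] by (auto simp: n_def g_def)
    have J: "curlJ r t = g * Jac r t" by (simp add: curlJ_def g_def n_def)
    show "\<bar>curlJ r t\<bar> \<le> curlJ r t + 2 * G * max 0 (- Jac r t)"
    proof (cases "0 \<le> Jac r t")
      case False
      then have "g * (- Jac r t) \<le> G * (- Jac r t)" using g by (intro mult_right_mono) auto
      then show ?thesis using False g by (simp add: J abs_mult max_def)
    qed (use g in \<open>simp add: J abs_mult\<close>)
  qed
  also have "\<dots> = 2 * G * neg_Jac"
    by (subst rect_int_add[OF form_conts(3) c(2)]) (simp add: 0 rect_int_cmult neg_Jac_def)
  finally show "err \<le> 2 * G * neg_Jac" .
qed

lemma e_slice_bound:
  assumes "a \<le> r" "r \<le> b"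
  shows "\<bar>e r t\<bar> \<le> integral {a..b} (\<lambda>\<rho>. \<bar>curlJ \<rho> t\<bar>)"
proof -
  have sub: "{a..r} \<subseteq> {a..b}" using assms by auto
  have c: "continuous_on {a..b} (\<lambda>\<rho>. curlJ \<rho> t)" by (rule cont_rect_slice1[OF form_conts(3)])
  have "\<bar>e r t\<bar> \<le> integral {a..r} (\<lambda>\<rho>. \<bar>curlJ \<rho> t\<bar>)"
    unfolding e_def real_norm_def[symmetric]
    by (intro integral_norm_bound_integral integrable_continuous_real continuous_intros
        continuous_on_subset[OF c sub]) auto
  also have "\<dots> \<le> integral {a..b} (\<lambda>\<rho>. \<bar>curlJ \<rho> t\<bar>)"
    by (intro integral_subset_le sub integrable_continuous_real continuous_intros
        continuous_on_subset[OF c]) (use sub in auto)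
  finally show ?thesis .
qed

text \<open>Valid on every circle and not only on average, because |e| is dominated by the curl
  integrated over the whole ray, which does not depend on \<open>r\<close>.\<close>

lemma e_window_bound:
  assumes "a \<le> r" "r \<le> b" "0 \<le> s" "s \<le> 2*pi"
  shows "integral {t..t+s} (\<lambda>\<tau>. \<bar>e r \<tau>\<bar>) \<le> err"
proof -
  define E where "E = (\<lambda>t. integral {a..b} (\<lambda>\<rho>. \<bar>curlJ \<rho> t\<bar>))"
  have cE: "continuous_on S E" for S
    unfolding E_def using ab by (intro cont_rect_integral1 cont_rects form_conts) auto
  have E0: "0 \<le> E t" for t
    unfolding E_def by (intro integral_nonneg integrable_continuous_real cont_rect_slice1 cont_rects form_conts) auto
  have "integral {t..t+s} (\<lambda>\<tau>. \<bar>e r \<tau>\<bar>) \<le> integral {t..t+s} E"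
    using assms e_slice_bound unfolding E_def[symmetric]
    by (intro integral_le integrable_continuous_real cE continuous_intros cont_rect_slice2[OF lift_conts(2)])
      (auto simp: E_def)
  also have "\<dots> \<le> integral {t..t+2*pi} E"
    using assms E0 by (intro integral_subset_le integrable_continuous_real cE) auto
  also have "\<dots> = integral {0..2*pi} (\<lambda>\<tau>. E (\<tau> + t))"
    using integral_shift_real_ivl[where a = t and b = "t + 2*pi" and c = t and f = E] by simp
  also have "\<dots> = integral {0..2*pi} E"
    by (rule periodic_integral_shift[OF cE]) (simp add: E_def lift_per)
  also have "\<dots> = err"
    unfolding err_def by (subst rect_int_tr) (auto simp: E_def intro!: cont_rects form_conts)
  finally show ?thesis .
qed

lemma rect_int_e_bound: "rect_int a b (\<lambda>r t. \<bar>e r t\<bar>) \<le> (b - a) * err"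
proof -
  have c: "cont_rect a b (\<lambda>r t. \<bar>e r t\<bar>)" by (intro cont_rects lift_conts)
  have "rect_int a b (\<lambda>r t. \<bar>e r t\<bar>) \<le> integral {a..b} (\<lambda>r. err)"
    unfolding rect_int_rt[OF c]
    by (intro integral_le integrable_continuous_real cont_rect_integral2 c)
      (use e_window_bound[of _ "2*pi" 0] in auto)
  then show ?thesis using ab by simp
qed

text \<open>On the outer circle \<open>A2\<close> is 1, so the derivative of \<open>X\<close>
  reduces to \<open>- e\<close>, whose window integrals are at most \<open>err\<close>; whole
  periods are removed to bring the two angles within one window.\<close>

lemma X_outer_oscillation: "\<bar>X b t - X b t'\<bar> \<le> err"
proof -
  have key: "\<bar>X b (t + s) - X b t\<bar> \<le> err" if "0 \<le> s" "s \<le> 2*pi" for t s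
  proof -
    have "((\<lambda>\<tau>. - e b \<tau>) has_integral X b (t + s) - X b t) {t..t+s}"
      using ab that
      by (intro fundamental_theorem_of_calculus)
        (auto intro!: has_field_derivative_at_within[OF X_b_t]
          simp: real_vector_derivative_iff[symmetric])
    then have 1: "integral {t..t+s} (\<lambda>\<tau>. - e b \<tau>) = X b (t + s) - X b t" by (rule integral_unique)
    have c: "continuous_on {t..t+s} (\<lambda>\<tau>. e b \<tau>)"
      using ab by (intro cont_rect_slice2[OF lift_conts(2)]) auto
    have "norm (integral {t..t+s} (\<lambda>\<tau>. - e b \<tau>)) \<le> integral {t..t+s} (\<lambda>\<tau>. \<bar>e b \<tau>\<bar>)"
      by (intro integral_norm_bound_integral integrable_continuous_real continuous_intros c) auto
    moreover have "integral {t..t+s} (\<lambda>\<tau>. \<bar>e b \<tau>\<bar>) \<le> err" using ab that by (intro e_window_bound) auto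
    ultimately show ?thesis using 1 by simp
  qed
  have per': "X b (t + 2 * pi * of_int n) = X b t" for t n
  proof -
    have "X b (t + 2 * pi * of_nat k) = X b t" for k t
    proof (induction k)
      case (Suc k)
      have eq: "t + 2 * pi * of_nat (Suc k) = t + 2 * pi * of_nat k + 2 * pi" by (simp add: algebra_simps)
      show ?case unfolding eq lift_per(1) by (rule Suc)
    qed simp
    note step = this
    obtain k where "n = int k \<or> n = - int k" by (metis int_cases2)
    then show ?thesis using step[of t k] step[of "t - 2 * pi * of_nat k" k] by auto
  qed
  define n where "n = \<lfloor>(t - t') / (2*pi)\<rfloor>"
  define s where "s = t - t' - 2 * pi * of_int n"
  have "of_int n \<le> (t - t') / (2*pi)" "(t - t') / (2*pi) < of_int n + 1"
    by (auto simp: n_def)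
  then have s: "0 \<le> s" "s \<le> 2*pi"
    by (simp_all add: s_def field_simps)
  have "X b (t' + s) = X b t"
    using per'[of "t' + s" n] by (simp add: s_def)
  then show ?thesis using key[OF s, of t'] by simp
qed

end

section \<open>Comparing the lifted angles of two cut-offs\<close>

lemma rect_int_swap:
  fixes G :: "real \<Rightarrow> real \<Rightarrow> real \<Rightarrow> real"
  assumes "continuous_on (({a..b} \<times> UNIV) \<times> UNIV) (\<lambda>q. G (fst (fst q)) (snd (fst q)) (snd q))"
  shows "rect_int a b (\<lambda>r t. integral {0..s} (\<lambda>\<sigma>. G r t \<sigma>)) = integral {0..s} (\<lambda>\<sigma>. rect_int a b (\<lambda>r t. G r t \<sigma>))"
proof -
  have "continuous_on (cbox ((a, 0), 0) ((b, 2*pi), s)) (\<lambda>(x, y). G (fst x) (snd x) y)"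
    using assms unfolding split_beta by (rule continuous_on_subset) (auto simp: cbox_Pair_eq)
  from integral_swap_continuous[OF this] show ?thesis
    unfolding rect_int_def by simp
qed

lemma cont_rect_product_shift:
  fixes f g :: "real \<Rightarrow> real \<Rightarrow> real"
  assumes "cont_rect a b f" "cont_rect a b g"
  shows "continuous_on (({a..b} \<times> UNIV) \<times> UNIV) (\<lambda>q. f (fst (fst q)) (snd (fst q)) * g (fst (fst q)) (snd (fst q) + c * snd q))"
proof (intro continuous_on_mult)
  show "continuous_on (({a..b} \<times> UNIV) \<times> UNIV) (\<lambda>q. f (fst (fst q)) (snd (fst q)))"
    by (rule continuous_on_compose2[OF assms(1)[unfolded cont_rect_def], where f = "\<lambda>q. fst q"])
      (auto intro!: continuous_intros)
  show "continuous_on (({a..b} \<times> UNIV) \<times> UNIV) (\<lambda>q. g (fst (fst q)) (snd (fst q) + c * snd q))"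
    by (rule continuous_on_compose2[OF assms(2)[unfolded cont_rect_def],
          where f = "\<lambda>q. (fst (fst q), snd (fst q) + c * snd q)", simplified])
      (auto intro!: continuous_intros)
qed

lemma integral_backward_window:
  fixes f :: "real \<Rightarrow> real"
  assumes "continuous_on UNIV f" "0 \<le> s"
  shows "integral {0..s} (\<lambda>\<sigma>. f (t - \<sigma>)) = integral {t-s..t} f"
    and "integral {0..s} (\<lambda>\<sigma>. f (t + \<sigma>)) = integral {t..t+s} f"
proof -
  obtain F where F: "\<And>x. (F has_vector_derivative f x) (at x)"
    using einterval_antiderivative[of "-\<infinity>" "\<infinity>" f] assms(1)
    by (auto simp: continuous_on_eq_continuous_at)
  have F': "(F has_real_derivative f x) (at x within A)" for x A
    using F by (simp add: real_vector_derivative_iff has_vector_derivative_at_within)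
  have 1: "integral {x..y} f = F y - F x" if "x \<le> y" for x y
    by (intro integral_unique fundamental_theorem_of_calculus that)
      (auto intro: F has_vector_derivative_at_within)
  have d1: "((\<lambda>\<sigma>. - F (t - \<sigma>)) has_real_derivative f (t - x)) (at x within {0..s})" for x
  proof -
    have "((\<lambda>\<sigma>. t - \<sigma>) has_real_derivative -1) (at x within {0..s})"
      by (auto intro!: derivative_eq_intros)
    from DERIV_minus[OF DERIV_chain2[OF F' this]] show ?thesis by simp
  qed
  have d2: "((\<lambda>\<sigma>. F (t + \<sigma>)) has_real_derivative f (t + x)) (at x within {0..s})" for x
  proof -
    have "((\<lambda>\<sigma>. t + \<sigma>) has_real_derivative 1) (at x within {0..s})"
      by (auto intro!: derivative_eq_intros)
    from DERIV_chain2[OF F' this] show ?thesis by simp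
  qed
  have "integral {0..s} (\<lambda>\<sigma>. f (t - \<sigma>)) = - F (t - s) - (- F (t - 0))"
    by (intro integral_unique fundamental_theorem_of_calculus assms)
      (auto intro: d1 simp: real_vector_derivative_iff[symmetric])
  then show "integral {0..s} (\<lambda>\<sigma>. f (t - \<sigma>)) = integral {t-s..t} f" using 1[of "t-s" t] assms by simp
  have "integral {0..s} (\<lambda>\<sigma>. f (t + \<sigma>)) = F (t + s) - F (t + 0)"
    by (intro integral_unique fundamental_theorem_of_calculus assms)
      (auto intro: d2 simp: real_vector_derivative_iff[symmetric])
  then show "integral {0..s} (\<lambda>\<sigma>. f (t + \<sigma>)) = integral {t..t+s} f" using 1[of t "t+s"] assms by simp
qed

text \<open>If u' = u and v' = v, the expression factors as
  \<open>Im (cnj p * q) * Im (cnj u * v)\<close>, the wedge of two covectors evaluated on two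
  vectors. The first summand on the right pays for the change of u and v.\<close>

lemma cross_product_bound:
  fixes p q u v u' v' :: complex
  shows "\<bar>Im (q * u) * Im (p * v') - Im (p * u') * Im (q * v)\<bar>
    \<le> cmod p * cmod q * (cmod u * cmod (v' - v) + cmod v * cmod (u' - u)) + cmod p * cmod q * \<bar>Im (cnj u * v)\<bar>"
proof -
  have I: "\<bar>Im (x * y)\<bar> \<le> cmod x * cmod y" for x y
    using abs_Im_le_cmod[of "x * y"] by (simp add: norm_mult)
  have "Im (q * u) * Im (p * v') - Im (p * u') * Im (q * v)
    = (Im (q * u) * Im (p * (v' - v)) - Im (p * (u' - u)) * Im (q * v)) + Im (cnj p * q) * Im (cnj u * v)"
    by (simp add: algebra_simps)
  moreover have "\<bar>Im (q * u) * Im (p * (v' - v))\<bar> \<le> (cmod q * cmod u) * (cmod p * cmod (v' - v))"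
    unfolding abs_mult by (intro mult_mono I) auto
  moreover have "\<bar>Im (p * (u' - u)) * Im (q * v)\<bar> \<le> (cmod p * cmod (u' - u)) * (cmod q * cmod v)"
    unfolding abs_mult by (intro mult_mono I) auto
  moreover have "\<bar>Im (cnj p * q) * Im (cnj u * v)\<bar> \<le> (cmod p * cmod q) * \<bar>Im (cnj u * v)\<bar>"
    unfolding abs_mult using I[of "cnj p" q] by (intro mult_mono) auto
  ultimately have "\<bar>Im (q * u) * Im (p * v') - Im (p * u') * Im (q * v)\<bar>
    \<le> (cmod q * cmod u) * (cmod p * cmod (v' - v)) + (cmod p * cmod (u' - u)) * (cmod q * cmod v)
      + (cmod p * cmod q) * \<bar>Im (cnj u * v)\<bar>"
    by linarith
  then show ?thesis by (simp add: algebra_simps)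
qed

text \<open>The wedge product of the two forms vanishes, because both are multiples of one form in the
  target. Integrating it against the difference of the two lifted angles shows that these have almost
  the same increment along the rays. As the errors \<open>e\<close> are only small in \<open>L\<^sup>1\<close>, the product
  is first averaged over rotations by an angle of at most \<open>s\<close>.\<close>

locale disc_form_pair =
  F: disc_form a b z z1 z2 z12 h h' G + K: disc_form a b z z1 z2 z12 k k' G'
  for a b z z1 z2 z12 h h' G k k' G' +
  fixes C :: real
  assumes bound: "\<And>s. 0 \<le> s \<Longrightarrow> \<bar>h s\<bar> * sqrt s \<le> C" "\<And>s. 0 \<le> s \<Longrightarrow> \<bar>k s\<bar> * sqrt s \<le> C"
    and diff_bound: "\<And>s. 0 \<le> s \<Longrightarrow> \<bar>k s - h s\<bar> * sqrt s \<le> C * (2 * (h s + s * h' s))"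
begin

lemma C_nonneg: "0 \<le> C"
  using bound(1)[of 0] by simp

definition D :: "real \<Rightarrow> real \<Rightarrow> real" where "D r t = K.X r t - F.X r t"
definition B1 :: "real \<Rightarrow> real \<Rightarrow> real" where "B1 r t = K.A1 r t - F.A1 r t"
definition B2 :: "real \<Rightarrow> real \<Rightarrow> real" where "B2 r t = K.A2 r t - F.A2 r t"
definition eD :: "real \<Rightarrow> real \<Rightarrow> real" where "eD r t = K.e r t - F.e r t"

lemma pair_conts: "cont_rect a b D" "cont_rect a b B1" "cont_rect a b B2" "cont_rect a b eD"
  unfolding D_def B1_def B2_def eD_def
  by (intro cont_rects K.lift_conts F.lift_conts K.form_conts F.form_conts)+

lemma pair_per: "D r (t + 2*pi) = D r t" "B1 r (t + 2*pi) = B1 r t" "B2 r (t + 2*pi) = B2 r t" "eD r (t + 2*pi) = eD r t"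
  by (simp_all add: D_def B1_def B2_def eD_def K.lift_per F.lift_per)

lemma D_r: "a \<le> r \<Longrightarrow> r \<le> b \<Longrightarrow> ((\<lambda>r. D r t) has_real_derivative B1 r t) (at r within {a..b})"
  unfolding D_def B1_def by (intro DERIV_diff K.X_r F.X_r)

lemma D_t: "a \<le> r \<Longrightarrow> r \<le> b \<Longrightarrow> ((\<lambda>t. D r t) has_real_derivative B2 r t - eD r t) (at t)"
  unfolding D_def B2_def eD_def
  by (rule DERIV_cong[OF DERIV_diff[OF K.X_t F.X_t]]) auto

lemma A_bounds: "\<bar>F.A1 r t\<bar> \<le> C * cmod (z1 r t)" "\<bar>K.A1 r t\<bar> \<le> C * cmod (z1 r t)" "\<bar>B1 r t\<bar> \<le> 2 * C * cmod (z1 r t)"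
proof -
  have *: "\<bar>c * Im (cnj (z r t) * z1 r t)\<bar> \<le> C * cmod (z1 r t)" if "\<bar>c\<bar> * sqrt ((cmod (z r t))^2) \<le> C" for c
  proof -
    have "\<bar>c * Im (cnj (z r t) * z1 r t)\<bar> \<le> \<bar>c\<bar> * (cmod (z r t) * cmod (z1 r t))"
      unfolding abs_mult by (intro mult_left_mono Im_cnj_mult_bound) auto
    also have "\<dots> = \<bar>c\<bar> * sqrt ((cmod (z r t))^2) * cmod (z1 r t)" by simp
    also have "\<dots> \<le> C * cmod (z1 r t)" using that by (intro mult_right_mono) auto
    finally show ?thesis .
  qed
  show 1: "\<bar>F.A1 r t\<bar> \<le> C * cmod (z1 r t)" "\<bar>K.A1 r t\<bar> \<le> C * cmod (z1 r t)"
    unfolding F.A1_def K.A1_def by (rule *, rule bound, simp)+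
  show "\<bar>B1 r t\<bar> \<le> 2 * C * cmod (z1 r t)" using 1 unfolding B1_def by linarith
qed

text \<open>After the shift the two forms sit at different image points and are no longer
  proportional. The defect is a multiple of the Jacobian times the difference of the weights; by
  \<open>diff_bound\<close> that difference is controlled by the curl density of the first form, so
  the defect is paid by \<open>F.err\<close>. The change of the derivatives under the shift is paid
  by \<open>spread\<close>, balanced against the energy by \<mu>.\<close>

lemma wedge_bound:
  assumes \<mu>: "0 < \<mu>"
  shows "\<bar>rect_int a b (\<lambda>r t. B1 r t * F.A2 r (t + \<sigma>)) - rect_int a b (\<lambda>r t. F.A1 r (t + \<sigma>) * B2 r t)\<bar>
    \<le> C^2 * (\<mu> * rect_int a b F.speed + F.spread \<sigma> / \<mu>) + C^2 * F.err"
proof -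
  define \<Delta> where "\<Delta> = (\<lambda>r t. sq2 (z1 r (t + \<sigma>) - z1 r t) (z2 r (t + \<sigma>) - z2 r t))"
  have c: "cont_rect a b (\<lambda>r t. B1 r t * F.A2 r (t + \<sigma>))" "cont_rect a b (\<lambda>r t. F.A1 r (t + \<sigma>) * B2 r t)"
    "cont_rect a b \<Delta>" "cont_rect a b (\<lambda>r t. \<bar>F.curlJ r t\<bar>)"
    unfolding \<Delta>_def
    by (intro cont_rects pair_conts F.form_conts F.conts cont_rect_shift)+
  define bd where "bd = (\<lambda>r t. C^2 * \<mu> * F.speed r t + C^2 / \<mu> * \<Delta> r t + C^2 * \<bar>F.curlJ r t\<bar>)"
  have cb: "cont_rect a b bd"
    unfolding bd_def using \<mu> by (intro cont_rects F.speed_cont c)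
  have pt: "\<bar>B1 r t * F.A2 r (t + \<sigma>) - F.A1 r (t + \<sigma>) * B2 r t\<bar> \<le> bd r t" for r t
  proof -
    define n n' where "n = (cmod (z r t))^2" and "n' = (cmod (z r (t + \<sigma>)))^2"
    define q p where "q = of_real (k n - h n) * cnj (z r t)" and "p = of_real (h n') * cnj (z r (t + \<sigma>))"
    define u v u' v' where "u = z1 r t" and "v = z2 r t" and "u' = z1 r (t + \<sigma>)" and "v' = z2 r (t + \<sigma>)"
    have A: "B1 r t = Im (q * u)" "B2 r t = Im (q * v)" "F.A1 r (t + \<sigma>) = Im (p * u')" "F.A2 r (t + \<sigma>) = Im (p * v')"
      by (simp_all add: B1_def B2_def F.A1_def F.A2_def K.A1_def K.A2_def q_def p_def u_def v_def u'_def v'_def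
          n_def n'_def algebra_simps)
    have n0: "0 \<le> n" "0 \<le> n'" and sq: "sqrt n = cmod (z r t)" "sqrt n' = cmod (z r (t + \<sigma>))"
      by (auto simp: n_def n'_def)
    have p: "cmod p \<le> C" using bound(1)[OF n0(2)] by (simp add: p_def norm_mult sq)
    have q: "cmod q = \<bar>k n - h n\<bar> * sqrt n"
      by (simp add: q_def norm_mult sq flip: of_real_diff)
    have qb: "cmod q \<le> 2 * C"
    proof -
      have "\<bar>k n - h n\<bar> * sqrt n \<le> (\<bar>k n\<bar> + \<bar>h n\<bar>) * sqrt n"
        using n0 by (intro mult_right_mono) auto
      then show ?thesis using bound[OF n0(1)] by (simp add: q algebra_simps)
    qed
    have qJ: "cmod q * \<bar>Im (cnj u * v)\<bar> \<le> C * \<bar>F.curlJ r t\<bar>"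
    proof -
      have g: "0 \<le> 2 * (h n + n * h' n)" using F.curl(1)[OF n0(1)] .
      have "cmod q * \<bar>Im (cnj u * v)\<bar> \<le> C * (2 * (h n + n * h' n)) * \<bar>Im (cnj u * v)\<bar>"
        unfolding q using diff_bound[OF n0(1)] by (intro mult_right_mono) auto
      also have "\<dots> = C * \<bar>2 * (h n + n * h' n) * Im (cnj u * v)\<bar>"
        using g by (simp add: abs_mult)
      finally show ?thesis by (simp add: F.curlJ_def F.Jac_def n_def u_def v_def)
    qed
    have amgm: "x * y \<le> (\<mu> * x^2 + y^2 / \<mu>) / 2" for x y :: real
    proof -
      have "0 \<le> (\<mu> * x - y)^2 / \<mu>" using \<mu> by simp
      also have "\<dots> = \<mu> * x^2 - 2 * (x * y) + y^2 / \<mu>"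
        using \<mu> by (simp add: power2_eq_square field_simps)
      finally show ?thesis by simp
    qed
    have "\<bar>B1 r t * F.A2 r (t + \<sigma>) - F.A1 r (t + \<sigma>) * B2 r t\<bar>
      \<le> cmod p * cmod q * (cmod u * cmod (v' - v) + cmod v * cmod (u' - u)) + cmod p * cmod q * \<bar>Im (cnj u * v)\<bar>"
      unfolding A by (rule cross_product_bound)
    also have "cmod p * cmod q * (cmod u * cmod (v' - v) + cmod v * cmod (u' - u))
        \<le> C * (2 * C) * ((\<mu> * F.speed r t + \<Delta> r t / \<mu>) / 2)"
    proof (intro mult_mono p qb)
      show "cmod u * cmod (v' - v) + cmod v * cmod (u' - u) \<le> (\<mu> * F.speed r t + \<Delta> r t / \<mu>) / 2"
        using amgm[of "cmod u" "cmod (v' - v)"] amgm[of "cmod v" "cmod (u' - u)"]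
        by (simp add: F.speed_def \<Delta>_def u_def v_def u'_def v'_def algebra_simps add_divide_distrib)
    qed (use C_nonneg in auto)
    also have "cmod p * cmod q * \<bar>Im (cnj u * v)\<bar> \<le> C * (C * \<bar>F.curlJ r t\<bar>)"
      unfolding mult.assoc by (rule mult_mono[OF p qJ C_nonneg]) simp
    also have "C * (2 * C) * ((\<mu> * F.speed r t + \<Delta> r t / \<mu>) / 2) + C * (C * \<bar>F.curlJ r t\<bar>) = bd r t"
      using \<mu> by (simp add: bd_def power2_eq_square field_simps)
    finally show ?thesis by simp
  qed
  have "\<bar>rect_int a b (\<lambda>r t. B1 r t * F.A2 r (t + \<sigma>) - F.A1 r (t + \<sigma>) * B2 r t)\<bar> \<le> rect_int a b bd"
    by (rule rect_int_abs_le[OF cont_rect_arith(2)[OF c(1,2)] cb pt])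
  also have "rect_int a b bd = C^2 * \<mu> * rect_int a b F.speed + C^2 / \<mu> * F.spread \<sigma> + C^2 * F.err"
    unfolding bd_def F.spread_def F.err_def \<Delta>_def[symmetric]
    by (subst rect_int_add; (intro cont_rects F.speed_cont c)?)+ (simp only: rect_int_cmult)
  finally show ?thesis unfolding rect_int_diff[OF c(1,2)] by (simp add: algebra_simps)
qed

text \<open>\<open>D * Y\<close> vanishes on the inner circle, so its flux through the outer circle
  is an integral over the annulus. There \<open>Y\<close>, the advance of the first angle over a
  window of length \<open>s\<close>, and the increment of \<open>D\<close> over the window are
  window integrals of \<open>A2\<close> and \<open>B2\<close> up to closing errors, which makes the
  integrand an average over \<sigma> of the products in \<open>wedge_bound\<close>. On the outer
  circle \<open>D\<close> is nearly constant and \<open>Y\<close> has integral 2 pi s.\<close>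

lemma D_outer_bound:
  assumes s: "0 < s" "s \<le> 2*pi" and \<mu>: "0 < \<mu>" and spread: "\<And>\<sigma>. 0 \<le> \<sigma> \<Longrightarrow> \<sigma> \<le> s \<Longrightarrow> F.spread \<sigma> \<le> \<omega>"
    and small: "F.err \<le> s"
  shows "\<bar>D b t0\<bar> \<le> F.err + K.err + C^2 * (\<mu> * rect_int a b F.speed + \<omega> / \<mu> + F.err)
      + 3 * C * (F.err + K.err) * (2 * pi * (b - a) + rect_int a b F.speed) / s"
proof -
  define W where "W = C^2 * (\<mu> * rect_int a b F.speed + \<omega> / \<mu> + F.err)"
  define E where "E = F.err + K.err"
  have E: "0 \<le> F.err" "0 \<le> K.err" "0 \<le> E" using F.err_bound(1) K.err_bound(1) by (auto simp: E_def)
  define S0 where "S0 = rect_int a b F.speed"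
  define Y where "Y = (\<lambda>r t. F.X r (t + s) - F.X r t + s)"
  define f where "f = (\<lambda>r t. B1 r t * Y r t + D r t * (F.A1 r (t + s) - F.A1 r t))"
  have cY: "cont_rect a b Y" unfolding Y_def by (intro cont_rects F.lift_conts cont_rect_shift)
  have cDY: "cont_rect a b (\<lambda>r t. D r t * Y r t)" by (intro cont_rects cY pair_conts)
  have cf: "cont_rect a b f" unfolding f_def
    by (intro cont_rects F.form_conts pair_conts cY cont_rect_shift)
  have ab: "a \<le> b" using F.ab by simp
  have DY_r: "((\<lambda>r. D r t * Y r t) has_real_derivative f r t) (at r within {a..b})" if "a \<le> r" "r \<le> b" for r t
  proof -
    have "((\<lambda>r. Y r t) has_real_derivative F.A1 r (t + s) - F.A1 r t + 0) (at r within {a..b})"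
      unfolding Y_def by (intro DERIV_add DERIV_diff F.X_r DERIV_const that)
    from DERIV_mult[OF D_r[OF that] this] show ?thesis by (simp add: f_def mult.commute)
  qed
  have Da: "D a t = 0" for t by (simp add: D_def F.X_inner K.X_inner)
  have fD: "rect_int a b f = integral {0..2*pi} (\<lambda>t. D b t * Y b t)"
    using rect_int_derivative1[OF ab cDY cf DY_r] by (simp add: Da)
  have Dosc: "\<bar>D b t - D b t0\<bar> \<le> E" for t
    using F.X_outer_oscillation[of t t0] K.X_outer_oscillation[of t t0] by (simp add: D_def E_def abs_le_iff)
  \<comment> \<open>With \<open>F.err\<close> at most \<open>s\<close>, the factor \<open>Y\<close>
    is a nonnegative weight on the outer circle, so \<open>D b t\<close> may be replaced by
    \<open>D b t0\<close> under the integral at the cost of the oscillation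
    \<open>E\<close>.\<close>
  have Yb: "0 \<le> Y b t" for t
    using F.X_outer_oscillation[of "t + s" t] small by (simp add: Y_def abs_le_iff)
  have cYb: "continuous_on {0..2*pi} (\<lambda>t. Y b t)" "continuous_on {0..2*pi} (\<lambda>t. D b t)"
    using ab by (auto intro!: cont_rect_slice2 cY pair_conts)
  have Yint: "integral {0..2*pi} (\<lambda>t. Y b t) = 2 * pi * s"
  proof -
    have c: "continuous_on A (\<lambda>t. F.X b t)" for A using ab by (auto intro!: cont_rect_slice2 F.lift_conts)
    have cs: "continuous_on A (\<lambda>t. F.X b (t + s))" for A
      using ab by (auto intro!: cont_rect_slice2[OF cont_rect_shift[OF F.lift_conts(1)]])
    have "integral {0..2*pi} (\<lambda>t. F.X b (t + s)) = integral {0..2*pi} (\<lambda>t. F.X b t)"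
      by (rule periodic_integral_shift[OF c F.lift_per(1)])
    then show ?thesis
      unfolding Y_def
      by (subst integral_add integral_diff; (intro integrable_continuous_real continuous_intros c cs)?)+ simp
  qed
  have bnd: "2 * pi * s * \<bar>D b t0\<bar> \<le> 2 * pi * s * E + \<bar>rect_int a b f\<bar>"
  proof -
    have i: "(\<lambda>t. (D b t0 + c) * Y b t) integrable_on {0..2*pi}" "(\<lambda>t. D b t * Y b t) integrable_on {0..2*pi}" for c
      by (intro integrable_continuous_real continuous_intros cYb)+
    have "integral {0..2*pi} (\<lambda>t. (D b t0 + - E) * Y b t) \<le> integral {0..2*pi} (\<lambda>t. D b t * Y b t)"
      using Dosc Yb by (intro integral_le i mult_right_mono) (auto simp: abs_le_iff minus_le_iff algebra_simps)
    moreover have "integral {0..2*pi} (\<lambda>t. D b t * Y b t) \<le> integral {0..2*pi} (\<lambda>t. (D b t0 + E) * Y b t)"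
      using Dosc Yb by (intro integral_le i mult_right_mono) (auto simp: abs_le_iff algebra_simps)
    ultimately have "(D b t0 - E) * (2 * pi * s) \<le> rect_int a b f" "rect_int a b f \<le> (D b t0 + E) * (2 * pi * s)"
      by (simp_all add: fD Yint)
    moreover have "2 * pi * s * \<bar>D b t0\<bar> = \<bar>D b t0 * (2 * pi * s)\<bar>" using s by (simp add: abs_mult)
    ultimately show ?thesis by (simp add: algebra_simps abs_le_iff) linarith
  qed
  \<comment> \<open>Window integrals that replace \<open>Y\<close> and the increment of
    \<open>D\<close>. The closing errors now enter only through windows, where they are at most
    \<open>E\<close> on every circle.\<close>
  define P where "P = (\<lambda>r t. integral {0..s} (\<lambda>\<sigma>. F.A2 r (t + \<sigma>)))"
  define Q where "Q = (\<lambda>r t. integral {0..s} (\<lambda>\<sigma>. B2 r (t - \<sigma>)))"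
  have sl: "continuous_on A (\<lambda>t. g r t)" if "cont_rect a b g" "a \<le> r" "r \<le> b" for g :: "real \<Rightarrow> real \<Rightarrow> real" and r A
    by (rule cont_rect_slice2[OF that])
  have sl2: "continuous_on A (\<lambda>\<sigma>. g r (t + \<sigma>))" "continuous_on A (\<lambda>\<sigma>. g r (t - \<sigma>))"
    if "cont_rect a b g" "a \<le> r" "r \<le> b" for g :: "real \<Rightarrow> real \<Rightarrow> real" and r A t
    by (rule continuous_on_compose2[OF sl[OF that, of UNIV]]; auto intro!: continuous_intros)+
  have window: "\<bar>integral {0..s} (\<lambda>\<sigma>. g r (t + \<sigma>))\<bar> \<le> W'" "\<bar>integral {0..s} (\<lambda>\<sigma>. g r (t - \<sigma>))\<bar> \<le> W'"
    if "cont_rect a b g" "a \<le> r" "r \<le> b" "\<And>t. integral {t..t+s} (\<lambda>t. \<bar>g r t\<bar>) \<le> W'"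
    for g :: "real \<Rightarrow> real \<Rightarrow> real" and r t W'
  proof -
    have c: "continuous_on UNIV (\<lambda>t. \<bar>g r t\<bar>)" by (intro continuous_intros sl that)
    have "\<bar>integral {0..s} (\<lambda>\<sigma>. g r (t + \<sigma>))\<bar> \<le> integral {0..s} (\<lambda>\<sigma>. \<bar>g r (t + \<sigma>)\<bar>)"
      unfolding real_norm_def[symmetric]
      by (intro integral_norm_bound_integral integrable_continuous_real continuous_intros sl2 that) auto
    then show "\<bar>integral {0..s} (\<lambda>\<sigma>. g r (t + \<sigma>))\<bar> \<le> W'"
      using that(4)[of t] integral_backward_window(2)[OF c, of s t] s by simp
    have "\<bar>integral {0..s} (\<lambda>\<sigma>. g r (t - \<sigma>))\<bar> \<le> integral {0..s} (\<lambda>\<sigma>. \<bar>g r (t - \<sigma>)\<bar>)"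
      unfolding real_norm_def[symmetric]
      by (intro integral_norm_bound_integral integrable_continuous_real continuous_intros sl2 that) auto
    then show "\<bar>integral {0..s} (\<lambda>\<sigma>. g r (t - \<sigma>))\<bar> \<le> W'"
      using that(4)[of "t - s"] integral_backward_window(1)[OF c, of s t] s by simp
  qed
  have YP: "\<bar>Y r t - P r t\<bar> \<le> E" if r: "a \<le> r" "r \<le> b" for r t
  proof -
    have "((\<lambda>\<sigma>. F.A2 r (t + \<sigma>) - F.e r (t + \<sigma>)) has_integral (F.X r (t + s) + s) - (F.X r (t + 0) + 0)) {0..s}"
    proof (rule fundamental_theorem_of_calculus)
      fix x assume "x \<in> {0..s}"
      have "((\<lambda>\<sigma>. t + \<sigma>) has_real_derivative 1) (at x within {0..s})"
        by (auto intro!: derivative_eq_intros)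
      from DERIV_add[OF DERIV_chain2[OF F.X_t[OF r] this] DERIV_ident]
      show "((\<lambda>\<sigma>. F.X r (t + \<sigma>) + \<sigma>) has_vector_derivative F.A2 r (t + x) - F.e r (t + x)) (at x within {0..s})"
        by (simp add: real_vector_derivative_iff[symmetric])
    qed (use s in simp)
    then have "integral {0..s} (\<lambda>\<sigma>. F.A2 r (t + \<sigma>) - F.e r (t + \<sigma>)) = Y r t"
      by (simp add: integral_unique Y_def)
    then have "Y r t = P r t - integral {0..s} (\<lambda>\<sigma>. F.e r (t + \<sigma>))"
      unfolding P_def
      by (subst (asm) integral_diff) (auto intro!: integrable_continuous_real sl2 F.form_conts F.lift_conts r)
    moreover have "\<bar>integral {0..s} (\<lambda>\<sigma>. F.e r (t + \<sigma>))\<bar> \<le> F.err"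
      using s by (intro window F.lift_conts r F.e_window_bound) auto
    ultimately show ?thesis using E by (simp add: E_def)
  qed
  have DQ: "\<bar>(D r t - D r (t - s)) - Q r t\<bar> \<le> E" if r: "a \<le> r" "r \<le> b" for r t
  proof -
    have "((\<lambda>\<sigma>. B2 r (t - \<sigma>) - eD r (t - \<sigma>)) has_integral (- D r (t - s)) - (- D r (t - 0))) {0..s}"
    proof (rule fundamental_theorem_of_calculus)
      fix x assume "x \<in> {0..s}"
      have "((\<lambda>\<sigma>. t - \<sigma>) has_real_derivative -1) (at x within {0..s})"
        by (auto intro!: derivative_eq_intros)
      from DERIV_minus[OF DERIV_chain2[OF D_t[OF r] this]]
      show "((\<lambda>\<sigma>. - D r (t - \<sigma>)) has_vector_derivative B2 r (t - x) - eD r (t - x)) (at x within {0..s})"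
        by (simp add: real_vector_derivative_iff[symmetric])
    qed (use s in simp)
    then have "integral {0..s} (\<lambda>\<sigma>. B2 r (t - \<sigma>) - eD r (t - \<sigma>)) = D r t - D r (t - s)"
      by (simp add: integral_unique)
    then have "D r t - D r (t - s) = Q r t - integral {0..s} (\<lambda>\<sigma>. eD r (t - \<sigma>))"
      unfolding Q_def
      by (subst (asm) integral_diff) (auto intro!: integrable_continuous_real sl2 pair_conts r)
    moreover have "\<bar>integral {0..s} (\<lambda>\<sigma>. eD r (t - \<sigma>))\<bar> \<le> E"
    proof -
      have "\<bar>integral {0..s} (\<lambda>\<sigma>. K.e r (t - \<sigma>))\<bar> \<le> K.err" "\<bar>integral {0..s} (\<lambda>\<sigma>. F.e r (t - \<sigma>))\<bar> \<le> F.err"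
        using s by (intro window F.lift_conts K.lift_conts r F.e_window_bound K.e_window_bound; simp)+
      moreover have "integral {0..s} (\<lambda>\<sigma>. eD r (t - \<sigma>)) = integral {0..s} (\<lambda>\<sigma>. K.e r (t - \<sigma>)) - integral {0..s} (\<lambda>\<sigma>. F.e r (t - \<sigma>))"
        unfolding eD_def by (intro integral_diff integrable_continuous_real sl2 K.lift_conts F.lift_conts r)
      ultimately show ?thesis unfolding E_def by linarith
    qed
    ultimately show ?thesis by simp
  qed
  have cont3: "continuous_on (({a..b} \<times> UNIV) \<times> UNIV) (\<lambda>q. B1 (fst (fst q)) (snd (fst q)) * F.A2 (fst (fst q)) (snd (fst q) + 1 * snd q))"
    "continuous_on (({a..b} \<times> UNIV) \<times> UNIV) (\<lambda>q. F.A1 (fst (fst q)) (snd (fst q)) * B2 (fst (fst q)) (snd (fst q) + (-1) * snd q))"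
    by (intro cont_rect_product_shift pair_conts F.form_conts)+
  define M1 M2 where "M1 = (\<lambda>\<sigma>. rect_int a b (\<lambda>r t. B1 r t * F.A2 r (t + \<sigma>)))"
    and "M2 = (\<lambda>\<sigma>. rect_int a b (\<lambda>r t. F.A1 r t * B2 r (t - \<sigma>)))"
  have M2': "M2 \<sigma> = rect_int a b (\<lambda>r t. F.A1 r (t + \<sigma>) * B2 r t)" for \<sigma>
  proof -
    have c: "cont_rect a b (\<lambda>r t. F.A1 r t * B2 r (t - \<sigma>))"
      using cont_rect_shift[OF pair_conts(3), of "- \<sigma>"] by (intro cont_rects F.form_conts) simp
    have p: "F.A1 r (t + 2*pi) * B2 r (t + 2*pi - \<sigma>) = F.A1 r t * B2 r (t - \<sigma>)" for r t
    proof -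
      have "B2 r (t + 2*pi - \<sigma>) = B2 r (t - \<sigma>)"
        using pair_per(3)[of r "t - \<sigma>"] by (simp add: algebra_simps)
      then show ?thesis by (simp add: F.lift_per)
    qed
    show ?thesis using rect_int_shift[OF c p, of \<sigma>] by (simp add: M2_def)
  qed
  have PM: "rect_int a b (\<lambda>r t. B1 r t * P r t) = integral {0..s} M1"
    using rect_int_swap[of a b "\<lambda>r t \<sigma>. B1 r t * F.A2 r (t + \<sigma>)" s] cont3(1)
    by (simp add: P_def M1_def)
  have QM: "rect_int a b (\<lambda>r t. F.A1 r t * Q r t) = integral {0..s} M2"
    using rect_int_swap[of a b "\<lambda>r t \<sigma>. F.A1 r t * B2 r (t - \<sigma>)" s] cont3(2)
    by (simp add: Q_def M2_def)
  have cM: "continuous_on {0..s} M1" "continuous_on {0..s} M2"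
  proof -
    have "continuous_on ({0..s} \<times> cbox (a, 0) (b, 2*pi)) (\<lambda>(\<sigma>, x). B1 (fst x) (snd x) * F.A2 (fst x) (snd x + \<sigma>))"
      unfolding split_beta
      by (rule continuous_on_compose2[OF cont3(1), where f = "\<lambda>q. (snd q, fst q)", simplified])
        (auto intro!: continuous_intros simp: cbox_Pair_eq)
    from integral_continuous_on_param[OF this] show "continuous_on {0..s} M1"
      by (simp add: M1_def rect_int_def)
    have "continuous_on ({0..s} \<times> cbox (a, 0) (b, 2*pi)) (\<lambda>(\<sigma>, x). F.A1 (fst x) (snd x) * B2 (fst x) (snd x - \<sigma>))"
      unfolding split_beta
      by (rule continuous_on_compose2[OF cont3(2), where f = "\<lambda>q. (snd q, fst q)", simplified])
        (auto intro!: continuous_intros simp: cbox_Pair_eq)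
    from integral_continuous_on_param[OF this] show "continuous_on {0..s} M2"
      by (simp add: M2_def rect_int_def)
  qed
  have main: "\<bar>integral {0..s} M1 - integral {0..s} M2\<bar> \<le> s * W"
  proof -
    have "\<bar>M1 \<sigma> - M2 \<sigma>\<bar> \<le> W" if "\<sigma> \<in> {0..s}" for \<sigma>
    proof -
      have "F.spread \<sigma> / \<mu> \<le> \<omega> / \<mu>" using spread[of \<sigma>] that \<mu> by (intro divide_right_mono) auto
      then have "C^2 * (\<mu> * rect_int a b F.speed + F.spread \<sigma> / \<mu>) + C^2 * F.err \<le> W"
        unfolding W_def by (simp add: distrib_left[symmetric] mult_left_mono)
      then show ?thesis using wedge_bound[OF \<mu>, of \<sigma>] unfolding M1_def M2' by linarith
    qed
    then have "norm (integral {0..s} (\<lambda>\<sigma>. M1 \<sigma> - M2 \<sigma>)) \<le> integral {0..s} (\<lambda>\<sigma>. W)"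
      by (intro integral_norm_bound_integral integrable_continuous_real continuous_intros cM) auto
    moreover have "integral {0..s} (\<lambda>\<sigma>. M1 \<sigma> - M2 \<sigma>) = integral {0..s} M1 - integral {0..s} M2"
      by (intro integral_diff integrable_continuous_real cM)
    ultimately show ?thesis using s by simp
  qed
  have cP: "cont_rect a b (\<lambda>r t. B1 r t * P r t)" "cont_rect a b (\<lambda>r t. F.A1 r t * Q r t)"
  proof -
    have "continuous_on (({a..b} \<times> UNIV) \<times> cbox 0 s) (\<lambda>(p, \<sigma>). F.A2 (fst p) (snd p + \<sigma>))"
      unfolding split_beta
      by (rule continuous_on_compose2[OF F.form_conts(2)[unfolded cont_rect_def],
            where f = "\<lambda>q. (fst (fst q), snd (fst q) + snd q)", simplified]) (auto intro!: continuous_intros)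
    from integral_continuous_on_param[OF this] have "cont_rect a b P"
      by (simp add: cont_rect_def P_def)
    then show "cont_rect a b (\<lambda>r t. B1 r t * P r t)" by (intro cont_rects pair_conts)
    have "continuous_on (({a..b} \<times> UNIV) \<times> cbox 0 s) (\<lambda>(p, \<sigma>). B2 (fst p) (snd p - \<sigma>))"
      unfolding split_beta
      by (rule continuous_on_compose2[OF pair_conts(3)[unfolded cont_rect_def],
            where f = "\<lambda>q. (fst (fst q), snd (fst q) - snd q)", simplified]) (auto intro!: continuous_intros)
    from integral_continuous_on_param[OF this] have "cont_rect a b Q"
      by (simp add: cont_rect_def Q_def)
    then show "cont_rect a b (\<lambda>r t. F.A1 r t * Q r t)" by (intro cont_rects F.form_conts)
  qed
  have cDs: "cont_rect a b (\<lambda>r t. D r (t - s))"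
    using cont_rect_shift[OF pair_conts(1), of "- s"] by simp
  define f2 where "f2 = (\<lambda>r t. B1 r t * Y r t - F.A1 r t * (D r t - D r (t - s)))"
  have cf2: "cont_rect a b f2" unfolding f2_def
    by (intro cont_rects F.form_conts pair_conts cY cDs)
  \<comment> \<open>Rotating one term by \<open>s\<close> moves the difference from
    \<open>A1\<close> to \<open>D\<close>; unlike \<open>D\<close> itself, its increments are window
    integrals.\<close>
  have ff2: "rect_int a b f = rect_int a b f2"
  proof -
    have c1: "cont_rect a b (\<lambda>r t. B1 r t * Y r t)" "cont_rect a b (\<lambda>r t. D r t * F.A1 r t)"
      "cont_rect a b (\<lambda>r t. D r t * F.A1 r (t + s))" "cont_rect a b (\<lambda>r t. D r (t - s) * F.A1 r t)"
      by (intro cont_rects F.form_conts pair_conts cY cDs cont_rect_shift)+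
    have p: "D r (t + 2*pi - s) * F.A1 r (t + 2*pi) = D r (t - s) * F.A1 r t" for r t
    proof -
      have "D r (t + 2*pi - s) = D r (t - s)"
        using pair_per(1)[of r "t - s"] by (simp add: algebra_simps)
      then show ?thesis by (simp add: F.lift_per)
    qed
    have sh: "rect_int a b (\<lambda>r t. D r t * F.A1 r (t + s)) = rect_int a b (\<lambda>r t. D r (t - s) * F.A1 r t)"
      using rect_int_shift[OF c1(4) p, of s] by simp
    have "f = (\<lambda>r t. B1 r t * Y r t + D r t * F.A1 r (t + s) - D r t * F.A1 r t)"
      by (auto simp: f_def fun_eq_iff algebra_simps)
    then have "rect_int a b f = rect_int a b (\<lambda>r t. B1 r t * Y r t) + rect_int a b (\<lambda>r t. D r t * F.A1 r (t + s))
        - rect_int a b (\<lambda>r t. D r t * F.A1 r t)"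
      using c1 by (simp add: rect_int_add rect_int_diff cont_rect_arith)
    also have "\<dots> = rect_int a b (\<lambda>r t. B1 r t * Y r t + D r (t - s) * F.A1 r t - D r t * F.A1 r t)"
      using c1 by (simp add: rect_int_add rect_int_diff cont_rect_arith sh)
    also have "(\<lambda>r t. B1 r t * Y r t + D r (t - s) * F.A1 r t - D r t * F.A1 r t) = f2"
      by (auto simp: f2_def fun_eq_iff algebra_simps)
    finally show ?thesis .
  qed
  have err: "\<bar>rect_int a b f2 - (integral {0..s} M1 - integral {0..s} M2)\<bar> \<le> 3 * C * E * (2 * pi * (b - a) + S0)"
  proof -
    define bd where "bd = (\<lambda>r t. 3 * C * E * (1 + F.speed r t))"
    have cb: "cont_rect a b bd" unfolding bd_def by (intro cont_rects F.speed_cont)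
    have pt: "\<bar>f2 r t - (B1 r t * P r t - F.A1 r t * Q r t)\<bar> \<le> bd r t" if r: "a \<le> r" "r \<le> b" for r t
    proof -
      have "f2 r t - (B1 r t * P r t - F.A1 r t * Q r t)
          = B1 r t * (Y r t - P r t) - F.A1 r t * ((D r t - D r (t - s)) - Q r t)"
        by (simp add: f2_def algebra_simps)
      moreover have "\<bar>B1 r t * (Y r t - P r t)\<bar> \<le> 2 * C * cmod (z1 r t) * E"
        unfolding abs_mult using YP[OF r] A_bounds C_nonneg by (intro mult_mono) auto
      moreover have "\<bar>F.A1 r t * ((D r t - D r (t - s)) - Q r t)\<bar> \<le> C * cmod (z1 r t) * E"
        unfolding abs_mult using DQ[OF r] A_bounds C_nonneg by (intro mult_mono) auto
      ultimately have "\<bar>f2 r t - (B1 r t * P r t - F.A1 r t * Q r t)\<bar> \<le> 3 * C * E * cmod (z1 r t)"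
        by (simp add: algebra_simps abs_le_iff)
      also have "cmod (z1 r t) \<le> 1 + F.speed r t"
      proof -
        have "0 \<le> (cmod (z1 r t) - 1)^2" by simp
        then have "2 * cmod (z1 r t) \<le> 1 + (cmod (z1 r t))^2" by (simp add: power2_diff)
        moreover have "0 \<le> (cmod (z2 r t))^2" "0 \<le> cmod (z1 r t)" by simp_all
        ultimately show ?thesis unfolding F.speed_def by linarith
      qed
      finally show ?thesis unfolding bd_def using C_nonneg E by (simp add: mult_left_mono)
    qed
    have "\<bar>rect_int a b (\<lambda>r t. f2 r t - (B1 r t * P r t - F.A1 r t * Q r t))\<bar> \<le> rect_int a b bd"
      by (intro rect_int_abs_le cb pt cont_rect_arith(2) cf2 cP)
    moreover have "rect_int a b bd = 3 * C * E * (2 * pi * (b - a) + S0)"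
      unfolding bd_def rect_int_cmult S0_def using ab
      by (simp add: rect_int_add cont_rect_const F.speed_cont rect_int_const)
    ultimately show ?thesis using cf2 cP by (simp add: rect_int_diff cont_rect_arith PM QM)
  qed
  have "\<bar>rect_int a b f\<bar> \<le> s * W + 3 * C * E * (2 * pi * (b - a) + S0)"
    using err main unfolding ff2 by linarith
  then have "2 * pi * s * \<bar>D b t0\<bar> \<le> 2 * pi * s * E + (s * W + 3 * C * E * (2 * pi * (b - a) + S0))"
    using bnd by linarith
  then have "\<bar>D b t0\<bar> \<le> E + (W + 3 * C * E * (2 * pi * (b - a) + S0) / s) / (2 * pi)"
    using s by (simp add: field_simps)
  also have "(W + 3 * C * E * (2 * pi * (b - a) + S0) / s) / (2 * pi) \<le> W + 3 * C * E * (2 * pi * (b - a) + S0) / s"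
  proof -
    have S: "0 \<le> S0" unfolding S0_def by (rule rect_int_nonneg[OF F.speed_cont]) (simp add: F.speed_def)
    have "0 \<le> F.spread 0" by (simp add: F.spread_def rect_int_def)
    then have "0 \<le> \<omega>" using spread[of 0] s by linarith
    then have W: "0 \<le> W" unfolding W_def using S \<mu> E by (auto simp: S0_def)
    have "0 \<le> 3 * C * E * (2 * pi * (b - a) + S0) / s"
      using C_nonneg E ab S s by (intro divide_nonneg_pos mult_nonneg_nonneg) auto
    then have x: "0 \<le> W + 3 * C * E * (2 * pi * (b - a) + S0) / s" using W by simp
    have "x / (2 * pi) \<le> x" if "0 \<le> x" for x
      using divide_left_mono[of 1 "2 * pi" x] that pi_gt3 by simp
    from this[OF x] show ?thesis .
  qed
  finally show ?thesis unfolding W_def E_def S0_def by simp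
qed

end

section \<open>Weights for the angle form and a smooth tangent length\<close>

lemma DERIV_glue:
  fixes f g :: "real \<Rightarrow> real"
  assumes f: "\<And>x. x \<le> c \<Longrightarrow> (f has_real_derivative f' x) (at x)"
    and g: "\<And>x. c \<le> x \<Longrightarrow> (g has_real_derivative g' x) (at x)"
    and eq: "f c = g c" "f' c = g' c"
  shows "((\<lambda>x. if x \<le> c then f x else g x) has_real_derivative (if x \<le> c then f' x else g' x)) (at x)"
proof (cases x c rule: linorder_cases)
  case less
  then have "(f has_real_derivative (if x \<le> c then f' x else g' x)) (at x)" using f[of x] by simp
  then show ?thesis
    by (rule has_field_derivative_transform_within_open[of _ _ _ "{..<c}"]) (use less in auto)
next
  case greater
  then have "(g has_real_derivative (if x \<le> c then f' x else g' x)) (at x)" using g[of x] by simp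
  then show ?thesis
    by (rule has_field_derivative_transform_within_open[of _ _ _ "{c<..}"]) (use greater in auto)
next
  case equal
  let ?F = "\<lambda>x. if x \<le> c then f x else g x"
  have "(f has_real_derivative f' c) (at c within {..c})"
    using f[of c] by (auto intro: has_field_derivative_at_within)
  then have "(?F has_real_derivative f' c) (at c within {..c})"
    by (rule has_field_derivative_transform_within[OF _ zero_less_one]) auto
  moreover have "(g has_real_derivative f' c) (at c within {c..})"
    using g[of c] eq by (auto intro: has_field_derivative_at_within)
  then have "(?F has_real_derivative f' c) (at c within {c..})"
    by (rule has_field_derivative_transform_within[OF _ zero_less_one]) (use eq in auto)
  ultimately have "(?F has_real_derivative f' c) (at c within ({..c} \<union> {c..}))"
    unfolding has_field_derivative_iff by (simp only: Lim_within_Un)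
  moreover have "{..c} \<union> {c..} = UNIV" by auto
  ultimately show ?thesis using equal by simp
qed

lemma continuous_glue:
  fixes f g :: "real \<Rightarrow> real"
  assumes "continuous_on {..c} f" "continuous_on {c..} g" "f c = g c"
  shows "continuous_on UNIV (\<lambda>x. if x \<le> c then f x else g x)"
proof -
  have "continuous_on ({..c} \<union> {c..}) (\<lambda>x. if x \<le> c then f x else g x)"
    using assms by (intro continuous_on_cases) auto
  moreover have "{..c} \<union> {c..} = UNIV" by auto
  ultimately show ?thesis by simp
qed

text \<open>A \<open>C\<^sup>1\<close> replacement for \<open>1 / max s (a^2)\<close>, which it approaches for large \<open>p\<close>.\<close>

definition wt :: "real \<Rightarrow> nat \<Rightarrow> real \<Rightarrow> real" where
  "wt a p s = (if s \<le> a^2 then (1 + (1 - (s / a^2) ^ p) / p) / a^2 else 1 / s)"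
definition wt' :: "real \<Rightarrow> nat \<Rightarrow> real \<Rightarrow> real" where
  "wt' a p s = (if s \<le> a^2 then - ((s / a^2) ^ (p - 1)) / a ^ 4 else - 1 / s^2)"

lemma wt_derivative:
  assumes "0 < a" "0 < p"
  shows "(wt a p has_real_derivative wt' a p s) (at s)"
  unfolding wt_def[abs_def] wt'_def
proof (rule DERIV_glue)
  show "((\<lambda>s. (1 + (1 - (s / a^2) ^ p) / p) / a^2) has_real_derivative - ((x / a^2) ^ (p - 1)) / a ^ 4) (at x)" for x
    by (rule DERIV_cong[OF DERIV_cdivide[OF DERIV_add[OF DERIV_const DERIV_cdivide[OF DERIV_diff[OF DERIV_const
              DERIV_power[OF DERIV_cdivide[OF DERIV_ident]]]]]]])
      (use assms in \<open>simp add: power4_eq_xxxx power2_eq_square\<close>)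
  show "((\<lambda>s. 1 / s) has_real_derivative - 1 / x^2) (at x)" if "a^2 \<le> x" for x
  proof -
    have "0 < x" using that assms by (meson less_le_trans zero_less_power)
    then show ?thesis by (auto intro!: derivative_eq_intros simp: power2_eq_square)
  qed
qed (use assms in \<open>auto simp: power4_eq_xxxx power2_eq_square\<close>)

lemma wt'_cont:
  assumes "0 < a" "0 < p"
  shows "continuous_on UNIV (wt' a p)"
proof -
  have "continuous_on UNIV (\<lambda>s. if s \<le> a^2 then - ((s / a^2) ^ (p - 1)) / a ^ 4 else - 1 / s^2)"
  proof (rule continuous_glue)
    show "continuous_on {a^2..} (\<lambda>s::real. - 1 / s^2)"
      using assms by (intro continuous_intros) auto
  qed (use assms in \<open>auto intro!: continuous_intros simp: power4_eq_xxxx power2_eq_square\<close>)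
  then show ?thesis by (simp add: wt'_def[abs_def])
qed

lemma wt_out: "0 < a \<Longrightarrow> a^2 \<le> s \<Longrightarrow> wt a p s = 1 / s"
  by (cases "s = a^2") (auto simp: wt_def)

text \<open>The power in \<open>wt\<close> is chosen for this outcome: h + s h' is a multiple of 1 -
  (s / a^2)^p on the disc, hence nonnegative there and zero on the circle, where it joins the closed
  form outside.\<close>

lemma wt_curl:
  assumes "0 < a" "0 < p" "0 \<le> s"
  shows "2 * (wt a p s + s * wt' a p s) = (if s \<le> a^2 then 2 / a^2 * (1 + 1 / p) * (1 - (s / a^2) ^ p) else 0)"
proof (cases "s \<le> a^2")
  case True
  define x where "x = s / a^2"
  have s: "s = a^2 * x" using assms by (simp add: x_def)
  obtain q where q: "p = Suc q" using assms by (cases p) auto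
  have "s * wt' a p s = - (x ^ p) / a^2"
    using True assms unfolding wt'_def x_def[symmetric] by (simp add: q s power4_eq_xxxx power2_eq_square)
  then have "2 * (wt a p s + s * wt' a p s) = 2 * ((1 + (1 - x ^ p) / p) / a^2 - x ^ p / a^2)"
    using True by (simp add: wt_def x_def)
  also have "\<dots> = 2 / a^2 * (1 + 1 / p) * (1 - x ^ p)"
    using assms by (simp add: field_simps)
  finally show ?thesis using True by (simp add: x_def)
next
  case False
  then have "0 < s" using assms by (meson le_less_trans not_le zero_le_power2)
  then show ?thesis using False by (simp add: wt_def wt'_def power2_eq_square)
qed

lemma wt_curl_range:
  assumes "0 < a" "0 < p" "0 \<le> s"
  shows "0 \<le> 2 * (wt a p s + s * wt' a p s)" "2 * (wt a p s + s * wt' a p s) \<le> 4 / a^2"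
proof -
  have p: "1 + 1 / real p \<le> 2" using assms by (simp add: Suc_leI)
  have x: "0 \<le> (s / a^2) ^ p" "s \<le> a^2 \<Longrightarrow> (s / a^2) ^ p \<le> 1"
    using assms by (auto intro: power_le_one)
  show "0 \<le> 2 * (wt a p s + s * wt' a p s)"
    unfolding wt_curl[OF assms] using x by auto
  have "2 / a^2 * (1 + 1 / p) * (1 - (s / a^2) ^ p) \<le> 2 / a^2 * 2 * 1" if "s \<le> a^2"
    using x that p by (intro mult_mono) auto
  then show "2 * (wt a p s + s * wt' a p s) \<le> 4 / a^2"
    unfolding wt_curl[OF assms] by auto
qed

lemma wt_le:
  assumes "0 < a" "0 < p" "0 \<le> s" "s \<le> a^2"
  shows "1 / a^2 \<le> wt a p s" "wt a p s \<le> (1 + 1 / p) / a^2"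
proof -
  have x: "0 \<le> (s / a^2) ^ p" "(s / a^2) ^ p \<le> 1"
    using assms by (auto intro: power_le_one)
  have "0 \<le> (1 - (s / a^2) ^ p) / p" "(1 - (s / a^2) ^ p) / p \<le> 1 / p"
    using x by (auto intro!: divide_right_mono)
  then show "1 / a^2 \<le> wt a p s" "wt a p s \<le> (1 + 1 / p) / a^2"
    using assms by (auto simp: wt_def intro!: divide_right_mono)
qed

lemma wt_bound:
  assumes "0 < a" "0 < p" "0 \<le> s"
  shows "\<bar>wt a p s\<bar> * sqrt s \<le> 2 / a"
proof (cases "s \<le> a^2")
  case True
  have "1 + 1 / real p \<le> 2" using assms by (simp add: Suc_leI)
  then have "(1 + 1 / real p) / a^2 \<le> 2 / a^2" by (simp add: divide_right_mono)
  moreover have "0 \<le> 1 / a^2" by simp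
  ultimately have "\<bar>wt a p s\<bar> \<le> 2 / a^2" using wt_le[OF assms True] by linarith
  moreover have "sqrt s \<le> a" using True assms by (simp add: real_le_lsqrt)
  ultimately have "\<bar>wt a p s\<bar> * sqrt s \<le> 2 / a^2 * a" using assms by (intro mult_mono) auto
  moreover have "2 / a^2 * a = 2 / a" using assms by (simp add: power2_eq_square)
  ultimately show ?thesis by simp
next
  case False
  then have s: "0 < s" using assms by (meson le_less_trans not_le zero_le_power2)
  have "a \<le> sqrt s" using False assms by (simp add: real_le_rsqrt)
  moreover have "\<bar>wt a p s\<bar> * sqrt s = 1 / sqrt s"
    using False s by (simp add: wt_def real_div_sqrt divide_eq_eq)
  moreover have "1 / sqrt s \<le> 1 / a" using calculation(1) assms by (simp add: frac_le)
  moreover have "1 / a \<le> 2 / a" using assms by (simp add: divide_right_mono)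
  ultimately show ?thesis by linarith
qed

text \<open>With x = s / a^2, the difference vanishes for x \<ge> 1 and is at most (1 - x) / s
  between the two circles, while the curl density is at least 2 / a^2 (1 - x) because x^p \<le> x.
  The condition 2 c \<le> a keeps the small disc away from the zero of that density. The extra
  summand 2 / c lets the same constant also bound the weights themselves.\<close>

lemma wt_diff_bound:
  assumes a: "0 < a" and p: "0 < p" and q: "0 < q" and c: "0 < c" "2 * c \<le> a" and s: "0 \<le> s"
  shows "\<bar>wt c q s - wt a p s\<bar> * sqrt s \<le> (2 / c + 2 * a ^ 3 / c^2) * (2 * (wt a p s + s * wt' a p s))"
proof (cases "s \<le> a^2")
  case False
  have "c^2 \<le> a^2" using c a by (intro power_mono) auto
  then have "c^2 \<le> s" "a^2 \<le> s" using False by linarith+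
  then have "wt c q s = wt a p s" using a c by (simp add: wt_out)
  then show ?thesis using wt_curl_range(1)[OF a p s] a c by simp
next
  case True
  define x where "x = s / a^2"
  have sx: "s = a^2 * x" using a by (simp add: x_def)
  have x: "0 \<le> x" "x \<le> 1" using s True a by (auto simp: x_def)
  have curl: "2 / a^2 * (1 - x) \<le> 2 * (wt a p s + s * wt' a p s)"
  proof -
    have "x ^ p \<le> x" using x p power_decreasing[of 1 p x] by simp
    then have "1 * (1 - x) \<le> (1 + 1 / p) * (1 - x ^ p)" using x by (intro mult_mono) auto
    then have "2 / a^2 * (1 - x) \<le> 2 / a^2 * ((1 + 1 / p) * (1 - x ^ p))"
      unfolding mult_1 by (intro mult_left_mono) auto
    also have "\<dots> = 2 * (wt a p s + s * wt' a p s)"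
      by (simp only: wt_curl[OF a p s] True if_True x_def mult.assoc)
    finally show ?thesis .
  qed
  have key: "\<bar>wt c q s - wt a p s\<bar> * sqrt s \<le> 4 * a / c^2 * (1 - x)"
  proof (cases "c^2 \<le> s")
    case c2: True
    have sq: "sqrt s \<le> a" using True a by (simp add: real_le_lsqrt)
    have s0: "0 < s" using c2 c by (meson less_le_trans zero_less_power)
    have "(1 - x ^ p) / p \<le> 1 - x"
    proof -
      have "1 + real p * (x - 1) \<le> (1 + (x - 1)) ^ p" using x by (intro Bernoulli_inequality) auto
      then have "1 - x ^ p \<le> p * (1 - x)" by (simp add: algebra_simps)
      then show ?thesis using p by (simp add: field_simps)
    qed
    then have "1 / a^2 \<le> wt a p s" "wt a p s \<le> (1 + (1 - x)) / a^2"
      using wt_le(1)[OF a p s True] True by (auto simp: wt_def x_def intro!: divide_right_mono)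
    moreover have k: "wt c q s = 1 / s" using c2 c by (simp add: wt_out)
    moreover have "1 / s - 1 / a^2 = (1 - x) / s" using s0 a by (simp add: x_def field_simps)
    moreover have "(1 + (1 - x)) / a^2 \<le> 1 / s"
    proof -
      have "(1 + (1 - x)) * x \<le> 1" using zero_le_power2[of "x - 1"] by (simp add: power2_eq_square algebra_simps)
      then have "(1 + (1 - x)) * x / s \<le> 1 / s" using s0 by (intro divide_right_mono) auto
      moreover have "(1 + (1 - x)) * x / s = (1 + (1 - x)) / a^2" using s0 a by (auto simp: sx)
      ultimately show ?thesis by simp
    qed
    ultimately have "\<bar>wt c q s - wt a p s\<bar> \<le> (1 - x) / s" by (simp add: abs_le_iff)
    also have "\<dots> \<le> (1 - x) / c^2" using c2 c x by (intro divide_left_mono) (auto intro: mult_pos_pos s0)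
    finally have "\<bar>wt c q s - wt a p s\<bar> * sqrt s \<le> (1 - x) / c^2 * a"
      using sq x s by (intro mult_mono) auto
    also have "\<dots> \<le> 4 * a / c^2 * (1 - x)"
    proof -
      have "0 \<le> a / c^2 * (1 - x)" using a x by simp
      moreover have "(1 - x) / c^2 * a = a / c^2 * (1 - x)" "4 * a / c^2 * (1 - x) = 4 * (a / c^2 * (1 - x))"
        by simp_all
      ultimately show ?thesis by linarith
    qed
    finally show ?thesis .
  next
    \<comment> \<open>Here x < 1/4, so 1 - x exceeds 3/4 and the crude bound 3 / c for the two
      weights is enough.\<close>
    case False
    have "\<bar>wt c q s\<bar> * sqrt s \<le> 2 / c" "\<bar>wt a p s\<bar> * sqrt s \<le> 2 / a"
      using wt_bound[OF c(1) q s] wt_bound[OF a p s] by auto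
    moreover have "\<bar>wt c q s - wt a p s\<bar> * sqrt s \<le> (\<bar>wt c q s\<bar> + \<bar>wt a p s\<bar>) * sqrt s"
      using s by (intro mult_right_mono) auto
    ultimately have "\<bar>wt c q s - wt a p s\<bar> * sqrt s \<le> 2 / c + 2 / a" by (simp add: algebra_simps)
    also have "\<dots> \<le> 2 / c + 1 / c" using a c by (simp add: field_simps)
    also have "\<dots> = 3 * c / c^2" using c by (simp add: power2_eq_square field_simps)
    also have "\<dots> \<le> 4 * a / c^2 * (3 / 4)" using a c by (simp add: divide_right_mono)
    also have "\<dots> \<le> 4 * a / c^2 * (1 - x)"
    proof -
      have "4 * c^2 \<le> a^2" using power_mono[OF c(2), of 2] c by (simp add: power_mult_distrib)
      then have "x \<le> 1 / 4" using False a by (simp add: x_def field_simps)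
      then show ?thesis using a c by (intro mult_left_mono) auto
    qed
    finally show ?thesis .
  qed
  have "4 * a / c^2 * (1 - x) = 2 * a ^ 3 / c^2 * (2 / a^2 * (1 - x))"
    using a by (simp add: power2_eq_square power3_eq_cube)
  also have "\<dots> \<le> 2 * a ^ 3 / c^2 * (2 * (wt a p s + s * wt' a p s))"
    using a by (intro mult_left_mono curl) auto
  also have "\<dots> \<le> (2 / c + 2 * a ^ 3 / c^2) * (2 * (wt a p s + s * wt' a p s))"
    using wt_curl_range(1)[OF a p s] c by (intro mult_right_mono) auto
  finally show ?thesis using key by linarith
qed

text \<open>A bounded \<open>C\<^sup>1\<close> replacement for the tangent length \<open>sqrt (s - a^2)\<close> of a point with squared
  modulus \<open>s\<close>; the last two estimates say that the point loses little energy and moves little.\<close>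

lemma tangent_length_exists:
  fixes a b \<delta> :: real
  assumes a: "0 < a" and b: "a < b" and \<delta>: "0 < \<delta>"
  obtains \<Lambda> \<Lambda>' :: "real \<Rightarrow> real" and L where
    "\<And>s. (\<Lambda> has_real_derivative \<Lambda>' s) (at s)" "continuous_on UNIV \<Lambda>'"
    "\<And>s. s \<le> a^2 \<Longrightarrow> \<Lambda> s = 0" "\<And>s. s \<le> a^2 \<Longrightarrow> \<Lambda>' s = 0" "\<And>s. 0 \<le> \<Lambda> s" "\<And>s. \<Lambda> s \<le> L"
    "\<And>s. a^2 \<le> s \<Longrightarrow> a^2 + (\<Lambda> s)^2 \<le> s"
    "\<And>s. a^2 \<le> s \<Longrightarrow> (2 * \<Lambda> s * \<Lambda>' s)^2 * s \<le> (1 + \<delta>) * (a^2 + (\<Lambda> s)^2)"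
    "b^2 - \<delta> \<le> a^2 + (\<Lambda> (b^2))^2"
proof -
  define B where "B = b^2 - a^2"
  have B: "0 < B" using a b by (simp add: B_def power_strict_mono)
  \<comment> \<open>The first entry absorbs the loss 3 \<epsilon> of \<open>f\<close> relative to
    a^2, the second the total loss \<epsilon> B^2 + 3 \<epsilon> at s = b^2.\<close>
  define \<epsilon> where "\<epsilon> = min (\<delta> * a^2 / 3) (\<delta> / (B^2 + 3))"
  have \<epsilon>: "0 < \<epsilon>" "3 * \<epsilon> / a^2 \<le> \<delta>" "\<epsilon> * (B^2 + 3) \<le> \<delta>"
  proof -
    have "0 < B^2 + 3" by (simp add: add_nonneg_pos)
    then show "0 < \<epsilon>" using a \<delta> by (simp add: \<epsilon>_def)
    have "\<epsilon> \<le> \<delta> * a^2 / 3" unfolding \<epsilon>_def by (rule min.cobounded1)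
    then show "3 * \<epsilon> / a^2 \<le> \<delta>" using a by (simp add: field_simps)
    have "\<epsilon> \<le> \<delta> / (B^2 + 3)" unfolding \<epsilon>_def by (rule min.cobounded2)
    then show "\<epsilon> * (B^2 + 3) \<le> \<delta>" using \<open>0 < B^2 + 3\<close> by (simp add: pos_le_divide_eq)
  qed
  \<comment> \<open>\<open>P\<close> makes the argument bounded, and \<open>f\<close> replaces the
    square root by a function of order p^2 at 0, which removes the singularity of the derivative
    there. The identities (sqrt p)^2 = p and 2 sqrt p (sqrt p)' = 1 survive as the bounds
    \<open>f_le\<close> and \<open>ff'\<close>.\<close>
  define P where "P = (\<lambda>w. w / (1 + \<epsilon> * w))"
  define f where "f = (\<lambda>p. p^2 / ((p + \<epsilon>) * sqrt (p + \<epsilon>)))"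
  define f' where "f' = (\<lambda>p. p * (p / 2 + 2 * \<epsilon>) / ((p + \<epsilon>)^2 * sqrt (p + \<epsilon>)))"
  have P: "0 \<le> P w" "P w \<le> w" "P w \<le> 1 / \<epsilon>" if "0 \<le> w" for w
  proof -
    have "0 < 1 + \<epsilon> * w" using that \<epsilon> by (simp add: add_pos_nonneg)
    then show "0 \<le> P w" "P w \<le> w" "P w \<le> 1 / \<epsilon>"
      using that \<epsilon> by (auto simp: P_def divide_simps mult_nonneg_nonneg algebra_simps)
  qed
  have P': "(P has_real_derivative 1 / (1 + \<epsilon> * w)^2) (at w)" if "0 \<le> w" for w
  proof -
    have "0 < 1 + \<epsilon> * w" using that \<epsilon> by (simp add: add_pos_nonneg)
    then show ?thesis unfolding P_def
      by (auto intro!: derivative_eq_intros simp: power2_eq_square algebra_simps)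
  qed
  have f_deriv: "(f has_real_derivative f' p) (at p)" if "0 \<le> p" for p
  proof -
    define S where "S = sqrt (p + \<epsilon>)"
    have p: "0 < p + \<epsilon>" using that \<epsilon> by simp
    then have S: "0 < S" "p + \<epsilon> = S * S" by (auto simp: S_def)
    have "((\<lambda>p. sqrt (p + \<epsilon>)) has_real_derivative inverse S / 2) (at p)"
      using p by (auto intro!: derivative_eq_intros simp: S_def)
    moreover have "((\<lambda>p. p + \<epsilon>) has_real_derivative 1) (at p)"
      by (auto intro!: derivative_eq_intros)
    ultimately have D2: "((\<lambda>p. (p + \<epsilon>) * sqrt (p + \<epsilon>)) has_real_derivative
        1 * sqrt (p + \<epsilon>) + inverse S / 2 * (p + \<epsilon>)) (at p)"
      by (intro DERIV_mult)
    have D1: "((\<lambda>p. p^2) has_real_derivative 2 * p) (at p)"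
      by (auto intro!: derivative_eq_intros)
    have "(2 * p * ((p + \<epsilon>) * sqrt (p + \<epsilon>)) - p^2 * (1 * sqrt (p + \<epsilon>) + inverse S / 2 * (p + \<epsilon>)))
        / ((p + \<epsilon>) * sqrt (p + \<epsilon>) * ((p + \<epsilon>) * sqrt (p + \<epsilon>))) = f' p"
    proof -
      have e: "\<epsilon> = S * S - p" using S by simp
      have "(2 * p * ((S * S) * S) - p^2 * (1 * S + inverse S / 2 * (S * S))) / (((S * S) * S) * ((S * S) * S))
         = p * (p / 2 + 2 * (S * S - p)) / ((S * S)^2 * S)"
        using S(1) by (simp add: field_simps power2_eq_square)
      then show ?thesis unfolding f'_def unfolding S_def[symmetric] unfolding S(2) e by simp
    qed
    moreover have "(p + \<epsilon>) * sqrt (p + \<epsilon>) \<noteq> 0" using p by simp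
    ultimately show ?thesis unfolding f_def using DERIV_divide[OF D1 D2] by simp
  qed
  have f0: "0 \<le> f p" if "0 \<le> p" for p using that \<epsilon> by (simp add: f_def)
  have f_sq: "(f p)^2 = p ^ 4 / (p + \<epsilon>) ^ 3" if "0 \<le> p" for p
  proof -
    define S where "S = sqrt (p + \<epsilon>)"
    have S: "0 < S" "p + \<epsilon> = S * S" using that \<epsilon> by (auto simp: S_def)
    show ?thesis
      unfolding f_def unfolding S_def[symmetric] unfolding S(2) using S(1)
      by (simp add: power_divide power_mult_distrib power3_eq_cube power2_eq_square power4_eq_xxxx)
  qed
  have f_le: "(f p)^2 \<le> p" "p - 3 * \<epsilon> \<le> (f p)^2" if "0 \<le> p" for p
  proof -
    have p: "0 < (p + \<epsilon>) ^ 3" using that \<epsilon> by simp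
    have "p ^ 4 \<le> p * (p + \<epsilon>) ^ 3"
    proof -
      have "p * p ^ 3 \<le> p * (p + \<epsilon>) ^ 3" using that \<epsilon> by (intro mult_left_mono power_mono) auto
      then show ?thesis by (simp add: power4_eq_xxxx power3_eq_cube)
    qed
    then show "(f p)^2 \<le> p" using p by (simp add: f_sq[OF that] divide_le_eq)
    have "p ^ 4 - (p - 3 * \<epsilon>) * (p + \<epsilon>) ^ 3 = 6 * p^2 * \<epsilon>^2 + 8 * p * \<epsilon> ^ 3 + 3 * \<epsilon> ^ 4"
      by algebra
    moreover have "0 \<le> 6 * p^2 * \<epsilon>^2 + 8 * p * \<epsilon> ^ 3 + 3 * \<epsilon> ^ 4" using that \<epsilon> by simp
    ultimately have "(p - 3 * \<epsilon>) * (p + \<epsilon>) ^ 3 \<le> p ^ 4" by linarith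
    then show "p - 3 * \<epsilon> \<le> (f p)^2" using p by (simp add: f_sq[OF that] le_divide_eq)
  qed
  have ff': "0 \<le> 2 * f p * f' p" "2 * f p * f' p \<le> 1" if "0 \<le> p" for p
  proof -
    have p: "0 < p + \<epsilon>" using that \<epsilon> by simp
    define S where "S = sqrt (p + \<epsilon>)"
    have S: "0 < S" "p + \<epsilon> = S * S" using p by (auto simp: S_def)
    have eq: "2 * f p * f' p = p ^ 3 * (p + 4 * \<epsilon>) / (p + \<epsilon>) ^ 4"
    proof -
      have "2 * f p * f' p = 2 * (p^2 / ((S * S) * S)) * (p * (p / 2 + 2 * \<epsilon>) / ((S * S)^2 * S))"
        unfolding f_def f'_def unfolding S_def[symmetric] unfolding S(2) by simp
      also have "\<dots> = p ^ 3 * (p + 4 * \<epsilon>) / (S * S) ^ 4"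
        using S(1) by (simp add: field_simps power2_eq_square power3_eq_cube power4_eq_xxxx)
      finally show ?thesis using S(2) by simp
    qed
    show "0 \<le> 2 * f p * f' p" unfolding eq using that \<epsilon> by simp
    have "(p + \<epsilon>) ^ 4 - p ^ 3 * (p + 4 * \<epsilon>) = 6 * p^2 * \<epsilon>^2 + 4 * p * \<epsilon> ^ 3 + \<epsilon> ^ 4" by algebra
    moreover have "0 \<le> 6 * p^2 * \<epsilon>^2 + 4 * p * \<epsilon> ^ 3 + \<epsilon> ^ 4" using that \<epsilon> by simp
    ultimately have "p ^ 3 * (p + 4 * \<epsilon>) \<le> (p + \<epsilon>) ^ 4" by linarith
    then show "2 * f p * f' p \<le> 1" unfolding eq using p by (simp add: divide_le_eq)
  qed
  define \<Lambda> where "\<Lambda> = (\<lambda>s. if s \<le> a^2 then 0 else f (P (s - a^2)))"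
  define \<Lambda>' where "\<Lambda>' = (\<lambda>s. if s \<le> a^2 then 0 else f' (P (s - a^2)) * (1 / (1 + \<epsilon> * (s - a^2))^2))"
  have z: "P 0 = 0" "f 0 = 0" "f' 0 = 0" by (simp_all add: P_def f_def f'_def)
  have d: "(\<Lambda> has_real_derivative \<Lambda>' s) (at s)" for s
    unfolding \<Lambda>_def \<Lambda>'_def
  proof (rule DERIV_glue)
    show "((\<lambda>s. f (P (s - a^2))) has_real_derivative f' (P (x - a^2)) * (1 / (1 + \<epsilon> * (x - a^2))^2)) (at x)"
      if "a^2 \<le> x" for x
    proof -
      have x: "0 \<le> x - a^2" using that by simp
      have "((\<lambda>s. P (s - a^2)) has_real_derivative 1 / (1 + \<epsilon> * (x - a^2))^2 * 1) (at x)"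
        by (rule DERIV_chain2[where f = P and g = "\<lambda>s. s - a^2", OF P'[OF x]]) (auto intro!: derivative_eq_intros)
      from DERIV_chain2[where f = f and g = "\<lambda>s. P (s - a^2)", OF f_deriv[OF P(1)[OF x]] this] show ?thesis by simp
    qed
  qed (auto simp: z)
  have c: "continuous_on UNIV \<Lambda>'"
    unfolding \<Lambda>'_def
  proof (rule continuous_glue)
    have P: "0 \<le> P (s - a^2)" "0 < 1 + \<epsilon> * (s - a^2)" if "a^2 \<le> s" for s
      using P(1)[of "s - a^2"] that \<epsilon> by (auto intro: add_pos_nonneg)
    then have "0 < P (s - a^2) + \<epsilon>" if "a^2 \<le> s" for s using that \<epsilon> by (simp add: add_nonneg_pos)
    moreover have "continuous_on {a^2..} (\<lambda>s. P (s - a^2))"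
      unfolding P_def using P(2) by (intro continuous_intros) (auto simp: less_imp_neq[THEN not_sym])
    ultimately show "continuous_on {a^2..} (\<lambda>s. f' (P (s - a^2)) * (1 / (1 + \<epsilon> * (s - a^2))^2))"
      unfolding f'_def using P(2)
      by (intro continuous_intros) (auto simp: less_imp_neq[THEN not_sym])
  qed (auto simp: z)
  have le: "(\<Lambda> s)^2 \<le> s - a^2" if "a^2 \<le> s" for s
    using f_le(1)[OF P(1), of "s - a^2"] P(2)[of "s - a^2"] that by (auto simp: \<Lambda>_def)
  have nn: "0 \<le> \<Lambda> s" for s using f0[OF P(1), of "s - a^2"] by (auto simp: \<Lambda>_def)
  have ub: "\<Lambda> s \<le> sqrt (1 / \<epsilon>)" for s
  proof (cases "s \<le> a^2")
    case False
    then have "(\<Lambda> s)^2 \<le> 1 / \<epsilon>"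
      using f_le(1)[OF P(1), of "s - a^2"] P(3)[of "s - a^2"] by (auto simp: \<Lambda>_def)
    then show ?thesis by (rule real_le_rsqrt)
  qed (use \<epsilon> in \<open>simp add: \<Lambda>_def\<close>)
  \<comment> \<open>The derivative of \<open>P\<close> contributes q^-4 after squaring. A single
    factor 1 / q already turns a^2 + w into at most a^2 + p, and the loss 3 \<epsilon> of
    \<open>f\<close> is absorbed by \<delta>.\<close>
  have en: "(2 * \<Lambda> s * \<Lambda>' s)^2 * s \<le> (1 + \<delta>) * (a^2 + (\<Lambda> s)^2)" if s: "a^2 \<le> s" for s
  proof (cases "s = a^2")
    case False
    define w where "w = s - a^2"
    have w: "0 < w" using False s by (simp add: w_def)
    define p where "p = P w"
    define q where "q = 1 + \<epsilon> * w"
    have q: "1 \<le> q" using w \<epsilon> by (simp add: q_def)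
    have p: "0 \<le> p" "p \<le> w" "q * p = w" using P[of w] w q by (auto simp: p_def P_def q_def)
    have L: "\<Lambda> s = f p" "\<Lambda>' s = f' p * (1 / q^2)" using w by (auto simp: \<Lambda>_def \<Lambda>'_def p_def q_def w_def)
    have "(2 * \<Lambda> s * \<Lambda>' s)^2 * s = (2 * f p * f' p)^2 * ((a^2 + w) / q ^ 4)"
      unfolding L by (simp add: w_def power_mult_distrib power_divide)
    also have "\<dots> \<le> 1 * ((a^2 + w) / q)"
    proof (intro mult_mono)
      show "(2 * f p * f' p)^2 \<le> 1" using ff'[OF p(1)] by (simp add: power_le_one)
      have "q ^ 1 \<le> q ^ 4" using q by (intro power_increasing) auto
      then show "(a^2 + w) / q ^ 4 \<le> (a^2 + w) / q" using w q by (intro divide_left_mono) auto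
    qed (use w q in auto)
    also have "\<dots> \<le> a^2 + p"
    proof -
      have "a^2 * 1 \<le> a^2 * q" using q by (intro mult_left_mono) auto
      then have "a^2 + w \<le> (a^2 + p) * q" using p by (simp add: algebra_simps)
      then show ?thesis using q by (simp add: divide_le_eq)
    qed
    also have "\<dots> \<le> a^2 + (f p)^2 + 3 * \<epsilon>" using f_le(2)[OF p(1)] by simp
    also have "\<dots> \<le> (1 + \<delta>) * (a^2 + (f p)^2)"
    proof -
      have "3 * \<epsilon> \<le> \<delta> * a^2" using \<epsilon>(2) a by (simp add: field_simps)
      also have "\<dots> \<le> \<delta> * (a^2 + (f p)^2)" using \<delta> by simp
      finally show ?thesis by (simp add: algebra_simps)
    qed
    finally show ?thesis by (simp add: L)
  qed (use \<delta> in \<open>simp add: \<Lambda>_def\<close>)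
  have fin: "b^2 - \<delta> \<le> a^2 + (\<Lambda> (b^2))^2"
  proof -
    have q: "1 \<le> 1 + \<epsilon> * B" using B \<epsilon> by simp
    have "B - \<epsilon> * B^2 \<le> P B"
    proof -
      have "(B - \<epsilon> * B^2) * (1 + \<epsilon> * B) = B - \<epsilon>^2 * B ^ 3" by algebra
      moreover have "0 \<le> \<epsilon>^2 * B ^ 3" using \<epsilon> B by simp
      ultimately show ?thesis using q by (simp add: P_def pos_le_divide_eq)
    qed
    moreover have "P B - 3 * \<epsilon> \<le> (\<Lambda> (b^2))^2"
      using f_le(2)[OF P(1), of B] B by (simp add: \<Lambda>_def B_def)
    moreover have "\<epsilon> * (B^2 + 3) = \<epsilon> * B^2 + 3 * \<epsilon>" by algebra
    ultimately have "B - \<delta> \<le> (\<Lambda> (b^2))^2" using \<epsilon>(3) by linarith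
    then show ?thesis by (simp add: B_def)
  qed
  show ?thesis
  proof (rule that[OF d c _ _ nn ub _ en fin])
    show "s \<le> a^2 \<Longrightarrow> \<Lambda> s = 0" "s \<le> a^2 \<Longrightarrow> \<Lambda>' s = 0" for s by (auto simp: \<Lambda>_def \<Lambda>'_def)
    show "a^2 \<le> s \<Longrightarrow> a^2 + (\<Lambda> s)^2 \<le> s" for s using le[of s] by simp
  qed
qed

section \<open>Calibration data of a map that may enter the disc\<close>

context polar_map
begin

lemma wt_form: "0 < p \<Longrightarrow> 0 < c \<Longrightarrow> c \<le> a \<Longrightarrow> disc_form a b z z1 z2 z12 (wt c p) (wt' c p) (4 / c^2)"
proof -
  assume c: "0 < p" "0 < c" "c \<le> a"
  then have "c^2 \<le> a^2" by (intro power_mono) auto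
  then have "a^2 \<le> s \<Longrightarrow> c^2 \<le> s" for s by linarith
  with c show ?thesis
    by unfold_locales (rule wt_derivative wt'_cont wt_curl_range wt_out; simp)+
qed

text \<open>Outside the disc the weight gives the exact angular derivative, and \<Lambda> costs at
  most the factor 1 + \<delta>. Inside, \<Lambda> = 0 and the point is treated as lying on the
  circle of radius \<open>a\<close>: its angular speed there is at most (1 + 1/p) |v|, because |y|
  \<le> a and the weight is at most (1 + 1/p) / a^2.\<close>

lemma speed_domination:
  fixes \<Lambda> \<Lambda>' :: "real \<Rightarrow> real" and y v :: complex
  assumes p: "0 < p" and \<kappa>: "1 + \<delta> \<le> \<kappa>" "(1 + 1 / real p)^2 \<le> \<kappa>" and \<delta>: "0 \<le> \<delta>"
    and \<Lambda>: "\<And>s. s \<le> a^2 \<Longrightarrow> \<Lambda> s = 0"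
      "\<And>s. a^2 \<le> s \<Longrightarrow> a^2 + (\<Lambda> s)^2 \<le> s"
      "\<And>s. a^2 \<le> s \<Longrightarrow> (2 * \<Lambda> s * \<Lambda>' s)^2 * s \<le> (1 + \<delta>) * (a^2 + (\<Lambda> s)^2)"
    and n: "n = (cmod y)^2"
  shows "(a^2 + (\<Lambda> n)^2) * (wt a p n * Im (cnj y * v))^2
      + (\<Lambda> n * (\<Lambda>' n * (2 * Re (cnj y * v))))^2 / (a^2 + (\<Lambda> n)^2) \<le> \<kappa> * (cmod v)^2"
proof -
  define R I where "R = Re (cnj y * v)" and "I = Im (cnj y * v)"
  have RI: "R^2 + I^2 = n * (cmod v)^2"
    unfolding R_def I_def n cmod_power2[symmetric] by (simp add: norm_mult power_mult_distrib)
  have n0: "0 \<le> n" by (simp add: n)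
  have \<kappa>0: "1 \<le> \<kappa>" "0 \<le> \<kappa>" using \<kappa> \<delta> by auto
  show ?thesis
  proof (cases "n \<le> a^2")
    case True
    have "(a^2 * (wt a p n)^2) * n \<le> (1 + 1 / p)^2"
    proof -
      have w: "0 \<le> wt a p n" "wt a p n \<le> (1 + 1 / p) / a^2"
        using wt_le[OF a_pos p n0 True] by (auto intro: order_trans[of 0 "1 / a^2"])
      have "(a^2 * (wt a p n)^2) * n \<le> (a^2 * ((1 + 1 / p) / a^2)^2) * a^2"
        using True n0 by (intro mult_mono mult_left_mono power_mono w) auto
      also have "\<dots> = (1 + 1 / p)^2" using a_pos by (simp add: power2_eq_square)
      finally show ?thesis .
    qed
    then have "(a^2 * (wt a p n)^2) * n \<le> \<kappa>" using \<kappa>(2) by linarith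
    then have "(a^2 * (wt a p n)^2) * n * (cmod v)^2 \<le> \<kappa> * (cmod v)^2" by (rule mult_right_mono) simp
    moreover have "(a^2 * (wt a p n)^2) * I^2 \<le> (a^2 * (wt a p n)^2) * (n * (cmod v)^2)"
    proof (intro mult_left_mono)
      show "I^2 \<le> n * (cmod v)^2" using RI zero_le_power2[of R] by linarith
    qed simp
    ultimately show ?thesis
      using \<Lambda>(1)[OF True] unfolding R_def[symmetric] I_def[symmetric] by (simp add: power_mult_distrib mult.assoc)
  next
    case False
    then have na: "a^2 \<le> n" and npos: "0 < n" using a_pos by (auto intro: less_trans[of 0 "a^2"])
    define Q where "Q = a^2 + (\<Lambda> n)^2"
    have Q: "0 < Q" "Q \<le> n" using \<Lambda>(2)[OF na] a_pos by (auto simp: Q_def add_pos_nonneg)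
    have "Q * (wt a p n * I)^2 \<le> n * (wt a p n * I)^2" using Q by (intro mult_right_mono) auto
    also have "\<dots> = I^2 / n" using npos by (simp add: wt_out[OF a_pos na] power2_eq_square)
    also have "\<dots> \<le> \<kappa> * I^2 / n"
      using \<kappa>0 npos by (intro divide_right_mono) (auto simp: mult_le_cancel_right1)
    finally have 1: "Q * (wt a p n * I)^2 \<le> \<kappa> * I^2 / n" .
    have "(\<Lambda> n * (\<Lambda>' n * (2 * R)))^2 / Q = ((2 * \<Lambda> n * \<Lambda>' n)^2 * n) * R^2 / (Q * n)"
      using npos by (simp add: power_mult_distrib)
    also have "\<dots> \<le> ((1 + \<delta>) * Q) * R^2 / (Q * n)"
      using \<Lambda>(3)[OF na] npos Q by (intro divide_right_mono mult_right_mono) (auto simp: Q_def)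
    also have "\<dots> = (1 + \<delta>) * R^2 / n" using Q by simp
    also have "\<dots> \<le> \<kappa> * R^2 / n" using \<kappa> npos by (intro divide_right_mono mult_right_mono) auto
    finally have 2: "(\<Lambda> n * (\<Lambda>' n * (2 * R)))^2 / Q \<le> \<kappa> * R^2 / n" .
    have "\<kappa> * I^2 / n + \<kappa> * R^2 / n = \<kappa> * ((R^2 + I^2) / n)" by (simp add: add_divide_distrib algebra_simps)
    also have "\<dots> = \<kappa> * (cmod v)^2" unfolding RI using npos by simp
    finally show ?thesis using 1 2 unfolding Q_def[symmetric] R_def[symmetric] I_def[symmetric] by linarith
  qed
qed

lemma energy_cont: "cont_rect a b (\<lambda>r t. wsq r (z1 r t) (z2 r t))"
  using a_pos by (intro cont_rects conts) auto

definition energy :: real where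
  "energy = rect_int a b (\<lambda>r t. wsq r (z1 r t) (z2 r t)) / 2"

text \<open>Every map with the right boundary values supplies data for \<open>exterior_lift\<close>
  once its modulus is replaced by sqrt (a^2 + \<Lambda>^2) and its speeds are enlarged by \<kappa>.
  The closing error becomes a multiple of the negative part of the Jacobian.\<close>

lemma energy_lower_bound:
  fixes \<Lambda> \<Lambda>' :: "real \<Rightarrow> real"
  assumes p: "0 < p" and \<kappa>: "1 + \<delta> \<le> \<kappa>" "(1 + 1 / real p)^2 \<le> \<kappa>" and \<delta>: "0 \<le> \<delta>"
    and \<Lambda>: "\<And>s. (\<Lambda> has_real_derivative \<Lambda>' s) (at s)" "continuous_on UNIV \<Lambda>'"
      "\<And>s. s \<le> a^2 \<Longrightarrow> \<Lambda> s = 0" "\<And>s. 0 \<le> \<Lambda> s" "\<And>s. \<Lambda> s \<le> L"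
      "\<And>s. a^2 \<le> s \<Longrightarrow> a^2 + (\<Lambda> s)^2 \<le> s"
      "\<And>s. a^2 \<le> s \<Longrightarrow> (2 * \<Lambda> s * \<Lambda>' s)^2 * s \<le> (1 + \<delta>) * (a^2 + (\<Lambda> s)^2)"
    and k: "a < k" "k < b" and m: "0 \<le> m" and \<eta>: "0 < \<eta>" "\<eta> \<le> 1"
    and X_b: "\<And>t. \<bar>disc_form.X a z z1 (wt a p) b t - \<Psi>\<bar> \<le> \<tau>" and \<tau>: "\<tau> \<le> \<Psi> - m * ln (k / a)"
  shows "\<kappa> * energy
    \<ge> pi * a^2 * (1 + m^2) * ln (k / a)
      - pi * (a * cosh (ln (b / k)) * (a * sinh (ln (b / k))) + a * m * sinh (ln (b / k)) * (a * m * cosh (ln (b / k))))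
      + 2 * pi * (sqrt (a^2 + (\<Lambda> (b^2))^2) * (a * sinh (ln (b / k)) * cos (\<Psi> - m * ln (k / a))
                    + a * m * cosh (ln (b / k)) * sin (\<Psi> - m * ln (k / a))))
      - twist_const a k b m L * (\<eta> + \<tau> + 2 * (b - a) * (4 / a^2) * neg_Jac)"
proof -
  interpret F: disc_form a b z z1 z2 z12 "wt a p" "wt' a p" "4 / a^2"
    using wt_form[OF p a_pos] by simp
  define l where "l = (\<lambda>r t. \<Lambda> ((cmod (z r t))^2))"
  define l1 where "l1 = (\<lambda>r t. \<Lambda>' ((cmod (z r t))^2) * (2 * Re (cnj (z r t) * z1 r t)))"
  define l2 where "l2 = (\<lambda>r t. \<Lambda>' ((cmod (z r t))^2) * (2 * Re (cnj (z r t) * z2 r t)))"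
  define M1 where "M1 = (\<lambda>r t. \<kappa> * (cmod (z1 r t))^2)"
  define M2 where "M2 = (\<lambda>r t. \<kappa> * (cmod (z2 r t))^2)"
  have c\<Lambda>: "continuous_on UNIV \<Lambda>" using \<Lambda>(1) by (meson DERIV_isCont continuous_at_imp_continuous_on)
  note dom = speed_domination[OF p \<kappa> \<delta> \<Lambda>(3) \<Lambda>(6) \<Lambda>(7) refl]
  have L: "0 \<le> L" using \<Lambda>(4)[of 0] \<Lambda>(5)[of 0] by linarith
  have lift: "exterior_lift a a b L F.X F.A1 F.A2 F.e l l1 l2 M1 M2"
  proof
    show "cont_rect a b l" "cont_rect a b l1" "cont_rect a b l2" "cont_rect a b M1" "cont_rect a b M2"
      unfolding l_def l1_def l2_def M1_def M2_def
      by (intro cont_rects conts cont_rect_compose[OF c\<Lambda>] cont_rect_compose[OF \<Lambda>(2)])+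
  next
    fix r t assume r: "a \<le> r" "r \<le> b"
    show "((\<lambda>r. l r t) has_real_derivative l1 r t) (at r within {a..b})"
      unfolding l_def l1_def
      by (rule DERIV_chain2[OF \<Lambda>(1) has_vector_derivative_cmod_square[OF z_r[OF r]]])
    show "((\<lambda>t. l r t) has_real_derivative l2 r t) (at t)"
      unfolding l_def l2_def
      by (rule DERIV_chain2[OF \<Lambda>(1) has_vector_derivative_cmod_square[OF z_t[OF r]]])
    show "((\<lambda>r. F.X r t) has_real_derivative F.A1 r t) (at r within {a..b})"
      "((\<lambda>t. F.X r t) has_real_derivative F.A2 r t - 1 - F.e r t) (at t)"
      using r by (rule F.X_r F.X_t)+
    show "(a^2 + (l r t)^2) * (F.A1 r t)^2 + (l r t * l1 r t)^2 / (a^2 + (l r t)^2) \<le> M1 r t"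
      unfolding l_def l1_def M1_def F.A1_def by (rule dom[of "z r t" "z1 r t"])
    show "(a^2 + (l r t)^2) * (F.A2 r t)^2 + (l r t * l2 r t)^2 / (a^2 + (l r t)^2) \<le> M2 r t"
      unfolding l_def l2_def M2_def F.A2_def by (rule dom[of "z r t" "z2 r t"])
  qed (use a_pos ab \<Lambda>(4,5) in \<open>auto simp: F.lift_conts F.form_conts F.lift_per l_def per\<close>)
  have "pi * a^2 * (1 + m^2) * ln (k / a)
      - pi * (a * cosh (ln (b / k)) * (a * sinh (ln (b / k))) + a * m * sinh (ln (b / k)) * (a * m * cosh (ln (b / k))))
      + 2 * pi * (sqrt (a^2 + (\<Lambda> (b^2))^2) * (a * sinh (ln (b / k)) * cos (\<Psi> - m * ln (k / a))
                    + a * m * cosh (ln (b / k)) * sin (\<Psi> - m * ln (k / a))))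
      - twist_const a k b m L * (\<eta> + \<tau> + rect_int a b (\<lambda>r t. \<bar>F.e r t\<bar>))
    \<le> rect_int a b (\<lambda>r t. r * M1 r t + M2 r t / r) / 2"
  proof (rule twist_lower_bound[OF lift k m _ _ _ X_b \<tau> \<eta>])
    show "F.X a t = 0" for t by (rule F.X_inner)
    show "l a t = 0" for t using a_pos \<Lambda>(3) by (simp add: l_def inner norm_mult)
    show "l b t = \<Lambda> (b^2)" for t using a_pos ab by (simp add: l_def outer norm_mult)
  qed
  also have "rect_int a b (\<lambda>r t. r * M1 r t + M2 r t / r) / 2 = \<kappa> * energy"
  proof -
    have "rect_int a b (\<lambda>r t. r * M1 r t + M2 r t / r)
        = rect_int a b (\<lambda>r t. \<kappa> * (wsq r (z1 r t) (z2 r t)))"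
      by (intro rect_int_cong) (simp add: M1_def M2_def algebra_simps)
    then show ?thesis by (simp add: energy_def rect_int_cmult)
  qed
  finally have main: "pi * a^2 * (1 + m^2) * ln (k / a)
      - pi * (a * cosh (ln (b / k)) * (a * sinh (ln (b / k))) + a * m * sinh (ln (b / k)) * (a * m * cosh (ln (b / k))))
      + 2 * pi * (sqrt (a^2 + (\<Lambda> (b^2))^2) * (a * sinh (ln (b / k)) * cos (\<Psi> - m * ln (k / a))
                    + a * m * cosh (ln (b / k)) * sin (\<Psi> - m * ln (k / a))))
      - twist_const a k b m L * (\<eta> + \<tau> + rect_int a b (\<lambda>r t. \<bar>F.e r t\<bar>)) \<le> \<kappa> * energy" .
  have "rect_int a b (\<lambda>r t. \<bar>F.e r t\<bar>) \<le> (b - a) * (2 * (4 / a^2) * neg_Jac)"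
    using F.rect_int_e_bound mult_left_mono[OF F.err_bound(2), of "b - a"] ab by linarith
  also have "\<dots> = 2 * (b - a) * (4 / a^2) * neg_Jac"
    by (simp only: mult_ac)
  finally have R: "rect_int a b (\<lambda>r t. \<bar>F.e r t\<bar>) \<le> 2 * (b - a) * (4 / a^2) * neg_Jac" .
  have T: "0 \<le> twist_const a k b m L"
  proof -
    have "0 < ln (b / k)" using k a_pos by simp
    then show ?thesis using a_pos k m L unfolding twist_const_def by simp
  qed
  have "twist_const a k b m L * (\<eta> + \<tau> + rect_int a b (\<lambda>r t. \<bar>F.e r t\<bar>))
      \<le> twist_const a k b m L * (\<eta> + \<tau> + 2 * (b - a) * (4 / a^2) * neg_Jac)"
    by (intro mult_left_mono add_left_mono R T)
  then show ?thesis using main by linarith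
qed

end

lemma norm_add3_square:
  fixes x y w :: complex
  shows "(cmod (x + y + w))^2 \<le> 3 * (sq2 x y + (cmod w)^2)"
proof -
  have "cmod (x + y + w) \<le> cmod x + cmod y + cmod w"
    using norm_triangle_ineq[of "x + y" w] norm_triangle_ineq[of x y] by linarith
  then have "(cmod (x + y + w))^2 \<le> (cmod x + cmod y + cmod w)^2" by (intro power_mono) auto
  also have "\<dots> \<le> 3 * (sq2 x y + (cmod w)^2)"
  proof -
    have "0 \<le> (cmod x - cmod y)^2 + (cmod y - cmod w)^2 + (cmod x - cmod w)^2" by simp
    then show ?thesis by (simp add: power2_eq_square algebra_simps)
  qed
  finally show ?thesis .
qed

subsection \<open>The lower bound along a sequence of maps\<close>

locale polar_map_seq =
  fixes a b :: real and z z1 z2 z12 :: "nat \<Rightarrow> real \<Rightarrow> real \<Rightarrow> complex"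
  assumes maps: "\<And>n. polar_map a b (z n) (z1 n) (z2 n) (z12 n)"
    and Cauchy: "\<And>\<epsilon>. 0 < \<epsilon> \<Longrightarrow> \<exists>M. \<forall>m\<ge>M. \<forall>n\<ge>M.
      rect_int a b (\<lambda>r t. sq2 (z1 m r t - z1 n r t) (z2 m r t - z2 n r t)) < \<epsilon>"
    and neg: "(\<lambda>n. polar_map.neg_Jac a b (z1 n) (z2 n)) \<longlonglongrightarrow> 0"
begin

abbreviation dist2 :: "nat \<Rightarrow> nat \<Rightarrow> real" where
  "dist2 m n \<equiv> rect_int a b (\<lambda>r t. sq2 (z1 m r t - z1 n r t) (z2 m r t - z2 n r t))"

lemma ab: "0 < a" "a < b"
  using polar_map.a_pos[OF maps] polar_map.ab[OF maps] by auto

lemma seq_conts: "cont_rect a b (z1 n)" "cont_rect a b (z2 n)"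
  using polar_map.conts[OF maps, of n] by auto

lemma seq_per: "z1 n r (t + 2*pi) = z1 n r t" "z2 n r (t + 2*pi) = z2 n r t"
  using polar_map.per[OF maps] by auto

lemma speed_bounded: "\<exists>S. \<exists>M. \<forall>n\<ge>M. rect_int a b (polar_map.speed (z1 n) (z2 n)) \<le> S"
proof -
  obtain M where M: "\<And>m n. m \<ge> M \<Longrightarrow> n \<ge> M \<Longrightarrow> dist2 m n < 1" using Cauchy[of 1] by auto
  have "rect_int a b (polar_map.speed (z1 n) (z2 n)) \<le> 3 * (1 + rect_int a b (polar_map.speed (z1 M) (z2 M)))"
    if "n \<ge> M" for n
  proof -
    have c: "cont_rect a b (polar_map.speed (z1 n) (z2 n))" for n by (rule polar_map.speed_cont[OF maps])
    have cd: "cont_rect a b (\<lambda>r t. sq2 (z1 n r t - z1 M r t) (z2 n r t - z2 M r t))"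
      by (intro cont_rects seq_conts)
    have "rect_int a b (polar_map.speed (z1 n) (z2 n)) \<le> rect_int a b (\<lambda>r t. 3 *
        ((sq2 (z1 n r t - z1 M r t) (z2 n r t - z2 M r t)) + polar_map.speed (z1 M) (z2 M) r t))"
    proof (rule rect_int_mono[OF c])
      show "cont_rect a b (\<lambda>r t. 3 *
        ((sq2 (z1 n r t - z1 M r t) (z2 n r t - z2 M r t)) + polar_map.speed (z1 M) (z2 M) r t))"
        by (intro cont_rects seq_conts c)
      show "polar_map.speed (z1 n) (z2 n) r t \<le> 3 *
        ((sq2 (z1 n r t - z1 M r t) (z2 n r t - z2 M r t)) + polar_map.speed (z1 M) (z2 M) r t)" for r t
        using norm_add3_square[of "z1 n r t - z1 M r t" "z1 M r t" 0] norm_add3_square[of "z2 n r t - z2 M r t" "z2 M r t" 0]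
        by (simp add: polar_map.speed_def[OF maps])
    qed
    also have "\<dots> = 3 * (dist2 n M + rect_int a b (polar_map.speed (z1 M) (z2 M)))"
      by (simp only: rect_int_cmult rect_int_add[OF cd c])
    also have "\<dots> \<le> 3 * (1 + rect_int a b (polar_map.speed (z1 M) (z2 M)))"
      using M[OF that, of M] by simp
    finally show ?thesis .
  qed
  then show ?thesis by blast
qed

text \<open>One member of the sequence has uniformly continuous derivatives, and all later ones are
  close to it in L2, before and after the rotation; hence one \<sigma>-range serves all of
  them.\<close>

lemma spread_small:
  assumes "0 < \<omega>"
  shows "\<exists>s>0. s \<le> 2*pi \<and> (\<exists>M. \<forall>n\<ge>M. \<forall>\<sigma>. 0 \<le> \<sigma> \<longrightarrow> \<sigma> \<le> s \<longrightarrow> polar_map.spread a b (z1 n) (z2 n) \<sigma> \<le> \<omega>)"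
proof -
  obtain M where M: "\<And>m n. m \<ge> M \<Longrightarrow> n \<ge> M \<Longrightarrow> dist2 m n < \<omega> / 9" using Cauchy[of "\<omega> / 9"] assms by auto
  have uc: "\<exists>d>0. \<forall>r t \<sigma>. a \<le> r \<longrightarrow> r \<le> b \<longrightarrow> 0 \<le> t \<longrightarrow> t \<le> 2*pi \<longrightarrow> 0 \<le> \<sigma> \<longrightarrow> \<sigma> \<le> d \<longrightarrow> cmod (f r (t + \<sigma>) - f r t) < \<epsilon>"
    if f: "cont_rect a b f" and \<epsilon>: "0 < \<epsilon>" for f :: "real \<Rightarrow> real \<Rightarrow> complex" and \<epsilon>
  proof -
    have "uniformly_continuous_on (cbox (a, 0) (b, 4*pi)) (\<lambda>p. f (fst p) (snd p))"
      by (intro compact_uniformly_continuous cont_rect_cbox f compact_cbox)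
    then obtain d where d: "d > 0" "\<And>x x'. x \<in> cbox (a, 0) (b, 4*pi) \<Longrightarrow> x' \<in> cbox (a, 0) (b, 4*pi) \<Longrightarrow>
        dist x' x < d \<Longrightarrow> dist (f (fst x') (snd x')) (f (fst x) (snd x)) < \<epsilon>"
      using \<epsilon> unfolding uniformly_continuous_on_def by metis
    define e where "e = min (d / 2) (2 * pi)"
    have "cmod (f r (t + \<sigma>) - f r t) < \<epsilon>"
      if "a \<le> r" "r \<le> b" "0 \<le> t" "t \<le> 2*pi" "0 \<le> \<sigma>" "\<sigma> \<le> e" for r t \<sigma>
    proof -
      have "\<sigma> < d" "\<sigma> \<le> 2 * pi" using that d by (auto simp: e_def)
      then show ?thesis
        using d(2)[of "(r, t)" "(r, t + \<sigma>)"] that by (auto simp: dist_prod_def dist_norm cbox_Pair_eq)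
    qed
    moreover have "e > 0" using d by (simp add: e_def)
    ultimately show ?thesis by blast
  qed
  \<comment> \<open>Two components, each below c pointwise on a rectangle of area 2 pi (b - a), add
    up to \<omega> / 9. Three terms of that size, with the factor 3 from
    \<open>norm_add3_square\<close>, make \<omega>.\<close>
  define c where "c = \<omega> / (18 * (2 * pi * (b - a)))"
  have c0: "0 < c" using assms ab by (simp add: c_def)
  obtain d1 where d1: "d1 > 0" "\<And>r t \<sigma>. a \<le> r \<Longrightarrow> r \<le> b \<Longrightarrow> 0 \<le> t \<Longrightarrow> t \<le> 2*pi \<Longrightarrow> 0 \<le> \<sigma> \<Longrightarrow> \<sigma> \<le> d1 \<Longrightarrow>
      cmod (z1 M r (t + \<sigma>) - z1 M r t) < sqrt c"
    using uc[OF seq_conts(1), of "sqrt c" M] c0 by auto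
  obtain d2 where d2: "d2 > 0" "\<And>r t \<sigma>. a \<le> r \<Longrightarrow> r \<le> b \<Longrightarrow> 0 \<le> t \<Longrightarrow> t \<le> 2*pi \<Longrightarrow> 0 \<le> \<sigma> \<Longrightarrow> \<sigma> \<le> d2 \<Longrightarrow>
      cmod (z2 M r (t + \<sigma>) - z2 M r t) < sqrt c"
    using uc[OF seq_conts(2), of "sqrt c" M] c0 by auto
  define s where "s = min (min d1 d2) (2*pi)"
  have s: "0 < s" "s \<le> 2*pi" "s \<le> d1" "s \<le> d2" using d1 d2 by (auto simp: s_def)
  have "polar_map.spread a b (z1 n) (z2 n) \<sigma> \<le> \<omega>" if n: "n \<ge> M" and \<sigma>: "0 \<le> \<sigma>" "\<sigma> \<le> s" for n \<sigma>
  proof -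
    define d where "d = (\<lambda>r t. sq2 (z1 n r t - z1 M r t) (z2 n r t - z2 M r t))"
    define g where "g = (\<lambda>r t. sq2 (z1 M r (t + \<sigma>) - z1 M r t) (z2 M r (t + \<sigma>) - z2 M r t))"
    have cd: "cont_rect a b d" "cont_rect a b (\<lambda>r t. d r (t + \<sigma>))" "cont_rect a b g"
    proof -
      show "cont_rect a b d" unfolding d_def by (intro cont_rects seq_conts)
      then show "cont_rect a b (\<lambda>r t. d r (t + \<sigma>))" by (rule cont_rect_shift)
      show "cont_rect a b g" unfolding g_def by (intro cont_rects seq_conts cont_rect_shift)
    qed
    have "polar_map.spread a b (z1 n) (z2 n) \<sigma> \<le> rect_int a b (\<lambda>r t. 3 * (d r (t + \<sigma>) + g r t + d r t))"
      unfolding polar_map.spread_def[OF maps]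
    proof (rule rect_int_mono)
      show "cont_rect a b (\<lambda>r t. sq2 (z1 n r (t + \<sigma>) - z1 n r t) (z2 n r (t + \<sigma>) - z2 n r t))"
        by (intro cont_rects seq_conts cont_rect_shift)
      show "cont_rect a b (\<lambda>r t. 3 * (d r (t + \<sigma>) + g r t + d r t))"
        by (intro cont_rects cd)
      show "sq2 (z1 n r (t + \<sigma>) - z1 n r t) (z2 n r (t + \<sigma>) - z2 n r t)
          \<le> 3 * (d r (t + \<sigma>) + g r t + d r t)" for r t
        using norm_add3_square[of "z1 n r (t + \<sigma>) - z1 M r (t + \<sigma>)" "z1 M r (t + \<sigma>) - z1 M r t" "z1 M r t - z1 n r t"]
          norm_add3_square[of "z2 n r (t + \<sigma>) - z2 M r (t + \<sigma>)" "z2 M r (t + \<sigma>) - z2 M r t" "z2 M r t - z2 n r t"]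
        by (simp add: d_def g_def norm_minus_commute)
    qed
    also have "\<dots> = 3 * (rect_int a b (\<lambda>r t. d r (t + \<sigma>)) + rect_int a b g + rect_int a b d)"
      unfolding rect_int_cmult
      by (subst rect_int_add rect_int_add[OF cd(2,3)]; (intro cont_rects cd)?)+ simp
    also have "rect_int a b (\<lambda>r t. d r (t + \<sigma>)) = rect_int a b d"
      by (rule rect_int_shift[OF cd(1)]) (simp add: d_def seq_per)
    also have "rect_int a b d < \<omega> / 9" using M[OF n, of M] by (simp add: d_def)
    also have "rect_int a b g \<le> \<omega> / 9"
    proof -
      have "rect_int a b g \<le> rect_int a b (\<lambda>r t. 2 * c)"
        unfolding rect_int_def
      proof (intro integral_le cont_rect_integrable cd cont_rect_const)
        fix x assume "x \<in> cbox (a, 0) (b, 2*pi)"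
        then obtain r t where x: "x = (r, t)" "a \<le> r" "r \<le> b" "0 \<le> t" "t \<le> 2*pi"
          by (cases x) (auto simp: cbox_Pair_eq)
        have "cmod (z1 M r (t + \<sigma>) - z1 M r t) < sqrt c" "cmod (z2 M r (t + \<sigma>) - z2 M r t) < sqrt c"
          using d1(2)[OF x(2-5) \<sigma>(1)] d2(2)[OF x(2-5) \<sigma>(1)] \<sigma> s by auto
        then have "(cmod (z1 M r (t + \<sigma>) - z1 M r t))^2 \<le> (sqrt c)^2" "(cmod (z2 M r (t + \<sigma>) - z2 M r t))^2 \<le> (sqrt c)^2"
          by (auto intro!: power_mono)
        then show "g (fst x) (snd x) \<le> 2 * c" using c0 by (simp add: g_def x)
      qed
      also have "\<dots> = \<omega> / 9"
      proof -
        have "w \<noteq> 0 \<Longrightarrow> w * (2 * (\<omega> / (18 * w))) = \<omega> / 9" for w :: real by simp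
        from this[of "2 * pi * (b - a)"] show ?thesis using ab by (simp only: rect_int_const c_def) simp
      qed
      finally show ?thesis .
    qed
    finally show ?thesis by simp
  qed
  then show ?thesis using s by blast
qed

lemma err_small:
  assumes "0 < \<epsilon>"
  shows "\<exists>M. \<forall>n\<ge>M. polar_map.neg_Jac a b (z1 n) (z2 n) < \<epsilon>"
  using LIMSEQ_D[OF neg assms] by (auto simp: abs_less_iff)

text \<open>The winding number fixes the increment of the angle for the cut-off radius
  \<open>c\<close>, whose disc the ray avoids, whereas the calibration needs the radius
  \<open>a\<close>. \<open>D_outer_bound\<close> transfers the value at the angle \<open>t0\<close>,
  and the small oscillation on the outer circle spreads it to all angles.\<close>

lemma lifted_angle_limit:
  assumes p: "0 < p" and c: "0 < c" "2 * c \<le> a"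
    and ray: "\<exists>M. \<forall>n\<ge>M. disc_form.X a (z n) (z1 n) (wt c 1) b t0 = \<Psi>" and \<tau>: "0 < \<tau>"
  shows "\<exists>M. \<forall>n\<ge>M. \<forall>t. \<bar>disc_form.X a (z n) (z1 n) (wt a p) b t - \<Psi>\<bar> \<le> \<tau>"
proof -
  have ca: "c \<le> a" using c by simp
  define C where "C = 2 / c + 2 * a ^ 3 / c^2"
  have C: "2 / a \<le> C" "2 / c \<le> C" "0 < C"
  proof -
    have "2 / a \<le> 2 / c" using c ca by (intro divide_left_mono) auto
    moreover have "0 \<le> 2 * a ^ 3 / c^2" "0 < 2 / c" using ab c by auto
    ultimately show "2 / a \<le> C" "2 / c \<le> C" "0 < C" unfolding C_def by linarith+
  qed
  have pair: "disc_form_pair a b (z n) (z1 n) (z2 n) (z12 n) (wt a p) (wt' a p) (4 / a^2) (wt c 1) (wt' c 1) (4 / c^2) C" for n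
  proof -
    interpret polar_map a b "z n" "z1 n" "z2 n" "z12 n" by (rule maps)
    show ?thesis
    proof (intro disc_form_pair.intro wt_form disc_form_pair_axioms.intro)
      fix s :: real assume s: "0 \<le> s"
      show "\<bar>wt a p s\<bar> * sqrt s \<le> C" using wt_bound[OF a_pos p s] C by linarith
      show "\<bar>wt c 1 s\<bar> * sqrt s \<le> C" using wt_bound[OF c(1) _ s, of 1] C by simp
      show "\<bar>wt c 1 s - wt a p s\<bar> * sqrt s \<le> C * (2 * (wt a p s + s * wt' a p s))"
        unfolding C_def by (rule wt_diff_bound[OF a_pos p _ c s]) simp
    qed (use a_pos ab c ca p in auto)
  qed
  obtain S M0 where S: "\<And>n. n \<ge> M0 \<Longrightarrow> rect_int a b (polar_map.speed (z1 n) (z2 n)) \<le> S"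
    using speed_bounded by blast
  have S0: "0 \<le> S"
  proof -
    have "0 \<le> rect_int a b (polar_map.speed (z1 M0) (z2 M0))"
      by (intro rect_int_nonneg polar_map.speed_cont[OF maps]) (simp add: polar_map.speed_def[OF maps])
    then show ?thesis using S[of M0] by simp
  qed
  \<comment> \<open>The order of choice matters: \<mu> from the energy bound, \<omega> from \<mu>,
    the window \<open>s\<close> from \<omega> by equicontinuity, and only then the size of the
    closing error, which gets divided by \<open>s\<close>.\<close>
  define \<mu> where "\<mu> = \<tau> / (8 * C^2 * (S + 1))"
  have \<mu>: "0 < \<mu>" "C^2 * (\<mu> * S) \<le> \<tau> / 8"
  proof -
    show "0 < \<mu>" using \<tau> C S0 by (simp add: \<mu>_def)
    have "x \<noteq> 0 \<Longrightarrow> y \<noteq> 0 \<Longrightarrow> x * (\<tau> / (8 * x * y) * S) = \<tau> / 8 * (S / y)" for x y :: real by simp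
    from this[of "C^2" "S + 1"] have "C^2 * (\<mu> * S) = \<tau> / 8 * (S / (S + 1))"
      using C S0 unfolding \<mu>_def by simp
    also have "\<dots> \<le> \<tau> / 8 * 1" using \<tau> S0 by (intro mult_left_mono) auto
    finally show "C^2 * (\<mu> * S) \<le> \<tau> / 8" by simp
  qed
  define \<omega> where "\<omega> = \<tau> * \<mu> / (8 * C^2)"
  have \<omega>: "0 < \<omega>" "C^2 * (\<omega> / \<mu>) = \<tau> / 8" using \<tau> \<mu> C by (auto simp: \<omega>_def)
  obtain s M1 where s: "0 < s" "s \<le> 2*pi"
    and M1: "\<And>n \<sigma>. n \<ge> M1 \<Longrightarrow> 0 \<le> \<sigma> \<Longrightarrow> \<sigma> \<le> s \<Longrightarrow> polar_map.spread a b (z1 n) (z2 n) \<sigma> \<le> \<omega>"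
    using spread_small[OF \<omega>(1)] by blast
  \<comment> \<open>All factors of the closing error in \<open>D_outer_bound\<close>, increased by
    one for the oscillation along the outer circle.\<close>
  define H where "H = 2 + C^2 + 3 * C * (2 * pi * (b - a) + S) / s"
  have H: "2 \<le> H"
    using C S0 s ab by (auto simp: H_def intro!: divide_nonneg_pos mult_nonneg_nonneg add_nonneg_nonneg)
  define \<epsilon> where "\<epsilon> = min (s / 2) (\<tau> / (4 * H))"
  have \<epsilon>: "0 < \<epsilon>" "\<epsilon> \<le> s / 2" "H * \<epsilon> \<le> \<tau> / 4"
  proof -
    show "0 < \<epsilon>" using s \<tau> H by (simp add: \<epsilon>_def)
    show "\<epsilon> \<le> s / 2" by (simp add: \<epsilon>_def)
    have "\<epsilon> \<le> \<tau> / (4 * H)" by (simp add: \<epsilon>_def)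
    then show "H * \<epsilon> \<le> \<tau> / 4" using H by (simp add: field_simps)
  qed
  define q where "q = 2 * (4 / a^2) + 2 * (4 / c^2)"
  have q: "0 < q" using ab c by (simp add: q_def add_pos_pos)
  obtain M2 where M2: "\<And>n. n \<ge> M2 \<Longrightarrow> polar_map.neg_Jac a b (z1 n) (z2 n) < \<epsilon> / q"
    using err_small[of "\<epsilon> / q"] \<epsilon> q by auto
  obtain M3 where M3: "\<And>n. n \<ge> M3 \<Longrightarrow> disc_form.X a (z n) (z1 n) (wt c 1) b t0 = \<Psi>"
    using ray by blast
  define M where "M = max (max M0 M1) (max M2 M3)"
  have "\<bar>disc_form.X a (z n) (z1 n) (wt a p) b t - \<Psi>\<bar> \<le> \<tau>" if n: "n \<ge> M" for n t
  proof -
    interpret disc_form_pair a b "z n" "z1 n" "z2 n" "z12 n" "wt a p" "wt' a p" "4 / a^2" "wt c 1" "wt' c 1" "4 / c^2" C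
      by (rule pair)
    have nM: "n \<ge> M0" "n \<ge> M1" "n \<ge> M2" "n \<ge> M3" using n by (auto simp: M_def)
    define E where "E = F.err + K.err"
    have E: "0 \<le> F.err" "0 \<le> K.err" "E \<le> \<epsilon>"
    proof -
      show "0 \<le> F.err" "0 \<le> K.err" by (rule F.err_bound K.err_bound)+
      have "E \<le> q * F.neg_Jac"
        using F.err_bound(2) K.err_bound(2) by (simp add: E_def q_def algebra_simps)
      also have "\<dots> \<le> q * (\<epsilon> / q)" using M2[OF nM(3)] q by (intro mult_left_mono) auto
      finally show "E \<le> \<epsilon>" using q by simp
    qed
    have "\<bar>D b t0\<bar> \<le> F.err + K.err + C^2 * (\<mu> * rect_int a b F.speed + \<omega> / \<mu> + F.err)
      + 3 * C * (F.err + K.err) * (2 * pi * (b - a) + rect_int a b F.speed) / s"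
    proof (rule D_outer_bound[OF s \<mu>(1)])
      show "F.spread \<sigma> \<le> \<omega>" if "0 \<le> \<sigma>" "\<sigma> \<le> s" for \<sigma> using M1[OF nM(2) that] .
      show "F.err \<le> s" using E \<epsilon> s by (simp add: E_def)
    qed
    also have "\<dots> \<le> E + C^2 * (\<mu> * S + \<omega> / \<mu> + E) + 3 * C * E * (2 * pi * (b - a) + S) / s"
    proof -
      have sp: "rect_int a b F.speed \<le> S" by (rule S[OF nM(1)])
      have "C^2 * (\<mu> * rect_int a b F.speed + \<omega> / \<mu> + F.err) \<le> C^2 * (\<mu> * S + \<omega> / \<mu> + E)"
        using sp \<mu> E by (intro mult_left_mono add_mono) (auto simp: E_def)
      moreover have "3 * C * E * (2 * pi * (b - a) + rect_int a b F.speed) / s \<le> 3 * C * E * (2 * pi * (b - a) + S) / s"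
        using sp C E s by (intro divide_right_mono mult_left_mono add_mono) (auto simp: E_def)
      ultimately show ?thesis unfolding E_def by linarith
    qed
    also have "\<dots> = (C^2 * (\<mu> * S) + C^2 * (\<omega> / \<mu>)) + (H - 1) * E"
      by (simp add: H_def algebra_simps add_divide_distrib diff_divide_distrib)
    also have "\<dots> \<le> (\<tau> / 8 + \<tau> / 8) + (H - 1) * E"
      using \<mu>(2) \<omega>(2) by (intro add_right_mono add_mono) auto
    finally have D: "\<bar>D b t0\<bar> \<le> \<tau> / 4 + (H - 1) * E" by simp
    have "\<bar>F.X b t - F.X b t0\<bar> \<le> F.err" by (rule F.X_outer_oscillation)
    moreover have "K.X b t0 = \<Psi>" using M3[OF nM(4)] .
    ultimately have "\<bar>F.X b t - \<Psi>\<bar> \<le> \<tau> / 4 + (H - 1) * E + E"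
      using D E unfolding D_def E_def by linarith
    also have "\<dots> = \<tau> / 4 + H * E" by (simp add: algebra_simps)
    also have "\<dots> \<le> \<tau> / 4 + H * \<epsilon>" using E H by simp
    also have "\<dots> \<le> \<tau>" using \<epsilon> \<tau> by linarith
    finally show ?thesis .
  qed
  then show ?thesis by blast
qed

text \<open>The assumptions \<open>U\<close> place the end of the harmonic part at modulus
  \<open>b\<close> and angle \<Psi> - m ln (k / a), and then the flux through r = \<open>b\<close>
  is 2 pi B. Subtracting pi B for the energy of the harmonic comparison map leaves pi B, the outer
  energy of the twist. \<theta> is chosen after \<Lambda>, as the error constant depends on the
  bound \<open>L\<close> of \<Lambda>.\<close>

lemma energy_limit_bound:
  assumes k: "a < k" "k < b" and m: "0 < m" and N: "0 < \<Psi> - m * ln (k / a)"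
    and U: "a * cosh (ln (b / k)) = b * cos (\<Psi> - m * ln (k / a))"
      "a * m * sinh (ln (b / k)) = b * sin (\<Psi> - m * ln (k / a))"
    and c: "0 < c" "2 * c \<le> a"
    and ray: "\<exists>M. \<forall>n\<ge>M. disc_form.X a (z n) (z1 n) (wt c 1) b t0 = \<Psi>" and \<epsilon>: "0 < \<epsilon>"
  shows "\<exists>M. \<forall>n\<ge>M. polar_map.energy a b (z1 n) (z2 n)
    \<ge> pi * a^2 * (1 + m^2) * (ln (k / a) + sinh (ln (b / k)) * cosh (ln (b / k))) - \<epsilon>"
proof -
  define T where "T = ln (b / k)"
  have T: "0 < T" using k ab by (simp add: T_def)
  define B where "B = a^2 * (1 + m^2) * (sinh T * cosh T)"
  have B: "0 \<le> B" using T by (simp add: B_def)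
  define E where "E = pi * a^2 * (1 + m^2) * (ln (k / a) + sinh T * cosh T)"
  have E: "0 \<le> E" using T k ab by (simp add: E_def)
  have E_eq: "E = pi * a^2 * (1 + m^2) * ln (k / a) + pi * B"
    by (simp add: E_def B_def algebra_simps)
  define \<tau> where "\<tau> = min (1/2) (\<epsilon> / (4 + E))"
  have \<tau>: "0 < \<tau>" "\<tau> \<le> 1/2" "\<tau> * (4 + E) \<le> \<epsilon>"
  proof -
    show "0 < \<tau>" using \<epsilon> E by (simp add: \<tau>_def)
    show "\<tau> \<le> 1/2" unfolding \<tau>_def by (rule min.cobounded1)
    have "\<tau> \<le> \<epsilon> / (4 + E)" by (simp add: \<tau>_def)
    then show "\<tau> * (4 + E) \<le> \<epsilon>" using E by (simp add: pos_le_divide_eq)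
  qed
  define \<delta> where "\<delta> = min \<tau> (min (b^2) (\<tau> * b^2 / (2 * pi * (B + 1))))"
  have b0: "0 < b" using ab by simp
  have \<delta>: "0 < \<delta>" "\<delta> \<le> \<tau>" "\<delta> \<le> b^2" "2 * pi * B * (\<delta> / b^2) \<le> \<tau>"
  proof -
    show "0 < \<delta>" using \<tau> b0 B by (simp add: \<delta>_def)
    show "\<delta> \<le> \<tau>" "\<delta> \<le> b^2" unfolding \<delta>_def by linarith+
    have "\<delta> \<le> \<tau> * b^2 / (2 * pi * (B + 1))" unfolding \<delta>_def by linarith
    then have "\<delta> / b^2 \<le> \<tau> / (2 * pi * (B + 1))" using b0 by (simp add: field_simps)
    then have "2 * pi * B * (\<delta> / b^2) \<le> 2 * pi * B * (\<tau> / (2 * pi * (B + 1)))"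
      using B by (intro mult_left_mono) auto
    also have "\<dots> = \<tau> * (B / (B + 1))"
    proof -
      have "x \<noteq> 0 \<Longrightarrow> y \<noteq> 0 \<Longrightarrow> x * B * (\<tau> / (x * y)) = \<tau> * (B / y)" for x y :: real by simp
      from this[of "2 * pi" "B + 1"] show ?thesis using B by simp
    qed
    also have "\<dots> \<le> \<tau> * 1" using B \<tau> by (intro mult_left_mono) auto
    finally show "2 * pi * B * (\<delta> / b^2) \<le> \<tau>" by simp
  qed
  obtain p :: nat where p: "0 < p" "3 / \<tau> < real p"
  proof -
    obtain p where "3 / \<tau> < real p" using reals_Archimedean2 by blast
    moreover from this have "0 < p" using \<tau> by (cases p) (auto simp: divide_less_0_iff)
    ultimately show ?thesis using that by blast
  qed
  have p\<tau>: "(1 + 1 / real p)^2 \<le> 1 + \<tau>"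
  proof -
    have x: "0 < 1 / real p" "1 / real p \<le> 1" "3 * (1 / real p) \<le> \<tau>" using p \<tau> by (auto simp: field_simps)
    have "(1 + y)^2 = 1 + 2 * y + y * y" for y :: real by algebra
    then have "(1 + 1 / real p)^2 = 1 + 2 * (1 / real p) + (1 / real p) * (1 / real p)" .
    also have "(1 / real p) * (1 / real p) \<le> 1 / real p * 1" using x by (intro mult_left_mono) auto
    finally show ?thesis using x by simp
  qed
  obtain \<Lambda> \<Lambda>' L where \<Lambda>: "\<And>s. (\<Lambda> has_real_derivative \<Lambda>' s) (at s)" "continuous_on UNIV \<Lambda>'"
      "\<And>s. s \<le> a^2 \<Longrightarrow> \<Lambda> s = 0" "\<And>s. 0 \<le> \<Lambda> s" "\<And>s. \<Lambda> s \<le> L"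
      "\<And>s. a^2 \<le> s \<Longrightarrow> a^2 + (\<Lambda> s)^2 \<le> s"
      "\<And>s. a^2 \<le> s \<Longrightarrow> (2 * \<Lambda> s * \<Lambda>' s)^2 * s \<le> (1 + \<delta>) * (a^2 + (\<Lambda> s)^2)"
    and \<Lambda>b: "b^2 - \<delta> \<le> a^2 + (\<Lambda> (b^2))^2"
    using tangent_length_exists[OF ab \<delta>(1)] by metis
  define Q where "Q = twist_const a k b m L"
  have L: "0 \<le> L" using \<Lambda>(4)[of 0] \<Lambda>(5)[of 0] by linarith
  have Q: "0 \<le> Q"
  proof -
    have "0 < ln (b / k)" using T by (simp add: T_def)
    then show ?thesis using ab k m L unfolding Q_def twist_const_def by simp
  qed
  define \<theta> where "\<theta> = min (min 1 (\<Psi> - m * ln (k / a))) (\<tau> / (3 * (Q + 1)))"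
  have \<theta>: "0 < \<theta>" "\<theta> \<le> 1" "\<theta> \<le> \<Psi> - m * ln (k / a)" "Q * (3 * \<theta>) \<le> \<tau>"
  proof -
    show "0 < \<theta>" using N \<tau> Q by (simp add: \<theta>_def)
    show "\<theta> \<le> 1" "\<theta> \<le> \<Psi> - m * ln (k / a)" unfolding \<theta>_def by linarith+
    have "\<theta> \<le> \<tau> / (3 * (Q + 1))" unfolding \<theta>_def by linarith
    then have "Q * (3 * \<theta>) \<le> Q * (3 * (\<tau> / (3 * (Q + 1))))" using Q by (intro mult_left_mono) auto
    also have "\<dots> = \<tau> * (Q / (Q + 1))" using Q by (simp add: field_simps)
    also have "\<dots> \<le> \<tau> * 1" using Q \<tau> by (intro mult_left_mono) auto
    finally show "Q * (3 * \<theta>) \<le> \<tau>" by simp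
  qed
  obtain M1 where M1: "\<And>n t. n \<ge> M1 \<Longrightarrow> \<bar>disc_form.X a (z n) (z1 n) (wt a p) b t - \<Psi>\<bar> \<le> \<theta>"
    using lifted_angle_limit[OF p(1) c ray \<theta>(1)] by blast
  define g where "g = 2 * (b - a) * (4 / a^2)"
  have g: "0 < g" using ab by (simp add: g_def)
  obtain M2 where M2: "\<And>n. n \<ge> M2 \<Longrightarrow> polar_map.neg_Jac a b (z1 n) (z2 n) < \<theta> / g"
    using err_small[of "\<theta> / g"] \<theta> g by auto
  have "E - \<epsilon> \<le> polar_map.energy a b (z1 n) (z2 n)" if n: "n \<ge> max M1 M2" for n
  proof -
    interpret polar_map a b "z n" "z1 n" "z2 n" "z12 n" by (rule maps)
    have low: "pi * a^2 * (1 + m^2) * ln (k / a)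
      - pi * (a * cosh T * (a * sinh T) + a * m * sinh T * (a * m * cosh T))
      + 2 * pi * (sqrt (a^2 + (\<Lambda> (b^2))^2) * (a * sinh T * cos (\<Psi> - m * ln (k / a))
                    + a * m * cosh T * sin (\<Psi> - m * ln (k / a))))
      - Q * (\<theta> + \<theta> + g * neg_Jac) \<le> (1 + \<tau>) * energy"
      unfolding T_def Q_def g_def
      by (rule energy_lower_bound[OF p(1) _ p\<tau> _ \<Lambda> k _ \<theta>(1,2) M1 \<theta>(3)]) (use \<delta> m n in auto)
    have "g * neg_Jac \<le> g * (\<theta> / g)" using M2[of n] n g by (intro mult_left_mono) auto
    then have "Q * (\<theta> + \<theta> + g * neg_Jac) \<le> Q * (3 * \<theta>)" using g Q by (intro mult_left_mono) auto
    then have 1: "Q * (\<theta> + \<theta> + g * neg_Jac) \<le> \<tau>" using \<theta>(4) by linarith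
    have 2: "a * cosh T * (a * sinh T) + a * m * sinh T * (a * m * cosh T) = B"
      by (simp add: B_def power2_eq_square algebra_simps)
    have 3: "a * sinh T * cos (\<Psi> - m * ln (k / a)) + a * m * cosh T * sin (\<Psi> - m * ln (k / a)) = B / b"
    proof -
      have "cos (\<Psi> - m * ln (k / a)) = a * cosh T / b" "sin (\<Psi> - m * ln (k / a)) = a * m * sinh T / b"
        using U b0 by (auto simp: T_def field_simps)
      then show ?thesis unfolding 2[symmetric] using b0 by (simp add: add_divide_distrib algebra_simps)
    qed
    have "1 - \<delta> / b^2 \<le> sqrt (a^2 + (\<Lambda> (b^2))^2) / b"
    proof -
      have d: "0 \<le> 1 - \<delta> / b^2" "1 - \<delta> / b^2 \<le> 1" using \<delta> b0 by (auto simp: field_simps)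
      have "(b * y)^2 \<le> b^2 * y" if "0 \<le> y" "y \<le> 1" for y
      proof -
        have "b^2 * (y * y) \<le> b^2 * (y * 1)" using that by (intro mult_left_mono) auto
        moreover have "(b * y)^2 = b^2 * (y * y)" by algebra
        ultimately show ?thesis by simp
      qed
      from this[OF d] have "(b * (1 - \<delta> / b^2))^2 \<le> b^2 * (1 - \<delta> / b^2)" .
      also have "\<dots> = b^2 - \<delta>" using b0 by (simp add: field_simps)
      finally have "(b * (1 - \<delta> / b^2))^2 \<le> a^2 + (\<Lambda> (b^2))^2" using \<Lambda>b by linarith
      then have "b * (1 - \<delta> / b^2) \<le> sqrt (a^2 + (\<Lambda> (b^2))^2)" by (rule real_le_rsqrt)
      then show ?thesis using b0 by (simp add: pos_le_divide_eq mult.commute)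
    qed
    then have "2 * pi * B * (1 - \<delta> / b^2) \<le> 2 * pi * B * (sqrt (a^2 + (\<Lambda> (b^2))^2) / b)"
      using B by (intro mult_left_mono) auto
    then have "2 * pi * B - \<tau> \<le> 2 * pi * (sqrt (a^2 + (\<Lambda> (b^2))^2) * (B / b))"
      using \<delta>(4) by (simp add: algebra_simps)
    then have "E - 2 * \<tau> \<le> (1 + \<tau>) * energy"
      using low 1 unfolding 2 3 E_eq by linarith
    moreover have "(E - 2 * \<tau>) - \<tau> * E \<le> energy" if "E - 2 * \<tau> \<le> (1 + \<tau>) * energy"
    proof (cases "energy \<le> E")
      case True
      then have "\<tau> * energy \<le> \<tau> * E" using \<tau> by (intro mult_left_mono) auto
      then show ?thesis using that by (simp add: algebra_simps)
    next
      case False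
      moreover have "0 \<le> \<tau> * E" using \<tau> E by simp
      ultimately show ?thesis using \<tau> by linarith
    qed
    moreover have "2 * \<tau> + \<tau> * E \<le> \<epsilon>" using \<tau> by (simp add: algebra_simps)
    ultimately show ?thesis by linarith
  qed
  then show ?thesis unfolding E_def T_def by blast
qed

end

subsection \<open>Smooth maps in polar coordinates\<close>

abbreviation pd :: "2 \<Rightarrow> (real^2 \<Rightarrow> real) \<Rightarrow> real^2 \<Rightarrow> real" where
  "pd j f x \<equiv> frechet_derivative f (at x) (axis j 1)"

lemma smooth_pd: "smooth f \<Longrightarrow> smooth (pd j f)"
  unfolding smooth_def using Ck.simps(2) by blast

lemma smooth_frechet:
  assumes "smooth f"
  shows "(f has_derivative frechet_derivative f (at x)) (at x)"
proof -
  have "f differentiable (at x)" using assms unfolding smooth_def by (metis Ck.simps(2))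
  then show ?thesis by (simp add: frechet_derivative_works)
qed

lemma smooth_has_derivative:
  assumes "smooth f"
  shows "(f has_derivative (\<lambda>h. h $ 1 * pd 1 f x + h $ 2 * pd 2 f x)) (at x)"
proof -
  note d = smooth_frechet[OF assms, of x]
  then interpret bounded_linear "frechet_derivative f (at x)" by (rule has_derivative_bounded_linear)
  have "frechet_derivative f (at x) h = h $ 1 * pd 1 f x + h $ 2 * pd 2 f x" for h
  proof -
    have "h = h $ 1 *\<^sub>R axis 1 1 + h $ 2 *\<^sub>R axis 2 1"
      by (simp add: vec_eq_iff forall_2 axis_def)
    then have "frechet_derivative f (at x) h = frechet_derivative f (at x) (h $ 1 *\<^sub>R axis 1 1 + h $ 2 *\<^sub>R axis 2 1)"
      by simp
    then show ?thesis by (simp add: add scaleR)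
  qed
  then show ?thesis by (intro has_derivative_eq_rhs[OF d] ext)
qed

lemma smooth_continuous: "smooth f \<Longrightarrow> continuous_on S f"
  using smooth_has_derivative
  by (meson continuous_at_imp_continuous_on differentiable_imp_continuous_within differentiableI)

lemma polar_continuous: "continuous_on S (\<lambda>p. polar (fst p) (snd p))"
proof -
  have "(\<lambda>p. polar (fst p) (snd p)) = (\<lambda>p. (fst p * cos (snd p)) *\<^sub>R axis 1 1 + (fst p * sin (snd p)) *\<^sub>R axis 2 1)"
    by (auto simp: polar_def vec_eq_iff forall_2 axis_def)
  then show ?thesis by (simp only:) (intro continuous_intros)
qed

lemma polar_nth [simp]: "polar r t $ 1 = r * cos t" "polar r t $ 2 = r * sin t"
  by (simp_all add: polar_def)

lemma polar_periodic [simp]: "polar r (t + 2*pi) = polar r t"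
  by (simp add: vec_eq_iff forall_2)

lemma norm_polar [simp]: "norm (polar r t) = \<bar>r\<bar>"
proof -
  have "(norm (polar r t))^2 = (r * cos t)^2 + (r * sin t)^2"
    by (simp add: norm_vec_def L2_set_def sum_2 power2_eq_square)
  also have "\<dots> = r^2 * ((cos t)^2 + (sin t)^2)" by algebra
  finally have "(norm (polar r t))^2 = r^2" by simp
  then show ?thesis by (metis abs_norm_cancel power2_eq_iff abs_eq_iff)
qed

lemma cont_rect_polar:
  assumes "continuous_on UNIV f"
  shows "cont_rect a b (\<lambda>r t. f (polar r t))"
  unfolding cont_rect_def
  by (rule continuous_on_compose2[OF assms polar_continuous]) auto

definition rad :: "(real^2 \<Rightarrow> real) \<Rightarrow> real \<Rightarrow> real \<Rightarrow> real" where
  "rad f r t = cos t * pd 1 f (polar r t) + sin t * pd 2 f (polar r t)"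
definition ang :: "(real^2 \<Rightarrow> real) \<Rightarrow> real \<Rightarrow> real \<Rightarrow> real" where
  "ang f r t = r * (cos t * pd 2 f (polar r t) - sin t * pd 1 f (polar r t))"

lemma polar_derivative:
  "((\<lambda>r. polar r t) has_derivative (\<lambda>h. h *\<^sub>R polar 1 t)) (at r within S)"
  "((\<lambda>t. polar r t) has_derivative (\<lambda>h. h *\<^sub>R vector [- (r * sin t), r * cos t])) (at t within S)"
proof -
  have eq: "polar r t = (r * cos t) *\<^sub>R axis 1 1 + (r * sin t) *\<^sub>R axis 2 1" for r t
    by (auto simp: polar_def vec_eq_iff forall_2 axis_def)
  show "((\<lambda>r. polar r t) has_derivative (\<lambda>h. h *\<^sub>R polar 1 t)) (at r within S)"
    unfolding eq by (auto intro!: derivative_eq_intros simp: algebra_simps)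
  have v: "vector [- (r * sin t), r * cos t] = (- (r * sin t)) *\<^sub>R axis 1 1 + (r * cos t) *\<^sub>R (axis 2 1 :: real^2)"
    by (auto simp: vec_eq_iff forall_2 axis_def)
  show "((\<lambda>t. polar r t) has_derivative (\<lambda>h. h *\<^sub>R vector [- (r * sin t), r * cos t])) (at t within S)"
    unfolding eq v by (auto intro!: derivative_eq_intros simp: algebra_simps)
qed

lemma rad_derivative:
  assumes "smooth f"
  shows "((\<lambda>r. f (polar r t)) has_real_derivative rad f r t) (at r within S)"
proof -
  have "((\<lambda>r. f (polar r t)) has_derivative (\<lambda>h. (h *\<^sub>R polar 1 t) $ 1 * pd 1 f (polar r t) + (h *\<^sub>R polar 1 t) $ 2 * pd 2 f (polar r t)))
      (at r within S)"
    by (rule has_derivative_compose[OF polar_derivative(1) smooth_has_derivative[OF assms]])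
  then show ?thesis
    unfolding has_field_derivative_def rad_def by (rule has_derivative_eq_rhs) (auto simp: algebra_simps)
qed

lemma ang_derivative:
  assumes "smooth f"
  shows "((\<lambda>t. f (polar r t)) has_real_derivative ang f r t) (at t within S)"
proof -
  let ?v = "vector [- (r * sin t), r * cos t] :: real^2"
  have "((\<lambda>t. f (polar r t)) has_derivative (\<lambda>h. (h *\<^sub>R ?v) $ 1 * pd 1 f (polar r t) + (h *\<^sub>R ?v) $ 2 * pd 2 f (polar r t)))
      (at t within S)"
    by (rule has_derivative_compose[OF polar_derivative(2) smooth_has_derivative[OF assms]])
  then show ?thesis
    unfolding has_field_derivative_def ang_def by (rule has_derivative_eq_rhs) (auto simp: algebra_simps)
qed

lemma rad_ang_cont:
  assumes "smooth f"
  shows "cont_rect a b (rad f)" "cont_rect a b (ang f)"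
proof -
  note c = cont_rect_polar[OF smooth_continuous[OF smooth_pd[OF assms]]]
  show "cont_rect a b (rad f)" "cont_rect a b (ang f)"
    unfolding rad_def ang_def by (intro cont_rects c)+
qed

definition rad_ang :: "(real^2 \<Rightarrow> real) \<Rightarrow> real \<Rightarrow> real \<Rightarrow> real" where
  "rad_ang f r t = - sin t * pd 1 f (polar r t) + cos t * ang (pd 1 f) r t
     + (cos t * pd 2 f (polar r t) + sin t * ang (pd 2 f) r t)"
definition rad_rad :: "(real^2 \<Rightarrow> real) \<Rightarrow> real \<Rightarrow> real \<Rightarrow> real" where
  "rad_rad f r t = cos t * rad (pd 1 f) r t + sin t * rad (pd 2 f) r t"
definition ang_ang :: "(real^2 \<Rightarrow> real) \<Rightarrow> real \<Rightarrow> real \<Rightarrow> real" where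
  "ang_ang f r t = r * ((- sin t * pd 2 f (polar r t) + cos t * ang (pd 2 f) r t)
     - (cos t * pd 1 f (polar r t) + sin t * ang (pd 1 f) r t))"

lemma second_derivatives:
  assumes "smooth f"
  shows "((\<lambda>t. rad f r t) has_real_derivative rad_ang f r t) (at t)"
    "((\<lambda>r. rad f r t) has_real_derivative rad_rad f r t) (at r within S)"
    "((\<lambda>t. ang f r t) has_real_derivative ang_ang f r t) (at t)"
proof -
  note A = ang_derivative[OF smooth_pd[OF assms]] and R = rad_derivative[OF smooth_pd[OF assms]]
  show "((\<lambda>t. rad f r t) has_real_derivative rad_ang f r t) (at t)"
    unfolding rad_def[of f] rad_ang_def
    by (rule DERIV_cong[OF DERIV_add[OF DERIV_mult[OF DERIV_cos A] DERIV_mult[OF DERIV_sin A]]]) (simp add: algebra_simps)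
  show "((\<lambda>r. rad f r t) has_real_derivative rad_rad f r t) (at r within S)"
    unfolding rad_def[of f] rad_rad_def by (intro DERIV_add DERIV_cmult R)
  show "((\<lambda>t. ang f r t) has_real_derivative ang_ang f r t) (at t)"
    unfolding ang_def[of f] ang_ang_def
    by (rule DERIV_cong[OF DERIV_cmult[OF DERIV_diff[OF DERIV_mult[OF DERIV_cos A] DERIV_mult[OF DERIV_sin A]]]])
      (simp add: algebra_simps)
qed

lemma second_cont:
  assumes "smooth f"
  shows "cont_rect a b (rad_ang f)" "cont_rect a b (rad_rad f)" "cont_rect a b (ang_ang f)"
proof -
  note c = cont_rect_polar[OF smooth_continuous[OF smooth_pd[OF assms]]]
  note ra = rad_ang_cont[OF smooth_pd[OF assms]]
  show "cont_rect a b (rad_ang f)" "cont_rect a b (rad_rad f)" "cont_rect a b (ang_ang f)"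
    unfolding rad_ang_def rad_rad_def ang_ang_def by (intro cont_rects c ra)+
qed

text \<open>Symmetry of the mixed derivatives by integration: f is its value on the inner circle
  plus the radial integral of \<open>rad f\<close>, and differentiating in the angle under the
  integral exhibits \<open>ang f\<close> as a primitive of \<open>rad_ang f\<close>.\<close>

lemma ang_rad_derivative:
  assumes f: "smooth f" and r: "a \<le> r" "r \<le> b"
  shows "((\<lambda>r. ang f r t) has_real_derivative rad_ang f r t) (at r within {a..b})"
proof -
  have eq: "ang f r t = ang f a t + integral {a..r} (\<lambda>\<rho>. rad_ang f \<rho> t)" if r: "a \<le> r" "r \<le> b" for r
  proof -
    have "f (polar r s) = f (polar a s) + integral {a..r} (\<lambda>\<rho>. rad f \<rho> s)" for s
    proof -
      have "((\<lambda>\<rho>. rad f \<rho> s) has_integral f (polar r s) - f (polar a s)) {a..r}"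
        using r by (intro fundamental_theorem_of_calculus)
          (auto simp: real_vector_derivative_iff[symmetric] intro: rad_derivative[OF f])
      then show ?thesis by (simp add: integral_unique)
    qed
    then have "(\<lambda>s. f (polar r s)) = (\<lambda>s. f (polar a s) + integral {a..r} (\<lambda>\<rho>. rad f \<rho> s))" by auto
    moreover have "((\<lambda>s. f (polar a s) + integral {a..r} (\<lambda>\<rho>. rad f \<rho> s)) has_real_derivative
        ang f a t + integral {a..r} (\<lambda>\<rho>. rad_ang f \<rho> t)) (at t)"
      by (intro DERIV_add ang_derivative[OF f]
          primitive_derivative2[OF rad_ang_cont(1)[OF f] second_cont(1)[OF f] r(2)] second_derivatives(1)[OF f])
    ultimately show ?thesis using ang_derivative[OF f, of r t UNIV] by (metis DERIV_unique)
  qed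
  have "((\<lambda>r. ang f a t + integral {a..r} (\<lambda>\<rho>. rad_ang f \<rho> t)) has_real_derivative 0 + rad_ang f r t) (at r within {a..b})"
    by (intro DERIV_add DERIV_const primitive_derivative1 second_cont f r)
  then have "((\<lambda>r. ang f a t + integral {a..r} (\<lambda>\<rho>. rad_ang f \<rho> t)) has_derivative (*) (rad_ang f r t)) (at r within {a..b})"
    by (simp add: has_field_derivative_def)
  then show ?thesis
    unfolding has_field_derivative_def
  proof (rule has_derivative_transform[rotated 2])
    show "r \<in> {a..b}" using r by simp
    show "ang f x t = ang f a t + integral {a..x} (\<lambda>\<rho>. rad_ang f \<rho> t)" if "x \<in> {a..b}" for x
      using that by (intro eq) auto
  qed
qed

lemma rad_ang_speed:
  assumes "0 < r"
  shows "(rad f r t)^2 + (ang f r t)^2 / r^2 = (pd 1 f (polar r t))^2 + (pd 2 f (polar r t))^2"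
proof -
  define x y c s where "x = pd 1 f (polar r t)" and "y = pd 2 f (polar r t)" and "c = cos t" and "s = sin t"
  have cs: "c^2 + s^2 = 1" by (simp add: c_def s_def)
  have "(ang f r t)^2 / r^2 = (c * y - s * x)^2"
    using assms by (simp add: ang_def x_def y_def c_def s_def power_mult_distrib)
  moreover have "rad f r t = c * x + s * y" by (simp add: rad_def x_def y_def c_def s_def)
  moreover have "(c * x + s * y)^2 + (c * y - s * x)^2 = (c^2 + s^2) * (x^2 + y^2)" by algebra
  ultimately show ?thesis by (simp add: cs x_def y_def)
qed

lemma rad_ang_jacobian:
  "rad f r t * ang g r t - rad g r t * ang f r t
    = r * (pd 1 f (polar r t) * pd 2 g (polar r t) - pd 2 f (polar r t) * pd 1 g (polar r t))"
proof -
  define x y u v c s where "x = pd 1 f (polar r t)" and "y = pd 2 f (polar r t)"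
    and "u = pd 1 g (polar r t)" and "v = pd 2 g (polar r t)" and "c = cos t" and "s = sin t"
  have cs: "c^2 + s^2 = 1" by (simp add: c_def s_def)
  have "(c * x + s * y) * (r * (c * v - s * u)) - (c * u + s * v) * (r * (c * y - s * x))
      = r * ((c^2 + s^2) * (x * v - y * u))" by algebra
  then show ?thesis
    unfolding cs by (simp add: rad_def ang_def x_def y_def u_def v_def c_def s_def)
qed

definition cpx :: "(real^2 \<Rightarrow> real^2) \<Rightarrow> real \<Rightarrow> real \<Rightarrow> complex" where
  "cpx w r t = Complex (w (polar r t) $ 1) (w (polar r t) $ 2)"

definition cmb :: "((real^2 \<Rightarrow> real) \<Rightarrow> real \<Rightarrow> real \<Rightarrow> real) \<Rightarrow> (real^2 \<Rightarrow> real^2) \<Rightarrow> real \<Rightarrow> real \<Rightarrow> complex" where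
  "cmb D w r t = Complex (D (\<lambda>x. w x $ 1) r t) (D (\<lambda>x. w x $ 2) r t)"

definition smooth_map :: "(real^2 \<Rightarrow> real^2) \<Rightarrow> bool" where
  "smooth_map w \<longleftrightarrow> (\<forall>i. smooth (\<lambda>x. w x $ i))"

lemma Complex_has_vector_derivative:
  assumes "(f has_real_derivative f') (at x within S)" "(g has_real_derivative g') (at x within S)"
  shows "((\<lambda>x. Complex (f x) (g x)) has_vector_derivative Complex f' g') (at x within S)"
proof -
  have "((\<lambda>x. f x *\<^sub>R 1 + g x *\<^sub>R \<i>) has_vector_derivative f' *\<^sub>R 1 + g' *\<^sub>R \<i>) (at x within S)"
    by (rule has_vector_derivative_eq_rhs[OF has_vector_derivative_add[OF
            has_vector_derivative_scaleR[OF assms(1) has_vector_derivative_const]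
            has_vector_derivative_scaleR[OF assms(2) has_vector_derivative_const]]]) simp
  then show ?thesis by (simp add: complex_eq_iff Complex_eq scaleR_conv_of_real mult.commute)
qed

lemma cont_rect_Complex:
  assumes "cont_rect a b f" "cont_rect a b g"
  shows "cont_rect a b (\<lambda>r t. Complex (f r t) (g r t))"
  using assms unfolding cont_rect_def Complex_eq by (auto intro!: continuous_intros)

lemma cpx_derivatives:
  assumes "smooth_map w"
  shows "((\<lambda>r. cpx w r t) has_vector_derivative cmb rad w r t) (at r within S)"
    "((\<lambda>t. cpx w r t) has_vector_derivative cmb ang w r t) (at t)"
    "((\<lambda>t. cmb rad w r t) has_vector_derivative cmb rad_ang w r t) (at t)"
    "((\<lambda>r. cmb rad w r t) has_vector_derivative cmb rad_rad w r t) (at r within S)"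
    "((\<lambda>t. cmb ang w r t) has_vector_derivative cmb ang_ang w r t) (at t)"
    "a \<le> r \<Longrightarrow> r \<le> b \<Longrightarrow> ((\<lambda>r. cmb ang w r t) has_vector_derivative cmb rad_ang w r t) (at r within {a..b})"
  unfolding cpx_def cmb_def using assms unfolding smooth_map_def
  by (intro Complex_has_vector_derivative rad_derivative ang_derivative second_derivatives ang_rad_derivative; simp)+

lemma cpx_cont:
  assumes "smooth_map w"
  shows "cont_rect a b (cpx w)" "cont_rect a b (cmb rad w)" "cont_rect a b (cmb ang w)"
    "cont_rect a b (cmb rad_ang w)" "cont_rect a b (cmb rad_rad w)" "cont_rect a b (cmb ang_ang w)"
  unfolding cpx_def cmb_def using assms unfolding smooth_map_def
  by (intro cont_rect_Complex cont_rect_polar smooth_continuous rad_ang_cont second_cont; simp)+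

lemma cpx_periodic:
  "cpx w r (t + 2*pi) = cpx w r t" "cmb rad w r (t + 2*pi) = cmb rad w r t"
  "cmb ang w r (t + 2*pi) = cmb ang w r t"
  by (simp_all add: cpx_def cmb_def rad_def ang_def)

lemma jacobian_nth:
  assumes "smooth_map w"
  shows "jacobian w (at x) $ i $ j = pd j (\<lambda>x. w x $ i) x"
proof -
  have "(w has_derivative (\<lambda>h. \<chi> i. h $ 1 * pd 1 (\<lambda>x. w x $ i) x + h $ 2 * pd 2 (\<lambda>x. w x $ i) x)) (at x)"
    unfolding has_derivative_componentwise_within[of w]
  proof
    fix e :: "real^2" assume "e \<in> Basis"
    then obtain i where e: "e = axis i 1" by (auto simp: Basis_vec_def)
    show "((\<lambda>x. w x \<bullet> e) has_derivative (\<lambda>h. (\<chi> i. h $ 1 * pd 1 (\<lambda>x. w x $ i) x + h $ 2 * pd 2 (\<lambda>x. w x $ i) x) \<bullet> e)) (at x)"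
      using smooth_has_derivative[of "\<lambda>x. w x $ i" x] assms unfolding smooth_map_def
      by (simp add: e inner_axis)
  qed
  then have "frechet_derivative w (at x) = (\<lambda>h. \<chi> i. h $ 1 * pd 1 (\<lambda>x. w x $ i) x + h $ 2 * pd 2 (\<lambda>x. w x $ i) x)"
    by (rule frechet_derivative_at[symmetric])
  then have "jacobian w (at x) $ i $ j = (axis j 1 :: real^2) $ 1 * pd 1 (\<lambda>x. w x $ i) x + (axis j 1 :: real^2) $ 2 * pd 2 (\<lambda>x. w x $ i) x"
    by (simp add: jacobian_def matrix_def)
  then show ?thesis using exhaust_2[of j] by (auto simp: axis_def)
qed

lemma norm_matrix_square: "(norm (A :: real^2^2))^2 = (A$1$1)^2 + (A$1$2)^2 + (A$2$1)^2 + (A$2$2)^2"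
  unfolding power2_norm_eq_inner by (simp add: inner_vec_def sum_2 power2_eq_square)

lemma cpx_speed:
  assumes "smooth_map w" "smooth_map w'" "0 < r"
  shows "(cmod (cmb rad w r t - cmb rad w' r t))^2 + (cmod (cmb ang w r t - cmb ang w' r t))^2 / r^2
    = (norm (jacobian w (at (polar r t)) - jacobian w' (at (polar r t))))^2"
proof -
  have sub: "pd j (\<lambda>x. f x - g x) x = pd j f x - pd j g x" if "smooth f" "smooth g" for f g :: "real^2 \<Rightarrow> real" and j x
  proof -
    have "((\<lambda>x. f x - g x) has_derivative (\<lambda>h. frechet_derivative f (at x) h - frechet_derivative g (at x) h)) (at x)"
      using that by (intro has_derivative_diff smooth_frechet)
    from frechet_derivative_at[OF this] show ?thesis by metis
  qed
  define f g where "f = (\<lambda>i x. w x $ i)" and "g = (\<lambda>i x. w' x $ i)"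
  have s: "smooth (f i)" "smooth (g i)" for i using assms by (auto simp: smooth_map_def f_def g_def)
  have ra: "rad (f i) r t - rad (g i) r t = rad (\<lambda>x. f i x - g i x) r t"
    "ang (f i) r t - ang (g i) r t = ang (\<lambda>x. f i x - g i x) r t" for i
    by (simp_all add: rad_def ang_def sub s algebra_simps)
  have "(cmod (cmb rad w r t - cmb rad w' r t))^2 + (cmod (cmb ang w r t - cmb ang w' r t))^2 / r^2
    = ((rad (\<lambda>x. f 1 x - g 1 x) r t)^2 + (ang (\<lambda>x. f 1 x - g 1 x) r t)^2 / r^2)
      + ((rad (\<lambda>x. f 2 x - g 2 x) r t)^2 + (ang (\<lambda>x. f 2 x - g 2 x) r t)^2 / r^2)"
    unfolding ra[symmetric] by (simp add: cmb_def cmod_power2 f_def g_def add_divide_distrib)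
  also have "\<dots> = (norm (jacobian w (at (polar r t)) - jacobian w' (at (polar r t))))^2"
    unfolding rad_ang_speed[OF assms(3)] norm_matrix_square
    by (simp add: jacobian_nth assms sub s) (simp add: f_def g_def)
  finally show ?thesis .
qed

lemma cpx_speed1:
  assumes "smooth_map w" "0 < r"
  shows "(cmod (cmb rad w r t))^2 + (cmod (cmb ang w r t))^2 / r^2 = (norm (jacobian w (at (polar r t))))^2"
proof -
  have "(cmod (cmb rad w r t))^2 + (cmod (cmb ang w r t))^2 / r^2
    = ((rad (\<lambda>x. w x $ 1) r t)^2 + (ang (\<lambda>x. w x $ 1) r t)^2 / r^2)
      + ((rad (\<lambda>x. w x $ 2) r t)^2 + (ang (\<lambda>x. w x $ 2) r t)^2 / r^2)"
    by (simp add: cmb_def cmod_power2 add_divide_distrib)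
  then show ?thesis
    unfolding rad_ang_speed[OF assms(2)] norm_matrix_square by (simp add: jacobian_nth assms)
qed

lemma cpx_det:
  assumes "smooth_map w"
  shows "Im (cnj (cmb rad w r t) * cmb ang w r t) = r * det (jacobian w (at (polar r t)))"
  using rad_ang_jacobian[of "\<lambda>x. w x $ 1" r t "\<lambda>x. w x $ 2"]
  by (simp add: cmb_def det_2 jacobian_nth assms algebra_simps)

section \<open>Integration in polar coordinates\<close>

definition strip :: "real \<Rightarrow> real \<Rightarrow> (real^2) set" where
  "strip a b = {x. a < x $ 1 \<and> x $ 1 < b \<and> 0 < x $ 2 \<and> x $ 2 < 2*pi}"

lemma strip_box: "strip a b = box (vector [a, 0]) (vector [b, 2*pi])"
  by (auto simp: strip_def mem_box_cart forall_2)

lemma polar_vec_derivative: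
  "((\<lambda>x :: real^2. polar (x $ 1) (x $ 2)) has_derivative
     (\<lambda>h. vector [h $ 1 * cos (x $ 2) - h $ 2 * (x $ 1 * sin (x $ 2)), h $ 1 * sin (x $ 2) + h $ 2 * (x $ 1 * cos (x $ 2))]))
   (at (x :: real^2) within S)"
proof -
  have 1: "(\<lambda>x :: real^2. polar (x $ 1) (x $ 2)) = (\<lambda>x. (x $ 1 * cos (x $ 2)) *\<^sub>R axis 1 1 + (x $ 1 * sin (x $ 2)) *\<^sub>R axis 2 1)"
    by (auto simp: polar_def vec_eq_iff forall_2 axis_def)
  have 2: "vector [p, q] = p *\<^sub>R axis 1 1 + q *\<^sub>R (axis 2 1 :: real^2)" for p q
    by (auto simp: vec_eq_iff forall_2 axis_def)
  have n: "((\<lambda>x :: real^2. x $ i) has_derivative (\<lambda>h. h $ i)) (at x within S)" for i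
    by (rule bounded_linear.has_derivative[OF bounded_linear_vec_nth has_derivative_ident])
  show ?thesis
    unfolding 1 2 by (auto intro!: derivative_eq_intros n simp: algebra_simps)
qed

lemma polar_vec_det:
  "det (matrix (\<lambda>h :: real^2. vector [h $ 1 * cos t - h $ 2 * (r * sin t), h $ 1 * sin t + h $ 2 * (r * cos t)] :: real^2)) = r"
proof -
  have "det (matrix (\<lambda>h :: real^2. vector [h $ 1 * cos t - h $ 2 * (r * sin t), h $ 1 * sin t + h $ 2 * (r * cos t)] :: real^2))
    = cos t * (r * cos t) - (- (r * sin t)) * sin t"
    by (simp add: det_2 matrix_def axis_def)
  also have "\<dots> = r * ((cos t)^2 + (sin t)^2)" by algebra
  finally show ?thesis by simp
qed

lemma polar_inj:
  assumes "0 \<le> a"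
  shows "inj_on (\<lambda>x :: real^2. polar (x $ 1) (x $ 2)) (strip a b)"
proof (rule inj_onI)
  fix x y :: "real^2" assume x: "x \<in> strip a b" and y: "y \<in> strip a b" and eq: "polar (x $ 1) (x $ 2) = polar (y $ 1) (y $ 2)"
  have "norm (polar (x $ 1) (x $ 2)) = norm (polar (y $ 1) (y $ 2))" using eq by simp
  then have r: "x $ 1 = y $ 1" "x $ 1 \<noteq> 0" using x y assms by (auto simp: strip_def)
  then have "cos (x $ 2) = cos (y $ 2)" "sin (x $ 2) = sin (y $ 2)"
    using eq by (auto simp: vec_eq_iff forall_2)
  then obtain n :: int where n: "x $ 2 = y $ 2 + 2 * pi * of_int n"
    using sin_cos_eq_iff[of "x $ 2" "y $ 2"] by auto
  have "\<bar>2 * pi * of_int n\<bar> < 2 * pi * 1" proof -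
    have "0 < x $ 2" "x $ 2 < 2 * pi" "0 < y $ 2" "y $ 2 < 2 * pi" using x y by (auto simp: strip_def)
    then show ?thesis using n by arith
  qed
  then have "\<bar>of_int n :: real\<bar> < 1" by (simp add: abs_mult)
  then have "n = 0" by linarith
  then show "x = y" using n r by (simp add: vec_eq_iff forall_2)
qed

lemma polar_image:
  assumes "0 \<le> a"
  shows "(\<lambda>x :: real^2. polar (x $ 1) (x $ 2)) ` strip a b \<subseteq> annulus a b"
    "annulus a b - (\<lambda>x :: real^2. polar (x $ 1) (x $ 2)) ` strip a b \<subseteq> {x :: real^2. x $ 2 = 0}"
proof -
  show "(\<lambda>x :: real^2. polar (x $ 1) (x $ 2)) ` strip a b \<subseteq> annulus a b"
    using assms by (auto simp: annulus_def strip_def)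
  show "annulus a b - (\<lambda>x :: real^2. polar (x $ 1) (x $ 2)) ` strip a b \<subseteq> {x :: real^2. x $ 2 = 0}"
  proof
    fix x :: "real^2" assume x: "x \<in> annulus a b - (\<lambda>x :: real^2. polar (x $ 1) (x $ 2)) ` strip a b"
    define r where "r = norm x"
    have r: "a < r" "r < b" "0 < r" using x assms by (auto simp: annulus_def r_def)
    have r2: "r^2 = (x $ 1)^2 + (x $ 2)^2"
      by (simp add: r_def norm_vec_def L2_set_def sum_2)
    have "(x $ 1 / r)^2 + (x $ 2 / r)^2 = 1"
      using r by (simp add: power_divide add_divide_distrib[symmetric] flip: r2)
    then obtain t where t: "0 \<le> t" "t < 2*pi" "x $ 1 / r = cos t" "x $ 2 / r = sin t"
      by (rule sincos_total_2pi)
    have eq: "x = polar r t" using t r by (simp add: vec_eq_iff forall_2 field_simps)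
    show "x \<in> {x :: real^2. x $ 2 = 0}"
    proof (cases "t = 0")
      case False
      then have "vector [r, t] \<in> strip a b" using r t by (simp add: strip_def)
      then have "polar r t \<in> (\<lambda>x :: real^2. polar (x $ 1) (x $ 2)) ` strip a b"
        by (intro image_eqI[of _ _ "vector [r, t]"]) auto
      then show ?thesis using x eq by auto
    qed (use eq in simp)
  qed
qed

lemma negligible_axis: "negligible {x :: real^2. x $ 2 = 0}"
  using negligible_hyperplane[of "axis 2 1 :: real^2" 0] by (simp add: inner_axis' axis_eq_0_iff)

text \<open>Connects pairs of reals, on which \<open>rect_int\<close> is defined, with the vectors
  on which the change of variables acts.\<close>

lemma has_integral_vector2:
  fixes F :: "real \<times> real \<Rightarrow> real"
  assumes "(F has_integral I) (cbox (p, q) (p', q'))"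
  shows "((\<lambda>x :: real^2. F (x $ 1, x $ 2)) has_integral I) (cbox (vector [p, q]) (vector [p', q']))"
proof -
  have c1: "(\<lambda>x :: real^2. (x $ 1, x $ 2)) ` cbox u v = cbox (u $ 1, u $ 2) (v $ 1, v $ 2)" for u v :: "real^2"
  proof
    show "cbox (u $ 1, u $ 2) (v $ 1, v $ 2) \<subseteq> (\<lambda>x :: real^2. (x $ 1, x $ 2)) ` cbox u v"
    proof
      fix y :: "real \<times> real" assume "y \<in> cbox (u $ 1, u $ 2) (v $ 1, v $ 2)"
      then show "y \<in> (\<lambda>x :: real^2. (x $ 1, x $ 2)) ` cbox u v"
        by (intro image_eqI[of _ _ "vector [fst y, snd y]"]) (auto simp: mem_box_cart forall_2 cbox_Pair_eq)
    qed
  qed (auto simp: mem_box_cart forall_2 cbox_Pair_eq)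
  have c2: "(\<lambda>y. vector [fst y, snd y] :: real^2) ` cbox (u1, u2) (v1, v2) = cbox (vector [u1, u2]) (vector [v1, v2])"
    for u1 u2 v1 v2 :: real
  proof
    show "cbox (vector [u1, u2]) (vector [v1, v2]) \<subseteq> (\<lambda>y. vector [fst y, snd y] :: real^2) ` cbox (u1, u2) (v1, v2)"
    proof
      fix x :: "real^2" assume "x \<in> cbox (vector [u1, u2]) (vector [v1, v2])"
      then show "x \<in> (\<lambda>y. vector [fst y, snd y] :: real^2) ` cbox (u1, u2) (v1, v2)"
        by (intro image_eqI[of _ _ "(x $ 1, x $ 2)"]) (auto simp: vec_eq_iff mem_box_cart forall_2 cbox_Pair_eq)
    qed
  qed (auto simp: mem_box_cart forall_2 cbox_Pair_eq)
  have "((\<lambda>x :: real^2. F (x $ 1, x $ 2)) has_integral (1 / 1) *\<^sub>R I) ((\<lambda>y. vector [fst y, snd y]) ` cbox (p, q) (p', q'))"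
  proof (rule has_integral_twiddle[OF _ _ _ _ _ _ _ assms])
    show "measure lborel ((\<lambda>x :: real^2. (x $ 1, x $ 2)) ` cbox u v) = 1 * measure lborel (cbox u v)" for u v :: "real^2"
    proof (cases "cbox u v = {}")
      case False
      then have "u $ 1 \<le> v $ 1" "u $ 2 \<le> v $ 2" by (auto simp: interval_ne_empty_cart forall_2)
      then show ?thesis using False unfolding c1 by (simp add: content_Pair content_cbox_cart prod_2 UNIV_2)
    qed simp
    show "\<exists>w z. (\<lambda>x :: real^2. (x $ 1, x $ 2)) ` cbox u v = cbox w z" for u v :: "real^2" using c1 by blast
    show "\<exists>w z. (\<lambda>y. vector [fst y, snd y] :: real^2) ` cbox u v = cbox w z" for u v :: "real \<times> real" using c2[of "fst u" "snd u" "fst v" "snd v"] by auto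
  qed (auto simp: vec_eq_iff forall_2 intro!: continuous_intros)
  then show ?thesis unfolding c2 by simp
qed

lemma polar_change_of_variables:
  fixes f :: "real^2 \<Rightarrow> real"
  assumes a: "0 \<le> a"
  shows "(\<lambda>x :: real^2. x $ 1 * f (polar (x $ 1) (x $ 2))) absolutely_integrable_on strip a b \<and>
      integral (strip a b) (\<lambda>x :: real^2. x $ 1 * f (polar (x $ 1) (x $ 2))) = c
    \<longleftrightarrow> f absolutely_integrable_on ((\<lambda>x :: real^2. polar (x $ 1) (x $ 2)) ` strip a b) \<and>
      integral ((\<lambda>x :: real^2. polar (x $ 1) (x $ 2)) ` strip a b) f = c"
proof -
  define g :: "real^2 \<Rightarrow> real^2" where "g = (\<lambda>x :: real^2. polar (x $ 1) (x $ 2))"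
  \<comment> \<open>The change of variables is applied to vector-valued functions, so
    \<open>f\<close> is carried into \<open>real^1\<close>; the equivalence \<open>v\<close> carries
    integrability and integral back.\<close>
  define vf :: "real^2 \<Rightarrow> real^1" where "vf = (\<lambda>x. vec (f x))"
  have S: "strip a b \<in> sets lebesgue" by (simp add: strip_box)
  have lin: "bounded_linear (\<lambda>x :: real. vec x :: real^1)" "bounded_linear (\<lambda>x :: real^1. x $ 1)"
    by (auto intro!: linear_conv_bounded_linear[THEN iffD1] linearI simp: vec_eq_iff)
  have v: "(\<lambda>x. vec (h x) :: real^1) absolutely_integrable_on T \<and> integral T (\<lambda>x. vec (h x) :: real^1) = vec c
      \<longleftrightarrow> h absolutely_integrable_on T \<and> integral T h = c" for h :: "real^2 \<Rightarrow> real" and T c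
  proof
    assume L: "(\<lambda>x. vec (h x) :: real^1) absolutely_integrable_on T \<and> integral T (\<lambda>x. vec (h x) :: real^1) = vec c"
    then have h: "h absolutely_integrable_on T"
      using absolutely_integrable_linear[OF _ lin(2), of T "\<lambda>x. vec (h x) :: real^1"] by (simp add: o_def)
    then have "h integrable_on T" using absolutely_integrable_on_def by blast
    from integral_linear[OF this lin(1)] L have "vec (integral T h) = (vec c :: real^1)" by (simp add: o_def)
    then show "h absolutely_integrable_on T \<and> integral T h = c" using h by (simp add: vec_eq_iff)
  next
    assume R: "h absolutely_integrable_on T \<and> integral T h = c"
    then have "h integrable_on T" using absolutely_integrable_on_def by blast
    from integral_linear[OF this lin(1)] R
    show "(\<lambda>x. vec (h x) :: real^1) absolutely_integrable_on T \<and> integral T (\<lambda>x. vec (h x) :: real^1) = vec c"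
      using absolutely_integrable_linear[OF _ lin(1), of T h] by (simp add: o_def)
  qed
  have "(\<lambda>x :: real^2. \<bar>x $ 1\<bar> *\<^sub>R vf (g x)) absolutely_integrable_on strip a b \<and>
      integral (strip a b) (\<lambda>x :: real^2. \<bar>x $ 1\<bar> *\<^sub>R vf (g x)) = vec c
    \<longleftrightarrow> vf absolutely_integrable_on (g ` strip a b) \<and> integral (g ` strip a b) vf = vec c"
    using has_absolute_integral_change_of_variables[OF S polar_vec_derivative polar_inj[OF a], of vf "vec c"]
    unfolding polar_vec_det g_def .
  moreover have "(\<lambda>x :: real^2. \<bar>x $ 1\<bar> *\<^sub>R vf (g x)) = (\<lambda>x. vec (\<bar>x $ 1\<bar> * f (g x)))"
    by (auto simp: vf_def vec_eq_iff fun_eq_iff)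
  moreover have "vf = (\<lambda>x. vec (f x))" by (simp add: vf_def)
  ultimately have "(\<lambda>x :: real^2. \<bar>x $ 1\<bar> * f (g x)) absolutely_integrable_on strip a b \<and>
      integral (strip a b) (\<lambda>x :: real^2. \<bar>x $ 1\<bar> * f (g x)) = c
    \<longleftrightarrow> f absolutely_integrable_on (g ` strip a b) \<and> integral (g ` strip a b) f = c"
    by (simp only: v)
  moreover have e: "\<bar>x $ 1\<bar> * f (g x) = x $ 1 * f (g x)" if "x \<in> strip a b" for x :: "real^2"
    using that a by (simp add: strip_def)
  have "(\<lambda>x :: real^2. \<bar>x $ 1\<bar> * f (g x)) absolutely_integrable_on strip a b
      \<longleftrightarrow> (\<lambda>x :: real^2. x $ 1 * f (g x)) absolutely_integrable_on strip a b"
    by (rule set_integrable_cong[OF refl refl]) (use e in auto)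
  moreover have "integral (strip a b) (\<lambda>x :: real^2. \<bar>x $ 1\<bar> * f (g x)) = integral (strip a b) (\<lambda>x :: real^2. x $ 1 * f (g x))"
    by (rule integral_cong) (rule e)
  ultimately show ?thesis unfolding g_def by simp
qed

lemma annulus_lebesgue: "annulus a b \<in> sets lebesgue"
proof -
  have "annulus a b = {x. a < norm x} \<inter> {x. norm x < b}" by (auto simp: annulus_def)
  moreover have "open ({x. a < norm x} \<inter> {x :: real^2. norm x < b})"
    by (intro open_Int open_Collect_less continuous_intros)
  ultimately show ?thesis by (metis borel_open sets_completionI_sets sets_lborel)
qed

lemma nn_integral_annulus:
  fixes f :: "real^2 \<Rightarrow> real"
  assumes a: "0 \<le> a" and f: "\<And>x. 0 \<le> f x" and c: "cont_rect a b (\<lambda>r t. f (polar r t))"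
  shows "(\<integral>\<^sup>+x. ennreal (f x) \<partial>lebesgue_on (annulus a b)) = ennreal (rect_int a b (\<lambda>r t. r * f (polar r t)))"
proof -
  let ?g = "\<lambda>x :: real^2. polar (x $ 1) (x $ 2)"
  have c': "cont_rect a b (\<lambda>r t. r * f (polar r t))" by (intro cont_rects c)
  have "((\<lambda>x :: real^2. (\<lambda>p. fst p * f (polar (fst p) (snd p))) (x $ 1, x $ 2)) has_integral rect_int a b (\<lambda>r t. r * f (polar r t)))
      (cbox (vector [a, 0]) (vector [b, 2*pi]))"
    unfolding rect_int_def by (intro has_integral_vector2 integrable_integral cont_rect_integrable[OF c'])
  then have I: "((\<lambda>x :: real^2. x $ 1 * f (?g x)) has_integral rect_int a b (\<lambda>r t. r * f (polar r t))) (strip a b)"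
    unfolding strip_box by (simp add: has_integral_open_interval)
  then have "(\<lambda>x :: real^2. x $ 1 * f (?g x)) absolutely_integrable_on strip a b"
    using a f by (intro nonnegative_absolutely_integrable_1) (auto simp: strip_def integrable_on_def)
  with I have "f absolutely_integrable_on (?g ` strip a b) \<and> integral (?g ` strip a b) f = rect_int a b (\<lambda>r t. r * f (polar r t))"
    using polar_change_of_variables[OF a, of b f "rect_int a b (\<lambda>r t. r * f (polar r t))"] by (simp add: integral_unique)
  then have "(f has_integral rect_int a b (\<lambda>r t. r * f (polar r t))) (?g ` strip a b)"
    using has_integral_integrable_integral absolutely_integrable_on_def by blast
  moreover have "(f has_integral rect_int a b (\<lambda>r t. r * f (polar r t))) (?g ` strip a b) \<longleftrightarrow>
      (f has_integral rect_int a b (\<lambda>r t. r * f (polar r t))) (annulus a b)"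
  proof (rule has_integral_spike_set_eq)
    show "negligible {x \<in> ?g ` strip a b - annulus a b. f x \<noteq> 0}"
      using polar_image(1)[OF a, of b] by (simp add: Diff_eq_empty_iff[THEN iffD2])
    show "negligible {x \<in> annulus a b - ?g ` strip a b. f x \<noteq> 0}"
      by (rule negligible_subset[OF negligible_axis]) (use polar_image(2)[OF a, of b] in auto)
  qed
  ultimately have "(f has_integral rect_int a b (\<lambda>r t. r * f (polar r t))) (annulus a b)" by blast
  then have "(\<integral>\<^sup>+x. ennreal (f x) * indicator (annulus a b) x \<partial>lborel) = ennreal (rect_int a b (\<lambda>r t. r * f (polar r t)))"
    by (intro nn_integral_has_integral_lebesgue' f)
  then show ?thesis
    by (simp add: nn_integral_restrict_space annulus_lebesgue nn_integral_completion)
qed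

lemma AE_negligible: "AE x in lebesgue. P x \<Longrightarrow> negligible {x. \<not> P x}"
  unfolding eventually_ae_filter by (auto simp: negligible_iff_null_sets[symmetric] intro: negligible_subset)

text \<open>The indicator of the exceptional set has integral zero. By the change of variables its
  preimage in the strip is null, since the Jacobian factor is positive there, and Fubini passes to
  almost every ray.\<close>

lemma AE_polar:
  assumes a: "0 \<le> a" and ae: "AE x in lebesgue_on (annulus a b). P x"
  shows "AE t in lebesgue_on {0..2*pi}. AE r in lebesgue_on {a<..<b}. P (polar r t)"
proof -
  let ?g = "\<lambda>x :: real^2. polar (x $ 1) (x $ 2)"
  define N where "N = {x \<in> annulus a b. \<not> P x}"
  have N: "negligible N"
  proof -
    have "AE x in lebesgue. x \<in> annulus a b \<longrightarrow> P x"
      using ae annulus_lebesgue[of a b] by (simp add: AE_restrict_space_iff)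
    from AE_negligible[OF this] show ?thesis by (simp add: N_def)
  qed
  define f :: "real^2 \<Rightarrow> real" where "f = indicator N"
  have f0: "(f has_integral 0) (?g ` strip a b)"
    by (rule has_integral_negligible[OF N]) (auto simp: f_def)
  then have "f absolutely_integrable_on (?g ` strip a b)"
    by (intro nonnegative_absolutely_integrable_1) (auto simp: f_def integrable_on_def)
  with f0 have "(\<lambda>x :: real^2. x $ 1 * f (?g x)) absolutely_integrable_on strip a b \<and> integral (strip a b) (\<lambda>x :: real^2. x $ 1 * f (?g x)) = 0"
    using polar_change_of_variables[OF a, of b f 0] by (simp add: integral_unique)
  then have ai: "(\<lambda>x :: real^2. x $ 1 * f (?g x)) absolutely_integrable_on strip a b"
    and I: "integral (strip a b) (\<lambda>x :: real^2. x $ 1 * f (?g x)) = 0" by auto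
  have S: "strip a b \<in> sets lebesgue" by (simp add: strip_box)
  have "set_lebesgue_integral lebesgue (strip a b) (\<lambda>x :: real^2. x $ 1 * f (?g x)) = 0"
    using set_lebesgue_integral_eq_integral(2)[OF ai] I by simp
  then have "AE x in lebesgue. indicator (strip a b) x *\<^sub>R (x $ 1 * f (?g x)) = 0"
    using ai a unfolding set_lebesgue_integral_def set_integrable_def
    by (subst (asm) integral_nonneg_eq_0_iff_AE) (auto simp: f_def strip_def indicator_def)
  then have "negligible {x. \<not> indicator (strip a b) x *\<^sub>R (x $ 1 * f (?g x)) = 0}" by (rule AE_negligible)
  moreover have "{x. \<not> indicator (strip a b) x *\<^sub>R (x $ 1 * f (?g x)) = 0} = {x \<in> strip a b. x $ 1 * f (?g x) \<noteq> 0}"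
    by (auto simp: indicator_def)
  ultimately have "negligible {x \<in> strip a b. x $ 1 * f (?g x) \<noteq> 0}" by simp
  moreover have "{x \<in> strip a b. x $ 1 * f (?g x) \<noteq> 0} = {x \<in> strip a b. ?g x \<in> N}"
    using a by (auto simp: f_def strip_def indicator_def)
  ultimately have neg: "negligible {x \<in> strip a b. ?g x \<in> N}" by simp
  \<comment> \<open>The coordinates are exchanged so that Fubini quantifies over the angle first and
    the radius second.\<close>
  define M where "M = (\<lambda>x :: real^2. (x $ 2, x $ 1)) ` {x \<in> strip a b. ?g x \<in> N}"
  have "negligible M"
    unfolding M_def
  proof (rule negligible_differentiable_image_negligible[OF _ neg])
    have "((\<lambda>x :: real^2. (x $ 2, x $ 1)) has_derivative (\<lambda>h. (h $ 2, h $ 1))) (at x within S)" for x S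
      by (intro has_derivative_Pair bounded_linear.has_derivative[OF bounded_linear_vec_nth has_derivative_ident])
    then show "(\<lambda>x :: real^2. (x $ 2, x $ 1)) differentiable_on {x \<in> strip a b. ?g x \<in> N}"
      unfolding differentiable_on_def differentiable_def by blast
  qed simp
  then have "AE p in lebesgue. p \<notin> M"
    unfolding negligible_iff_null_sets by (rule AE_not_in)
  then have "AE p in lborel \<Otimes>\<^sub>M lborel. p \<notin> M" by (simp only: AE_completion_iff lborel_prod)
  then have AE2: "AE t in lborel. AE r in lborel. (t, r) \<notin> M"
    by (rule lborel_pair.AE_pair)
  have "AE t in lebesgue. t \<in> {0..2*pi} \<longrightarrow> (AE r in lebesgue_on {a<..<b}. P (polar r t))"
  proof -
    have "AE t in lborel. t \<noteq> 0 \<and> t \<noteq> 2*pi"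
      by (simp add: AE_conj_iff AE_lborel_singleton)
    with AE2 have "AE t in lborel. t \<in> {0..2*pi} \<longrightarrow> (AE r in lebesgue_on {a<..<b}. P (polar r t))"
    proof eventually_elim
      case (elim t)
      show ?case
      proof
        assume t: "t \<in> {0..2*pi}"
        have "AE r in lebesgue. r \<in> {a<..<b} \<longrightarrow> P (polar r t)"
        proof (rule AE_mp[OF AE_completion[OF elim(1)]], rule AE_I2, intro impI)
          fix r assume r: "(t, r) \<notin> M" "r \<in> {a<..<b}"
          have "vector [r, t] \<in> strip a b" using r t elim(2) by (auto simp: strip_def)
          moreover have "(t, r) = (\<lambda>x :: real^2. (x $ 2, x $ 1)) (vector [r, t])" by simp
          ultimately have "polar r t \<notin> N" using r(1) unfolding M_def by (metis (mono_tags, lifting) image_eqI mem_Collect_eq vector_2)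
          then show "P (polar r t)" using r a by (auto simp: N_def annulus_def)
        qed
        then show "AE r in lebesgue_on {a<..<b}. P (polar r t)"
          by (simp add: AE_restrict_space_iff)
      qed
    qed
    then show ?thesis by (rule AE_completion)
  qed
  then show ?thesis by (simp add: AE_restrict_space_iff)
qed

section \<open>Smooth approximants of an admissible map\<close>

lemma norm_square_diff_bound:
  fixes x y :: "'a::real_inner"
  assumes "0 < s"
  shows "norm (x - y) * (norm x + norm y) \<le> s * (norm y)^2 + (1 + 1 / s) * (norm (x - y))^2"
    "\<bar>(norm x)\<^sup>2 - (norm y)\<^sup>2\<bar> \<le> s * (norm y)^2 + (1 + 1 / s) * (norm (x - y))^2"
proof -
  define d q where "d = norm (x - y)" and "q = norm y"
  have d: "0 \<le> d" by (simp add: d_def)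
  have n: "norm x \<le> q + d" using norm_triangle_ineq[of "x - y" y] by (simp add: d_def q_def)
  have "norm (x - y) * (norm x + norm y) \<le> d * (2 * q + d)"
    using n d unfolding d_def[symmetric] q_def[symmetric] by (intro mult_left_mono) auto
  also have "\<dots> \<le> s * q^2 + (1 + 1 / s) * d^2"
  proof -
    have "0 \<le> (s * q - d)^2 / s" using assms by simp
    also have "\<dots> = s * q^2 + d^2 / s - 2 * q * d"
      using assms by (simp add: field_simps power2_eq_square)
    finally show ?thesis by (simp add: algebra_simps power2_eq_square)
  qed
  finally show 1: "norm (x - y) * (norm x + norm y) \<le> s * (norm y)^2 + (1 + 1 / s) * (norm (x - y))^2"
    by (simp add: d_def q_def)
  have "\<bar>(norm x)\<^sup>2 - (norm y)\<^sup>2\<bar> = \<bar>norm x - norm y\<bar> * (norm x + norm y)"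
    unfolding power2_eq_square square_diff_square_factored by (simp add: abs_mult)
  also have "\<dots> \<le> norm (x - y) * (norm x + norm y)"
    by (intro mult_right_mono norm_triangle_ineq3) auto
  finally show "\<bar>(norm x)\<^sup>2 - (norm y)\<^sup>2\<bar> \<le> s * (norm y)^2 + (1 + 1 / s) * (norm (x - y))^2"
    using 1 by linarith
qed

lemma continuous_on_vec_components:
  fixes f :: "'a::topological_space \<Rightarrow> ('b::topological_space)^'n"
  assumes "\<And>i. continuous_on S (\<lambda>x. f x $ i)"
  shows "continuous_on S f"
  using continuous_on_vec_lambda[of S "\<lambda>i x. f x $ i"] assms by simp

lemma smooth_map_continuous:
  assumes "smooth_map w"
  shows "continuous_on S w" "continuous_on S (\<lambda>x. jacobian w (at x))"
  using assms unfolding smooth_map_def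
  by (auto intro!: continuous_on_vec_components smooth_continuous smooth_pd simp: jacobian_nth[OF assms])

lemma four_square_bound:
  fixes p q r s x y z k :: real
  shows "\<bar>p * x - q * y - r * z + s * k\<bar> \<le> sqrt (p^2 + q^2 + r^2 + s^2) * sqrt (k^2 + z^2 + y^2 + x^2)"
proof -
  have "0 \<le> (p * y + q * x)^2 + (p * z + r * x)^2 + (p * k - s * x)^2 + (q * z - r * y)^2 + (q * k + s * y)^2 + (r * k + s * z)^2"
    by simp
  then have "(p * x - q * y - r * z + s * k)^2 \<le> (p^2 + q^2 + r^2 + s^2) * (k^2 + z^2 + y^2 + x^2)"
    by (simp add: power2_eq_square algebra_simps)
  from real_sqrt_le_mono[OF this] show ?thesis by (simp only: real_sqrt_abs real_sqrt_mult)
qed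

text \<open>The determinant is a quadratic form, so twice the difference is its polar form applied
  to A - B and each of A and B; \<open>four_square_bound\<close> is the Cauchy-Schwarz inequality
  for that form.\<close>

lemma det_diff_bound:
  fixes A B :: "real^2^2"
  shows "\<bar>det A - det B\<bar> \<le> norm (A - B) * (norm A + norm B)"
proof -
  define e where "e M i j = (M $ i) $ j" for M :: "real^2^2" and i j
  have n: "norm M = sqrt ((e M 1 1)^2 + (e M 1 2)^2 + (e M 2 1)^2 + (e M 2 2)^2)" for M
    using norm_matrix_square[of M] by (metis norm_ge_zero real_sqrt_unique e_def)
  have d: "det M = e M 1 1 * e M 2 2 - e M 1 2 * e M 2 1" for M by (simp add: det_2 e_def)
  have s: "e (A - B) i j = e A i j - e B i j" for i j by (simp add: e_def)
  define p q r s where "p = e (A - B) 1 1" and "q = e (A - B) 1 2" and "r = e (A - B) 2 1" and "s = e (A - B) 2 2"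
  have nab: "norm (A - B) = sqrt (p^2 + q^2 + r^2 + s^2)" by (simp add: n p_def q_def r_def s_def)
  have b: "\<bar>p * e M 2 2 - q * e M 2 1 - r * e M 1 2 + s * e M 1 1\<bar> \<le> norm (A - B) * norm M" for M
    unfolding nab n[of M] by (rule four_square_bound)
  have "2 * (det A - det B) = (p * e A 2 2 - q * e A 2 1 - r * e A 1 2 + s * e A 1 1)
      + (p * e B 2 2 - q * e B 2 1 - r * e B 1 2 + s * e B 1 1)"
    unfolding d p_def q_def r_def s_def s by algebra
  then have "2 * \<bar>det A - det B\<bar> \<le> norm (A - B) * (norm A + norm B)"
    using b[of A] b[of B] unfolding distrib_left by linarith
  moreover have "0 \<le> norm (A - B) * (norm A + norm B)" by simp
  moreover have "2 * x \<le> y \<Longrightarrow> 0 \<le> y \<Longrightarrow> x \<le> y" for x y :: real by linarith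
  ultimately show ?thesis by blast
qed

lemma L2_on_nn_integral:
  fixes f :: "real^2 \<Rightarrow> 'a::euclidean_space"
  assumes "L2_on \<Omega> f"
  shows "(\<integral>\<^sup>+x. ennreal ((norm (f x))^2) \<partial>lebesgue_on \<Omega>) = ennreal (LINT x|lebesgue_on \<Omega>. (norm (f x))^2)"
  using assms unfolding L2_on_def by (intro nn_integral_eq_integral) auto

text \<open>Serves the recurring perturbation estimate in which a bounded quantity is weighted by
  \<open>s\<close> and a small one by 1 + 1 / s: first \<open>s\<close> is fixed by
  \<open>g\<close>, then \<open>d\<close> by \<open>s\<close>.\<close>

lemma small_parameter:
  fixes g :: real
  assumes "0 \<le> g" "0 < \<epsilon>"
  obtains s d where "0 < s" "0 < d" "s * g + (1 + 1 / s) * d < (\<epsilon> :: real)"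
proof
  define s where "s = \<epsilon> / (4 * (g + 1))"
  show s: "0 < s" using assms by (simp add: s_def)
  then show "0 < \<epsilon> / (2 * (1 + 1 / s))" using assms by (intro divide_pos_pos) (auto intro: add_pos_pos)
  have "s * g \<le> \<epsilon> / 4" using assms by (simp add: s_def field_simps)
  moreover have "(1 + 1 / s) * (\<epsilon> / (2 * (1 + 1 / s))) = \<epsilon> / 2"
  proof -
    have "0 < 1 + 1 / s" using s by (intro add_pos_pos) auto
    moreover have "y * (\<epsilon> / (2 * y)) = \<epsilon> / 2" if "0 < y" for y :: real using that by simp
    ultimately show ?thesis by blast
  qed
  ultimately show "s * g + (1 + 1 / s) * (\<epsilon> / (2 * (1 + 1 / s))) < \<epsilon>" using assms by linarith
qed

text \<open>\<open>G\<close> plays the role of the weak gradient; it enters only as the L2 limit of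
  the Jacobians of smooth maps whose boundary values approach the identity in L2.\<close>

locale trace_seq =
  fixes a b :: real and w :: "nat \<Rightarrow> real^2 \<Rightarrow> real^2" and u :: "real^2 \<Rightarrow> real^2" and G :: "real^2 \<Rightarrow> real^2^2"
  assumes a: "0 < a" and ab: "a < b" and w: "\<And>n. smooth_map (w n)"
    and u: "L2_on (annulus a b) u" and G: "L2_on (annulus a b) G"
    and conv: "(\<lambda>n. \<integral>\<^sup>+x. ennreal ((norm (w n x - u x))^2 + (norm (jacobian (w n) (at x) - G x))^2)
       \<partial>lebesgue_on (annulus a b)) \<longlonglongrightarrow> 0"
    and bdry: "\<And>c. c \<in> {a, b} \<Longrightarrow> (\<lambda>n. \<integral>\<^sup>+t. ennreal ((norm (w n (polar c t) - polar c t))^2 * c)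
       \<partial>lebesgue_on {0..2*pi}) \<longlonglongrightarrow> 0"
begin

abbreviation "\<Omega> \<equiv> lebesgue_on (annulus a b)"

definition \<gamma> :: real where "\<gamma> = (LINT x|\<Omega>. (norm (G x))^2)"

lemma \<gamma>: "0 \<le> \<gamma>" "(\<integral>\<^sup>+x. ennreal ((norm (G x))^2) \<partial>\<Omega>) = ennreal \<gamma>"
  using L2_on_nn_integral[OF G] by (simp_all add: \<gamma>_def)

lemma meas: "w n \<in> borel_measurable \<Omega>" "(\<lambda>x. jacobian (w n) (at x)) \<in> borel_measurable \<Omega>"
  "u \<in> borel_measurable \<Omega>" "G \<in> borel_measurable \<Omega>"
proof -
  show "w n \<in> borel_measurable \<Omega>" "(\<lambda>x. jacobian (w n) (at x)) \<in> borel_measurable \<Omega>"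
    by (rule continuous_imp_measurable_on_sets_lebesgue[OF smooth_map_continuous(1)[OF w] annulus_lebesgue],
        rule continuous_imp_measurable_on_sets_lebesgue[OF smooth_map_continuous(2)[OF w] annulus_lebesgue])
qed (use u G in \<open>auto simp: L2_on_def\<close>)

lemma errors_small:
  assumes "0 < \<epsilon>"
  shows "\<exists>M. \<forall>n\<ge>M. (\<integral>\<^sup>+x. ennreal ((norm (w n x - u x))^2) \<partial>\<Omega>) \<le> ennreal \<epsilon> \<and>
    (\<integral>\<^sup>+x. ennreal ((norm (jacobian (w n) (at x) - G x))^2) \<partial>\<Omega>) \<le> ennreal \<epsilon>"
proof -
  have "\<forall>\<^sub>F n in sequentially. (\<integral>\<^sup>+x. ennreal ((norm (w n x - u x))^2 + (norm (jacobian (w n) (at x) - G x))^2) \<partial>\<Omega>) < ennreal \<epsilon>"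
    using order_tendstoD(2)[OF conv, of "ennreal \<epsilon>"] assms by simp
  then obtain M where M: "\<And>n. n \<ge> M \<Longrightarrow> (\<integral>\<^sup>+x. ennreal ((norm (w n x - u x))^2 + (norm (jacobian (w n) (at x) - G x))^2) \<partial>\<Omega>) < ennreal \<epsilon>"
    unfolding eventually_sequentially by auto
  have "(\<integral>\<^sup>+x. ennreal ((norm (w n x - u x))^2) \<partial>\<Omega>) \<le> (\<integral>\<^sup>+x. ennreal ((norm (w n x - u x))^2 + (norm (jacobian (w n) (at x) - G x))^2) \<partial>\<Omega>)"
    "(\<integral>\<^sup>+x. ennreal ((norm (jacobian (w n) (at x) - G x))^2) \<partial>\<Omega>) \<le> (\<integral>\<^sup>+x. ennreal ((norm (w n x - u x))^2 + (norm (jacobian (w n) (at x) - G x))^2) \<partial>\<Omega>)" for n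
    by (intro nn_integral_mono ennreal_leI; simp)+
  then show ?thesis using M by (meson less_imp_le order_trans)
qed

text \<open>Interface between the two kinds of integral: bounds that hold almost everywhere on the
  annulus, in terms of functions that are merely measurable, become bounds for rectangle integrals
  of continuous functions.\<close>

lemma rect_int_le:
  fixes f :: "real^2 \<Rightarrow> real"
  assumes "\<And>x. 0 \<le> f x" "cont_rect a b (\<lambda>r t. f (polar r t))"
    and g: "g \<in> borel_measurable \<Omega>" "(\<integral>\<^sup>+x. ennreal (g x) \<partial>\<Omega>) \<le> ennreal \<gamma>1" "\<And>x. 0 \<le> g x" "0 \<le> \<gamma>1"
    and h: "h \<in> borel_measurable \<Omega>" "(\<integral>\<^sup>+x. ennreal (h x) \<partial>\<Omega>) \<le> ennreal \<gamma>2" "\<And>x. 0 \<le> h x" "0 \<le> \<gamma>2"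
    and pq: "0 \<le> p" "0 \<le> q" and le: "AE x in \<Omega>. f x \<le> p * g x + q * h x"
  shows "rect_int a b (\<lambda>r t. r * f (polar r t)) \<le> p * \<gamma>1 + q * \<gamma>2"
proof -
  have "ennreal (rect_int a b (\<lambda>r t. r * f (polar r t))) = (\<integral>\<^sup>+x. ennreal (f x) \<partial>\<Omega>)"
    using a assms by (intro nn_integral_annulus[symmetric]) auto
  also have "\<dots> \<le> (\<integral>\<^sup>+x. ennreal p * ennreal (g x) + ennreal q * ennreal (h x) \<partial>\<Omega>)"
    using le pq g(3) h(3) by (intro nn_integral_mono_AE) (auto elim!: eventually_mono simp flip: ennreal_mult' ennreal_plus intro!: ennreal_leI)
  also have "\<dots> = ennreal p * (\<integral>\<^sup>+x. ennreal (g x) \<partial>\<Omega>) + ennreal q * (\<integral>\<^sup>+x. ennreal (h x) \<partial>\<Omega>)"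
    using g h by (simp add: nn_integral_add nn_integral_cmult)
  also have "\<dots> \<le> ennreal p * ennreal \<gamma>1 + ennreal q * ennreal \<gamma>2"
    by (intro add_mono mult_left_mono g h) auto
  also have "\<dots> = ennreal (p * \<gamma>1 + q * \<gamma>2)" using pq g h by (simp add: ennreal_mult' ennreal_plus)
  finally show ?thesis using pq g h by (subst (asm) ennreal_le_iff) auto
qed

abbreviation "W n \<equiv> cpx (w n)"
abbreviation "W1 n \<equiv> cmb rad (w n)"
abbreviation "W2 n \<equiv> cmb ang (w n)"

lemma jac_cont: "cont_rect a b (\<lambda>r t. (norm (jacobian (w n) (at (polar r t)) - B))^2)"
  "cont_rect a b (\<lambda>r t. (norm (jacobian (w n) (at (polar r t)) - jacobian (w m) (at (polar r t))))^2)"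
  "cont_rect a b (\<lambda>r t. det (jacobian (w n) (at (polar r t))))"
proof -
  have c: "cont_rect a b (\<lambda>r t. pd j (\<lambda>x. w n x $ i) (polar r t))" for n i j
    using w unfolding smooth_map_def by (intro cont_rect_polar smooth_continuous smooth_pd) auto
  show "cont_rect a b (\<lambda>r t. (norm (jacobian (w n) (at (polar r t)) - B))^2)"
    "cont_rect a b (\<lambda>r t. (norm (jacobian (w n) (at (polar r t)) - jacobian (w m) (at (polar r t))))^2)"
    "cont_rect a b (\<lambda>r t. det (jacobian (w n) (at (polar r t))))"
    unfolding norm_matrix_square det_2 vector_minus_component jacobian_nth[OF w]
    by (intro cont_rects c)+
qed

lemma polar_energy:
  "a \<le> r \<Longrightarrow> r * (cmod (W1 n r t))^2 + (cmod (W2 n r t))^2 / r = r * (norm (jacobian (w n) (at (polar r t))))^2"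
  "a \<le> r \<Longrightarrow> r * (cmod (W1 n r t - W1 m r t))^2 + (cmod (W2 n r t - W2 m r t))^2 / r
    = r * (norm (jacobian (w n) (at (polar r t)) - jacobian (w m) (at (polar r t))))^2"
proof -
  have e: "r * p + q / r = r * (p + q / r^2)" if "a \<le> r" for p q r
    using that a by (simp add: field_simps power2_eq_square)
  show "a \<le> r \<Longrightarrow> r * (cmod (W1 n r t))^2 + (cmod (W2 n r t))^2 / r = r * (norm (jacobian (w n) (at (polar r t))))^2"
    using a by (simp add: e cpx_speed1 w)
  show "a \<le> r \<Longrightarrow> r * (cmod (W1 n r t - W1 m r t))^2 + (cmod (W2 n r t - W2 m r t))^2 / r
    = r * (norm (jacobian (w n) (at (polar r t)) - jacobian (w m) (at (polar r t))))^2"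
    using a by (simp add: e cpx_speed w)
qed

lemma seq_Cauchy:
  assumes "0 < \<epsilon>"
  shows "\<exists>M. \<forall>m\<ge>M. \<forall>n\<ge>M. rect_int a b (\<lambda>r t. wsq r (W1 m r t - W1 n r t) (W2 m r t - W2 n r t)) < \<epsilon>"
proof -
  obtain M where M: "\<And>n. n \<ge> M \<Longrightarrow> (\<integral>\<^sup>+x. ennreal ((norm (jacobian (w n) (at x) - G x))^2) \<partial>\<Omega>) \<le> ennreal (\<epsilon> / 5)"
    using errors_small[of "\<epsilon> / 5"] assms by auto
  have "rect_int a b (\<lambda>r t. wsq r (W1 m r t - W1 n r t) (W2 m r t - W2 n r t)) < \<epsilon>"
    if "m \<ge> M" "n \<ge> M" for m n
  proof -
    have "rect_int a b (\<lambda>r t. wsq r (W1 m r t - W1 n r t) (W2 m r t - W2 n r t))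
      = rect_int a b (\<lambda>r t. r * (norm (jacobian (w m) (at (polar r t)) - jacobian (w n) (at (polar r t))))^2)"
      by (intro rect_int_cong polar_energy)
    also have "\<dots> \<le> 2 * (\<epsilon> / 5) + 2 * (\<epsilon> / 5)"
    proof (rule rect_int_le[where g = "\<lambda>x. (norm (jacobian (w m) (at x) - G x))^2" and h = "\<lambda>x. (norm (jacobian (w n) (at x) - G x))^2"])
      have "(norm (A - B))^2 \<le> 2 * (norm (A - C))^2 + 2 * (norm (B - C))^2" for A B C :: "real^2^2"
      proof -
        have "norm (A - B) \<le> norm (A - C) + norm (B - C)" using norm_triangle_ineq4[of "A - C" "B - C"] by simp
        then have "(norm (A - B))^2 \<le> (norm (A - C) + norm (B - C))^2" by (intro power_mono) auto
        also have "\<dots> \<le> 2 * (norm (A - C))^2 + 2 * (norm (B - C))^2"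
          using zero_le_power2[of "norm (A - C) - norm (B - C)"] by (simp add: power2_eq_square algebra_simps)
        finally show ?thesis .
      qed
      then show "AE x in \<Omega>. (norm (jacobian (w m) (at x) - jacobian (w n) (at x)))^2
          \<le> 2 * (norm (jacobian (w m) (at x) - G x))^2 + 2 * (norm (jacobian (w n) (at x) - G x))^2" by simp
    qed (use M that assms meas jac_cont in auto)
    also have "\<dots> < \<epsilon>" using assms by simp
    finally show ?thesis .
  qed
  then show ?thesis by blast
qed

lemma seq_energy:
  assumes "0 < \<epsilon>"
  shows "\<exists>M. \<forall>n\<ge>M. \<bar>rect_int a b (\<lambda>r t. wsq r (W1 n r t) (W2 n r t)) - \<gamma>\<bar> < \<epsilon>"
proof -
  obtain s d where sd: "0 < s" "0 < d" "s * \<gamma> + (1 + 1 / s) * d < \<epsilon>"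
    using small_parameter[OF \<gamma>(1) assms] by blast
  obtain M where M: "\<And>n. n \<ge> M \<Longrightarrow> (\<integral>\<^sup>+x. ennreal ((norm (jacobian (w n) (at x) - G x))^2) \<partial>\<Omega>) \<le> ennreal d"
    using errors_small[of d] sd by auto
  have "\<bar>rect_int a b (\<lambda>r t. wsq r (W1 n r t) (W2 n r t)) - \<gamma>\<bar> < \<epsilon>" if n: "n \<ge> M" for n
  proof -
    let ?J = "\<lambda>x. jacobian (w n) (at x)"
    define E where "E = rect_int a b (\<lambda>r t. r * (norm (?J (polar r t)))^2)"
    have c: "cont_rect a b (\<lambda>r t. (norm (?J (polar r t)))^2)" using jac_cont(1)[of n 0] by simp
    have E: "rect_int a b (\<lambda>r t. wsq r (W1 n r t) (W2 n r t)) = E"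
      unfolding E_def by (intro rect_int_cong polar_energy)
    note b = norm_square_diff_bound(2)[OF sd(1)]
    have "E \<le> (1 + s) * \<gamma> + (1 + 1 / s) * d"
      unfolding E_def
    proof (rule rect_int_le[where g = "\<lambda>x. (norm (G x))^2" and h = "\<lambda>x. (norm (?J x - G x))^2"])
      show "AE x in \<Omega>. (norm (?J x))^2 \<le> (1 + s) * (norm (G x))^2 + (1 + 1 / s) * (norm (?J x - G x))^2"
        proof (rule AE_I2)
        fix x
        have "(norm (?J x))^2 \<le> (norm (G x))^2 + (s * (norm (G x))^2 + (1 + 1 / s) * (norm (?J x - G x))^2)"
          using b[of "?J x" "G x"] by linarith
        then show "(norm (?J x))^2 \<le> (1 + s) * (norm (G x))^2 + (1 + 1 / s) * (norm (?J x - G x))^2"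
          by (simp only: distrib_right mult_1)
      qed
    qed (use \<gamma> M n meas c sd in auto)
    moreover have "\<gamma> \<le> E + (s * \<gamma> + (1 + 1 / s) * d)"
    proof -
      have E0: "0 \<le> E" using a unfolding E_def by (intro rect_int_nonneg cont_rects c) auto
      have "ennreal \<gamma> = (\<integral>\<^sup>+x. ennreal ((norm (G x))^2) \<partial>\<Omega>)" by (simp add: \<gamma>)
      also have "\<dots> \<le> (\<integral>\<^sup>+x. ennreal ((norm (?J x))^2) + (ennreal s * ennreal ((norm (G x))^2) + ennreal (1 + 1 / s) * ennreal ((norm (?J x - G x))^2)) \<partial>\<Omega>)"
      proof (rule nn_integral_mono)
        fix x
        have "(norm (G x))^2 \<le> (norm (?J x))^2 + (s * (norm (G x))^2 + (1 + 1 / s) * (norm (?J x - G x))^2)"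
          using b[of "?J x" "G x"] by linarith
        then show "ennreal ((norm (G x))^2) \<le> ennreal ((norm (?J x))^2) + (ennreal s * ennreal ((norm (G x))^2) + ennreal (1 + 1 / s) * ennreal ((norm (?J x - G x))^2))"
          using sd by (simp flip: ennreal_mult' ennreal_plus add: ennreal_leI)
      qed
      also have "\<dots> = (\<integral>\<^sup>+x. ennreal ((norm (?J x))^2) \<partial>\<Omega>) + (ennreal s * ennreal \<gamma> + ennreal (1 + 1 / s) * (\<integral>\<^sup>+x. ennreal ((norm (?J x - G x))^2) \<partial>\<Omega>))"
        using meas by (simp add: nn_integral_add nn_integral_cmult \<gamma>)
      also have "\<dots> \<le> ennreal E + (ennreal s * ennreal \<gamma> + ennreal (1 + 1 / s) * ennreal d)"
        using nn_integral_annulus[of a "\<lambda>x. (norm (?J x))^2" b] a c M[OF n]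
        by (intro add_mono mult_left_mono) (auto simp: E_def)
      also have "\<dots> = ennreal (E + (s * \<gamma> + (1 + 1 / s) * d))"
        using sd \<gamma> E0 by (simp add: ennreal_mult' ennreal_plus)
      finally show ?thesis using sd \<gamma> E0 by (subst (asm) ennreal_le_iff) auto
    qed
    ultimately show ?thesis unfolding E using sd(3) by (simp add: algebra_simps abs_less_iff)
  qed
  then show ?thesis by blast
qed

text \<open>As det G is nonnegative, the negative part of the approximating determinant is at most
  its distance to det G, and the determinant is continuous from L2 to L1.\<close>

lemma seq_neg_det:
  assumes G0: "AE x in \<Omega>. 0 \<le> det (G x)" and "0 < \<epsilon>"
  shows "\<exists>M. \<forall>n\<ge>M. rect_int a b (\<lambda>r t. max 0 (- Im (cnj (W1 n r t) * W2 n r t))) < \<epsilon>"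
proof -
  obtain s d where sd: "0 < s" "0 < d" "s * \<gamma> + (1 + 1 / s) * d < \<epsilon>"
    using small_parameter[OF \<gamma>(1) assms(2)] by blast
  obtain M where M: "\<And>n. n \<ge> M \<Longrightarrow> (\<integral>\<^sup>+x. ennreal ((norm (jacobian (w n) (at x) - G x))^2) \<partial>\<Omega>) \<le> ennreal d"
    using errors_small[of d] sd by auto
  have "rect_int a b (\<lambda>r t. max 0 (- Im (cnj (W1 n r t) * W2 n r t))) < \<epsilon>" if n: "n \<ge> M" for n
  proof -
    let ?J = "\<lambda>x. jacobian (w n) (at x)"
    have m: "max 0 (- (r * y)) = r * max 0 (- y)" if "a \<le> r" for r y :: real
      using that a by (simp add: max_def mult_le_0_iff)
    have "rect_int a b (\<lambda>r t. max 0 (- Im (cnj (W1 n r t) * W2 n r t))) = rect_int a b (\<lambda>r t. r * max 0 (- det (?J (polar r t))))"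
      by (intro rect_int_cong) (simp only: cpx_det[OF w] m)
    also have "\<dots> \<le> s * \<gamma> + (1 + 1 / s) * d"
    proof (rule rect_int_le[where g = "\<lambda>x. (norm (G x))^2" and h = "\<lambda>x. (norm (?J x - G x))^2"])
      show "AE x in \<Omega>. max 0 (- det (?J x)) \<le> s * (norm (G x))^2 + (1 + 1 / s) * (norm (?J x - G x))^2"
        using G0
      proof eventually_elim
        case (elim x)
        have "0 \<le> s * (norm (G x))^2 + (1 + 1 / s) * (norm (?J x - G x))^2" using sd by (intro add_nonneg_nonneg mult_nonneg_nonneg) auto
        then show ?case
          using det_diff_bound[of "?J x" "G x"] norm_square_diff_bound(1)[OF sd(1), of "?J x" "G x"] elim by linarith
      qed
    qed (use \<gamma> M n meas jac_cont(3) sd in \<open>auto intro!: cont_rects\<close>)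
    finally show ?thesis using sd by simp
  qed
  then show ?thesis by blast
qed

lemma seq_boundary:
  assumes c: "c = a \<or> c = b" and "0 < \<epsilon>"
  shows "\<exists>M. \<forall>n\<ge>M. integral {0..2*pi} (\<lambda>t. (cmod (W n c t - of_real c * cis t))^2) < \<epsilon>"
proof -
  have c0: "0 < c" using c a ab by auto
  have "\<forall>\<^sub>F n in sequentially. (\<integral>\<^sup>+t. ennreal ((norm (w n (polar c t) - polar c t))^2 * c) \<partial>lebesgue_on {0..2*pi}) < ennreal (\<epsilon> * c)"
    using order_tendstoD(2)[OF bdry, of c "ennreal (\<epsilon> * c)"] assms c0 by auto
  then obtain M where M: "\<And>n. n \<ge> M \<Longrightarrow> (\<integral>\<^sup>+t. ennreal ((norm (w n (polar c t) - polar c t))^2 * c) \<partial>lebesgue_on {0..2*pi}) < ennreal (\<epsilon> * c)"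
    unfolding eventually_sequentially by auto
  have "integral {0..2*pi} (\<lambda>t. (cmod (W n c t - of_real c * cis t))^2) < \<epsilon>" if n: "n \<ge> M" for n
  proof -
    define f where "f t = (cmod (W n c t - of_real c * cis t))^2" for t
    have f: "(norm (w n (polar c t) - polar c t))^2 = f t" for t
      by (simp add: f_def cpx_def cmod_power2 norm_vec_def L2_set_def sum_2)
    have cf: "continuous_on {0..2*pi} f"
      unfolding f_def using ab c
      by (intro continuous_intros cont_rect_slice2[OF cpx_cont(1)[OF w, of a b n]]) (use ab c in auto)
    have "((\<lambda>t. f t * c) has_integral integral {0..2*pi} f * c) {0..2*pi}"
      by (intro has_integral_mult_left integrable_integral integrable_continuous_real cf)
    then have "(\<integral>\<^sup>+t. ennreal (f t * c) * indicator {0..2*pi} t \<partial>lborel) = ennreal (integral {0..2*pi} f * c)"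
      using c0 by (intro nn_integral_has_integral_lebesgue') (auto simp: f_def)
    moreover have "(\<integral>\<^sup>+t. ennreal (f t * c) \<partial>lebesgue_on {0..2*pi}) = (\<integral>\<^sup>+t. ennreal (f t * c) * indicator {0..2*pi} t \<partial>lborel)"
      by (simp add: nn_integral_restrict_space nn_integral_completion)
    ultimately have "ennreal (integral {0..2*pi} f * c) < ennreal (\<epsilon> * c)" using M[OF n] by (simp add: f)
    then have "integral {0..2*pi} f * c < \<epsilon> * c" using assms(2) c0 by (subst (asm) ennreal_less_iff) (auto intro!: mult_nonneg_nonneg integral_nonneg integrable_continuous_real cf simp: f_def)
    then show ?thesis using c0 unfolding f_def[abs_def] by simp
  qed
  then show ?thesis by blast
qed

lemma seq_L2:
  assumes "AE x in \<Omega>. u x = u' x" "continuous_on {x. x \<noteq> 0} u'" "0 < \<epsilon>"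
  shows "\<exists>M. \<forall>n\<ge>M. rect_int a b (\<lambda>r t. r * (cmod (W n r t - cpx u' r t))^2) < \<epsilon>"
proof -
  obtain M where M: "\<And>n. n \<ge> M \<Longrightarrow> (\<integral>\<^sup>+x. ennreal ((norm (w n x - u x))^2) \<partial>\<Omega>) \<le> ennreal (\<epsilon> / 2)"
    using errors_small[of "\<epsilon> / 2"] assms by auto
  have "rect_int a b (\<lambda>r t. r * (cmod (W n r t - cpx u' r t))^2) < \<epsilon>" if n: "n \<ge> M" for n
  proof -
    have e: "(cmod (W n r t - cpx u' r t))^2 = (norm (w n (polar r t) - u' (polar r t)))^2" for r t
      by (simp add: cpx_def cmod_power2 norm_vec_def L2_set_def sum_2)
    have cu: "cont_rect a b (\<lambda>r t. (norm (w n (polar r t) - u' (polar r t)))^2)"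
      unfolding cont_rect_def
    proof (rule continuous_on_compose2[OF _ polar_continuous])
      show "continuous_on {x. x \<noteq> 0} (\<lambda>x. (norm (w n x - u' x))^2)" by (intro continuous_intros assms smooth_map_continuous w)
      show "(\<lambda>p. polar (fst p) (snd p)) ` ({a..b} \<times> UNIV) \<subseteq> {x. x \<noteq> 0}"
      proof
        fix x assume "x \<in> (\<lambda>p. polar (fst p) (snd p)) ` ({a..b} \<times> UNIV)"
        then obtain r t where "x = polar r t" "a \<le> r" by auto
        then have "0 < norm x" using a by simp
        then show "x \<in> {x. x \<noteq> 0}" by simp
      qed
    qed
    have "rect_int a b (\<lambda>r t. r * (norm (w n (polar r t) - u' (polar r t)))^2) \<le> 1 * (\<epsilon> / 2) + 0 * 0"
    proof (rule rect_int_le[where g = "\<lambda>x. (norm (w n x - u x))^2" and h = "\<lambda>x. 0"])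
      show "AE x in \<Omega>. (norm (w n x - u' x))^2 \<le> 1 * (norm (w n x - u x))^2 + 0 * 0"
        using assms(1) by eventually_elim simp
    qed (use M n meas cu assms in auto)
    then show ?thesis using assms by (simp add: e)
  qed
  then show ?thesis by blast
qed

lemma seq_AE: "\<exists>\<sigma>. strict_mono \<sigma> \<and> (AE x in \<Omega>. (\<lambda>n. w (\<sigma> n) x) \<longlonglongrightarrow> u x)"
proof -
  obtain M where M: "\<And>n. n \<ge> M \<Longrightarrow> (\<integral>\<^sup>+x. ennreal ((norm (w n x - u x))^2) \<partial>\<Omega>) \<le> ennreal 1"
    using errors_small[of 1] by auto
  define f where "f n x = (norm (w (M + n) x - u x))^2" for n x
  have fm: "f n \<in> borel_measurable \<Omega>" for n unfolding f_def using meas by measurable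
  have int: "integrable \<Omega> (f n)" for n
    using M[of "M + n"] by (intro integrableI_nonneg fm) (auto simp: f_def intro: le_less_trans)
  have "(\<lambda>n. LINT x|\<Omega>. norm (f n x)) \<longlonglongrightarrow> 0"
  proof (rule LIMSEQ_I)
    fix \<epsilon> :: real assume \<epsilon>: "0 < \<epsilon>"
    obtain M' where M': "\<And>n. n \<ge> M' \<Longrightarrow> (\<integral>\<^sup>+x. ennreal ((norm (w n x - u x))^2) \<partial>\<Omega>) \<le> ennreal (\<epsilon> / 2)"
      using errors_small[of "\<epsilon> / 2"] \<epsilon> by auto
    have "norm ((LINT x|\<Omega>. norm (f n x)) - 0) < \<epsilon>" if "n \<ge> M'" for n
    proof -
      have "ennreal (LINT x|\<Omega>. norm (f n x)) \<le> ennreal (\<epsilon> / 2)"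
        using M'[of "M + n"] that nn_integral_eq_integral[OF integrable_norm[OF int[of n]]] by (simp add: f_def)
      then have "(LINT x|\<Omega>. norm (f n x)) \<le> \<epsilon> / 2" using \<epsilon> by (subst (asm) ennreal_le_iff) auto
      moreover have "0 \<le> (LINT x|\<Omega>. norm (f n x))" by simp
      ultimately show ?thesis using \<epsilon> by simp
    qed
    then show "\<exists>no. \<forall>n\<ge>no. norm ((LINT x|\<Omega>. norm (f n x)) - 0) < \<epsilon>" by blast
  qed
  then obtain r where r: "strict_mono r" "AE x in \<Omega>. (\<lambda>n. f (r n) x) \<longlonglongrightarrow> 0"
    using tendsto_L1_AE_subseq[of \<Omega> f, OF int] by blast
  have "AE x in \<Omega>. (\<lambda>n. w (M + r n) x) \<longlonglongrightarrow> u x"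
    using r(2)
  proof eventually_elim
    case (elim x)
    from tendsto_real_sqrt[OF elim] have "(\<lambda>n. norm (w (M + r n) x - u x)) \<longlonglongrightarrow> 0" by (simp add: f_def)
    then show ?case using LIM_zero_iff tendsto_norm_zero_iff by blast
  qed
  moreover have "strict_mono (\<lambda>n. M + r n)" using r(1) by (simp add: strict_mono_def)
  ultimately show ?thesis by blast
qed

end

subsection \<open>Correcting the boundary values\<close>

text \<open>One minus the squared distance to the core [a + \<delta>, b - \<delta>] in units of
  \<delta>; the square makes it continuously differentiable at the edges of the core.\<close>

definition cutoff :: "real \<Rightarrow> real \<Rightarrow> real \<Rightarrow> real \<Rightarrow> real" where
  "cutoff a b \<delta> r = 1 - ((max 0 (a + \<delta> - r))^2 + (max 0 (r - (b - \<delta>)))^2) / \<delta>^2"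
definition cutoff' :: "real \<Rightarrow> real \<Rightarrow> real \<Rightarrow> real \<Rightarrow> real" where
  "cutoff' a b \<delta> r = (2 * max 0 (a + \<delta> - r) - 2 * max 0 (r - (b - \<delta>))) / \<delta>^2"

lemma cutoff_derivative:
  assumes "0 < \<delta>"
  shows "(cutoff a b \<delta> has_real_derivative cutoff' a b \<delta> r) (at r within S)"
proof -
  have neg: "- r - (- (a + \<delta>)) = a + \<delta> - r" for r by simp
  have 1: "((\<lambda>r. (max 0 (- r - (- (a + \<delta>))))^2) has_real_derivative 2 * max 0 (- r - (- (a + \<delta>))) * - 1) (at r)"
    by (rule DERIV_chain2[OF has_derivative_max_square DERIV_minus[OF DERIV_ident]])
  have "((\<lambda>r. 1 - ((max 0 (- r - (- (a + \<delta>))))^2 + (max 0 (r - (b - \<delta>)))^2) / \<delta>^2) has_real_derivative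
      0 - (2 * max 0 (- r - (- (a + \<delta>))) * - 1 + 2 * max 0 (r - (b - \<delta>))) / \<delta>^2) (at r)"
    by (rule DERIV_diff[OF DERIV_const DERIV_cdivide[OF DERIV_add[OF 1 has_derivative_max_square]]])
  moreover have "(\<lambda>r. 1 - ((max 0 (- r - (- (a + \<delta>))))^2 + (max 0 (r - (b - \<delta>)))^2) / \<delta>^2) = cutoff a b \<delta>"
    by (simp only: cutoff_def[abs_def] neg)
  moreover have "0 - (2 * max 0 (- r - (- (a + \<delta>))) * - 1 + 2 * max 0 (r - (b - \<delta>))) / \<delta>^2 = cutoff' a b \<delta> r"
    unfolding neg by (simp add: cutoff'_def diff_divide_distrib add_divide_distrib)
  ultimately have "(cutoff a b \<delta> has_real_derivative cutoff' a b \<delta> r) (at r)" by simp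
  then show ?thesis by (rule has_field_derivative_at_within)
qed

lemma cutoff'_cont: "0 < \<delta> \<Longrightarrow> continuous_on S (cutoff' a b \<delta>)"
  unfolding cutoff'_def[abs_def] by (intro continuous_intros) auto

lemma cutoff_cont: "0 < \<delta> \<Longrightarrow> continuous_on S (cutoff a b \<delta>)"
  using cutoff_derivative by (meson DERIV_continuous continuous_on_eq_continuous_within)

lemma cutoff_boundary:
  assumes "0 < \<delta>" "2 * \<delta> \<le> b - a"
  shows "cutoff a b \<delta> a = 0" "cutoff a b \<delta> b = 0"
  using assms by (auto simp: cutoff_def max_def)

lemma cutoff_middle:
  assumes "a + \<delta> \<le> r" "r \<le> b - \<delta>"
  shows "cutoff a b \<delta> r = 1" "cutoff' a b \<delta> r = 0"
  using assms by (auto simp: cutoff_def cutoff'_def max_def)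

lemma cutoff_shell:
  assumes \<delta>: "0 < \<delta>" "2 * \<delta> \<le> b - a" and r: "a \<le> r" "r \<le> b" and "r \<le> a + \<delta> \<or> b - \<delta> \<le> r"
  shows "\<bar>cutoff a b \<delta> r - 1\<bar> \<le> 1" "\<bar>cutoff' a b \<delta> r\<bar> \<le> 2 / \<delta>"
proof -
  define p where "p = (if r \<le> a + \<delta> then a + \<delta> - r else r - (b - \<delta>))"
  have p: "0 \<le> p" "p \<le> \<delta>" using assms by (auto simp: p_def)
  have "cutoff a b \<delta> r = 1 - p^2 / \<delta>^2" "\<bar>cutoff' a b \<delta> r\<bar> = 2 * p / \<delta>^2"
    using assms by (auto simp: cutoff_def cutoff'_def p_def max_def)
  moreover have "p^2 / \<delta>^2 \<le> 1" using p \<delta> by (simp add: power_mono)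
  moreover have "2 * p / \<delta>^2 \<le> 2 / \<delta>" using p \<delta> by (simp add: field_simps power2_eq_square)
  ultimately show "\<bar>cutoff a b \<delta> r - 1\<bar> \<le> 1" "\<bar>cutoff' a b \<delta> r\<bar> \<le> 2 / \<delta>" by auto
qed

text \<open>The approximant blended into the identity near both circles, so that its boundary values
  are exact; \<open>bl1\<close>, \<open>bl2\<close> and \<open>bl12\<close> are its derivatives in
  r, in t and in both.\<close>

definition bl0 :: "real \<Rightarrow> real \<Rightarrow> real \<Rightarrow> (real^2 \<Rightarrow> real^2) \<Rightarrow> real \<Rightarrow> real \<Rightarrow> complex" where
  "bl0 a b \<delta> w r t = of_real r * cis t + of_real (cutoff a b \<delta> r) * (cpx w r t - of_real r * cis t)"
definition bl1 :: "real \<Rightarrow> real \<Rightarrow> real \<Rightarrow> (real^2 \<Rightarrow> real^2) \<Rightarrow> real \<Rightarrow> real \<Rightarrow> complex" where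
  "bl1 a b \<delta> w r t = cis t + (of_real (cutoff a b \<delta> r) * (cmb rad w r t - cis t) + of_real (cutoff' a b \<delta> r) * (cpx w r t - of_real r * cis t))"
definition bl2 :: "real \<Rightarrow> real \<Rightarrow> real \<Rightarrow> (real^2 \<Rightarrow> real^2) \<Rightarrow> real \<Rightarrow> real \<Rightarrow> complex" where
  "bl2 a b \<delta> w r t = \<i> * (of_real r * cis t) + of_real (cutoff a b \<delta> r) * (cmb ang w r t - \<i> * (of_real r * cis t))"
definition bl12 :: "real \<Rightarrow> real \<Rightarrow> real \<Rightarrow> (real^2 \<Rightarrow> real^2) \<Rightarrow> real \<Rightarrow> real \<Rightarrow> complex" where
  "bl12 a b \<delta> w r t = \<i> * cis t + (of_real (cutoff a b \<delta> r) * (cmb rad_ang w r t - \<i> * cis t) + of_real (cutoff' a b \<delta> r) * (cmb ang w r t - \<i> * (of_real r * cis t)))"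

lemma cis_vector_derivative: "(cis has_vector_derivative \<i> * cis t) (at t within S)"
proof -
  have "((\<lambda>x. exp (\<i> * x)) has_field_derivative \<i> * exp (\<i> * of_real t)) (at (of_real t))"
    by (auto intro!: derivative_eq_intros)
  from has_vector_derivative_real_field[OF this] have "(cis has_vector_derivative \<i> * cis t) (at t)"
    by (simp add: cis_conv_exp[abs_def])
  then show ?thesis by (rule has_vector_derivative_at_within)
qed

lemma of_real_times_derivative:
  fixes w :: complex
  shows "((\<lambda>r. of_real r * w) has_vector_derivative w) (at r within S)"
  using has_vector_derivative_mult_left[OF has_vector_derivative_of_real[OF DERIV_ident]] by simp

lemma cis_cont_rect: "cont_rect a b (\<lambda>r t. cis t)"
  by (intro cont_rect_snd continuous_intros)

lemma shell_conts:
  assumes "smooth_map w"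
  shows "cont_rect a b (\<lambda>r t. cpx w r t - of_real r * cis t)" "cont_rect a b (\<lambda>r t. cmb rad w r t - cis t)"
    "cont_rect a b (\<lambda>r t. cmb ang w r t - \<i> * (of_real r * cis t))"
  by (intro cont_rects cpx_cont[OF assms] cis_cont_rect)+

lemma blend_polar_map:
  assumes w: "smooth_map w" and a: "0 < a" and \<delta>: "0 < \<delta>" "2 * \<delta> \<le> b - a"
  shows "polar_map a b (bl0 a b \<delta> w) (bl1 a b \<delta> w) (bl2 a b \<delta> w) (bl12 a b \<delta> w)"
proof
  note cw = cpx_cont[OF w] and dw = cpx_derivatives[OF w]
  have cc: "cont_rect a b (\<lambda>r t. cutoff a b \<delta> r)" "cont_rect a b (\<lambda>r t. cutoff' a b \<delta> r)"
    by (intro cont_rect_fst cutoff_cont cutoff'_cont \<delta>)+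
  show "0 < a" "a < b" using a \<delta> by auto
  show "cont_rect a b (bl0 a b \<delta> w)" "cont_rect a b (bl1 a b \<delta> w)" "cont_rect a b (bl2 a b \<delta> w)" "cont_rect a b (bl12 a b \<delta> w)"
    unfolding bl0_def bl1_def bl2_def bl12_def by (intro cont_rects cis_cont_rect cw cc)+
  have dc: "((\<lambda>r. complex_of_real (cutoff a b \<delta> r)) has_vector_derivative of_real (cutoff' a b \<delta> r)) (at r within S)" for r S
    by (intro has_vector_derivative_of_real cutoff_derivative \<delta>)
  have ci: "((\<lambda>t. of_real r * cis t) has_vector_derivative \<i> * (of_real r * cis t)) (at t)" for r t
    using has_vector_derivative_mult_right[OF cis_vector_derivative[of t UNIV], of "of_real r"] by (simp add: mult.left_commute)
  have ci2: "((\<lambda>t. \<i> * (of_real r * cis t)) has_vector_derivative \<i> * (\<i> * (of_real r * cis t))) (at t)" for r t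
    by (intro has_vector_derivative_mult_right ci)
  have ri: "((\<lambda>r. \<i> * (of_real r * cis t)) has_vector_derivative \<i> * cis t) (at r within S)" for r t S
    by (intro has_vector_derivative_mult_right of_real_times_derivative)
  show "((\<lambda>r. bl0 a b \<delta> w r t) has_vector_derivative bl1 a b \<delta> w r t) (at r within {a..b})" for r t
    unfolding bl0_def bl1_def
    by (intro has_vector_derivative_add has_vector_derivative_mult has_vector_derivative_diff dc dw of_real_times_derivative)
  show "((\<lambda>t. bl0 a b \<delta> w r t) has_vector_derivative bl2 a b \<delta> w r t) (at t)" for r t
    unfolding bl0_def bl2_def
    by (intro has_vector_derivative_add has_vector_derivative_mult_right has_vector_derivative_diff dw ci)
  show "((\<lambda>t. bl1 a b \<delta> w r t) has_vector_derivative bl12 a b \<delta> w r t) (at t)" for r t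
    unfolding bl1_def bl12_def
    by (intro has_vector_derivative_add has_vector_derivative_mult_right has_vector_derivative_diff dw ci cis_vector_derivative)
  show "((\<lambda>r. bl2 a b \<delta> w r t) has_vector_derivative bl12 a b \<delta> w r t) (at r within {a..b})" if "a \<le> r" "r \<le> b" for r t
    unfolding bl2_def bl12_def
    by (intro has_vector_derivative_add has_vector_derivative_mult has_vector_derivative_diff dc dw(6)[OF that] ri)
  show "bl0 a b \<delta> w r (t + 2*pi) = bl0 a b \<delta> w r t" "bl1 a b \<delta> w r (t + 2*pi) = bl1 a b \<delta> w r t"
    "bl2 a b \<delta> w r (t + 2*pi) = bl2 a b \<delta> w r t" for r t
    unfolding bl0_def bl1_def bl2_def cpx_periodic by (simp_all add: cis.ctr)
  show "bl0 a b \<delta> w a t = of_real a * cis t" "bl0 a b \<delta> w b t = of_real b * cis t" for t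
    by (simp_all add: bl0_def cutoff_boundary[OF \<delta>])
qed

text \<open>The Cauchy-Schwarz inequality against constants, from the nonnegativity of the variance
  of f on the interval.\<close>

lemma integral_square_le:
  fixes f :: "real \<Rightarrow> real"
  assumes "p < q" "continuous_on {p..q} f"
  shows "(integral {p..q} f)^2 \<le> (q - p) * integral {p..q} (\<lambda>x. (f x)^2)"
proof -
  define m where "m = integral {p..q} f / (q - p)"
  have i: "f integrable_on {p..q}" "(\<lambda>x. (f x)^2) integrable_on {p..q}"
    by (intro integrable_continuous_real continuous_intros assms)+
  have "0 \<le> integral {p..q} (\<lambda>x. (f x - m)^2)"
    by (intro integral_nonneg integrable_continuous_real continuous_intros assms) auto
  also have "integral {p..q} (\<lambda>x. (f x - m)^2) = integral {p..q} (\<lambda>x. (f x)^2 - 2 * m * f x + m^2)"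
    by (intro integral_cong) (simp add: power2_eq_square algebra_simps)
  also have "\<dots> = integral {p..q} (\<lambda>x. (f x)^2) - 2 * m * integral {p..q} f + m^2 * (q - p)"
  proof (rule integral_unique)
    have "((\<lambda>x. (f x)^2 - 2 * m * f x + m^2) has_integral
        integral {p..q} (\<lambda>x. (f x)^2) - 2 * m * integral {p..q} f + measure lborel {p..q} *\<^sub>R m\<^sup>2) {p..q}"
      using i by (intro has_integral_add has_integral_diff has_integral_mult_right has_integral_const_real integrable_integral)
        auto
    then show "((\<lambda>x. (f x)^2 - 2 * m * f x + m^2) has_integral
        integral {p..q} (\<lambda>x. (f x)^2) - 2 * m * integral {p..q} f + m^2 * (q - p)) {p..q}"
      using assms(1) by (simp add: mult.commute)
  qed
  also have "\<dots> = integral {p..q} (\<lambda>x. (f x)^2) - (integral {p..q} f)^2 / (q - p)"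
  proof -
    have "m * (q - p) = integral {p..q} f" using assms(1) by (simp add: m_def)
    then have "m^2 * (q - p) = m * integral {p..q} f" by (simp add: power2_eq_square mult.assoc)
    moreover have "m * integral {p..q} f = (integral {p..q} f)^2 / (q - p)" by (simp add: m_def power2_eq_square)
    ultimately show ?thesis by (simp add: algebra_simps)
  qed
  finally show ?thesis using assms(1) by (simp add: field_simps)
qed

lemma norm_add_square:
  fixes x y :: "'a::real_normed_vector"
  shows "(norm (x + y))^2 \<le> 2 * (norm x)^2 + 2 * (norm y)^2"
proof -
  have "(norm (x + y))^2 \<le> (norm x + norm y)^2" by (intro power_mono norm_triangle_ineq) auto
  also have "\<dots> \<le> 2 * (norm x)^2 + 2 * (norm y)^2"
    using zero_le_power2[of "norm x - norm y"] by (simp add: power2_eq_square algebra_simps)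
  finally show ?thesis .
qed

lemma increment_square_le:
  fixes f f' :: "real \<Rightarrow> complex"
  assumes pq: "p < q" and d: "\<And>r. p \<le> r \<Longrightarrow> r \<le> q \<Longrightarrow> (f has_vector_derivative f' r) (at r within {p..q})"
    and c': "continuous_on {p..q} f'" and r: "p \<le> r" "r \<le> s" "s \<le> q"
  shows "(cmod (f s - f r))^2 \<le> (q - p) * integral {p..q} (\<lambda>x. (cmod (f' x))^2)"
proof -
  have "(f' has_integral f s - f r) {r..s}"
    using r by (intro fundamental_theorem_of_calculus) (auto intro: has_vector_derivative_within_subset[OF d])
  moreover have c: "continuous_on {r..s} f'" by (rule continuous_on_subset[OF c']) (use r in auto)
  ultimately have "cmod (f s - f r) \<le> integral {r..s} (\<lambda>x. cmod (f' x))"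
    using integral_norm_bound_integral[OF integrable_continuous_real[OF c], of "\<lambda>x. cmod (f' x)"]
    by (simp add: integral_unique integrable_continuous_real continuous_on_norm c)
  also have "\<dots> \<le> integral {p..q} (\<lambda>x. cmod (f' x))"
    using r by (intro integral_subset_le integrable_continuous_real continuous_intros c c') auto
  finally have "(cmod (f s - f r))^2 \<le> (integral {p..q} (\<lambda>x. cmod (f' x)))^2" by (intro power_mono) auto
  also have "\<dots> \<le> (q - p) * integral {p..q} (\<lambda>x. (cmod (f' x))^2)"
    by (intro integral_square_le pq continuous_intros c')
  finally show ?thesis .
qed

text \<open>The value at \<open>r\<close> is the one on the chosen side plus an increment controlled
  by Cauchy-Schwarz along the ray. Integration over a strip of width q - p gives a further factor q
  - p, just enough to offset the squared slope of the cut-off.\<close>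

lemma poincare_strip:
  fixes d d' :: "real \<Rightarrow> real \<Rightarrow> complex"
  assumes pq: "p < q" and c: "c = p \<or> c = q" and cd: "cont_rect p q d" "cont_rect p q d'"
    and der: "\<And>r t. p \<le> r \<Longrightarrow> r \<le> q \<Longrightarrow> ((\<lambda>r. d r t) has_vector_derivative d' r t) (at r within {p..q})"
  shows "rect_int p q (\<lambda>r t. (cmod (d r t))^2)
    \<le> (q - p) * (2 * integral {0..2*pi} (\<lambda>t. (cmod (d c t))^2) + 2 * (q - p) * rect_int p q (\<lambda>r t. (cmod (d' r t))^2))"
proof -
  define I where "I t = integral {p..q} (\<lambda>r. (cmod (d' r t))^2)" for t
  have cI: "continuous_on S I" for S
    unfolding I_def by (intro cont_rect_integral1 cont_rects cd) (use pq in auto)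
  have cc: "continuous_on S (\<lambda>t. d c t)" for S by (rule cont_rect_slice2[OF cd(1)]) (use c pq in auto)
  have "rect_int p q (\<lambda>r t. (cmod (d r t))^2) \<le> rect_int p q (\<lambda>r t. 2 * (cmod (d c t))^2 + 2 * (q - p) * I t)"
  proof (rule rect_int_mono)
    show "cont_rect p q (\<lambda>r t. (cmod (d r t))^2)" by (intro cont_rects cd)
    show "cont_rect p q (\<lambda>r t. 2 * (cmod (d c t))^2 + 2 * (q - p) * I t)"
      by (intro cont_rect_snd continuous_intros cI cc)
    fix r t assume r: "p \<le> r" "r \<le> q"
    have inc: "(cmod (d s t - d u t))^2 \<le> (q - p) * I t" if "p \<le> u" "u \<le> s" "s \<le> q" for s u
      unfolding I_def using that der by (intro increment_square_le pq cont_rect_slice1[OF cd(2)]) auto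
    have "(cmod (d r t - d c t))^2 \<le> (q - p) * I t"
      using c
    proof
      assume "c = p" then show ?thesis using inc[of p r] r by simp
    next
      assume "c = q" then show ?thesis using inc[of r q] r by (simp add: norm_minus_commute)
    qed
    then show "(cmod (d r t))^2 \<le> 2 * (cmod (d c t))^2 + 2 * (q - p) * I t"
      using norm_add_square[of "d c t" "d r t - d c t"] by (simp only: add_diff_cancel_left' mult.assoc[of 2 "q - p"] add.commute[of "d c t"] diff_add_cancel)
  qed
  also have "\<dots> = (q - p) * integral {0..2*pi} (\<lambda>t. 2 * (cmod (d c t))^2 + 2 * (q - p) * I t)"
    using pq by (subst rect_int_rt) (auto intro!: cont_rect_snd continuous_intros cI cc)
  finally have "rect_int p q (\<lambda>r t. (cmod (d r t))^2)
    \<le> (q - p) * integral {0..2*pi} (\<lambda>t. 2 * (cmod (d c t))^2 + 2 * (q - p) * I t)" .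
  moreover have "integral {0..2*pi} (\<lambda>t. 2 * (cmod (d c t))^2 + 2 * (q - p) * I t)
      = 2 * integral {0..2*pi} (\<lambda>t. (cmod (d c t))^2) + 2 * (q - p) * integral {0..2*pi} I"
    by (simp add: integral_add integrable_continuous_real continuous_intros cI cc)
  moreover have "integral {0..2*pi} I = rect_int p q (\<lambda>r t. (cmod (d' r t))^2)"
    unfolding I_def by (rule rect_int_tr[symmetric]) (intro cont_rects cd)
  ultimately show ?thesis by simp
qed

abbreviation shell :: "(real^2 \<Rightarrow> real^2) \<Rightarrow> real \<Rightarrow> real \<Rightarrow> real" where
  "shell w r t \<equiv> (cmod (cmb rad w r t - cis t))^2 + (cmod (cmb ang w r t - \<i> * (of_real r * cis t)))^2"

definition blend_err :: "real \<Rightarrow> real \<Rightarrow> real \<Rightarrow> (real^2 \<Rightarrow> real^2) \<Rightarrow> real" where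
  "blend_err a b \<delta> w = rect_int a b (\<lambda>r t. sq2 (bl1 a b \<delta> w r t - cmb rad w r t) (bl2 a b \<delta> w r t - cmb ang w r t))"

text \<open>Only the two shells contribute. There the squared slope of the cut-off is at most 4 /
  \<delta>^2, and \<open>poincare_strip\<close> bounds the distance to the identity by boundary
  values D and derivatives S: 8 / \<delta>^2 times \<delta> (2 D + 2 \<delta> S), plus 2 S, is 16 /
  \<delta> D + 18 S.\<close>

lemma blend_err_bound:
  assumes w: "smooth_map w" and a: "0 < a" and \<delta>: "0 < \<delta>" "2 * \<delta> \<le> b - a"
  shows "blend_err a b \<delta> w \<le>
     16 / \<delta> * integral {0..2*pi} (\<lambda>t. (cmod (cpx w a t - of_real a * cis t))^2)
     + 16 / \<delta> * integral {0..2*pi} (\<lambda>t. (cmod (cpx w b t - of_real b * cis t))^2)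
     + 18 * rect_int a (a + \<delta>) (shell w) + 18 * rect_int (b - \<delta>) b (shell w)"
proof -
  define d where "d r t = cpx w r t - of_real r * cis t" for r t
  define d1 where "d1 r t = cmb rad w r t - cis t" for r t
  define d2 where "d2 r t = cmb ang w r t - \<i> * (of_real r * cis t)" for r t
  define f where "f r t = sq2 (bl1 a b \<delta> w r t - cmb rad w r t) (bl2 a b \<delta> w r t - cmb ang w r t)" for r t
  have cd: "cont_rect p q d" "cont_rect p q d1" "cont_rect p q d2" for p q
    unfolding d_def[abs_def] d1_def[abs_def] d2_def[abs_def] by (rule shell_conts[OF w])+
  interpret polar_map a b "bl0 a b \<delta> w" "bl1 a b \<delta> w" "bl2 a b \<delta> w" "bl12 a b \<delta> w"
    by (rule blend_polar_map[OF w a \<delta>])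
  have cf: "cont_rect a b f"
    unfolding f_def[abs_def] by (intro cont_rects conts cpx_cont[OF w])
  have der: "((\<lambda>r. d r t) has_vector_derivative d1 r t) (at r within S)" for r t S
    unfolding d_def d1_def by (intro has_vector_derivative_diff cpx_derivatives[OF w] of_real_times_derivative)
  have e: "bl1 a b \<delta> w r t - cmb rad w r t = of_real (cutoff' a b \<delta> r) * d r t + of_real (cutoff a b \<delta> r - 1) * d1 r t"
    "bl2 a b \<delta> w r t - cmb ang w r t = of_real (cutoff a b \<delta> r - 1) * d2 r t" for r t
    by (simp_all add: bl1_def bl2_def d_def d1_def d2_def algebra_simps)
  have mid: "f r t = 0" if "a + \<delta> \<le> r" "r \<le> b - \<delta>" for r t
    unfolding f_def e using cutoff_middle[OF that] by simp
  have bd: "f r t \<le> 8 / \<delta>^2 * (cmod (d r t))^2 + 2 * shell w r t"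
    if "a \<le> r" "r \<le> b" "r \<le> a + \<delta> \<or> b - \<delta> \<le> r" for r t
  proof -
    have s: "(cutoff' a b \<delta> r)^2 \<le> (2 / \<delta>)^2" "(cutoff a b \<delta> r - 1)^2 \<le> 1^2"
      using cutoff_shell[OF \<delta> that] \<delta> by (auto simp: abs_le_square_iff[symmetric] simp del: power_one one_power2)
    have "(cmod (of_real (cutoff' a b \<delta> r) * d r t + of_real (cutoff a b \<delta> r - 1) * d1 r t))^2
      \<le> 2 * ((cutoff' a b \<delta> r)^2 * (cmod (d r t))^2) + 2 * ((cutoff a b \<delta> r - 1)^2 * (cmod (d1 r t))^2)"
      using norm_add_square[of "of_real (cutoff' a b \<delta> r) * d r t" "of_real (cutoff a b \<delta> r - 1) * d1 r t"]
      by (simp only: norm_mult norm_of_real power_mult_distrib power2_abs)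
    also have "\<dots> \<le> 2 * ((2 / \<delta>)^2 * (cmod (d r t))^2) + 2 * (1^2 * (cmod (d1 r t))^2)"
      by (intro add_mono mult_left_mono mult_right_mono s) auto
    finally have 1: "(cmod (of_real (cutoff' a b \<delta> r) * d r t + of_real (cutoff a b \<delta> r - 1) * d1 r t))^2
      \<le> 8 / \<delta>^2 * (cmod (d r t))^2 + 2 * (cmod (d1 r t))^2" by (simp add: power_divide)
    have 2: "(cutoff a b \<delta> r - 1)^2 * (cmod (d2 r t))^2 \<le> 1^2 * (cmod (d2 r t))^2"
      by (intro mult_right_mono s) auto
    have 3: "(cmod (of_real (cutoff a b \<delta> r - 1) * d2 r t))^2 = (cutoff a b \<delta> r - 1)^2 * (cmod (d2 r t))^2"
      by (simp only: norm_mult norm_of_real power_mult_distrib power2_abs)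
    have 4: "1^2 * (cmod (d2 r t))^2 \<le> 2 * (cmod (d2 r t))^2" by simp
    have "(cmod (of_real (cutoff a b \<delta> r - 1) * d2 r t))^2 \<le> 2 * (cmod (d2 r t))^2"
      by (rule order_trans[OF eq_refl[OF 3] order_trans[OF 2 4]])
    then show ?thesis using 1 unfolding f_def e by (simp add: d1_def d2_def)
  qed
  have shell: "rect_int p q f \<le> 16 / \<delta> * integral {0..2*pi} (\<lambda>t. (cmod (d c t))^2) + 18 * rect_int p q (shell w)"
    if p: "a \<le> p" "q \<le> b" "q = p + \<delta>" and r: "\<And>r. p \<le> r \<Longrightarrow> r \<le> q \<Longrightarrow> r \<le> a + \<delta> \<or> b - \<delta> \<le> r" and c: "c = p \<or> c = q" for p q c
  proof -
    have cs: "cont_rect p q (shell w)"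
      by (intro cont_rects shell_conts w)
    have c2: "cont_rect p q (\<lambda>r t. (cmod (d r t))^2)" "cont_rect p q (\<lambda>r t. (cmod (d1 r t))^2)" by (intro cont_rects cd)+
    define D S where "D = integral {0..2*pi} (\<lambda>t. (cmod (d c t))^2)" and "S = rect_int p q (shell w)"
    have "rect_int p q f \<le> rect_int p q (\<lambda>r t. 8 / \<delta>^2 * (cmod (d r t))^2 + 2 * shell w r t)"
      using p r by (intro rect_int_mono cont_rect_subset[OF cf] cont_rects cd bd cpx_cont w cis_cont_rect) auto
    moreover have "rect_int p q (\<lambda>r t. 8 / \<delta>^2 * (cmod (d r t))^2 + 2 * shell w r t)
        = 8 / \<delta>^2 * rect_int p q (\<lambda>r t. (cmod (d r t))^2) + 2 * S"
      unfolding S_def rect_int_cmult[symmetric] by (rule rect_int_add) (intro cont_rects cs c2)+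
    moreover have "8 / \<delta>^2 * rect_int p q (\<lambda>r t. (cmod (d r t))^2) \<le> 8 / \<delta>^2 * (\<delta> * (2 * D + 2 * \<delta> * S))"
    proof (intro mult_left_mono)
      have "rect_int p q (\<lambda>r t. (cmod (d r t))^2) \<le> \<delta> * (2 * D + 2 * \<delta> * rect_int p q (\<lambda>r t. (cmod (d1 r t))^2))"
        using poincare_strip[of p q c d d1, OF _ c cd(1,2) der] p \<delta> unfolding D_def by simp
      moreover have "rect_int p q (\<lambda>r t. (cmod (d1 r t))^2) \<le> S"
        unfolding S_def by (intro rect_int_mono c2 cs) (simp add: d1_def)
      then have "\<delta> * (2 * D + 2 * \<delta> * rect_int p q (\<lambda>r t. (cmod (d1 r t))^2)) \<le> \<delta> * (2 * D + 2 * \<delta> * S)"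
        using \<delta> by (intro mult_left_mono add_mono) auto
      ultimately show "rect_int p q (\<lambda>r t. (cmod (d r t))^2) \<le> \<delta> * (2 * D + 2 * \<delta> * S)" by linarith
    qed simp
    ultimately have "rect_int p q f \<le> 8 / \<delta>^2 * (\<delta> * (2 * D + 2 * \<delta> * S)) + 2 * S" by linarith
    moreover have "8 / \<delta>^2 * (\<delta> * (2 * D + 2 * \<delta> * S)) = 16 / \<delta> * D + 16 * S"
      using \<delta> by (simp add: field_simps power2_eq_square)
    ultimately show ?thesis unfolding D_def S_def by linarith
  qed
  have "blend_err a b \<delta> w = rect_int a (a + \<delta>) f + (rect_int (a + \<delta>) (b - \<delta>) f + rect_int (b - \<delta>) b f)"
    unfolding blend_err_def f_def[symmetric] using \<delta>
    by (simp add: rect_int_combine[OF cf, of "a + \<delta>"] rect_int_combine[OF cont_rect_subset[OF cf], of "a + \<delta>" b "b - \<delta>"])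
  moreover have "rect_int (a + \<delta>) (b - \<delta>) f = rect_int (a + \<delta>) (b - \<delta>) (\<lambda>r t. 0)"
    by (intro rect_int_cong mid)
  moreover have "rect_int (a + \<delta>) (b - \<delta>) (\<lambda>r t. 0) = 0" by (simp add: rect_int_def)
  ultimately show ?thesis
    using shell[of a "a + \<delta>" a] shell[of "b - \<delta>" b b] \<delta> unfolding d_def by simp
qed

lemma cont_rect_shell: "smooth_map w \<Longrightarrow> cont_rect p q (shell w)"
  by (intro cont_rects shell_conts)

section \<open>Diagonal choice of shell widths and approximants\<close>

context trace_seq
begin

abbreviation "\<kappa> \<equiv> max b (1 / a)"

lemma weight_bounds:
  assumes "a \<le> r" "r \<le> b" "0 \<le> p" "0 \<le> q"
  shows "p + q \<le> \<kappa> * (r * p + q / r)" "r * p + q / r \<le> \<kappa> * (p + q)"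
proof -
  have r: "0 < r" using assms a by simp
  have "1 = (1 / a) * a" using a by simp
  also have "\<dots> \<le> \<kappa> * r" using assms a by (intro mult_mono) auto
  finally have 1: "1 \<le> \<kappa> * r" .
  have "r \<le> \<kappa>" using assms by simp
  then have 2: "1 \<le> \<kappa> / r" using r by simp
  have 3: "r \<le> \<kappa>" using assms by simp
  have "1 / r \<le> 1 / a" using assms a by (simp add: field_simps)
  then have 4: "1 / r \<le> \<kappa>" by simp
  have "1 * p + 1 * q \<le> (\<kappa> * r) * p + (\<kappa> / r) * q" using 1 2 assms by (intro add_mono mult_right_mono) auto
  then show "p + q \<le> \<kappa> * (r * p + q / r)" by (simp add: distrib_left mult.assoc)
  have "r * p + (1 / r) * q \<le> \<kappa> * p + \<kappa> * q" using 3 4 assms by (intro add_mono mult_right_mono) auto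
  then show "r * p + q / r \<le> \<kappa> * (p + q)" by (simp add: distrib_left)
qed

lemma energy_dist:
  assumes "cont_rect a b f" "cont_rect a b g"
  shows "rect_int a b (\<lambda>r t. sq2 (f r t) (g r t)) \<le> \<kappa> * rect_int a b (\<lambda>r t. wsq r (f r t) (g r t))"
    "rect_int a b (\<lambda>r t. wsq r (f r t) (g r t)) \<le> \<kappa> * rect_int a b (\<lambda>r t. sq2 (f r t) (g r t))"
proof -
  have c: "cont_rect a b (\<lambda>r t. sq2 (f r t) (g r t))"
    "cont_rect a b (\<lambda>r t. wsq r (f r t) (g r t))"
    by (intro cont_rects assms; use a in simp)+
  show "rect_int a b (\<lambda>r t. sq2 (f r t) (g r t)) \<le> \<kappa> * rect_int a b (\<lambda>r t. wsq r (f r t) (g r t))"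
    "rect_int a b (\<lambda>r t. wsq r (f r t) (g r t)) \<le> \<kappa> * rect_int a b (\<lambda>r t. sq2 (f r t) (g r t))"
    unfolding rect_int_cmult[symmetric]
    by (intro rect_int_mono c cont_rects weight_bounds; simp)+
qed

abbreviation "ldist m n \<equiv> rect_int a b (\<lambda>r t. sq2 (W1 m r t - W1 n r t) (W2 m r t - W2 n r t))"

lemma W_cont: "cont_rect p q (W n)" "cont_rect p q (W1 n)" "cont_rect p q (W2 n)"
  by (rule cpx_cont[OF w])+

lemma kappa_pos: "0 < \<kappa>" using a ab by (simp add: less_max_iff_disj)

lemma seq_ldist:
  assumes "0 < \<epsilon>"
  shows "\<exists>M. \<forall>m\<ge>M. \<forall>n\<ge>M. ldist m n < \<epsilon>"
proof -
  have "0 < \<epsilon> / \<kappa>" using assms kappa_pos by simp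
  from seq_Cauchy[OF this] obtain M where M: "\<And>m n. m \<ge> M \<Longrightarrow> n \<ge> M \<Longrightarrow>
    rect_int a b (\<lambda>r t. wsq r (W1 m r t - W1 n r t) (W2 m r t - W2 n r t)) < \<epsilon> / \<kappa>" by blast
  have "ldist m n < \<epsilon>" if "m \<ge> M" "n \<ge> M" for m n
  proof -
    have "ldist m n \<le> \<kappa> * rect_int a b (\<lambda>r t. wsq r (W1 m r t - W1 n r t) (W2 m r t - W2 n r t))"
      by (intro energy_dist cont_rects W_cont)
    also have "\<dots> < \<kappa> * (\<epsilon> / \<kappa>)" using M[OF that] kappa_pos by (intro mult_strict_left_mono)
    finally show ?thesis using kappa_pos by simp
  qed
  then show ?thesis by blast
qed

text \<open>The boundary values converge only in \<open>L\<^sup>2\<close>, so the width of the shell has to be chosen before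
  the index of the approximant.\<close>

lemma blend_err_small:
  assumes \<epsilon>: "0 < \<epsilon>"
  shows "\<exists>\<delta>0>0. \<forall>\<delta>. 0 < \<delta> \<and> \<delta> \<le> \<delta>0 \<and> 2 * \<delta> \<le> b - a \<longrightarrow> (\<exists>M. \<forall>n\<ge>M. blend_err a b \<delta> (w n) < \<epsilon>)"
proof -
  obtain n0 where n0: "\<And>n. n \<ge> n0 \<Longrightarrow> ldist n n0 < \<epsilon> / 720"
    using seq_ldist[of "\<epsilon> / 720"] \<epsilon> by auto
  obtain B where B: "0 < B" "\<And>r t. a \<le> r \<Longrightarrow> r \<le> b \<Longrightarrow> 0 \<le> t \<Longrightarrow> t \<le> 2 * pi \<Longrightarrow> norm (shell (w n0) r t) \<le> B"
    using cont_rect_bounded[OF cont_rect_shell[OF w[of n0]], of a b 0 "2 * pi"] by blast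
  \<comment> \<open>A shell of this width has so little area that the bounded quantity
    \<open>shell (w n0)\<close> integrates to at most \<epsilon> / 720; later approximants stay
    close to the member \<open>n0\<close> in L2.\<close>
  define \<delta>0 where "\<delta>0 = \<epsilon> / (720 * (2 * pi * B))"
  have \<delta>0: "0 < \<delta>0" using \<epsilon> B by (simp add: \<delta>0_def)
  have "\<exists>M. \<forall>n\<ge>M. blend_err a b \<delta> (w n) < \<epsilon>" if \<delta>: "0 < \<delta>" "\<delta> \<le> \<delta>0" "2 * \<delta> \<le> b - a" for \<delta>
  proof -
    \<comment> \<open>Each of the four terms of \<open>blend_err_bound\<close> is to be at most
      \<epsilon> / 10: 16 / \<delta> times \<epsilon> \<delta> / 160 for the boundary values, and 18
      times \<epsilon> / 180 for the shells, where \<epsilon> / 180 is four times \<epsilon> /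
      720.\<close>
    have e\<delta>: "0 < \<epsilon> * \<delta> / 160" using \<epsilon> \<delta> by simp
    obtain Ma where Ma: "\<And>n. n \<ge> Ma \<Longrightarrow> integral {0..2*pi} (\<lambda>t. (cmod (W n a t - of_real a * cis t))^2) < \<epsilon> * \<delta> / 160"
      using seq_boundary[of a, OF _ e\<delta>] by auto
    obtain Mb where Mb: "\<And>n. n \<ge> Mb \<Longrightarrow> integral {0..2*pi} (\<lambda>t. (cmod (W n b t - of_real b * cis t))^2) < \<epsilon> * \<delta> / 160"
      using seq_boundary[of b, OF _ e\<delta>] by auto
    have sh: "rect_int p q (shell (w n)) \<le> \<epsilon> / 180" if p: "a \<le> p" "q \<le> b" "q = p + \<delta>" and n: "n \<ge> n0" for p q n
    proof -
      let ?d = "\<lambda>r t. sq2 (W1 n r t - W1 n0 r t) (W2 n r t - W2 n0 r t)"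
      have cd: "cont_rect p q ?d" for p q by (intro cont_rects W_cont)
      have "rect_int p q (shell (w n)) \<le> rect_int p q (\<lambda>r t. 2 * ?d r t + 2 * shell (w n0) r t)"
      proof (intro rect_int_mono cont_rect_shell w cont_rects W_cont cis_cont_rect)
        fix r t
        show "shell (w n) r t \<le> 2 * ?d r t + 2 * shell (w n0) r t"
          using norm_add_square[of "W1 n r t - W1 n0 r t" "W1 n0 r t - cis t"]
            norm_add_square[of "W2 n r t - W2 n0 r t" "W2 n0 r t - \<i> * (of_real r * cis t)"] by simp
      qed
      moreover have "rect_int p q (\<lambda>r t. 2 * ?d r t + 2 * shell (w n0) r t) = 2 * rect_int p q ?d + 2 * rect_int p q (shell (w n0))"
        unfolding rect_int_cmult[symmetric]
        by (rule rect_int_add) (intro cont_rects W_cont cis_cont_rect)+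
      moreover have "rect_int p q ?d \<le> rect_int a b ?d"
      proof -
        have "0 \<le> rect_int a p ?d" "0 \<le> rect_int q b ?d" by (intro rect_int_nonneg cd; simp)+
        moreover have "rect_int a b ?d = rect_int a p ?d + (rect_int p q ?d + rect_int q b ?d)"
          using p \<delta> by (simp add: rect_int_combine[OF cd, of a p b] rect_int_combine[OF cd, of p q b])
        ultimately show ?thesis by simp
      qed
      moreover have "rect_int a b ?d < \<epsilon> / 720" using n0[OF n] .
      moreover have "rect_int p q (shell (w n0)) \<le> \<delta> * (2 * pi * B)"
      proof -
        have "rect_int p q (shell (w n0)) \<le> rect_int p q (\<lambda>r t. B)"
          unfolding rect_int_def
        proof (rule integral_le)
          show "(\<lambda>x. shell (w n0) (fst x) (snd x)) integrable_on cbox (p, 0) (q, 2 * pi)"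
            by (intro cont_rect_integrable cont_rect_shell w)
          show "(\<lambda>x :: real \<times> real. B) integrable_on cbox (p, 0) (q, 2 * pi)"
            by (intro integrable_continuous continuous_intros)
          show "shell (w n0) (fst x) (snd x) \<le> B" if "x \<in> cbox (p, 0) (q, 2 * pi)" for x
          proof -
            have "norm (shell (w n0) (fst x) (snd x)) \<le> B"
              using p that by (intro B) (auto simp: cbox_Pair_eq)
            then show ?thesis by simp
          qed
        qed
        also have "\<dots> = \<delta> * (2 * pi * B)" using p \<delta> by (simp add: rect_int_const)
        finally show ?thesis .
      qed
      moreover have "\<delta> * (2 * pi * B) \<le> \<epsilon> / 720"
      proof -
        have "\<delta> * (2 * pi * B) \<le> \<delta>0 * (2 * pi * B)" using \<delta> B by (intro mult_right_mono) auto
        also have "\<dots> = \<epsilon> / 720" using B by (simp add: \<delta>0_def)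
        finally show ?thesis .
      qed
      ultimately show ?thesis by linarith
    qed
    have "blend_err a b \<delta> (w n) < \<epsilon>" if n: "n \<ge> max n0 (max Ma Mb)" for n
    proof -
      have i: "16 / \<delta> * I < \<epsilon> / 10" if "I < \<epsilon> * \<delta> / 160" for I
        using that \<delta> by (simp add: field_simps)
      show ?thesis
        using blend_err_bound[OF w a \<delta>(1,3), of n] i[OF Ma[of n]] i[OF Mb[of n]] sh[of a "a + \<delta>" n] sh[of "b - \<delta>" b n] \<delta> n \<epsilon>
        by auto
    qed
    then show ?thesis by blast
  qed
  with \<delta>0 show ?thesis by blast
qed

lemma blended_sequence:
  assumes G0: "AE x in \<Omega>. 0 \<le> det (G x)"
  obtains \<sigma> \<delta> where "filterlim \<sigma> at_top sequentially" "\<delta> \<longlonglongrightarrow> 0"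
    "\<And>j. 0 < \<delta> j" "\<And>j. 2 * \<delta> j \<le> b - a"
    "\<And>j. blend_err a b (\<delta> j) (w (\<sigma> j)) < inverse (real (Suc j))"
proof -
  have "\<exists>\<delta> n. 0 < \<delta> \<and> 2 * \<delta> \<le> b - a \<and> \<delta> \<le> inverse (real (Suc j)) \<and> j \<le> n \<and> blend_err a b \<delta> (w n) < inverse (real (Suc j))" for j
  proof -
    obtain \<delta>0 where \<delta>0: "0 < \<delta>0" "\<And>\<delta>. 0 < \<delta> \<Longrightarrow> \<delta> \<le> \<delta>0 \<Longrightarrow> 2 * \<delta> \<le> b - a \<Longrightarrow> \<exists>M. \<forall>n\<ge>M. blend_err a b \<delta> (w n) < inverse (real (Suc j))"
      using blend_err_small[of "inverse (real (Suc j))"] by auto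
    define \<delta> where "\<delta> = min \<delta>0 (min (inverse (real (Suc j))) ((b - a) / 2))"
    have \<delta>: "0 < \<delta>" "\<delta> \<le> \<delta>0" "\<delta> \<le> inverse (real (Suc j))" "2 * \<delta> \<le> b - a"
    proof -
      show "0 < \<delta>" "\<delta> \<le> \<delta>0" "\<delta> \<le> inverse (real (Suc j))" using \<delta>0(1) ab by (auto simp: \<delta>_def)
      have "\<delta> \<le> (b - a) / 2" unfolding \<delta>_def by (intro min.coboundedI2 order_refl)
      then show "2 * \<delta> \<le> b - a" by simp
    qed
    then obtain M where "\<And>n. n \<ge> M \<Longrightarrow> blend_err a b \<delta> (w n) < inverse (real (Suc j))" using \<delta>0(2)[of \<delta>] by (auto simp: mult.commute)
    then have "blend_err a b \<delta> (w (max M j)) < inverse (real (Suc j))" by simp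
    with \<delta> show ?thesis by (intro exI[of _ \<delta>] exI[of _ "max M j"]) auto
  qed
  then obtain \<delta> \<sigma> where j: "\<And>j. 0 < \<delta> j \<and> 2 * \<delta> j \<le> b - a \<and> \<delta> j \<le> inverse (real (Suc j)) \<and> j \<le> \<sigma> j \<and> blend_err a b (\<delta> j) (w (\<sigma> j)) < inverse (real (Suc j))"
    by metis
  show thesis
  proof
    show "filterlim \<sigma> at_top sequentially"
      by (rule filterlim_at_top_mono[OF filterlim_ident]) (use j in auto)
    show "\<delta> \<longlonglongrightarrow> 0"
      by (rule tendsto_sandwich[OF _ _ tendsto_const LIMSEQ_inverse_real_of_nat]) (use j in \<open>auto intro!: always_eventually less_imp_le\<close>)
  qed (use j in auto)
qed

end

text \<open>The outcome of the diagonal choice: the maps \<open>z j\<close> have exact boundary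
  values, and their derivatives share the L2 limit of those of \<open>w\<close>.\<close>

locale blended_seq = trace_seq +
  fixes \<sigma> :: "nat \<Rightarrow> nat" and \<delta> :: "nat \<Rightarrow> real"
  assumes \<sigma>: "filterlim \<sigma> at_top sequentially" and \<delta>0: "\<delta> \<longlonglongrightarrow> 0"
    and \<delta>: "\<And>j. 0 < \<delta> j" "\<And>j. 2 * \<delta> j \<le> b - a"
    and err: "\<And>j. blend_err a b (\<delta> j) (w (\<sigma> j)) < inverse (real (Suc j))"
    and G0: "AE x in \<Omega>. 0 \<le> det (G x)"
begin

abbreviation "z j \<equiv> bl0 a b (\<delta> j) (w (\<sigma> j))"
abbreviation "z1 j \<equiv> bl1 a b (\<delta> j) (w (\<sigma> j))"
abbreviation "z2 j \<equiv> bl2 a b (\<delta> j) (w (\<sigma> j))"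
abbreviation "z12 j \<equiv> bl12 a b (\<delta> j) (w (\<sigma> j))"

lemma maps: "polar_map a b (z j) (z1 j) (z2 j) (z12 j)"
  by (rule blend_polar_map[OF w a \<delta>])

lemma z_cont: "cont_rect a b (z1 j)" "cont_rect a b (z2 j)"
  using polar_map.conts[OF maps] by auto

lemma \<sigma>_large: "\<exists>J. \<forall>j\<ge>J. M \<le> \<sigma> j"
  using \<sigma> unfolding filterlim_at_top eventually_sequentially by blast

lemma err_small: "0 < \<epsilon> \<Longrightarrow> \<exists>J. \<forall>j\<ge>J. blend_err a b (\<delta> j) (w (\<sigma> j)) < \<epsilon>"
proof -
  assume "0 < \<epsilon>"
  then obtain J where "inverse (real (Suc J)) < \<epsilon>" using reals_Archimedean by blast
  moreover have "inverse (real (Suc j)) \<le> inverse (real (Suc J))" if "J \<le> j" for j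
    using that by (simp add: divide_simps)
  ultimately show ?thesis using err by (meson less_trans le_less_trans less_imp_le)
qed

abbreviation "zdist m n \<equiv> rect_int a b (\<lambda>r t. sq2 (z1 m r t - z1 n r t) (z2 m r t - z2 n r t))"

lemma zdist_bound:
  "zdist m n \<le> 3 * blend_err a b (\<delta> m) (w (\<sigma> m)) + 3 * ldist (\<sigma> m) (\<sigma> n) + 3 * blend_err a b (\<delta> n) (w (\<sigma> n))"
proof -
  have c: "cont_rect a b (\<lambda>r t. sq2 (z1 j r t - W1 (\<sigma> j) r t) (z2 j r t - W2 (\<sigma> j) r t))" for j
    by (intro cont_rects z_cont W_cont)
  have c2: "cont_rect a b (\<lambda>r t. sq2 (W1 (\<sigma> m) r t - W1 (\<sigma> n) r t) (W2 (\<sigma> m) r t - W2 (\<sigma> n) r t))"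
    by (intro cont_rects W_cont)
  have "zdist m n \<le> rect_int a b (\<lambda>r t. 3 * (sq2 (z1 m r t - W1 (\<sigma> m) r t) (z2 m r t - W2 (\<sigma> m) r t))
      + 3 * (sq2 (W1 (\<sigma> m) r t - W1 (\<sigma> n) r t) (W2 (\<sigma> m) r t - W2 (\<sigma> n) r t))
      + 3 * (sq2 (z1 n r t - W1 (\<sigma> n) r t) (z2 n r t - W2 (\<sigma> n) r t)))"
  proof (intro rect_int_mono cont_rects z_cont W_cont)
    fix r t
    show "sq2 (z1 m r t - z1 n r t) (z2 m r t - z2 n r t)
      \<le> 3 * (sq2 (z1 m r t - W1 (\<sigma> m) r t) (z2 m r t - W2 (\<sigma> m) r t))
      + 3 * (sq2 (W1 (\<sigma> m) r t - W1 (\<sigma> n) r t) (W2 (\<sigma> m) r t - W2 (\<sigma> n) r t))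
      + 3 * (sq2 (z1 n r t - W1 (\<sigma> n) r t) (z2 n r t - W2 (\<sigma> n) r t))"
      using norm_add3_square[of "z1 m r t - W1 (\<sigma> m) r t" "W1 (\<sigma> m) r t - W1 (\<sigma> n) r t" "W1 (\<sigma> n) r t - z1 n r t"]
        norm_add3_square[of "z2 m r t - W2 (\<sigma> m) r t" "W2 (\<sigma> m) r t - W2 (\<sigma> n) r t" "W2 (\<sigma> n) r t - z2 n r t"]
        norm_minus_commute[of "W1 (\<sigma> n) r t" "z1 n r t"] norm_minus_commute[of "W2 (\<sigma> n) r t" "z2 n r t"] by simp
  qed
  also have "\<dots> = 3 * blend_err a b (\<delta> m) (w (\<sigma> m)) + 3 * ldist (\<sigma> m) (\<sigma> n) + 3 * blend_err a b (\<delta> n) (w (\<sigma> n))"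
    unfolding blend_err_def rect_int_cmult[symmetric]
    by (subst rect_int_add, (intro cont_rects z_cont W_cont)+)+ simp
  finally show ?thesis .
qed

text \<open>The Jacobian is quadratic in the pair of derivatives. This pair is regarded as one point
  of a product space, so that \<open>norm_square_diff_bound\<close> bounds the change of the
  Jacobian by the blending error; the Jacobian of the approximants themselves is handled by
  \<open>seq_neg_det\<close>.\<close>

lemma neg_Jac_lim: "(\<lambda>n. polar_map.neg_Jac a b (z1 n) (z2 n)) \<longlonglongrightarrow> 0"
proof (rule LIMSEQ_I)
  fix \<epsilon> :: real assume \<epsilon>: "0 < \<epsilon>"
  have \<gamma>1: "0 \<le> \<kappa> * (\<gamma> + 1)" using \<gamma> kappa_pos by (intro mult_nonneg_nonneg) auto
  obtain s d where sd: "0 < s" "0 < d" "s * (\<kappa> * (\<gamma> + 1)) + (1 + 1 / s) * d < \<epsilon> / 2"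
    using small_parameter[OF \<gamma>1, of "\<epsilon> / 2"] \<epsilon> by auto
  obtain M1 where M1: "\<And>n. n \<ge> M1 \<Longrightarrow> \<bar>rect_int a b (\<lambda>r t. wsq r (W1 n r t) (W2 n r t)) - \<gamma>\<bar> < 1"
    using seq_energy[of 1] by auto
  obtain M2 where M2: "\<And>n. n \<ge> M2 \<Longrightarrow> rect_int a b (\<lambda>r t. max 0 (- Im (cnj (W1 n r t) * W2 n r t))) < \<epsilon> / 2"
    using seq_neg_det[OF G0, of "\<epsilon> / 2"] \<epsilon> by auto
  obtain J1 where J1: "\<And>j. j \<ge> J1 \<Longrightarrow> max M1 M2 \<le> \<sigma> j" using \<sigma>_large by blast
  obtain J2 where J2: "\<And>j. j \<ge> J2 \<Longrightarrow> blend_err a b (\<delta> j) (w (\<sigma> j)) < d" using err_small[OF sd(2)] by blast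
  have "norm (polar_map.neg_Jac a b (z1 j) (z2 j) - 0) < \<epsilon>" if j: "j \<ge> max J1 J2" for j
  proof -
    define n where "n = \<sigma> j"
    have n: "n \<ge> M1" "n \<ge> M2" using J1[of j] j by (auto simp: n_def)
    have cn: "cont_rect a b (\<lambda>r t. max 0 (- Im (cnj (W1 n r t) * W2 n r t)))"
      "cont_rect a b (\<lambda>r t. sq2 (W1 n r t) (W2 n r t))"
      "cont_rect a b (\<lambda>r t. sq2 (z1 j r t - W1 n r t) (z2 j r t - W2 n r t))"
      by (intro cont_rects W_cont z_cont)+
    have Wb: "rect_int a b (\<lambda>r t. sq2 (W1 n r t) (W2 n r t)) \<le> \<kappa> * (\<gamma> + 1)"
    proof (rule order_trans[OF energy_dist(1)])
      show "\<kappa> * rect_int a b (\<lambda>r t. wsq r (W1 n r t) (W2 n r t)) \<le> \<kappa> * (\<gamma> + 1)"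
        using M1[OF n(1)] kappa_pos by (intro mult_left_mono) auto
    qed (rule W_cont)+
    have "polar_map.neg_Jac a b (z1 j) (z2 j) = rect_int a b (\<lambda>r t. max 0 (- Im (cnj (z1 j r t) * z2 j r t)))"
      by (simp add: polar_map.neg_Jac_def[OF maps] polar_map.Jac_def[OF maps])
    also have "\<dots> \<le> rect_int a b (\<lambda>r t. max 0 (- Im (cnj (W1 n r t) * W2 n r t))
        + (s * (sq2 (W1 n r t) (W2 n r t)) + (1 + 1 / s) * (sq2 (z1 j r t - W1 n r t) (z2 j r t - W2 n r t))))"
    proof (intro rect_int_mono cont_rects z_cont W_cont)
      fix r t
      define x y where "x = (z1 j r t, z2 j r t)" and "y = (W1 n r t, W2 n r t)"
      have "\<bar>Im (cnj (z1 j r t) * z2 j r t) - Im (cnj (W1 n r t) * W2 n r t)\<bar>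
          = \<bar>Im (cnj (z1 j r t - W1 n r t) * z2 j r t) + Im (cnj (W1 n r t) * (z2 j r t - W2 n r t))\<bar>"
        by (simp add: algebra_simps)
      also have "\<dots> \<le> cmod (z1 j r t - W1 n r t) * cmod (z2 j r t) + cmod (W1 n r t) * cmod (z2 j r t - W2 n r t)"
        using Im_cnj_mult_bound[of "z1 j r t - W1 n r t" "z2 j r t"] Im_cnj_mult_bound[of "W1 n r t" "z2 j r t - W2 n r t"] by linarith
      also have "\<dots> \<le> norm (x - y) * norm x + norm y * norm (x - y)"
        unfolding x_def y_def diff_Pair by (intro add_mono mult_mono norm_fst_le norm_snd_le norm_ge_zero)
      also have "\<dots> = norm (x - y) * (norm x + norm y)" by (simp add: algebra_simps)
      also have "\<dots> \<le> s * (norm y)^2 + (1 + 1 / s) * (norm (x - y))^2" by (rule norm_square_diff_bound(1)[OF sd(1)])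
      finally have "\<bar>Im (cnj (z1 j r t) * z2 j r t) - Im (cnj (W1 n r t) * W2 n r t)\<bar>
        \<le> s * (sq2 (W1 n r t) (W2 n r t)) + (1 + 1 / s) * (sq2 (z1 j r t - W1 n r t) (z2 j r t - W2 n r t))"
        by (simp add: x_def y_def norm_Pair)
      then show "max 0 (- Im (cnj (z1 j r t) * z2 j r t)) \<le> max 0 (- Im (cnj (W1 n r t) * W2 n r t))
        + (s * (sq2 (W1 n r t) (W2 n r t)) + (1 + 1 / s) * (sq2 (z1 j r t - W1 n r t) (z2 j r t - W2 n r t)))"
        by linarith
    qed
    also have "\<dots> = rect_int a b (\<lambda>r t. max 0 (- Im (cnj (W1 n r t) * W2 n r t)))
        + (s * rect_int a b (\<lambda>r t. sq2 (W1 n r t) (W2 n r t)) + (1 + 1 / s) * blend_err a b (\<delta> j) (w n))"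
    proof -
      have "blend_err a b (\<delta> j) (w n) = rect_int a b (\<lambda>r t. sq2 (z1 j r t - W1 n r t) (z2 j r t - W2 n r t))"
        by (simp add: blend_err_def n_def)
      moreover have "cont_rect a b (\<lambda>r t. s * (sq2 (W1 n r t) (W2 n r t)))"
        "cont_rect a b (\<lambda>r t. (1 + 1 / s) * (sq2 (z1 j r t - W1 n r t) (z2 j r t - W2 n r t)))"
        by (intro cont_rect_arith(3) cont_rect_const cn)+
      ultimately show ?thesis
        by (simp only: rect_int_add[OF cn(1) cont_rect_arith(1)] rect_int_add rect_int_cmult)
    qed
    also have "\<dots> < \<epsilon> / 2 + (s * (\<kappa> * (\<gamma> + 1)) + (1 + 1 / s) * d)"
    proof (intro add_less_le_mono add_mono mult_left_mono Wb M2 n)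
      show "blend_err a b (\<delta> j) (w n) \<le> d" using J2[of j] j by (simp add: n_def)
    qed (use sd in auto)
    also have "\<dots> < \<epsilon>" using sd(3) by linarith
    finally have lt: "polar_map.neg_Jac a b (z1 j) (z2 j) < \<epsilon>" .
    have "0 \<le> polar_map.neg_Jac a b (z1 j) (z2 j)"
      unfolding polar_map.neg_Jac_def[OF maps] by (intro rect_int_nonneg cont_rects polar_map.Jac_cont[OF maps]) simp
    with lt show ?thesis by simp
  qed
  then show "\<exists>no. \<forall>n\<ge>no. norm (polar_map.neg_Jac a b (z1 n) (z2 n) - 0) < \<epsilon>" by blast
qed

sublocale S: polar_map_seq a b z z1 z2 z12
proof (rule polar_map_seq.intro)
  show "polar_map a b (z n) (z1 n) (z2 n) (z12 n)" for n by (rule maps)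
  show "\<exists>M. \<forall>m\<ge>M. \<forall>n\<ge>M. zdist m n < \<epsilon>" if \<epsilon>: "0 < \<epsilon>" for \<epsilon>
  proof -
    obtain M where M: "\<And>m n. m \<ge> M \<Longrightarrow> n \<ge> M \<Longrightarrow> ldist m n < \<epsilon> / 9"
      using seq_ldist[of "\<epsilon> / 9"] \<epsilon> by auto
    obtain J1 where J1: "\<And>j. j \<ge> J1 \<Longrightarrow> M \<le> \<sigma> j" using \<sigma>_large by blast
    obtain J2 where J2: "\<And>j. j \<ge> J2 \<Longrightarrow> blend_err a b (\<delta> j) (w (\<sigma> j)) < \<epsilon> / 9" using err_small[of "\<epsilon> / 9"] \<epsilon> by auto
    have "zdist m n < \<epsilon>" if "m \<ge> max J1 J2" "n \<ge> max J1 J2" for m n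
      using zdist_bound[of m n] M[OF J1 J1, of m n] J2[of m] J2[of n] that by auto
    then show ?thesis by blast
  qed
qed (rule neg_Jac_lim)

lemma energy_upper:
  assumes \<epsilon>: "0 < \<epsilon>"
  shows "\<exists>M. \<forall>j\<ge>M. polar_map.energy a b (z1 j) (z2 j) \<le> \<gamma> / 2 + \<epsilon>"
proof -
  have \<gamma>1: "0 \<le> \<gamma> + 1" using \<gamma> by simp
  obtain s d where sd: "0 < s" "0 < d" "s * (\<gamma> + 1) + (1 + 1 / s) * d < \<epsilon>"
    using small_parameter[OF \<gamma>1 \<epsilon>] by auto
  obtain M1 where M1: "\<And>n. n \<ge> M1 \<Longrightarrow> \<bar>rect_int a b (\<lambda>r t. wsq r (W1 n r t) (W2 n r t)) - \<gamma>\<bar> < min 1 \<epsilon>"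
    using seq_energy[of "min 1 \<epsilon>"] \<epsilon> by auto
  obtain J1 where J1: "\<And>j. j \<ge> J1 \<Longrightarrow> M1 \<le> \<sigma> j" using \<sigma>_large by blast
  have dk: "0 < d / \<kappa>" using sd kappa_pos by simp
  obtain J2 where J2: "\<And>j. j \<ge> J2 \<Longrightarrow> blend_err a b (\<delta> j) (w (\<sigma> j)) < d / \<kappa>" using err_small[OF dk] by blast
  have "polar_map.energy a b (z1 j) (z2 j) \<le> \<gamma> / 2 + \<epsilon>" if j: "j \<ge> max J1 J2" for j
  proof -
    define n where "n = \<sigma> j"
    define EW where "EW = rect_int a b (\<lambda>r t. wsq r (W1 n r t) (W2 n r t))"
    define ED where "ED = rect_int a b (\<lambda>r t. wsq r (z1 j r t - W1 n r t) (z2 j r t - W2 n r t))"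
    have EW: "\<bar>EW - \<gamma>\<bar> < min 1 \<epsilon>" unfolding EW_def by (rule M1) (use J1[of j] j in \<open>auto simp: n_def\<close>)
    have ED: "ED \<le> d"
    proof -
      have "ED \<le> \<kappa> * blend_err a b (\<delta> j) (w n)"
        unfolding ED_def blend_err_def n_def by (intro energy_dist cont_rects z_cont W_cont)
      also have "\<dots> \<le> \<kappa> * (d / \<kappa>)" using J2[of j] j kappa_pos by (intro mult_left_mono) (auto simp: n_def)
      finally show ?thesis using kappa_pos by simp
    qed
    have cW: "cont_rect a b (\<lambda>r t. wsq r (W1 n r t) (W2 n r t))"
      "cont_rect a b (\<lambda>r t. wsq r (z1 j r t - W1 n r t) (z2 j r t - W2 n r t))"
      "cont_rect a b (\<lambda>r t. wsq r (z1 j r t) (z2 j r t))"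
      by (intro cont_rects W_cont z_cont; use a in simp)+
    have "2 * polar_map.energy a b (z1 j) (z2 j) = rect_int a b (\<lambda>r t. wsq r (z1 j r t) (z2 j r t))"
      by (simp add: polar_map.energy_def[OF maps])
    also have "\<dots> \<le> rect_int a b (\<lambda>r t. (1 + s) * (wsq r (W1 n r t) (W2 n r t))
        + (1 + 1 / s) * (wsq r (z1 j r t - W1 n r t) (z2 j r t - W2 n r t)))"
    proof (rule rect_int_mono)
      show "cont_rect a b (\<lambda>r t. (1 + s) * (wsq r (W1 n r t) (W2 n r t))
        + (1 + 1 / s) * (wsq r (z1 j r t - W1 n r t) (z2 j r t - W2 n r t)))"
        by (intro cont_rect_arith(1) cont_rect_arith(3) cont_rect_const cW)
      fix r t assume r: "a \<le> r" "r \<le> b"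
      have n1: "(cmod (z1 j r t))^2 \<le> (1 + s) * (cmod (W1 n r t))^2 + (1 + 1 / s) * (cmod (z1 j r t - W1 n r t))^2"
        "(cmod (z2 j r t))^2 \<le> (1 + s) * (cmod (W2 n r t))^2 + (1 + 1 / s) * (cmod (z2 j r t - W2 n r t))^2"
        using norm_square_diff_bound(2)[OF sd(1), of "z1 j r t" "W1 n r t"] norm_square_diff_bound(2)[OF sd(1), of "z2 j r t" "W2 n r t"]
        unfolding distrib_right[of 1 s] mult_1 by linarith+
      have "r * (cmod (z1 j r t))^2 + (1 / r) * (cmod (z2 j r t))^2
        \<le> r * ((1 + s) * (cmod (W1 n r t))^2 + (1 + 1 / s) * (cmod (z1 j r t - W1 n r t))^2)
          + (1 / r) * ((1 + s) * (cmod (W2 n r t))^2 + (1 + 1 / s) * (cmod (z2 j r t - W2 n r t))^2)"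
        using r a by (intro add_mono mult_left_mono n1) auto
      then show "wsq r (z1 j r t) (z2 j r t) \<le> (1 + s) * (wsq r (W1 n r t) (W2 n r t))
        + (1 + 1 / s) * (wsq r (z1 j r t - W1 n r t) (z2 j r t - W2 n r t))"
        by (simp add: algebra_simps add_divide_distrib)
    qed (rule cW)
    also have "\<dots> = (1 + s) * EW + (1 + 1 / s) * ED"
      unfolding EW_def ED_def rect_int_cmult[symmetric]
      by (intro rect_int_add cont_rect_arith(3) cont_rect_const cW)
    also have "\<dots> \<le> EW + (s * (\<gamma> + 1) + (1 + 1 / s) * d)"
    proof -
      have "s * EW \<le> s * (\<gamma> + 1)" using EW sd by (intro mult_left_mono) auto
      moreover have "(1 + 1 / s) * ED \<le> (1 + 1 / s) * d" using ED sd by (intro mult_left_mono) auto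
      ultimately show ?thesis unfolding distrib_right[of 1 s] mult_1 by linarith
    qed
    also have "\<dots> \<le> \<gamma> + 2 * \<epsilon>" using EW sd(3) by linarith
    finally show ?thesis by simp
  qed
  then show ?thesis by blast
qed

end

subsection \<open>Winding along the rays\<close>

text \<open>The curve equals its initial value times the exponential of the integral of q1 / q: the
  quotient has derivative zero. The imaginary part of the exponent is the increment of the
  angle.\<close>

lemma ray_angle:
  fixes q q1 :: "real \<Rightarrow> complex"
  assumes ab: "a < b" and R: "0 < R" and d: "\<And>r. a \<le> r \<Longrightarrow> r \<le> b \<Longrightarrow> (q has_vector_derivative q1 r) (at r within {a..b})"
    and c1: "continuous_on {a..b} q1" and q0: "\<And>r. a \<le> r \<Longrightarrow> r \<le> b \<Longrightarrow> q r \<noteq> 0" and qa: "q a = of_real R * cis t"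
    and r: "a \<le> r" "r \<le> b"
  shows "sgn (q r) = cis (t + integral {a..r} (\<lambda>r. Im (cnj (q r) * q1 r) / (cmod (q r))^2))"
proof -
  have c: "continuous_on {a..b} q"
    using d by (meson atLeastAtMost_iff continuous_on_eq_continuous_within has_vector_derivative_continuous)
  have cq: "continuous_on {a..b} (\<lambda>r. q1 r / q r)" by (intro continuous_intros c c1) (use q0 in auto)
  define L where "L r = integral {a..r} (\<lambda>r. q1 r / q r)" for r
  have dL: "(L has_vector_derivative q1 r / q r) (at r within {a..b})" if "a \<le> r" "r \<le> b" for r
    unfolding L_def[abs_def] by (rule integral_has_vector_derivative[OF cq]) (use that in auto)
  have dE: "((\<lambda>r. q r * exp (- L r)) has_vector_derivative 0) (at r within {a..b})" if "a \<le> r" "r \<le> b" for r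
  proof -
    have e: "((\<lambda>r. exp (- L r)) has_vector_derivative - (q1 r / q r) * exp (- L r)) (at r within {a..b})"
      using field_vector_diff_chain_within[OF has_vector_derivative_minus[OF dL[OF that]] DERIV_subset[OF DERIV_exp subset_UNIV]]
      by (simp add: o_def mult.commute)
    have "((\<lambda>r. q r * exp (- L r)) has_vector_derivative q r * (- (q1 r / q r) * exp (- L r)) + q1 r * exp (- L r)) (at r within {a..b})"
      by (rule has_vector_derivative_mult[OF d[OF that] e])
    then show ?thesis using q0[OF that] by simp
  qed
  obtain k where k: "\<And>x. x \<in> {a..b} \<Longrightarrow> q x * exp (- L x) = k"
    using has_vector_derivative_zero_constant[of "{a..b}" "\<lambda>r. q r * exp (- L r)"] dE by auto
  have "k = q a" using k[of a] ab by (simp add: L_def)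
  then have "q r * exp (- L r) = of_real R * cis t" using k[of r] r qa by simp
  then have "q r = of_real R * cis t * exp (L r)" by (simp add: exp_minus field_simps)
  also have "\<dots> = of_real (R * exp (Re (L r))) * cis (t + Im (L r))"
    by (simp add: exp_eq_polar[of "L r"] cis_mult[symmetric] exp_of_real[symmetric])
  finally have qr: "q r = of_real (R * exp (Re (L r))) * cis (t + Im (L r))" .
  have "sgn (q r) = cis (t + Im (L r))"
    unfolding qr using R by (simp add: sgn_mult sgn_div_norm[of "cis _"] sgn_of_real del: of_real_mult)
  moreover have "Im (L r) = integral {a..r} (\<lambda>r. Im (cnj (q r) * q1 r) / (cmod (q r))^2)"
  proof -
    have "(\<lambda>r. q1 r / q r) integrable_on {a..r}"
      by (intro integrable_continuous_real continuous_on_subset[OF cq]) (use r in auto)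
    from integral_linear[OF this bounded_linear_Im] have "Im (L r) = integral {a..r} (\<lambda>r. Im (q1 r / q r))"
      by (simp add: L_def o_def)
    moreover have "Im (x / y) = Im (cnj y * x) / (cmod y)^2" for x y
      by (simp add: Im_divide cmod_power2 algebra_simps)
    ultimately show ?thesis by simp
  qed
  ultimately show ?thesis by simp
qed

lemma sgn_diff_less:
  fixes x y :: complex
  assumes "2 * c \<le> cmod y" "cmod (x - y) < c"
  shows "cmod (sgn x - sgn y) < 1" "c \<le> cmod x"
proof -
  have c: "0 < c" using assms(2) norm_ge_zero[of "x - y"] by linarith
  then have y: "0 < cmod y" using assms by linarith
  have xy: "\<bar>cmod x - cmod y\<bar> \<le> cmod (x - y)" by (rule norm_triangle_ineq3)
  show x: "c \<le> cmod x" using assms xy by linarith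
  then have x0: "0 < cmod x" using c by linarith
  have "cmod (sgn x - x /\<^sub>R cmod y) = \<bar>cmod y - cmod x\<bar> / cmod y"
  proof -
    have "sgn x - x /\<^sub>R cmod y = ((cmod y - cmod x) / (cmod x * cmod y)) *\<^sub>R x"
      using x0 y by (simp add: sgn_div_norm scaleR_left_diff_distrib[symmetric] field_simps)
    then show ?thesis using x0 y by (simp add: abs_mult)
  qed
  moreover have "cmod (x /\<^sub>R cmod y - sgn y) = cmod (x - y) / cmod y"
  proof -
    have "x /\<^sub>R cmod y - sgn y = (x - y) /\<^sub>R cmod y" by (simp add: sgn_div_norm scaleR_right_diff_distrib)
    then show ?thesis using y by (simp add: divide_inverse mult.commute)
  qed
  ultimately have "cmod (sgn x - sgn y) \<le> (\<bar>cmod y - cmod x\<bar> + cmod (x - y)) / cmod y"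
    using norm_triangle_ineq[of "sgn x - x /\<^sub>R cmod y" "x /\<^sub>R cmod y - sgn y"] by (simp add: add_divide_distrib)
  also have "\<dots> < 1" using xy assms y by simp
  finally show "cmod (sgn x - sgn y) < 1" .
qed

text \<open>After normalisation the two loops stay less than one apart on the unit circle, hence
  wind equally often around the origin. For \<open>q\<close> the winding number is the increment of
  the angle from \<open>ray_angle\<close>, because the normalised curve is the exponential of an
  explicit lift.\<close>

lemma ray_winding:
  fixes q q1 \<zeta> :: "real \<Rightarrow> complex"
  assumes ab: "a < b" and a: "0 < a" and d: "\<And>r. a \<le> r \<Longrightarrow> r \<le> b \<Longrightarrow> (q has_vector_derivative q1 r) (at r within {a..b})"
    and c1: "continuous_on {a..b} q1" and ends: "q a = of_real a * cis t" "q b = of_real b * cis t"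
    and \<zeta>: "continuous_on {a..b} \<zeta>" "\<And>r. a \<le> r \<Longrightarrow> r \<le> b \<Longrightarrow> 2 * c \<le> cmod (\<zeta> r)"
      "sgn (\<zeta> a) = sgn (\<zeta> b)" "winding_number ((\<lambda>r. sgn (\<zeta> r)) \<circ> linepath a b) 0 = of_int N"
    and near: "\<And>r. a \<le> r \<Longrightarrow> r \<le> b \<Longrightarrow> cmod (q r - \<zeta> r) < c"
  shows "integral {a..b} (\<lambda>r. Im (cnj (q r) * q1 r) / (cmod (q r))^2) = 2 * pi * of_int N"
proof -
  have c: "0 < c" using near[of a] ab norm_ge_zero[of "q a - \<zeta> a"] by linarith
  have q0: "q r \<noteq> 0" if "a \<le> r" "r \<le> b" for r using sgn_diff_less(2)[OF \<zeta>(2) near, OF that that] c by auto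
  have \<zeta>0: "\<zeta> r \<noteq> 0" if "a \<le> r" "r \<le> b" for r using \<zeta>(2)[OF that] c by auto
  have cq: "continuous_on {a..b} q"
    using d by (meson atLeastAtMost_iff continuous_on_eq_continuous_within has_vector_derivative_continuous)
  have lp: "linepath a b x \<in> {a..b}" if "x \<in> {0..1}" for x
    using linepath_in_path[OF that, of a b] ab by (simp add: closed_segment_eq_real_ivl)
  have path: "path ((\<lambda>r. sgn (f r)) \<circ> linepath a b)" if "continuous_on {a..b} f" "\<And>r. a \<le> r \<Longrightarrow> r \<le> b \<Longrightarrow> f r \<noteq> 0" for f :: "real \<Rightarrow> complex"
  proof -
    have "continuous_on {a..b} (\<lambda>r. sgn (f r))"
      unfolding sgn_div_norm by (intro continuous_intros that) (use that(2) in auto)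
    from continuous_on_compose2[OF this continuous_on_linepath[of "{0..1}" a b]] show ?thesis
      unfolding path_def comp_def using lp by blast
  qed
  define I where "I r = integral {a..r} (\<lambda>r. Im (cnj (q r) * q1 r) / (cmod (q r))^2)" for r
  have cI: "continuous_on {a..b} I"
    unfolding I_def by (intro indefinite_integral_continuous_1 integrable_continuous_real continuous_intros cq c1) (use q0 in auto)
  have sq: "sgn (q r) = cis (t + I r)" if "a \<le> r" "r \<le> b" for r
    unfolding I_def by (rule ray_angle[OF ab a d c1 q0 ends(1) that])
  have "winding_number ((\<lambda>r. sgn (q r)) \<circ> linepath a b) 0 = of_int N"
    unfolding \<zeta>(4)[symmetric]
  proof (rule winding_number_nearby_loops_eq)
    show "norm (((\<lambda>r. sgn (q r)) \<circ> linepath a b) s - ((\<lambda>r. sgn (\<zeta> r)) \<circ> linepath a b) s)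
        < norm (((\<lambda>r. sgn (\<zeta> r)) \<circ> linepath a b) s - 0)" if "s \<in> {0..1}" for s
      using lp[OF that] sgn_diff_less(1)[OF \<zeta>(2) near, of "linepath a b s"] \<zeta>0 by (simp add: norm_sgn)
    show "pathfinish ((\<lambda>r. sgn (q r)) \<circ> linepath a b) = pathstart ((\<lambda>r. sgn (q r)) \<circ> linepath a b)"
      using ends a ab by (simp add: pathfinish_def pathstart_def sgn_mult linepath_def sgn_of_real)
    show "pathfinish ((\<lambda>r. sgn (\<zeta> r)) \<circ> linepath a b) = pathstart ((\<lambda>r. sgn (\<zeta> r)) \<circ> linepath a b)"
      using \<zeta>(3) by (simp add: pathfinish_def pathstart_def linepath_def)
  qed (intro path cq \<zeta> q0 \<zeta>0; simp)+
  moreover have "winding_number ((\<lambda>r. sgn (q r)) \<circ> linepath a b) 0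
      = winding_number (exp \<circ> (\<lambda>s. \<i> * of_real (t + I (linepath a b s)))) 0"
  proof (rule winding_number_cong)
    fix s :: real assume "0 \<le> s" "s \<le> 1"
    then have "linepath a b s \<in> {a..b}" by (intro lp) auto
    then show "((\<lambda>r. sgn (q r)) \<circ> linepath a b) s = (exp \<circ> (\<lambda>s. \<i> * of_real (t + I (linepath a b s)))) s"
      by (simp add: sq cis_conv_exp)
  qed
  moreover have "winding_number (exp \<circ> (\<lambda>s. \<i> * of_real (t + I (linepath a b s)))) 0
      = (\<i> * of_real (t + I b) - \<i> * of_real (t + I a)) / (2 * of_real pi * \<i>)"
  proof -
    have "path (\<lambda>s. \<i> * of_real (t + I (linepath a b s)))"
      unfolding path_def by (intro continuous_intros continuous_on_compose2[OF cI]) (use lp in auto)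
    from winding_number_compose_exp[OF this] show ?thesis by (simp add: pathfinish_def pathstart_def linepath_def)
  qed
  moreover have "I a = 0" by (simp add: I_def)
  moreover have "(\<i> * of_real (t + I b) - \<i> * of_real (t + 0)) / (2 * of_real pi * \<i>) = complex_of_real (I b) / (2 * of_real pi)"
    by (simp add: field_simps)
  ultimately have "complex_of_real (I b) / (2 * of_real pi) = of_int N" by simp
  then have "complex_of_real (I b) = of_real (2 * pi * of_int N)" by (simp add: field_simps)
  then show ?thesis unfolding I_def by (simp only: of_real_eq_iff)
qed

lemma AE_eq_continuous:
  fixes f g :: "real \<Rightarrow> complex"
  assumes ab: "a < b" and c: "continuous_on {a..b} f" "continuous_on {a..b} g"
    and ae: "AE r in lebesgue_on {a<..<b}. f r = g r" and r: "r \<in> {a..b}"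
  shows "f r = g r"
proof -
  have inn: "f r = g r" if "r \<in> {a<..<b}" for r
  proof (rule ccontr)
    assume ne: "f r \<noteq> g r"
    have "AE r in lebesgue. r \<in> {a<..<b} \<longrightarrow> f r = g r" using ae by (simp add: AE_restrict_space_iff)
    from AE_negligible[OF this] have neg: "negligible {r. \<not> (r \<in> {a<..<b} \<longrightarrow> f r = g r)}" .
    have "continuous_on {a<..<b} (\<lambda>r. f r - g r)"
      by (intro continuous_intros continuous_on_subset[OF c(1)] continuous_on_subset[OF c(2)]) auto
    then have "open ({a<..<b} \<inter> (\<lambda>r. f r - g r) -` (- {0}))"
      by (rule continuous_open_preimage) auto
    moreover have "r \<in> {a<..<b} \<inter> (\<lambda>r. f r - g r) -` (- {0})" using that ne by simp
    ultimately have "\<not> negligible ({a<..<b} \<inter> (\<lambda>r. f r - g r) -` (- {0}))"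
      using open_not_negligible by blast
    moreover have "{a<..<b} \<inter> (\<lambda>r. f r - g r) -` (- {0}) \<subseteq> {r. \<not> (r \<in> {a<..<b} \<longrightarrow> f r = g r)}" by auto
    ultimately show False using neg negligible_subset by blast
  qed
  have "continuous_on (closure {a<..<b}) (\<lambda>r. f r - g r)"
    using ab by (simp add: continuous_intros c)
  from continuous_constant_on_closure[OF this, of 0 r] show ?thesis using ab r by (simp add: inn)
qed

section \<open>Uniform convergence along almost every ray\<close>

context polar_map_seq
begin

lemma subsequence:
  assumes "strict_mono \<tau>"
  shows "polar_map_seq a b (\<lambda>j. z (\<tau> j)) (\<lambda>j. z1 (\<tau> j)) (\<lambda>j. z2 (\<tau> j)) (\<lambda>j. z12 (\<tau> j))"
proof (rule polar_map_seq.intro)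
  show "\<exists>M. \<forall>m\<ge>M. \<forall>n\<ge>M. dist2 (\<tau> m) (\<tau> n) < \<epsilon>" if \<epsilon>: "0 < \<epsilon>" for \<epsilon>
  proof -
    obtain M where M: "\<And>m n. m \<ge> M \<Longrightarrow> n \<ge> M \<Longrightarrow> dist2 m n < \<epsilon>" using Cauchy[OF \<epsilon>] by blast
    have "dist2 (\<tau> m) (\<tau> n) < \<epsilon>" if "m \<ge> M" "n \<ge> M" for m n
      using that seq_suble[OF assms, of m] seq_suble[OF assms, of n] by (intro M) linarith+
    then show ?thesis by blast
  qed
  show "(\<lambda>j. polar_map.neg_Jac a b (z1 (\<tau> j)) (z2 (\<tau> j))) \<longlonglongrightarrow> 0"
    using LIMSEQ_subseq_LIMSEQ[OF neg assms] by (simp add: o_def)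
qed (rule maps)

text \<open>Along a subsequence with squared distances below 8^-j, the sum of 4^j times the ray
  integrals \<open>S j\<close> has finite integral over the circle. For almost every angle
  \<open>S j\<close> is thus of order 4^-j, and since all maps agree at r = \<open>a\<close>,
  Cauchy-Schwarz along the ray bounds their successive differences by a geometric series.\<close>

lemma rays_converge:
  "\<exists>\<tau>. strict_mono \<tau> \<and> (AE t in lebesgue_on {0..2*pi}. \<exists>\<zeta>. continuous_on {a..b} \<zeta> \<and>
     uniform_limit {a..b} (\<lambda>j r. z (\<tau> j) r t) \<zeta> sequentially)"
proof -
  have "\<forall>j. \<exists>M. \<forall>m\<ge>M. \<forall>n\<ge>M. dist2 m n < (1 / 8) ^ j" by (intro allI Cauchy) simp
  from choice[OF this] obtain M where M: "\<And>j m n. m \<ge> M j \<Longrightarrow> n \<ge> M j \<Longrightarrow> dist2 m n < (1 / 8) ^ j" by blast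
  \<comment> \<open>The summand j makes the sequence strictly increasing, and the partial sums put
    both \<tau> j and \<tau> (j + 1) beyond \<open>M j\<close>.\<close>
  define \<tau> where "\<tau> j = j + (\<Sum>i\<le>j. M i)" for j
  have \<tau>: "strict_mono \<tau>" by (rule strict_monoI_Suc) (simp add: \<tau>_def)
  have \<tau>M: "M j \<le> \<tau> j" "M j \<le> \<tau> (Suc j)" for j
  proof -
    have 1: "M j \<le> (\<Sum>i\<le>j. M i)" by (cases j) simp_all
    then show "M j \<le> \<tau> j" unfolding \<tau>_def by (rule trans_le_add2)
    have "(\<Sum>i\<le>j. M i) \<le> (\<Sum>i\<le>Suc j. M i)" by simp
    with 1 have "M j \<le> (\<Sum>i\<le>Suc j. M i)" by (rule order_trans)
    then show "M j \<le> \<tau> (Suc j)" unfolding \<tau>_def by (rule trans_le_add2)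
  qed
  have fast: "dist2 (\<tau> (Suc j)) (\<tau> j) < (1 / 8) ^ j" for j by (intro M \<tau>M)
  define S where "S j t = integral {a..b} (\<lambda>r. (cmod (z1 (\<tau> (Suc j)) r t - z1 (\<tau> j) r t))^2)" for j t
  have c: "cont_rect a b (\<lambda>r t. (cmod (z1 (\<tau> (Suc j)) r t - z1 (\<tau> j) r t))^2)" for j
    by (intro cont_rects seq_conts)
  have cS: "continuous_on T (S j)" for j T unfolding S_def using ab by (intro cont_rect_integral1 c) auto
  have S0: "0 \<le> S j t" for j t
    unfolding S_def by (intro integral_nonneg integrable_continuous_real cont_rect_slice1[OF c]) auto
  have IS: "integral {0..2*pi} (S j) \<le> (1 / 8) ^ j" for j
  proof -
    have "integral {0..2*pi} (S j) = rect_int a b (\<lambda>r t. (cmod (z1 (\<tau> (Suc j)) r t - z1 (\<tau> j) r t))^2)"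
      unfolding S_def by (rule rect_int_tr[OF c, symmetric])
    also have "\<dots> \<le> dist2 (\<tau> (Suc j)) (\<tau> j)"
      by (intro rect_int_mono cont_rects seq_conts) auto
    finally show ?thesis using fast[of j] by simp
  qed
  have nn: "(\<integral>\<^sup>+t. ennreal (4 ^ j * S j t) \<partial>lebesgue_on {0..2*pi}) \<le> ennreal ((1 / 2) ^ j)" for j
  proof -
    have "((\<lambda>t. 4 ^ j * S j t) has_integral 4 ^ j * integral {0..2*pi} (S j)) {0..2*pi}"
      by (intro has_integral_mult_right integrable_integral integrable_continuous_real cS)
    then have "(\<integral>\<^sup>+t. ennreal (4 ^ j * S j t) * indicator {0..2*pi} t \<partial>lborel) = ennreal (4 ^ j * integral {0..2*pi} (S j))"
      by (intro nn_integral_has_integral_lebesgue') (auto simp: S0)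
    moreover have "4 ^ j * integral {0..2*pi} (S j) \<le> 4 ^ j * (1 / 8) ^ j" using IS by (intro mult_left_mono) auto
    moreover have "(4::real) ^ j * (1 / 8) ^ j = (1 / 2) ^ j" by (simp add: power_mult_distrib[symmetric])
    ultimately show ?thesis
      by (simp add: nn_integral_restrict_space nn_integral_completion ennreal_leI)
  qed
  have mS: "(\<lambda>t. ennreal (4 ^ j * S j t)) \<in> borel_measurable (lebesgue_on {0..2*pi})" for j
  proof -
    have "(\<lambda>t. 4 ^ j * S j t) \<in> borel_measurable (lebesgue_on {0..2*pi})"
      by (intro continuous_imp_measurable_on_sets_lebesgue continuous_intros cS) auto
    then show ?thesis by measurable
  qed
  have "(\<integral>\<^sup>+t. (\<Sum>j. ennreal (4 ^ j * S j t)) \<partial>lebesgue_on {0..2*pi}) = (\<Sum>j. \<integral>\<^sup>+t. ennreal (4 ^ j * S j t) \<partial>lebesgue_on {0..2*pi})"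
    by (rule nn_integral_suminf[OF mS])
  also have "\<dots> \<le> (\<Sum>j. ennreal ((1 / 2) ^ j))" by (intro suminf_le nn) auto
  also have "\<dots> = ennreal (\<Sum>j. (1 / 2) ^ j)" by (intro suminf_ennreal2) auto
  finally have "(\<integral>\<^sup>+t. (\<Sum>j. ennreal (4 ^ j * S j t)) \<partial>lebesgue_on {0..2*pi}) \<noteq> \<infinity>" by (metis ennreal_neq_top infinity_ennreal_def neq_top_trans)
  then have "AE t in lebesgue_on {0..2*pi}. (\<Sum>j. ennreal (4 ^ j * S j t)) \<noteq> \<infinity>"
    by (intro nn_integral_PInf_AE borel_measurable_suminf_order mS)
  then have "AE t in lebesgue_on {0..2*pi}. \<exists>\<zeta>. continuous_on {a..b} \<zeta> \<and>
     uniform_limit {a..b} (\<lambda>j r. z (\<tau> j) r t) \<zeta> sequentially"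
  proof eventually_elim
    case (elim t)
    then have "summable (\<lambda>j. 4 ^ j * S j t)" using S0 by (intro summable_suminf_not_top) auto
    from summable_imp_Bseq[OF this] obtain K where K: "0 < K" "\<And>j. norm (4 ^ j * S j t) \<le> K" unfolding Bseq_def by blast
    define C where "C = sqrt ((b - a) * K)"
    define f where "f j r = z (\<tau> (Suc j)) r t - z (\<tau> j) r t" for j r
    have der: "((\<lambda>r. z n r t) has_vector_derivative z1 n r t) (at r within {a..b})" if "a \<le> r" "r \<le> b" for n r
      by (rule polar_map.z_r[OF maps that])
    have zc: "continuous_on {a..b} (\<lambda>r. z n r t)" for n
      using polar_map.conts(1)[OF maps] by (rule cont_rect_slice1)
    have bd: "norm (f j r) \<le> C * (1 / 2) ^ j" if "r \<in> {a..b}" for j r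
    proof -
      have "(cmod (f j r - f j a))^2 \<le> (b - a) * S j t"
        unfolding f_def S_def
        by (rule increment_square_le[OF ab(2) has_vector_derivative_diff[OF der der]])
          (use that in \<open>auto intro!: continuous_intros cont_rect_slice1[OF seq_conts(1)]\<close>)
      moreover have "f j a = 0" by (simp add: f_def polar_map.inner[OF maps])
      moreover have "S j t \<le> K * (1 / 4) ^ j"
        using K(2)[of j] S0[of j t] by (simp add: field_simps power_divide)
      then have "(b - a) * S j t \<le> (b - a) * (K * (1 / 4) ^ j)" using ab by (intro mult_left_mono) auto
      ultimately have "(cmod (f j r))^2 \<le> (b - a) * K * (1 / 4) ^ j" by simp
      from real_sqrt_le_mono[OF this] have "cmod (f j r) \<le> C * sqrt ((1 / 4) ^ j)"
        by (simp add: C_def real_sqrt_mult)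
      also have "sqrt ((1 / 4) ^ j) = (1 / 2 :: real) ^ j"
      proof -
        have "(1 / 4 :: real) ^ j = ((1 / 2) ^ j)^2" by (simp add: power_even_eq[symmetric] power_mult power2_eq_square power_divide flip: power_mult_distrib)
        then show ?thesis by simp
      qed
      finally show ?thesis .
    qed
    have "uniform_limit {a..b} (\<lambda>n r. \<Sum>j<n. f j r) (\<lambda>r. \<Sum>j. f j r) sequentially"
      by (rule Weierstrass_m_test[OF bd]) (auto intro!: summable_mult summable_geometric)
    from uniform_limit_add[OF uniform_limit_const this]
    have lim: "uniform_limit {a..b} (\<lambda>n r. z (\<tau> 0) r t + (\<Sum>j<n. f j r)) (\<lambda>r. z (\<tau> 0) r t + (\<Sum>j. f j r)) sequentially" .
    moreover have "z (\<tau> 0) r t + (\<Sum>j<n. f j r) = z (\<tau> n) r t" for n r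
      unfolding f_def by (subst sum_lessThan_telescope) simp
    ultimately have lim: "uniform_limit {a..b} (\<lambda>n r. z (\<tau> n) r t) (\<lambda>r. z (\<tau> 0) r t + (\<Sum>j. f j r)) sequentially" by simp
    moreover have "continuous_on {a..b} (\<lambda>r. z (\<tau> 0) r t + (\<Sum>j. f j r))"
      by (rule uniform_limit_theorem[OF _ lim]) (auto simp: zc)
    ultimately show ?case by blast
  qed
  with \<tau> show ?thesis by blast
qed

text \<open>A curve closer than c to \<zeta> stays outside the disc of radius c, where the weight is
  1 / s and \<open>X\<close> is the true increment of the angle. By \<open>ray_winding\<close> it
  has the exact value 2 pi N from some index on, not only in the limit.\<close>

lemma ray_condition:
  assumes \<zeta>: "continuous_on {a..b} \<zeta>" "\<And>r. a \<le> r \<Longrightarrow> r \<le> b \<Longrightarrow> 2 * c \<le> cmod (\<zeta> r)"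
      "sgn (\<zeta> a) = sgn (\<zeta> b)" "winding_number ((\<lambda>r. sgn (\<zeta> r)) \<circ> linepath a b) 0 = of_int N"
    and c: "0 < c" "2 * c \<le> a" and lim: "uniform_limit {a..b} (\<lambda>j r. z j r t) \<zeta> sequentially"
  shows "\<exists>M. \<forall>n\<ge>M. disc_form.X a (z n) (z1 n) (wt c 1) b t = 2 * pi * of_int N"
proof -
  obtain M where M: "\<And>n r. n \<ge> M \<Longrightarrow> r \<in> {a..b} \<Longrightarrow> dist (z n r t) (\<zeta> r) < c"
    using uniform_limitD[OF lim c(1)] unfolding eventually_sequentially by blast
  have "disc_form.X a (z n) (z1 n) (wt c 1) b t = 2 * pi * of_int N" if n: "n \<ge> M" for n
  proof -
    interpret polar_map a b "z n" "z1 n" "z2 n" "z12 n" by (rule maps)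
    interpret F: disc_form a b "z n" "z1 n" "z2 n" "z12 n" "wt c 1" "wt' c 1" "4 / c^2"
      by (rule wt_form) (use c in auto)
    have near: "cmod (z n r t - \<zeta> r) < c" if "a \<le> r" "r \<le> b" for r using M[OF n, of r] that by (simp add: dist_norm)
    have "F.X b t = integral {a..b} (\<lambda>r. Im (cnj (z n r t) * z1 n r t) / (cmod (z n r t))^2)"
      unfolding F.X_def
    proof (rule integral_cong)
      fix r assume r: "r \<in> {a..b}"
      have "c \<le> cmod (z n r t)" using sgn_diff_less(2)[OF \<zeta>(2) near] r by auto
      then have "c^2 \<le> (cmod (z n r t))^2" using c by (intro power_mono) auto
      then show "F.A1 r t = Im (cnj (z n r t) * z1 n r t) / (cmod (z n r t))^2"
        unfolding F.A1_def using wt_out[OF c(1), of "(cmod (z n r t))^2" 1] by (simp del: One_nat_def)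
    qed
    also have "\<dots> = 2 * pi * of_int N"
      using ray_winding[OF _ a_pos z_r cont_rect_slice1[OF conts(2)] inner outer \<zeta> near] polar_map.ab[OF maps] by simp
    finally show ?thesis .
  qed
  then show ?thesis by blast
qed

end

lemma AE_circle_ex:
  assumes "AE t in lebesgue_on {0..2*pi}. P t"
  shows "\<exists>t. P t"
proof (rule ccontr)
  assume no: "\<nexists>t. P t"
  have "AE t in lebesgue. t \<in> {0..2*pi} \<longrightarrow> P t" using assms by (simp add: AE_restrict_space_iff)
  from AE_negligible[OF this] have "negligible {t. \<not> (t \<in> {0..2*pi} \<longrightarrow> P t)}" .
  moreover have "{t. \<not> (t \<in> {0..2*pi} \<longrightarrow> P t)} = cbox 0 (2*pi)" using no by auto
  ultimately show False using negligible_interval(1)[of 0 "2*pi"] pi_gt_zero by (simp add: box_real)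
qed

context trace_seq
begin

lemma trace_subseq:
  assumes "strict_mono \<tau>"
  shows "trace_seq a b (\<lambda>n. w (\<tau> n)) u G"
proof
  show "(\<lambda>n. \<integral>\<^sup>+x. ennreal ((norm (w (\<tau> n) x - u x))^2 + (norm (jacobian (w (\<tau> n)) (at x) - G x))^2) \<partial>\<Omega>) \<longlonglongrightarrow> 0"
    using LIMSEQ_subseq_LIMSEQ[OF conv assms] by (simp add: o_def)
  show "(\<lambda>n. \<integral>\<^sup>+t. ennreal ((norm (w (\<tau> n) (polar c t) - polar c t))^2 * c) \<partial>lebesgue_on {0..2*pi}) \<longlonglongrightarrow> 0"
    if "c \<in> {a, b}" for c
    using LIMSEQ_subseq_LIMSEQ[OF bdry[OF that] assms] by (simp add: o_def)
qed (rule a ab w u G)+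

end

context blended_seq
begin

text \<open>The shells shrink, so at a fixed interior point the blending is eventually switched
  off.\<close>

lemma z_pointwise:
  fixes v :: "real^2"
  assumes lim: "(\<lambda>n. w n (polar r t)) \<longlonglongrightarrow> v" and r: "a < r" "r < b"
  shows "(\<lambda>j. z j r t) \<longlonglongrightarrow> Complex (v $ 1) (v $ 2)"
proof -
  have "(\<lambda>j. w (\<sigma> j) (polar r t)) \<longlonglongrightarrow> v" by (rule filterlim_compose[OF lim \<sigma>])
  then have "(\<lambda>j. W (\<sigma> j) r t) \<longlonglongrightarrow> Complex (v $ 1) (v $ 2)"
    unfolding cpx_def by (intro tendsto_Complex tendsto_vec_nth)
  moreover have "\<forall>\<^sub>F j in sequentially. \<delta> j < min (r - a) (b - r)"
    using order_tendstoD(2)[OF \<delta>0, of "min (r - a) (b - r)"] r by simp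
  then have "\<forall>\<^sub>F j in sequentially. W (\<sigma> j) r t = z j r t"
    by eventually_elim (simp add: bl0_def cutoff_middle)
  ultimately show ?thesis by (rule Lim_transform_eventually)
qed

text \<open>One ray is enough, chosen among those on which three properties hold: the continuous
  representative \<eta> winds N times, a subsequence of the blended maps converges uniformly, and
  the approximants converge to u almost everywhere. The last two identify the uniform limit with
  \<eta> on the closed interval, so the maps themselves inherit its winding.\<close>

lemma energy_lower:
  assumes rw: "AE t in lebesgue_on {0..2*pi}. radial_winding a b u t N"
    and ae: "AE x in \<Omega>. (\<lambda>n. w n x) \<longlonglongrightarrow> u x"
    and k: "a < k" "k < b" and m: "0 < m" and pos: "0 < 2 * pi * of_int N - m * ln (k / a)"
    and U: "a * cosh (ln (b / k)) = b * cos (2 * pi * of_int N - m * ln (k / a))"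
      "a * m * sinh (ln (b / k)) = b * sin (2 * pi * of_int N - m * ln (k / a))"
  shows "pi * a^2 * (1 + m^2) * (ln (k / a) + sinh (ln (b / k)) * cosh (ln (b / k))) \<le> \<gamma> / 2"
proof -
  obtain \<tau> where \<tau>: "strict_mono \<tau>" and rays: "AE t in lebesgue_on {0..2*pi}. \<exists>\<zeta>. continuous_on {a..b} \<zeta> \<and>
     uniform_limit {a..b} (\<lambda>j r. z (\<tau> j) r t) \<zeta> sequentially"
    using S.rays_converge by blast
  have "AE t in lebesgue_on {0..2*pi}. AE r in lebesgue_on {a<..<b}. (\<lambda>n. w n (polar r t)) \<longlonglongrightarrow> u (polar r t)"
    using a ae by (intro AE_polar) auto
  with rw rays have "AE t in lebesgue_on {0..2*pi}. radial_winding a b u t N \<and>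
      (\<exists>\<zeta>. continuous_on {a..b} \<zeta> \<and> uniform_limit {a..b} (\<lambda>j r. z (\<tau> j) r t) \<zeta> sequentially) \<and>
      (AE r in lebesgue_on {a<..<b}. (\<lambda>n. w n (polar r t)) \<longlonglongrightarrow> u (polar r t))"
    by eventually_elim blast
  from AE_circle_ex[OF this] obtain t \<zeta> where t: "radial_winding a b u t N"
    and \<zeta>: "continuous_on {a..b} \<zeta>" "uniform_limit {a..b} (\<lambda>j r. z (\<tau> j) r t) \<zeta> sequentially"
    and conv_ray: "AE r in lebesgue_on {a<..<b}. (\<lambda>n. w n (polar r t)) \<longlonglongrightarrow> u (polar r t)"
    by blast
  obtain \<eta> :: "real \<Rightarrow> real^2" where \<eta>: "continuous_on {a..b} \<eta>" "AE r in lebesgue_on {a<..<b}. \<eta> r = u (polar r t)"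
      "\<And>r. r \<in> {a..b} \<Longrightarrow> \<eta> r \<noteq> 0" "\<eta> a /\<^sub>R norm (\<eta> a) = \<eta> b /\<^sub>R norm (\<eta> b)" "wind a b (\<lambda>r. \<eta> r /\<^sub>R norm (\<eta> r)) = of_int N"
    using t unfolding radial_winding_def Let_def by blast
  define c\<eta> where "c\<eta> r = Complex (\<eta> r $ 1) (\<eta> r $ 2)" for r
  have nc: "cmod (c\<eta> r) = norm (\<eta> r)" for r
    by (simp add: c\<eta>_def complex_norm norm_vec_def L2_set_def sum_2)
  have sg: "sgn (c\<eta> r) = Complex ((\<eta> r /\<^sub>R norm (\<eta> r)) $ 1) ((\<eta> r /\<^sub>R norm (\<eta> r)) $ 2)" for r
    unfolding sgn_div_norm nc by (simp add: c\<eta>_def complex_eq_iff)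
  have cc: "continuous_on {a..b} c\<eta>"
    unfolding c\<eta>_def Complex_eq by (intro continuous_intros \<eta>(1))
  have eq: "\<zeta> r = c\<eta> r" if "r \<in> {a..b}" for r
  proof (rule AE_eq_continuous[OF ab \<zeta>(1) cc _ that])
    have ends: "AE r in lebesgue_on {a<..<b}. r \<in> {a<..<b}" by (rule AE_I2) (simp add: space_restrict_space)
    show "AE r in lebesgue_on {a<..<b}. \<zeta> r = c\<eta> r"
      using conv_ray \<eta>(2) ends
    proof eventually_elim
      case (elim r)
      then have "(\<lambda>j. z j r t) \<longlonglongrightarrow> c\<eta> r" unfolding c\<eta>_def by (auto intro: z_pointwise)
      from LIMSEQ_subseq_LIMSEQ[OF this \<tau>] have "(\<lambda>j. z (\<tau> j) r t) \<longlonglongrightarrow> c\<eta> r" by (simp add: o_def)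
      moreover have "(\<lambda>j. z (\<tau> j) r t) \<longlonglongrightarrow> \<zeta> r"
        by (rule tendsto_uniform_limitI[OF \<zeta>(2)]) (use elim in auto)
      ultimately show ?case using LIMSEQ_unique by blast
    qed
  qed
  have "continuous_on {a..b} (\<lambda>r. cmod (c\<eta> r))" by (intro continuous_intros cc)
  from continuous_attains_inf[OF _ _ this] ab obtain r0 where r0: "r0 \<in> {a..b}" "\<And>r. r \<in> {a..b} \<Longrightarrow> cmod (c\<eta> r0) \<le> cmod (c\<eta> r)" by auto
  \<comment> \<open>Half the smaller of \<open>a\<close> and the least modulus of the ray: the ray
    avoids the disc of radius 2 c, and 2 c \<le> a is what the comparison of the weights asks
    for.\<close>
  define c where "c = min (cmod (c\<eta> r0)) a / 2"
  have c: "0 < c" "2 * c \<le> a" "2 * c \<le> cmod (c\<eta> r0)" using a \<eta>(3)[OF r0(1)] by (auto simp: c_def nc)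
  interpret Q: polar_map_seq a b "\<lambda>j. z (\<tau> j)" "\<lambda>j. z1 (\<tau> j)" "\<lambda>j. z2 (\<tau> j)" "\<lambda>j. z12 (\<tau> j)"
    by (rule S.subsequence[OF \<tau>])
  have ray: "\<exists>M. \<forall>n\<ge>M. disc_form.X a (z (\<tau> n)) (z1 (\<tau> n)) (wt c 1) b t = 2 * pi * of_int N"
  proof (rule Q.ray_condition[OF cc _ _ _ c(1,2)])
    show "2 * c \<le> cmod (c\<eta> r)" if "a \<le> r" "r \<le> b" for r using r0(2)[of r] c(3) that by simp
    show "sgn (c\<eta> a) = sgn (c\<eta> b)" unfolding sg by (simp only: \<eta>(4))
    show "winding_number ((\<lambda>r. sgn (c\<eta> r)) \<circ> linepath a b) 0 = of_int N"
      using \<eta>(5) unfolding wind_def sg .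
    show "uniform_limit {a..b} (\<lambda>j r. z (\<tau> j) r t) c\<eta> sequentially"
      using \<zeta>(2) by (rule uniform_limit_cong'[THEN iffD1, rotated 2]) (auto simp: eq)
  qed
  show ?thesis
  proof (rule field_le_epsilon)
    fix \<epsilon> :: real assume \<epsilon>: "0 < \<epsilon>"
    obtain M1 where M1: "\<And>n. n \<ge> M1 \<Longrightarrow> polar_map.energy a b (z1 (\<tau> n)) (z2 (\<tau> n))
        \<ge> pi * a^2 * (1 + m^2) * (ln (k / a) + sinh (ln (b / k)) * cosh (ln (b / k))) - \<epsilon> / 2"
      using Q.energy_limit_bound[OF k m pos U c(1,2) ray, of "\<epsilon> / 2"] \<epsilon> by auto
    obtain M2 where M2: "\<And>j. j \<ge> M2 \<Longrightarrow> polar_map.energy a b (z1 j) (z2 j) \<le> \<gamma> / 2 + \<epsilon> / 2"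
      using energy_upper[of "\<epsilon> / 2"] \<epsilon> by auto
    have "max M1 M2 \<le> \<tau> (max M1 M2)" by (rule seq_suble[OF \<tau>])
    then show "pi * a^2 * (1 + m^2) * (ln (k / a) + sinh (ln (b / k)) * cosh (ln (b / k))) \<le> \<gamma> / 2 + \<epsilon>"
      using M1[of "max M1 M2"] M2[of "\<tau> (max M1 M2)"] by simp
  qed
qed

end

context trace_seq
begin

lemma energy_lower_bound:
  assumes G0: "AE x in \<Omega>. 0 \<le> det (G x)"
    and rw: "AE t in lebesgue_on {0..2*pi}. radial_winding a b u t N"
    and k: "a < k" "k < b" and m: "0 < m" and pos: "0 < 2 * pi * of_int N - m * ln (k / a)"
    and U: "a * cosh (ln (b / k)) = b * cos (2 * pi * of_int N - m * ln (k / a))"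
      "a * m * sinh (ln (b / k)) = b * sin (2 * pi * of_int N - m * ln (k / a))"
  shows "pi * a^2 * (1 + m^2) * (ln (k / a) + sinh (ln (b / k)) * cosh (ln (b / k))) \<le> \<gamma> / 2"
proof -
  obtain \<sigma>0 where \<sigma>0: "strict_mono \<sigma>0" "AE x in \<Omega>. (\<lambda>n. w (\<sigma>0 n) x) \<longlonglongrightarrow> u x" using seq_AE by blast
  interpret T: trace_seq a b "\<lambda>n. w (\<sigma>0 n)" u G by (rule trace_subseq[OF \<sigma>0(1)])
  obtain \<sigma> \<delta> where "filterlim \<sigma> at_top sequentially" "\<delta> \<longlonglongrightarrow> 0"
    "\<And>j. 0 < \<delta> j" "\<And>j. 2 * \<delta> j \<le> b - a"
    "\<And>j. blend_err a b (\<delta> j) (w (\<sigma>0 (\<sigma> j))) < inverse (real (Suc j))"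
    using T.blended_sequence[OF G0] by blast
  then interpret B: blended_seq a b "\<lambda>n. w (\<sigma>0 n)" u G \<sigma> \<delta>
    using G0 by unfold_locales auto
  show ?thesis by (rule B.energy_lower[OF rw \<sigma>0(2) k m pos U])
qed

end

subsection \<open>The energy of the twist map\<close>

lemma has_vector_derivative_Re_cnj:
  assumes "(u has_vector_derivative u') (at x within S)" "(v has_vector_derivative v') (at x within S)"
  shows "((\<lambda>x. Re (cnj (u x) * v x)) has_real_derivative Re (cnj u' * v x) + Re (cnj (u x) * v')) (at x within S)"
proof -
  have "((\<lambda>x. cnj (u x) * v x) has_vector_derivative cnj (u x) * v' + cnj u' * v x) (at x within S)"
    by (intro has_vector_derivative_mult has_vector_derivative_cnj assms)
  then have "((\<lambda>x. Re (cnj (u x) * v x)) has_vector_derivative Re (cnj (u x) * v' + cnj u' * v x)) (at x within S)"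
    by (rule bounded_linear.has_vector_derivative[OF bounded_linear_Re])
  then show ?thesis by (simp add: real_vector_derivative_iff add.commute)
qed

lemma Re_cnj_bound:
  assumes "0 < s"
  shows "\<bar>Re (cnj x * y)\<bar> \<le> s * (cmod y)^2 + (1 / s) * (cmod x)^2"
proof -
  have "\<bar>Re (cnj x * y)\<bar> \<le> cmod x * cmod y" using abs_Re_le_cmod[of "cnj x * y"] by (simp add: norm_mult)
  also have "\<dots> \<le> 2 * (cmod x * cmod y)" by simp
  also have "\<dots> \<le> s * (cmod y)^2 + (1 / s) * (cmod x)^2"
  proof -
    have "0 \<le> (s * cmod y - cmod x)^2 / s" using assms by simp
    also have "\<dots> = s * (cmod y)^2 + (1 / s) * (cmod x)^2 - 2 * (cmod x * cmod y)"
      using assms by (simp add: field_simps power2_eq_square)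
    finally show ?thesis by simp
  qed
  finally show ?thesis .
qed

lemma weak_limit_rect:
  assumes D: "\<And>n. cont_rect a b (D n)" and lim: "\<And>\<epsilon>. 0 < \<epsilon> \<Longrightarrow> \<exists>M. \<forall>n\<ge>M. rect_int a b (\<lambda>r t. (cmod (D n r t))^2) < (\<epsilon> :: real)"
    and K: "cont_rect a b K" and \<epsilon>: "0 < \<epsilon>"
  shows "\<exists>M. \<forall>n\<ge>M. \<bar>rect_int a b (\<lambda>r t. Re (cnj (D n r t) * K r t))\<bar> < \<epsilon>"
proof -
  define B where "B = rect_int a b (\<lambda>r t. (cmod (K r t))^2)"
  have B: "0 \<le> B" unfolding B_def by (intro rect_int_nonneg cont_rects K) simp
  obtain s d where sd: "0 < s" "0 < d" "s * B + (1 + 1 / s) * d < \<epsilon>" using small_parameter[OF B \<epsilon>] by blast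
  obtain M where M: "\<And>n. n \<ge> M \<Longrightarrow> rect_int a b (\<lambda>r t. (cmod (D n r t))^2) < d" using lim[OF sd(2)] by blast
  have "\<bar>rect_int a b (\<lambda>r t. Re (cnj (D n r t) * K r t))\<bar> < \<epsilon>" if n: "n \<ge> M" for n
  proof -
    have "cont_rect a b (\<lambda>r t. cnj (D n r t))"
      using D[of n] unfolding cont_rect_def by (rule continuous_on_cnj)
    then have "\<bar>rect_int a b (\<lambda>r t. Re (cnj (D n r t) * K r t))\<bar>
        \<le> rect_int a b (\<lambda>r t. s * (cmod (K r t))^2 + (1 / s) * (cmod (D n r t))^2)"
      by (intro rect_int_abs_le cont_rects D K Re_cnj_bound sd)
    also have "\<dots> = s * B + (1 / s) * rect_int a b (\<lambda>r t. (cmod (D n r t))^2)"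
      unfolding B_def rect_int_cmult[symmetric] by (intro rect_int_add cont_rects D K)
    also have "\<dots> \<le> s * B + (1 / s) * d" using M[OF n] sd by (intro add_left_mono mult_left_mono) auto
    also have "\<dots> < \<epsilon>" using sd by (simp add: distrib_right)
    finally show ?thesis .
  qed
  then show ?thesis by blast
qed

lemma weak_limit_circle:
  fixes D :: "nat \<Rightarrow> real \<Rightarrow> complex"
  assumes D: "\<And>n. continuous_on {0..2*pi} (D n)"
    and lim: "\<And>\<epsilon>. 0 < \<epsilon> \<Longrightarrow> \<exists>M. \<forall>n\<ge>M. integral {0..2*pi} (\<lambda>t. (cmod (D n t))^2) < (\<epsilon> :: real)"
    and K: "continuous_on {0..2*pi} K" and \<epsilon>: "0 < \<epsilon>"
  shows "\<exists>M. \<forall>n\<ge>M. \<bar>integral {0..2*pi} (\<lambda>t. Re (cnj (D n t) * K t))\<bar> < \<epsilon>"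
proof -
  define B where "B = integral {0..2*pi} (\<lambda>t. (cmod (K t))^2)"
  have B: "0 \<le> B" unfolding B_def by (intro integral_nonneg integrable_continuous_real continuous_intros K) simp
  obtain s d where sd: "0 < s" "0 < d" "s * B + (1 + 1 / s) * d < \<epsilon>" using small_parameter[OF B \<epsilon>] by blast
  obtain M where M: "\<And>n. n \<ge> M \<Longrightarrow> integral {0..2*pi} (\<lambda>t. (cmod (D n t))^2) < d" using lim[OF sd(2)] by blast
  have "\<bar>integral {0..2*pi} (\<lambda>t. Re (cnj (D n t) * K t))\<bar> < \<epsilon>" if n: "n \<ge> M" for n
  proof -
    have i: "(\<lambda>t. s * (cmod (K t))^2) integrable_on {0..2*pi}" "(\<lambda>t. (1 / s) * (cmod (D n t))^2) integrable_on {0..2*pi}"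
      by (intro integrable_continuous_real continuous_intros K D)+
    have "norm (integral {0..2*pi} (\<lambda>t. Re (cnj (D n t) * K t)))
        \<le> integral {0..2*pi} (\<lambda>t. s * (cmod (K t))^2 + (1 / s) * (cmod (D n t))^2)"
      unfolding real_norm_def[symmetric]
    proof (rule integral_norm_bound_integral[OF _ integrable_add[OF i]])
      show "(\<lambda>t. Re (cnj (D n t) * K t)) integrable_on {0..2*pi}"
        by (intro integrable_continuous_real continuous_intros K D)
      show "norm (Re (cnj (D n t) * K t)) \<le> s * (cmod (K t))^2 + (1 / s) * (cmod (D n t))^2" for t
        unfolding real_norm_def by (rule Re_cnj_bound[OF sd(1)])
    qed
    also have "\<dots> = s * B + (1 / s) * integral {0..2*pi} (\<lambda>t. (cmod (D n t))^2)"
      using integral_add[OF i] by (simp add: B_def)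
    also have "\<dots> \<le> s * B + (1 / s) * d" using M[OF n] sd by (intro add_left_mono mult_left_mono) auto
    also have "\<dots> < \<epsilon>" using sd by (simp add: distrib_right)
    finally show ?thesis by simp
  qed
  then show ?thesis by blast
qed

context trace_seq
begin

text \<open>The smooth approximants converge weakly to the twist, hence their energies cannot exceed its
  energy in the limit; the weak convergence is integration by parts.\<close>

lemma energy_upper_bound:
  assumes L2: "\<And>\<epsilon>. 0 < \<epsilon> \<Longrightarrow> \<exists>M. \<forall>n\<ge>M. rect_int a b (\<lambda>r t. (cmod (W n r t - cis t * Y r))^2) < \<epsilon>"
    and Y: "\<And>r. a \<le> r \<Longrightarrow> r \<le> b \<Longrightarrow> (Y has_vector_derivative Y' r) (at r within {a..b})"
    and cY': "continuous_on {a..b} Y'" and ends: "Y a = of_real a" "Y b = of_real b"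
  shows "\<gamma> \<le> 2 * pi * integral {a..b} (\<lambda>r. wsq r (Y' r) (Y r))"
proof (rule field_le_epsilon)
  fix \<epsilon> :: real assume \<epsilon>: "0 < \<epsilon>"
  have cY: "continuous_on {a..b} Y"
    using Y by (meson atLeastAtMost_iff continuous_on_eq_continuous_within has_vector_derivative_continuous)
  define U where "U r t = cis t * Y r" for r t
  define U1 where "U1 r t = cis t * Y' r" for r t
  define U2 where "U2 r t = \<i> * cis t * Y r" for r t
  have cU: "cont_rect a b U" "cont_rect a b U1" "cont_rect a b U2"
    unfolding U_def U1_def U2_def by (intro cont_rects cis_cont_rect cont_rect_fst cY cY')+
  have cnj_cont: "cont_rect a b f \<Longrightarrow> cont_rect a b (\<lambda>r t. cnj (f r t))" for f
    unfolding cont_rect_def by (rule continuous_on_cnj)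
  have ir: "cont_rect a b (\<lambda>r t. 1 / r)" by (intro cont_rects) (use a in auto)
  have cir: "continuous_on {a..b} (\<lambda>r. 1 / r)" using a by (intro continuous_intros) auto
  define E where "E m = rect_int a b (\<lambda>r t. wsq r (W1 m r t) (W2 m r t))" for m
  define EU where "EU = rect_int a b (\<lambda>r t. wsq r (U1 r t) (U2 r t))"
  define ED where "ED m n = rect_int a b (\<lambda>r t. wsq r (W1 m r t - W1 n r t) (W2 m r t - W2 n r t))" for m n
  \<comment> \<open>Weighted inner product of the gradient of approximant m with that of the
    difference between approximant n and the twist. It tends to zero as n grows with m held
    fixed.\<close>
  define I where "I m n = rect_int a b (\<lambda>r t. r * Re (cnj (W1 n r t - U1 r t) * W1 m r t) + (1 / r) * Re (cnj (W2 n r t - U2 r t) * W2 m r t))" for m n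
  define D where "D n r t = W n r t - U r t" for n r t
  have cD: "cont_rect a b (D n)" for n unfolding D_def by (intro cont_rects cU W_cont)
  have I_small: "\<exists>M. \<forall>n\<ge>M. I m n < e" if e: "0 < e" for m e
  proof -
    define R where "R = cmb rad_rad (w m)"
    define A where "A = cmb ang_ang (w m)"
    have cRA: "cont_rect a b R" "cont_rect a b A" unfolding R_def A_def by (rule cpx_cont[OF w])+
    \<comment> \<open>This is r times the Laplacian of the fixed approximant m: integration by parts
      moves all derivatives onto it, so only L2 convergence of the maps and of their boundary values
      is used.\<close>
    define K where "K r t = W1 m r t + of_real r * R r t + of_real (1 / r) * A r t" for r t
    have cK: "cont_rect a b K" unfolding K_def by (intro cont_rects W_cont cRA ir) (use a in auto)
    have L2': "\<exists>M. \<forall>n\<ge>M. rect_int a b (\<lambda>r t. (cmod (D n r t))^2) < \<epsilon>" if "0 < \<epsilon>" for \<epsilon>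
      using L2[OF that] by (simp add: D_def U_def)
    have e3: "0 < e / 3" using e by simp
    obtain M1 where M1: "\<And>n. n \<ge> M1 \<Longrightarrow> \<bar>rect_int a b (\<lambda>r t. Re (cnj (D n r t) * K r t))\<bar> < e / 3"
      using weak_limit_rect[OF cD L2' cK e3] by blast
    have bd: "\<exists>M. \<forall>n\<ge>M. \<bar>integral {0..2*pi} (\<lambda>t. Re (cnj (D n c t) * (of_real c * W1 m c t)))\<bar> < e / 3" if c: "c = a \<or> c = b" for c
    proof (rule weak_limit_circle[OF _ _ _ e3])
      show "continuous_on {0..2*pi} (D n c)" for n by (rule cont_rect_slice2[OF cD]) (use c ab in auto)
      show "continuous_on {0..2*pi} (\<lambda>t. of_real c * W1 m c t)"
        by (intro continuous_intros cont_rect_slice2[OF W_cont(2)[of a b m]]) (use c ab in auto)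
      have "Y c = of_real c" using c ends by auto
      then have "D n c t = W n c t - of_real c * cis t" for n t by (simp add: D_def U_def)
      then show "\<exists>M. \<forall>n\<ge>M. integral {0..2*pi} (\<lambda>t. (cmod (D n c t))^2) < \<epsilon>" if "0 < \<epsilon>" for \<epsilon>
        using seq_boundary[OF c that] by simp
    qed
    obtain M2 where M2: "\<And>n. n \<ge> M2 \<Longrightarrow> \<bar>integral {0..2*pi} (\<lambda>t. Re (cnj (D n a t) * (of_real a * W1 m a t)))\<bar> < e / 3"
      using bd[of a] by blast
    obtain M3 where M3: "\<And>n. n \<ge> M3 \<Longrightarrow> \<bar>integral {0..2*pi} (\<lambda>t. Re (cnj (D n b t) * (of_real b * W1 m b t)))\<bar> < e / 3"
      using bd[of b] by blast
    have "I m n < e" if n: "n \<ge> max M1 (max M2 M3)" for n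
    proof -
      define F1 where "F1 r t = Re (cnj (D n r t) * (of_real r * W1 m r t))" for r t
      define f1 where "f1 r t = Re (cnj (W1 n r t - U1 r t) * (of_real r * W1 m r t)) + Re (cnj (D n r t) * (W1 m r t + of_real r * R r t))" for r t
      define f2 where "f2 r t = Re (cnj (W2 n r t - U2 r t) * W2 m r t) + Re (cnj (D n r t) * A r t)" for r t
      have dD: "((\<lambda>r. D n r t) has_vector_derivative W1 n r t - U1 r t) (at r within {a..b})" if "a \<le> r" "r \<le> b" for r t
        unfolding D_def U_def U1_def
        by (intro has_vector_derivative_diff has_vector_derivative_mult_right cpx_derivatives[OF w] Y that)
      have dD2: "((\<lambda>t. D n r t) has_vector_derivative W2 n r t - U2 r t) (at t)" for r t
      proof -
        have "((\<lambda>t. cis t * Y r) has_vector_derivative \<i> * cis t * Y r) (at t)"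
          by (rule has_vector_derivative_mult_left[OF cis_vector_derivative])
        then show ?thesis unfolding D_def U_def U2_def by (intro has_vector_derivative_diff cpx_derivatives[OF w])
      qed
      have dW: "((\<lambda>r. of_real r * W1 m r t) has_vector_derivative W1 m r t + of_real r * R r t) (at r within {a..b})" for r t
        unfolding R_def
        using has_vector_derivative_mult[OF has_vector_derivative_of_real[OF DERIV_ident] cpx_derivatives(4)[OF w, of m t r "{a..b}"]]
        by (simp add: add.commute)
      have d1: "((\<lambda>r. F1 r t) has_real_derivative f1 r t) (at r within {a..b})" if "a \<le> r" "r \<le> b" for r t
        unfolding F1_def f1_def by (rule has_vector_derivative_Re_cnj[OF dD[OF that] dW])
      have d2: "((\<lambda>t. Re (cnj (D n r t) * W2 m r t)) has_real_derivative f2 r t) (at t)" for r t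
        unfolding f2_def A_def by (rule has_vector_derivative_Re_cnj[OF dD2 cpx_derivatives(5)[OF w]])
      have cc: "cont_rect a b (\<lambda>r t. cnj (W1 n r t - U1 r t))" "cont_rect a b (\<lambda>r t. cnj (D n r t))" "cont_rect a b (\<lambda>r t. cnj (W2 n r t - U2 r t))"
        by (intro cnj_cont cont_rects W_cont cU cD)+
      have cf: "cont_rect a b F1" "cont_rect a b f1" "cont_rect a b f2"
        unfolding F1_def f1_def f2_def by (intro cont_rects W_cont cRA cc)+
      have i1: "rect_int a b f1 = integral {0..2*pi} (\<lambda>t. F1 b t) - integral {0..2*pi} (\<lambda>t. F1 a t)"
        using ab by (intro rect_int_derivative1 cf d1) auto
      have per: "D n r (t + 2*pi) = D n r t" for r t by (simp add: D_def U_def cpx_periodic cis.ctr)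
      have i2: "rect_int a b (\<lambda>r t. (1 / r) * f2 r t) = 0"
        by (rule rect_int_derivative2[OF cf(3) cir d2]) (simp add: per cpx_periodic)
      have "I m n = rect_int a b (\<lambda>r t. (f1 r t + (1 / r) * f2 r t) - Re (cnj (D n r t) * K r t))"
        unfolding I_def f1_def f2_def K_def by (intro rect_int_cong) (simp add: algebra_simps add_divide_distrib)
      also have "\<dots> = rect_int a b f1 + rect_int a b (\<lambda>r t. (1 / r) * f2 r t) - rect_int a b (\<lambda>r t. Re (cnj (D n r t) * K r t))"
      proof -
        have c1: "cont_rect a b (\<lambda>r t. (1 / r) * f2 r t)" "cont_rect a b (\<lambda>r t. Re (cnj (D n r t) * K r t))"
          by (intro cont_rect_arith(3) cont_rect_complex(1) ir cf cc cK)+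
        show ?thesis
          using rect_int_diff[OF cont_rect_arith(1)[OF cf(2) c1(1)] c1(2)] rect_int_add[OF cf(2) c1(1)] by simp
      qed
      finally show ?thesis
        using i1 i2 M1[of n] M2[of n] M3[of n] n unfolding F1_def by (simp add: abs_less_iff)
    qed
    then show ?thesis by blast
  qed
  \<comment> \<open>The squared gradient is split by testing it against three differences:
    approximants m and n, small by the Cauchy property; approximant n and the twist, small by
    \<open>I_small\<close>; and the twist itself, for which the product is bounded by half the sum
    of the squares.\<close>
  have main: "E m \<le> 2 * s * E m + (2 / s) * ED m n + 2 * I m n + EU" if s: "0 < s" for s m n
  proof -
    define e1 where "e1 r t = wsq r (W1 m r t) (W2 m r t)" for r t
    define e2 where "e2 r t = wsq r (W1 m r t - W1 n r t) (W2 m r t - W2 n r t)" for r t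
    define e3 where "e3 r t = r * Re (cnj (W1 n r t - U1 r t) * W1 m r t) + (1 / r) * Re (cnj (W2 n r t - U2 r t) * W2 m r t)" for r t
    define e4 where "e4 r t = wsq r (U1 r t) (U2 r t)" for r t
    have c: "cont_rect a b e1" "cont_rect a b e2" "cont_rect a b e3" "cont_rect a b e4"
      unfolding e1_def e2_def e3_def e4_def by (intro cont_rects cnj_cont W_cont cU ir; use a in simp)+
    have pw: "(cmod x)^2 \<le> 2 * s * (cmod x)^2 + (2 / s) * (cmod (x - y))^2 + 2 * Re (cnj (y - v) * x) + (cmod v)^2" for x y v
    proof -
      have "(cmod x)^2 = Re (cnj (x - y) * x) + Re (cnj (y - v) * x) + Re (cnj v * x)"
        unfolding cmod_power2 by (simp add: power2_eq_square algebra_simps)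
      moreover have "Re (cnj (x - y) * x) \<le> s * (cmod x)^2 + (1 / s) * (cmod (x - y))^2" using Re_cnj_bound[OF s, of "x - y" x] by linarith
      moreover have "2 * Re (cnj v * x) \<le> sq2 v x"
      proof -
        have "0 \<le> (cmod (v - x))^2" by simp
        also have "(cmod (v - x))^2 = sq2 v x - 2 * Re (cnj v * x)"
          unfolding cmod_power2 by (simp add: power2_eq_square algebra_simps)
        finally show ?thesis by simp
      qed
      moreover have "(2 / s) * (cmod (x - y))^2 = 2 * ((1 / s) * (cmod (x - y))^2)" by simp
      ultimately show ?thesis by linarith
    qed
    have ce: "cont_rect a b (\<lambda>r t. 2 * s * e1 r t)" "cont_rect a b (\<lambda>r t. (2 / s) * e2 r t)" "cont_rect a b (\<lambda>r t. 2 * e3 r t)"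
      by (intro cont_rect_arith(3) cont_rect_const c)+
    have "E m \<le> rect_int a b (\<lambda>r t. 2 * s * e1 r t + (2 / s) * e2 r t + 2 * e3 r t + e4 r t)"
      unfolding E_def e1_def[symmetric]
    proof (rule rect_int_mono[OF c(1)])
      show "cont_rect a b (\<lambda>r t. 2 * s * e1 r t + (2 / s) * e2 r t + 2 * e3 r t + e4 r t)"
        by (intro cont_rect_arith(1) ce c)
      fix r t assume r: "a \<le> r" "r \<le> b"
      have "r * (cmod (W1 m r t))^2 + (1 / r) * (cmod (W2 m r t))^2
        \<le> r * (2 * s * (cmod (W1 m r t))^2 + (2 / s) * (cmod (W1 m r t - W1 n r t))^2 + 2 * Re (cnj (W1 n r t - U1 r t) * W1 m r t) + (cmod (U1 r t))^2)
          + (1 / r) * (2 * s * (cmod (W2 m r t))^2 + (2 / s) * (cmod (W2 m r t - W2 n r t))^2 + 2 * Re (cnj (W2 n r t - U2 r t) * W2 m r t) + (cmod (U2 r t))^2)"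
        using r a by (intro add_mono mult_left_mono pw) auto
      also have "\<dots> = 2 * s * e1 r t + (2 / s) * e2 r t + 2 * e3 r t + e4 r t"
        unfolding e1_def e2_def e3_def e4_def divide_inverse[of _ r] distrib_left by (simp only: mult_1 mult_ac add_ac)
      finally show "e1 r t \<le> 2 * s * e1 r t + (2 / s) * e2 r t + 2 * e3 r t + e4 r t" by (simp add: e1_def)
    qed
    also have "\<dots> = 2 * s * E m + (2 / s) * ED m n + 2 * I m n + EU"
      unfolding E_def ED_def I_def EU_def e1_def[symmetric] e2_def[symmetric] e3_def[symmetric] e4_def[symmetric] rect_int_cmult[symmetric]
      using rect_int_add[OF ce(1,2)] rect_int_add[OF cont_rect_arith(1)[OF ce(1,2)] ce(3)]
        rect_int_add[OF cont_rect_arith(1)[OF cont_rect_arith(1)[OF ce(1,2)] ce(3)] c(4)] by simp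
    finally show ?thesis .
  qed
  have \<gamma>1: "0 \<le> \<gamma> + 1" using \<gamma> by simp
  have e8: "0 < \<epsilon> / 8" using \<epsilon> by simp
  obtain s d where sd: "0 < s" "0 < d" "s * (\<gamma> + 1) + (1 + 1 / s) * d < \<epsilon> / 8" using small_parameter[OF \<gamma>1 e8] by blast
  obtain M1 where M1: "\<And>m n. m \<ge> M1 \<Longrightarrow> n \<ge> M1 \<Longrightarrow> ED m n < d" using seq_Cauchy[OF sd(2)] unfolding ED_def by blast
  have "0 < min 1 (\<epsilon> / 4)" using \<epsilon> by simp
  from seq_energy[OF this] obtain M2 where M2: "\<And>m. m \<ge> M2 \<Longrightarrow> \<bar>E m - \<gamma>\<bar> < min 1 (\<epsilon> / 4)" unfolding E_def by blast
  define m where "m = max M1 M2"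
  obtain M3 where M3: "\<And>n. n \<ge> M3 \<Longrightarrow> I m n < \<epsilon> / 8" using I_small[OF e8] by blast
  define n where "n = max M1 M3"
  have Em: "\<bar>E m - \<gamma>\<bar> < min 1 (\<epsilon> / 4)" by (rule M2) (simp add: m_def)
  have "s * E m \<le> s * (\<gamma> + 1)" using Em sd by (intro mult_left_mono) auto
  moreover have "(1 / s) * ED m n \<le> (1 / s) * d" using M1[of m n] sd by (intro mult_left_mono) (auto simp: m_def n_def)
  moreover have "I m n < \<epsilon> / 8" by (rule M3) (simp add: n_def)
  moreover have "2 * s * E m = 2 * (s * E m)" "(2 / s) * ED m n = 2 * ((1 / s) * ED m n)" by simp_all
  moreover have "(1 + 1 / s) * d = d + (1 / s) * d" by (simp add: distrib_right)
  ultimately have "E m \<le> EU + \<epsilon> / 2" using main[OF sd(1), of m n] sd by linarith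
  then have "\<gamma> \<le> EU + \<epsilon>" using Em by linarith
  moreover have "EU = 2 * pi * integral {a..b} (\<lambda>r. wsq r (Y' r) (Y r))"
    unfolding EU_def U1_def U2_def using a by (subst rect_int_fst[symmetric]) (auto intro!: continuous_intros cY cY' simp: norm_mult)
  ultimately show "\<gamma> \<le> 2 * pi * integral {a..b} (\<lambda>r. wsq r (Y' r) (Y r)) + \<epsilon>" by simp
qed

end

section \<open>The explicit twist and the conclusion\<close>

lemma polar_exists: "\<exists>t. x = polar (norm x) t"
proof (cases "x = 0")
  case True
  then show ?thesis by (intro exI[of _ 0]) (simp add: vec_eq_iff forall_2)
next
  case False
  define r where "r = norm x"
  have r: "0 < r" using False by (simp add: r_def)
  have r2: "(x $ 1)^2 + (x $ 2)^2 = r^2"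
    by (simp add: r_def norm_vec_def L2_set_def sum_2)
  have "(x $ 1 / r)^2 + (x $ 2 / r)^2 = ((x $ 1)^2 + (x $ 2)^2) / r^2"
    by (simp add: power_divide add_divide_distrib)
  also have "\<dots> = 1" unfolding r2 using r by simp
  finally obtain t where t: "x $ 1 / r = cos t" "x $ 2 / r = sin t" by (rule sincos_total_2pi)
  have "x $ 1 = r * cos t" "x $ 2 = r * sin t" using t r by (simp_all add: field_simps)
  then show ?thesis unfolding r_def[symmetric] by (intro exI[of _ t]) (simp add: vec_eq_iff forall_2)
qed

lemma I_inf_eq:
  assumes w: "L2_on (annulus a b) (weak_grad (annulus a b) u)"
    and d: "AE x in lebesgue_on (annulus a b). det (weak_grad (annulus a b) u x) \<ge> 0"
  shows "I_inf a b u = ennreal ((LINT x|lebesgue_on (annulus a b). (norm (weak_grad (annulus a b) u x))^2) / 2)"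
proof -
  let ?G = "weak_grad (annulus a b) u" and ?M = "lebesgue_on (annulus a b)"
  have m: "?G \<in> borel_measurable ?M" using w by (simp add: L2_on_def)
  have e: "ennreal (1/2 * x) = ennreal (1/2) * ennreal x" for x by (rule ennreal_mult') simp
  have "I_inf a b u = (\<integral>\<^sup>+x. ennreal (1/2) * ennreal ((norm (?G x))^2) \<partial>?M)"
    unfolding I_inf_def
    by (rule nn_integral_cong_AE) (use d in eventually_elim, simp only: e h_inf_def if_True add_0_right)
  also have "\<dots> = ennreal (1/2) * ennreal (LINT x|?M. (norm (?G x))^2)"
    using m by (subst nn_integral_cmult) (simp_all add: L2_on_nn_integral[OF w])
  also have "\<dots> = ennreal ((LINT x|?M. (norm (?G x))^2) / 2)"
    unfolding e[symmetric] by simp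
  finally show ?thesis .
qed

lemma weak_grad_L2:
  assumes "u \<in> W12 \<Omega>"
  shows "L2_on \<Omega> (weak_grad \<Omega> u)"
proof -
  obtain G where "is_weak_grad \<Omega> u G" using assms by (auto simp: W12_def)
  then have "is_weak_grad \<Omega> u (weak_grad \<Omega> u)" unfolding weak_grad_def by (rule someI[of "is_weak_grad \<Omega> u"])
  then show ?thesis by (simp add: is_weak_grad_def)
qed

lemma trace_seq_exists:
  assumes "0 < a" "a < b" "u \<in> admissible a b N"
  shows "\<exists>w. trace_seq a b w u (weak_grad (annulus a b) u)"
proof -
  have W: "u \<in> W12 (annulus a b)" and tr: "has_trace_annulus a b u (\<lambda>x. x)"
    using assms by (auto simp: admissible_def)
  obtain w :: "nat \<Rightarrow> real^2 \<Rightarrow> real^2" where w: "\<And>n i. smooth (\<lambda>x. w n x $ i)"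
    "(\<lambda>n. \<integral>\<^sup>+x. ennreal ((norm (w n x - u x))^2 + (norm (jacobian (w n) (at x) - weak_grad (annulus a b) u x))^2)
             \<partial>lebesgue_on (annulus a b)) \<longlonglongrightarrow> 0"
    "\<And>c. c \<in> {a, b} \<Longrightarrow> (\<lambda>n. \<integral>\<^sup>+\<theta>. ennreal ((norm (w n (polar c \<theta>) - polar c \<theta>))^2 * c) \<partial>lebesgue_on {0..2*pi}) \<longlonglongrightarrow> 0"
    using tr unfolding has_trace_annulus_def by blast
  have "trace_seq a b w u (weak_grad (annulus a b) u)"
  proof
    show "L2_on (annulus a b) u" using W by (simp add: W12_def)
    show "smooth_map (w n)" for n using w(1) by (simp add: smooth_map_def)
  qed (use assms w weak_grad_L2[OF W] in auto)
  then show ?thesis by blast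
qed

text \<open>The positive part of 2 sinh (ln (r / k)).\<close>

abbreviation bulge :: "real \<Rightarrow> real \<Rightarrow> real" where "bulge k r \<equiv> max 0 (r / k - k / r)"

text \<open>For r > \<open>k\<close> the formula for the modulus is a completed square in r / k - k
  / r. Since the positive part enters squared, one expression that is differentiable across r =
  \<open>k\<close> covers both phases.\<close>

lemma rho_eq:
  assumes "0 < a" "0 < k" "0 < r"
  shows "rho a \<omega> k r = sqrt (a^2 + (a^2 + \<omega>^2 / a^2) / 4 * (bulge k r)^2)"
proof (cases "r \<le> k")
  case True
  then have "r / k - k / r \<le> 0" using assms by (simp add: field_simps power2_eq_square mult_mono)
  then show ?thesis using True assms by (simp add: rho_def)
next
  case False
  then have "0 \<le> r / k - k / r" using assms by (simp add: field_simps mult_mono)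
  then have sq: "(bulge k r)^2 = r^2 / k^2 + k^2 / r^2 - 2"
    using assms by (simp add: power2_diff power_divide)
  define p q where "p = a^2" and "q = \<omega>^2 / a^2"
  have "a^2 + (a^2 + \<omega>^2 / a^2) / 4 * (bulge k r)^2
      = ((a^2 + \<omega>^2 / a^2) * (r^2 / k^2 + k^2 / r^2) + 2 * (a^2 - \<omega>^2 / a^2)) / 4"
    unfolding sq p_def[symmetric] q_def[symmetric] by (simp add: algebra_simps add_divide_distrib)
  then have "sqrt (a^2 + (a^2 + \<omega>^2 / a^2) / 4 * (bulge k r)^2)
      = sqrt ((a^2 + \<omega>^2 / a^2) * (r^2 / k^2 + k^2 / r^2) + 2 * (a^2 - \<omega>^2 / a^2)) / sqrt 4"
    by (simp only: real_sqrt_divide)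
  then show ?thesis using False by (simp add: rho_def)
qed

locale twist =
  fixes a b \<omega> k :: real and N :: int and \<psi> :: "real \<Rightarrow> real"
  assumes a: "0 < a" and \<omega>: "0 < \<omega>" and k: "a < k" "k < b" and outer: "rho a \<omega> k b = b"
    and \<psi>: "\<And>r. a \<le> r \<Longrightarrow> r \<le> b \<Longrightarrow> (\<psi> has_real_derivative \<omega> / (r * (rho a \<omega> k r)^2)) (at r within {a..b})"
    and \<psi>a: "\<psi> a = 0" and \<psi>b: "\<psi> b = 2 * pi * of_int N"
begin

definition C :: real where "C = (a^2 + \<omega>^2 / a^2) / 4"
definition m :: real where "m = \<omega> / a^2"
definition Q :: "real \<Rightarrow> real" where "Q r = a^2 + C * (bulge k r)^2"
definition Q' :: "real \<Rightarrow> real" where "Q' r = C * (2 * bulge k r * (1 / k + k / r^2))"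

lemma C: "0 < C" "4 * C = a^2 * (1 + m^2)" "4 * C * a^2 = a ^ 4 + \<omega>^2"
  using a \<omega> by (simp_all add: C_def m_def field_simps power2_eq_square power4_eq_xxxx add_pos_pos)

lemma m: "0 < m" using a \<omega> by (simp add: m_def)

lemma Q_pos: "a^2 \<le> Q r" "0 < Q r"
proof -
  have "0 \<le> C * (bulge k r)^2" using C by simp
  then show "a^2 \<le> Q r" by (simp add: Q_def)
  moreover have "0 < a^2" using a by simp
  ultimately show "0 < Q r" by linarith
qed

lemma rho: "0 < r \<Longrightarrow> rho a \<omega> k r = sqrt (Q r)"
  using rho_eq[OF a, of k r \<omega>] a k by (simp add: Q_def C_def)

lemma Q_derivative: "0 < r \<Longrightarrow> (Q has_real_derivative Q' r) (at r within S)"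
proof -
  assume r: "0 < r"
  have "((\<lambda>r. r / k - k / r) has_real_derivative 1 / k + k / r^2) (at r within S)"
    using r a k by (auto intro!: derivative_eq_intros simp: power2_eq_square)
  from DERIV_chain2[OF has_derivative_max_square[of 0] this]
  have "((\<lambda>r. (bulge k r)^2) has_real_derivative 2 * bulge k r * (1 / k + k / r^2)) (at r within S)" by simp
  from DERIV_add[OF DERIV_const DERIV_cmult[OF this]] show ?thesis unfolding Q_def[abs_def] Q'_def by simp
qed

lemma cont: "continuous_on {a..b} Q" "continuous_on {a..b} Q'" "continuous_on {a..b} \<psi>"
proof -
  show "continuous_on {a..b} Q" "continuous_on {a..b} Q'"
    unfolding Q_def[abs_def] Q'_def[abs_def] using a k by (auto intro!: continuous_intros)
  show "continuous_on {a..b} \<psi>"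
    using \<psi> by (meson DERIV_continuous atLeastAtMost_iff continuous_on_eq_continuous_within)
qed

text \<open>The twist on the ray t = 0 in complex form; the whole map is
  \<open>cis t * Y r\<close>.\<close>

definition Y :: "real \<Rightarrow> complex" where "Y r = of_real (rho a \<omega> k r) * cis (\<psi> r)"
definition Y' :: "real \<Rightarrow> complex" where
  "Y' r = Complex (Q' r / (2 * sqrt (Q r))) (\<omega> / (r * sqrt (Q r))) * cis (\<psi> r)"

lemma Y_derivative:
  assumes r: "a \<le> r" "r \<le> b"
  shows "(Y has_vector_derivative Y' r) (at r within {a..b})"
proof -
  have r0: "0 < r" using a r by simp
  have s0: "0 < sqrt (Q r)" using Q_pos by simp
  have "((\<lambda>r. sqrt (Q r)) has_real_derivative Q' r * (inverse (sqrt (Q r)) / 2)) (at r within {a..b})"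
    using DERIV_chain2[OF DERIV_real_sqrt[OF Q_pos(2)] Q_derivative[OF r0]] by (simp add: mult.commute)
  then have 1: "((\<lambda>r. complex_of_real (sqrt (Q r))) has_vector_derivative of_real (Q' r * (inverse (sqrt (Q r)) / 2))) (at r within {a..b})"
    by (rule has_vector_derivative_of_real)
  have 2: "((\<lambda>r. cis (\<psi> r)) has_vector_derivative (\<omega> / (r * (rho a \<omega> k r)^2)) *\<^sub>R (\<i> * cis (\<psi> r))) (at r within {a..b})"
    using vector_diff_chain_within[OF \<psi>[OF r, unfolded real_vector_derivative_iff] cis_vector_derivative]
    by (simp add: o_def)
  have e: "of_real (sqrt (Q r)) * ((\<omega> / (r * (rho a \<omega> k r)^2)) *\<^sub>R (\<i> * cis (\<psi> r))) + of_real (Q' r * (inverse (sqrt (Q r)) / 2)) * cis (\<psi> r) = Y' r"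
  proof -
    have "sqrt (Q r) * (\<omega> / (r * (rho a \<omega> k r)^2)) = \<omega> / (r * sqrt (Q r))"
      using s0 r0 by (simp add: rho field_simps)
    then have "complex_of_real (sqrt (Q r)) * ((\<omega> / (r * (rho a \<omega> k r)^2)) *\<^sub>R (\<i> * cis (\<psi> r))) = of_real (\<omega> / (r * sqrt (Q r))) * (\<i> * cis (\<psi> r))"
      by (metis mult.assoc of_real_mult scaleR_conv_of_real)
    moreover have "Q' r * (inverse (sqrt (Q r)) / 2) = Q' r / (2 * sqrt (Q r))" by (simp add: field_simps)
    ultimately show ?thesis by (simp add: Y'_def Complex_eq algebra_simps)
  qed
  have "((\<lambda>r. of_real (sqrt (Q r)) * cis (\<psi> r)) has_vector_derivative Y' r) (at r within {a..b})"
    using has_vector_derivative_mult[OF 1 2] unfolding e .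
  then show ?thesis
    by (rule has_vector_derivative_transform[rotated 2]) (use r a in \<open>auto simp: Y_def rho\<close>)
qed

lemma Y'_cont: "continuous_on {a..b} Y'"
proof -
  have "sqrt (Q r) \<noteq> 0" for r using Q_pos(2)[of r] by simp
  then show ?thesis
    unfolding Y'_def Complex_eq using a by (intro continuous_intros cont) auto
qed

lemma Y_ends: "Y a = of_real a" "Y b = of_real b"
proof -
  show "Y a = of_real a" using k a by (simp add: Y_def rho_def \<psi>a)
  have "cis (\<psi> b) = 1" unfolding \<psi>b by (simp add: complex_eq_iff cos_int_2pin sin_int_2pin)
  then show "Y b = of_real b" by (simp add: Y_def outer)
qed

text \<open>Two relations make the numerator divisible by the squared modulus \<open>Q r\<close>:
  a^4 + \<omega>^2 = 4 C a^2, and (r / k + k / r)^2 = h^2 + 4 wherever the bulge h is nonzero. What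
  remains has an elementary primitive.\<close>

lemma density:
  assumes "a \<le> r"
  shows "wsq r (Y' r) (Y r) = 2 * C * ((bulge k r)^2 + 2) / r"
proof -
  have r: "0 < r" using a assms by simp
  have k0: "0 < k" using a k by simp
  define h g where "h = bulge k r" and "g = r / k + k / r"
  have h: "h = 0 \<or> g^2 = h^2 + 4"
    using r k0 by (auto simp: h_def g_def max_def power2_eq_square field_simps)
  have rQ: "r * Q' r = 2 * C * h * g"
    using r by (simp add: Q'_def h_def g_def field_simps power2_eq_square)
  have Q: "Q r = a^2 + C * h^2" by (simp add: Q_def h_def)
  have n1: "(cmod (Y' r))^2 = (Q' r)^2 / (4 * Q r) + \<omega>^2 / (r^2 * Q r)"
    using Q_pos(2)[of r] by (simp add: Y'_def norm_mult cmod_power2 power_divide power_mult_distrib)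
  have n2: "(cmod (Y r))^2 = Q r" using Q_pos(2)[of r] by (simp add: Y_def norm_mult rho[OF r])
  have "r^2 * (cmod (Y' r))^2 = (r * Q' r)^2 / (4 * Q r) + \<omega>^2 / Q r"
    unfolding n1 using r Q_pos(2)[of r] by (simp add: distrib_left power_mult_distrib)
  also have "\<dots> = (C^2 * (h^2 * g^2) + \<omega>^2) / Q r"
    unfolding rQ using Q_pos(2)[of r] by (simp add: power_mult_distrib add_divide_distrib mult.assoc)
  also have "h^2 * g^2 = h^2 * (h^2 + 4)" using h by auto
  finally have "r^2 * (cmod (Y' r))^2 + Q r = (C^2 * (h^2 * (h^2 + 4)) + \<omega>^2 + Q r * Q r) / Q r"
    using Q_pos(2)[of r] by (simp add: add_divide_distrib)
  also have "C^2 * (h^2 * (h^2 + 4)) + \<omega>^2 + Q r * Q r = Q r * (2 * C * (h^2 + 2))"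
  proof -
    have w: "\<omega>^2 = 4 * C * a^2 - a ^ 4" using C(3) by simp
    show ?thesis unfolding Q w by (simp add: power2_eq_square power4_eq_xxxx algebra_simps)
  qed
  also have "\<dots> / Q r = 2 * C * (h^2 + 2)" using Q_pos(2)[of r] by simp
  finally have "r^2 * (cmod (Y' r))^2 + (cmod (Y r))^2 = 2 * C * (h^2 + 2)" unfolding n2 .
  then have "(r^2 * (cmod (Y' r))^2 + (cmod (Y r))^2) / r = 2 * C * ((bulge k r)^2 + 2) / r" by (simp add: h_def)
  then show ?thesis using r by (simp add: add_divide_distrib power2_eq_square)
qed

lemma bulge_le: "0 < r \<Longrightarrow> r \<le> k \<Longrightarrow> bulge k r = 0"
proof -
  assume r: "0 < r" "r \<le> k"
  then have "r * r \<le> k * k" by (intro mult_mono) auto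
  then have "r / k - k / r \<le> 0" using r by (simp add: field_simps)
  then show ?thesis by simp
qed

lemma bulge_ge: "k \<le> r \<Longrightarrow> bulge k r = r / k - k / r"
proof -
  assume "k \<le> r"
  then have "k * k \<le> r * r" "0 < k" "0 < r" using a k by (auto intro: mult_mono)
  then have "0 \<le> r / k - k / r" by (simp add: field_simps)
  then show ?thesis by simp
qed

lemma energy_integral:
  "integral {a..b} (\<lambda>r. wsq r (Y' r) (Y r))
    = a^2 * (1 + m^2) * (ln (k / a) + sinh (ln (b / k)) * cosh (ln (b / k)))"
proof -
  have k0: "0 < k" and b0: "0 < b" using a k by auto
  have i1: "((\<lambda>r. wsq r (Y' r) (Y r)) has_integral 4 * C * ln k - 4 * C * ln a) {a..k}"
  proof (rule has_integral_eq)
    show "((\<lambda>r. 4 * C / r) has_integral 4 * C * ln k - 4 * C * ln a) {a..k}"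
      using a k by (intro fundamental_theorem_of_calculus)
        (auto intro!: derivative_eq_intros simp: real_vector_derivative_iff[symmetric])
    show "4 * C / r = wsq r (Y' r) (Y r)" if "r \<in> {a..k}" for r
      using that a by (simp only: density atLeastAtMost_iff) (simp add: bulge_le)
  qed
  have i2: "((\<lambda>r. wsq r (Y' r) (Y r)) has_integral
      C * (b^2 / k^2 - k^2 / b^2) - C * (k^2 / k^2 - k^2 / k^2)) {k..b}"
  proof (rule has_integral_eq)
    have "((\<lambda>r. C * (r^2 / k^2 - k^2 / r^2)) has_real_derivative C * (2 * r / k^2 + 2 * k^2 / r ^ 3)) (at r within {k..b})" if "k \<le> r" for r
      using that k0 by (auto intro!: derivative_eq_intros simp: field_simps power2_eq_square power3_eq_cube)
    then show "((\<lambda>r. C * (2 * r / k^2 + 2 * k^2 / r ^ 3)) has_integral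
        C * (b^2 / k^2 - k^2 / b^2) - C * (k^2 / k^2 - k^2 / k^2)) {k..b}"
      using k by (intro fundamental_theorem_of_calculus) (auto simp: real_vector_derivative_iff[symmetric])
    show "C * (2 * r / k^2 + 2 * k^2 / r ^ 3) = wsq r (Y' r) (Y r)" if "r \<in> {k..b}" for r
    proof -
      have r: "k \<le> r" "a \<le> r" "0 < r" using that k a by auto
      have "(r / k - k / r)^2 + 2 = r^2 / k^2 + k^2 / r^2" using r k0 by (simp add: power2_diff power_divide)
      then show ?thesis unfolding density[OF r(2)] bulge_ge[OF r(1)]
        using r k0 by (simp add: field_simps power2_eq_square power3_eq_cube)
    qed
  qed
  have s: "sinh (ln (b / k)) * cosh (ln (b / k)) = (b^2 / k^2 - k^2 / b^2) / 4"
  proof -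
    have "(x - y) / 2 * ((x + y) / 2) = (x^2 - y^2) / 4" for x y :: real by (simp add: power2_eq_square algebra_simps)
    then show ?thesis using k0 b0 by (simp add: sinh_ln_real cosh_ln_real power_divide)
  qed
  have "integral {a..b} (\<lambda>r. wsq r (Y' r) (Y r))
      = 4 * C * ln k - 4 * C * ln a + (C * (b^2 / k^2 - k^2 / b^2) - C * (k^2 / k^2 - k^2 / k^2))"
    by (rule integral_unique[OF has_integral_combine[OF _ _ i1 i2]]) (use k in auto)
  also have "\<dots> = 4 * C * (ln (k / a) + sinh (ln (b / k)) * cosh (ln (b / k)))"
  proof -
    have "4 * C * p - 4 * C * q + (C * x - C * (y - y)) = 4 * C * (p - q + x / 4)" for p q x y
      by (simp add: algebra_simps)
    moreover have "ln (k / a) = ln k - ln a" using a k0 by (simp add: ln_div)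
    ultimately show ?thesis unfolding s by simp
  qed
  finally show ?thesis unfolding C(2) .
qed

lemma psi_inner: "\<psi> k = m * ln (k / a)"
proof -
  have "(\<psi> has_real_derivative m / r) (at r within {a..k})" if "r \<in> {a..k}" for r
  proof -
    have r: "a \<le> r" "r \<le> b" using that k by auto
    have "(\<psi> has_real_derivative \<omega> / (r * (rho a \<omega> k r)^2)) (at r within {a..k})"
      by (rule DERIV_subset[OF \<psi>[OF r]]) (use k in auto)
    then show ?thesis using that by (simp add: rho_def m_def field_simps)
  qed
  moreover have "((\<lambda>r. m * ln r) has_real_derivative m / r) (at r within {a..k})" if "r \<in> {a..k}" for r
    using that a by (auto intro!: derivative_eq_intros)
  ultimately have "((\<lambda>r. \<psi> r - m * ln r) has_vector_derivative 0) (at r within {a..k})" if "r \<in> {a..k}" for r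
    using DERIV_diff[of \<psi> "m / r" r "{a..k}" "\<lambda>r. m * ln r" "m / r"] that
    by (simp add: real_vector_derivative_iff)
  then obtain c where "\<And>r. r \<in> {a..k} \<Longrightarrow> \<psi> r - m * ln r = c"
    using has_vector_derivative_zero_constant[of "{a..k}" "\<lambda>r. \<psi> r - m * ln r"] by auto
  from this[of a] this[of k] show ?thesis using k a \<psi>a by (simp add: ln_div algebra_simps)
qed

lemma psi_increment:
  "\<psi> b - \<psi> k = integral {k..b} (\<lambda>r. \<omega> / (r * (rho a \<omega> k r)^2))" "0 < \<psi> b - \<psi> k"
proof -
  have "((\<lambda>r. \<omega> / (r * (rho a \<omega> k r)^2)) has_integral \<psi> b - \<psi> k) {k..b}"
    using k by (intro fundamental_theorem_of_calculus)
      (auto simp: real_vector_derivative_iff[symmetric] intro: DERIV_subset[OF \<psi>])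
  then show "\<psi> b - \<psi> k = integral {k..b} (\<lambda>r. \<omega> / (r * (rho a \<omega> k r)^2))" by (simp add: integral_unique)
  have "\<exists>x\<in>{k<..<b}. \<psi> b - \<psi> k = \<omega> / (x * (rho a \<omega> k x)^2) * (b - k)"
  proof (rule mvt_simple[OF k(2)])
    fix x assume x: "k \<le> x" "x \<le> b"
    show "(\<psi> has_derivative (*) (\<omega> / (x * (rho a \<omega> k x)^2))) (at x within {k..b})"
      unfolding has_field_derivative_def[symmetric] by (rule DERIV_subset[OF \<psi>]) (use x k in auto)
  qed
  then obtain x where "k < x" "\<psi> b - \<psi> k = \<omega> / (x * (rho a \<omega> k x)^2) * (b - k)" by auto
  moreover have "0 < (rho a \<omega> k x)^2" if "k < x" for x using Q_pos(2)[of x] that a k by (simp add: rho)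
  ultimately show "0 < \<psi> b - \<psi> k" using k a \<omega> by simp
qed

text \<open>The curve \<open>V\<close> with components a cosh (ln (r / k)) and a m sinh (ln (r / k))
  is the twist for r \<ge> \<open>k\<close> in the rotating frame: its modulus is
  \<open>rho\<close>, and its cross product with its derivative is \<omega> / r, so its angle has
  the same derivative as \<psi> and increases by \<psi> b - \<psi> k. The value at \<open>b\<close>
  gives both equations.\<close>

lemma outer_position:
  "a * cosh (ln (b / k)) = b * cos (2 * pi * of_int N - m * ln (k / a))"
  "a * m * sinh (ln (b / k)) = b * sin (2 * pi * of_int N - m * ln (k / a))"
proof -
  have k0: "0 < k" and b0: "0 < b" using a k by auto
  define V where "V r = Complex (a / 2 * (r / k + k / r)) (a * m / 2 * (r / k - k / r))" for r
  define V' where "V' r = Complex (a / 2 * (1 / k - k / r^2)) (a * m / 2 * (1 / k + k / r^2))" for r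
  have dV: "(V has_vector_derivative V' r) (at r within {k..b})" if "k \<le> r" for r
    unfolding V_def[abs_def] V'_def using that k0
    by (intro Complex_has_vector_derivative) (auto intro!: derivative_eq_intros simp: power2_eq_square)
  have cV': "continuous_on {k..b} V'"
    unfolding V'_def Complex_eq using k0 by (intro continuous_intros) auto
  have nV: "(cmod (V r))^2 = (rho a \<omega> k r)^2" if "k \<le> r" for r
  proof -
    have r: "0 < r" using that k0 by simp
    define h g where "h = r / k - k / r" and "g = r / k + k / r"
    have g: "g^2 = h^2 + 4" using r k0 by (simp add: h_def g_def power2_sum power2_diff)
    have "(cmod (V r))^2 = a^2 / 4 * g^2 + a^2 * m^2 / 4 * h^2"
      by (simp add: V_def cmod_power2 h_def[symmetric] g_def[symmetric] power_mult_distrib power_divide)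
    also have "\<dots> = a^2 + a^2 * (1 + m^2) / 4 * h^2" unfolding g by (simp add: algebra_simps add_divide_distrib)
    also have "\<dots> = Q r" unfolding C(2)[symmetric] Q_def bulge_ge[OF that] h_def by simp
    finally show ?thesis using Q_pos(2)[of r] by (simp add: rho[OF r])
  qed
  have ang: "Im (cnj (V r) * V' r) = \<omega> / r" if "k \<le> r" for r
  proof -
    have r: "0 < r" using that k0 by simp
    define x y where "x = r / k" and "y = k / r"
    have xy: "x * y = 1" using r k0 by (simp add: x_def y_def)
    have "V r = Complex (a / 2 * (x + y)) (a * m / 2 * (x - y))" by (simp add: V_def x_def y_def)
    moreover have "V' r = Complex (a / 2 * ((x - y) / r)) (a * m / 2 * ((x + y) / r))"
      using r k0 by (simp add: V'_def x_def y_def field_simps power2_eq_square)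
    ultimately have "Im (cnj (V r) * V' r) = a^2 * m / 4 * ((x + y)^2 - (x - y)^2) / r"
      using r by (simp add: field_simps power2_eq_square)
    also have "(x + y)^2 - (x - y)^2 = 4 * (x * y)" by (simp add: power2_eq_square algebra_simps)
    finally show ?thesis using a by (simp add: xy m_def)
  qed
  have V0: "V r \<noteq> 0" if "k \<le> r" for r
    using nV[OF that] Q_pos(2)[of r] that k0 by (auto simp: rho)
  have Vk: "V k = of_real a * cis 0" using k0 by (simp add: V_def complex_eq_iff)
  have sg: "sgn (V b) = cis (0 + integral {k..b} (\<lambda>r. Im (cnj (V r) * V' r) / (cmod (V r))^2))"
    by (rule ray_angle[OF k(2) a dV cV' V0 Vk]) (use k in auto)
  have "integral {k..b} (\<lambda>r. Im (cnj (V r) * V' r) / (cmod (V r))^2) = integral {k..b} (\<lambda>r. \<omega> / (r * (rho a \<omega> k r)^2))"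
    by (intro integral_cong) (simp only: ang nV atLeastAtMost_iff divide_divide_eq_left)
  then have "sgn (V b) = cis (\<psi> b - \<psi> k)" using sg psi_increment(1) by simp
  moreover have "cmod (V b) = b"
  proof -
    have "(cmod (V b))^2 = b^2" using nV[of b] outer k by simp
    then show ?thesis using b0 by (simp add: power2_eq_iff_nonneg)
  qed
  then have "V b = of_real b * sgn (V b)" using b0 by (simp add: sgn_div_norm scaleR_conv_of_real field_simps)
  ultimately have Vb: "V b = of_real b * cis (2 * pi * of_int N - m * ln (k / a))" by (simp add: \<psi>b psi_inner)
  from arg_cong[OF Vb, of Re] show "a * cosh (ln (b / k)) = b * cos (2 * pi * of_int N - m * ln (k / a))"
    using k0 b0 by (simp add: V_def cosh_ln_real field_simps)
  from arg_cong[OF Vb, of Im] show "a * m * sinh (ln (b / k)) = b * sin (2 * pi * of_int N - m * ln (k / a))"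
    using k0 b0 by (simp add: V_def sinh_ln_real field_simps)
qed

end

text \<open>Rotationally equivariant map with profile \<open>y\<close>: the direction of x is
  multiplied by \<open>y (norm x)\<close>. It is a total map, continuous away from the origin, which
  is the form that \<open>seq_L2\<close> accepts for a representative.\<close>

definition spiral :: "(real \<Rightarrow> complex) \<Rightarrow> real^2 \<Rightarrow> real^2" where
  "spiral y x = (let v = Complex (x $ 1) (x $ 2) / of_real (norm x) * y (norm x) in vector [Re v, Im v])"

lemma spiral_polar: "0 < r \<Longrightarrow> spiral y (polar r t) = vector [Re (cis t * y r), Im (cis t * y r)]"
proof -
  assume r: "0 < r"
  have "Complex (r * cos t) (r * sin t) / of_real r = cis t" using r by (simp add: complex_eq_iff)
  then show ?thesis using r by (simp add: spiral_def Let_def)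
qed

lemma spiral_continuous:
  assumes "continuous_on UNIV y"
  shows "continuous_on {x. x \<noteq> 0} (spiral y)"
proof (rule continuous_on_vec_components)
  fix i :: 2
  define v where "v x = Complex ((x :: real^2) $ 1) (x $ 2) / of_real (norm x) * y (norm x)" for x
  have "continuous_on {x. x \<noteq> 0} v"
    unfolding v_def Complex_eq by (intro continuous_intros continuous_on_compose2[OF assms]) auto
  then have c: "continuous_on {x. x \<noteq> 0} (\<lambda>x. Re (v x))" "continuous_on {x. x \<noteq> 0} (\<lambda>x. Im (v x))"
    by (rule continuous_on_Re, rule continuous_on_Im)
  have e: "spiral y x $ 1 = Re (v x)" "spiral y x $ 2 = Im (v x)" for x by (simp_all add: spiral_def Let_def v_def)
  consider "i = 1" | "i = 2" using exhaust_2 by blast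
  then show "continuous_on {x. x \<noteq> 0} (\<lambda>x. spiral y x $ i)" using c by cases (simp_all add: e)
qed

lemma twist_energy_upper:
  assumes ts: "trace_seq a b w u G" and tw: "twist a b \<omega> k N \<psi>"
    and eq: "AE x in lebesgue_on (annulus a b). u x = u' x"
    and u': "\<And>r t. r \<in> {a<..<b} \<Longrightarrow> u' (polar r t) = polar (rho a \<omega> k r) (t + \<psi> r)"
  shows "trace_seq.\<gamma> a b G \<le> 2 * pi * (a^2 * (1 + (\<omega> / a^2)^2) * (ln (k / a) + sinh (ln (b / k)) * cosh (ln (b / k))))"
proof -
  interpret T: twist a b \<omega> k N \<psi> by (rule tw)
  interpret trace_seq a b w u G by (rule ts)
  \<comment> \<open>Clamping the radius extends the profile continuously to all reals and leaves it
    unchanged on [a, b].\<close>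
  define y where "y r = T.Y (max a (min b r))" for r
  have cY: "continuous_on {a..b} T.Y"
    using T.Y_derivative by (meson atLeastAtMost_iff continuous_on_eq_continuous_within has_vector_derivative_continuous)
  have cy: "continuous_on UNIV y"
    unfolding y_def by (intro continuous_on_compose2[OF cY] continuous_intros) (use ab in auto)
  have ae: "AE x in \<Omega>. u x = spiral y x"
  proof -
    have "AE x in \<Omega>. x \<in> annulus a b" by (rule AE_I2) (simp add: space_restrict_space)
    with eq show ?thesis
    proof eventually_elim
      case (elim x)
      obtain t where t: "x = polar (norm x) t" using polar_exists by blast
      define r where "r = norm x"
      have r: "a < r" "r < b" using elim by (auto simp: annulus_def r_def)
      have x: "x = polar r t" using t by (simp add: r_def)
      have "u x = polar (rho a \<omega> k r) (t + \<psi> r)" using elim(1) u'[of r t] r unfolding x by simp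
      also have "\<dots> = spiral y (polar r t)"
        using r a by (simp add: spiral_polar[of r] y_def T.Y_def vec_eq_iff forall_2 cos_add sin_add algebra_simps)
      finally show ?case by (simp add: x)
    qed
  qed
  have "\<gamma> \<le> 2 * pi * integral {a..b} (\<lambda>r. wsq r (T.Y' r) (T.Y r))"
  proof (rule energy_upper_bound[OF _ T.Y_derivative T.Y'_cont T.Y_ends])
    fix \<epsilon> :: real assume \<epsilon>: "0 < \<epsilon>"
    then have "0 < \<epsilon> * a" using a by simp
    from seq_L2[OF ae spiral_continuous[OF cy] this] obtain M
      where M: "\<And>n. n \<ge> M \<Longrightarrow> rect_int a b (\<lambda>r t. r * (cmod (W n r t - cpx (spiral y) r t))^2) < \<epsilon> * a" by blast
    have "rect_int a b (\<lambda>r t. (cmod (W n r t - cis t * T.Y r))^2) < \<epsilon>" if n: "n \<ge> M" for n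
    proof -
      have e: "cpx (spiral y) r t = cis t * T.Y r" if "a \<le> r" "r \<le> b" for r t
        using that a by (simp add: cpx_def spiral_polar y_def complex_eq_iff)
      have c: "cont_rect a b (\<lambda>r t. (cmod (W n r t - cis t * T.Y r))^2)"
        by (intro cont_rects W_cont cis_cont_rect cont_rect_fst cY)
      have "a * rect_int a b (\<lambda>r t. (cmod (W n r t - cis t * T.Y r))^2) \<le> rect_int a b (\<lambda>r t. r * (cmod (W n r t - cis t * T.Y r))^2)"
        unfolding rect_int_cmult[symmetric] by (intro rect_int_mono cont_rect_arith(3) cont_rect_const cont_rect_var c mult_right_mono) auto
      also have "\<dots> = rect_int a b (\<lambda>r t. r * (cmod (W n r t - cpx (spiral y) r t))^2)"
        by (intro rect_int_cong) (simp add: e)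
      also have "\<dots> < a * \<epsilon>" using M[OF n] by (simp add: mult.commute)
      finally show ?thesis using a by simp
    qed
    then show "\<exists>M. \<forall>n\<ge>M. rect_int a b (\<lambda>r t. (cmod (W n r t - cis t * T.Y r))^2) < \<epsilon>" by blast
  qed
  then show ?thesis by (simp add: T.energy_integral T.m_def)
qed

theorem corollary7:
  fixes a b \<omega> k r_star :: real and N :: int and u v :: "real^2 \<Rightarrow> real^2"
  assumes "0 < a" and "a < b" and "1 \<le> N"
    and "is_arg_min (I_inf a b) (\<lambda>w. w \<in> admissible_sym a b N) u"
    and "has_twist_parameters a b N u \<omega> k"
    and "1 / r_star = 1 / k + a\<^sup>2 / (a\<^sup>2 + \<omega>\<^sup>2)"
    and "annulus r_star b \<subseteq> annulus a b"
    and "v \<in> admissible a b N"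
    and "AE x in lebesgue_on (annulus a b). x \<notin> annulus r_star b \<longrightarrow> v x - u x = 0"
  shows "I_inf a b v \<ge> I_inf a b u"
proof -
  have u: "u \<in> admissible a b N" using assms(4) by (simp add: is_arg_min_def admissible_sym_def)
  obtain \<psi> u' where p: "0 < \<omega>" "a < k" "k < b" "rho a \<omega> k b = b"
      "\<And>r. r \<in> {a..b} \<Longrightarrow> (\<psi> has_real_derivative \<omega> / (r * (rho a \<omega> k r)\<^sup>2)) (at r within {a..b})"
      "\<psi> a = 0" "\<psi> b = 2 * pi * of_int N"
    and u': "\<And>r t. r \<in> {a<..<b} \<Longrightarrow> u' (polar r t) = polar (rho a \<omega> k r) (t + \<psi> r)"
      "AE x in lebesgue_on (annulus a b). u x = u' x"
    using assms(5) unfolding has_twist_parameters_def by blast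
  have tw: "twist a b \<omega> k N \<psi>" using assms(1) p by unfold_locales auto
  interpret T: twist a b \<omega> k N \<psi> by (rule tw)
  obtain wu where wu: "trace_seq a b wu u (weak_grad (annulus a b) u)" using trace_seq_exists[OF assms(1,2) u] by blast
  obtain wv where wv: "trace_seq a b wv v (weak_grad (annulus a b) v)" using trace_seq_exists[OF assms(1,2,8)] by blast
  \<comment> \<open>The explicit energy that separates the two maps: the weak convergence argument
    bounds the energy of \<open>u\<close> from above by it, the calibration bounds that of
    \<open>v\<close> from below.\<close>
  define E where "E = pi * a\<^sup>2 * (1 + T.m\<^sup>2) * (ln (k / a) + sinh (ln (b / k)) * cosh (ln (b / k)))"
  have I: "I_inf a b x = ennreal (trace_seq.\<gamma> a b (weak_grad (annulus a b) x) / 2)"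
    if x: "x \<in> admissible a b N" and ts: "trace_seq a b w x (weak_grad (annulus a b) x)" for x w
    unfolding trace_seq.\<gamma>_def[OF ts] using x by (intro I_inf_eq weak_grad_L2) (auto simp: admissible_def)
  have "trace_seq.\<gamma> a b (weak_grad (annulus a b) u)
      \<le> 2 * pi * (a\<^sup>2 * (1 + (\<omega> / a\<^sup>2)\<^sup>2) * (ln (k / a) + sinh (ln (b / k)) * cosh (ln (b / k))))"
    by (rule twist_energy_upper[OF wu tw u'(2)]) (rule u'(1))
  moreover have "2 * pi * (a\<^sup>2 * (1 + (\<omega> / a\<^sup>2)\<^sup>2) * (ln (k / a) + sinh (ln (b / k)) * cosh (ln (b / k)))) = 2 * E"
    unfolding E_def T.m_def by (simp only: mult.assoc)
  ultimately have "trace_seq.\<gamma> a b (weak_grad (annulus a b) u) / 2 \<le> E" by linarith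
  also have "E \<le> trace_seq.\<gamma> a b (weak_grad (annulus a b) v) / 2"
    unfolding E_def
  proof (rule trace_seq.energy_lower_bound[OF wv _ _ T.k T.m _ T.outer_position])
    \<comment> \<open>This is the angle swept by the twist between the radii \<open>k\<close> and
      \<open>b\<close>.\<close>
    show "0 < 2 * pi * of_int N - T.m * ln (k / a)"
      using T.psi_increment(2) by (simp add: T.\<psi>b T.psi_inner)
  qed (use assms(8) in \<open>auto simp: admissible_def\<close>)
  finally show ?thesis unfolding I[OF u wu] I[OF assms(8) wv] by (rule ennreal_leI)
qed

end
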